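(* Let $M^2$ be a Riemannian surface. A surface $\Sigma^2\subset M^2\times\mathbb{R}$ makes a constant angle $\theta$ with $\partial_t$ if, and only if, up to isometries of $M^2\times\mathbb{R}$, $\Sigma^2$ is locally parametrized as $$X(u,v)=\Big(\exp^M_{\alpha(u)}\big(v\cos\theta\,J(\alpha'(u))\big),\,v\sin\theta\Big),$$ where $\alpha:I\to M^2$ is a unit speed curve, $\exp^M$ is the exponential map in $M^2$, and $J$ is a $\frac{\pi}{2}$-rotation on the tangent planes of $M^2$.
   Context: $M^2\times\mathbb{R}$ carries the product metric $g^M+\mathrm{d}t^2$, and $\partial_t$ is the vertical unit vector field tangent to the factor $\mathbb{R}$ (it is parallel). The surface $\Sigma^2$ is regular, and "makes a constant angle $\theta$ with $\partial_t$" means that its unit normal $\nu$ satisfies $\langle\nu,\partial_t\rangle=\cos\theta$ with $\theta$ constant.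
   Formalization: "Up to isometries of M×ℝ" is restricted to isometries sending ∂_t to ∂_t or −∂_t (chosen per point), since in ℝ³ a rotation takes a vertical plane to a horizontal one; the unit normal and J are chosen locally, as Σ may be one-sided or M non-orientable. *)

theory Defs
  imports "HOL-Analysis.Analysis"
begin

text \<open>The library has no smooth manifolds, so the elementary notions of Riemannian geometry
  are set up here. A manifold is a topological space (the type \<open>'a\<close>) with an atlas of
  charts into a Euclidean space \<open>'e\<close>. Everything smooth is of class
  \<open>C\<^sup>\<infinity>\<close>.\<close>

subsection \<open>Smooth manifolds\<close>

primrec Ck_on :: "nat \<Rightarrow> 'd::euclidean_space set \<Rightarrow> ('d \<Rightarrow> 'e::euclidean_space) \<Rightarrow> bool" where
  "Ck_on 0 S f \<longleftrightarrow> continuous_on S f"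
| "Ck_on (Suc k) S f \<longleftrightarrow> (\<forall>x\<in>S. f differentiable (at x)) \<and>
     (\<forall>v. Ck_on k S (\<lambda>x. frechet_derivative f (at x) v))"

text \<open>Only used for open \<open>S\<close>.\<close>

definition smooth_on :: "'d::euclidean_space set \<Rightarrow> ('d \<Rightarrow> 'e::euclidean_space) \<Rightarrow> bool" where
  "smooth_on S f \<longleftrightarrow> (\<forall>k. Ck_on k S f)"

type_synonym ('a, 'e) chart = "'a set \<times> ('a \<Rightarrow> 'e)"

abbreviation dom_chart :: "('a, 'e) chart \<Rightarrow> 'a set" where
  "dom_chart \<equiv> fst"

abbreviation inv_chart :: "('a, 'e) chart \<Rightarrow> 'e \<Rightarrow> 'a" where
  "inv_chart c \<equiv> inv_into (fst c) (snd c)"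

definition is_chart :: "('a::topological_space, 'e::euclidean_space) chart \<Rightarrow> bool" where
  "is_chart c \<longleftrightarrow> open (dom_chart c) \<and> open (snd c ` dom_chart c) \<and>
     homeomorphism (dom_chart c) (snd c ` dom_chart c) (snd c) (inv_chart c)"

definition smooth_atlas :: "('a::topological_space, 'e::euclidean_space) chart set \<Rightarrow> bool" where
  "smooth_atlas A \<longleftrightarrow> (\<forall>c\<in>A. is_chart c) \<and> (\<Union>c\<in>A. dom_chart c) = UNIV \<and>
     (\<forall>c\<in>A. \<forall>d\<in>A. smooth_on (snd c ` (dom_chart c \<inter> dom_chart d)) (snd d \<circ> inv_chart c))"

definition euclid_chart :: "('e, 'e) chart" where
  "euclid_chart = (UNIV, id)"

definition euclid_atlas :: "('e, 'e) chart set" where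
  "euclid_atlas = {euclid_chart}"

definition prod_chart :: "('a, 'e) chart \<Rightarrow> ('a \<times> real, 'e \<times> real) chart" where
  "prod_chart c = (dom_chart c \<times> UNIV, \<lambda>(p, t). (snd c p, t))"

text \<open>The manifold structure of \<open>M \<times> \<real>\<close>.\<close>

definition prod_atlas :: "('a, 'e) chart set \<Rightarrow> ('a \<times> real, 'e \<times> real) chart set" where
  "prod_atlas A = prod_chart ` A"

text \<open>Smoothness of a map on an open subset \<open>S\<close> of a manifold.\<close>

definition smooth_map ::
  "('a::topological_space, 'e::euclidean_space) chart set \<Rightarrow>
   ('b::topological_space, 'f::euclidean_space) chart set \<Rightarrow> 'a set \<Rightarrow> ('a \<Rightarrow> 'b) \<Rightarrow> bool" where
  "smooth_map A B S f \<longleftrightarrow> continuous_on S f \<and>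
     (\<forall>c\<in>A. \<forall>d\<in>B. smooth_on (snd c ` (S \<inter> dom_chart c \<inter> f -` dom_chart d))
                            (snd d \<circ> f \<circ> inv_chart c))"

subsection \<open>Tangent vectors\<close>

text \<open>A tangent vector at \<open>p\<close> is the family of its coordinate representations, indexed by the
  charts around \<open>p\<close>; members of the family are related by the derivatives of the transition
  maps, and the family vanishes at all other indices. The vector space operations are pointwise.\<close>

type_synonym ('a, 'e) tvec = "('a, 'e) chart \<Rightarrow> 'e"

definition tangent_space :: "('a, 'e::euclidean_space) chart set \<Rightarrow> 'a \<Rightarrow> ('a, 'e) tvec set" where
  "tangent_space A p = {\<xi>.
     (\<forall>c. \<not> (c \<in> A \<and> p \<in> dom_chart c) \<longrightarrow> \<xi> c = 0) \<and>
     (\<forall>c\<in>A. \<forall>d\<in>A. p \<in> dom_chart c \<longrightarrow> p \<in> dom_chart d \<longrightarrow>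
        \<xi> d = frechet_derivative (snd d \<circ> inv_chart c) (at (snd c p)) (\<xi> c))}"

definition tadd :: "('a, 'e::euclidean_space) tvec \<Rightarrow> ('a, 'e) tvec \<Rightarrow> ('a, 'e) tvec" where
  "tadd \<xi> \<eta> = (\<lambda>c. \<xi> c + \<eta> c)"

definition tscale :: "real \<Rightarrow> ('a, 'e::euclidean_space) tvec \<Rightarrow> ('a, 'e) tvec" where
  "tscale r \<xi> = (\<lambda>c. r *\<^sub>R \<xi> c)"

definition tzero :: "('a, 'e::euclidean_space) tvec" where
  "tzero = (\<lambda>c. 0)"

text \<open>The tangent vector at \<open>p\<close> whose representation in the chart \<open>c\<close> is \<open>a\<close>.\<close>

definition coord_vec ::
  "('a, 'e::euclidean_space) chart set \<Rightarrow> ('a, 'e) chart \<Rightarrow> 'a \<Rightarrow> 'e \<Rightarrow> ('a, 'e) tvec" where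
  "coord_vec A c p a = (\<lambda>d. if d \<in> A \<and> p \<in> dom_chart d
     then frechet_derivative (snd d \<circ> inv_chart c) (at (snd c p)) a else 0)"

text \<open>On \<open>tangent_space A p\<close> the result does not depend on the choice of the chart \<open>c\<close>.\<close>

definition differential ::
  "('a, 'e::euclidean_space) chart set \<Rightarrow> ('b, 'f::euclidean_space) chart set \<Rightarrow>
   ('a \<Rightarrow> 'b) \<Rightarrow> 'a \<Rightarrow> ('a, 'e) tvec \<Rightarrow> ('b, 'f) tvec" where
  "differential A B f p \<xi> = (\<lambda>d. if d \<in> B \<and> f p \<in> dom_chart d
     then (let c = (SOME c. c \<in> A \<and> p \<in> dom_chart c) in
       frechet_derivative (snd d \<circ> f \<circ> inv_chart c) (at (snd c p)) (\<xi> c)) else 0)"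

definition velocity ::
  "('a, 'e::euclidean_space) chart set \<Rightarrow> (real \<Rightarrow> 'a) \<Rightarrow> real \<Rightarrow> ('a, 'e) tvec" where
  "velocity A \<gamma> t = (\<lambda>c. if c \<in> A \<and> \<gamma> t \<in> dom_chart c
     then vector_derivative (snd c \<circ> \<gamma>) (at t) else 0)"

subsection \<open>Riemannian metrics, geodesics and the exponential map\<close>

type_synonym ('a, 'e) metric = "'a \<Rightarrow> ('a, 'e) tvec \<Rightarrow> ('a, 'e) tvec \<Rightarrow> real"

definition metric_coord ::
  "('a, 'e::euclidean_space) chart set \<Rightarrow> ('a, 'e) metric \<Rightarrow> ('a, 'e) chart \<Rightarrow>
   'e \<Rightarrow> 'e \<Rightarrow> 'e \<Rightarrow> real" where
  "metric_coord A g c x a b =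
     g (inv_chart c x) (coord_vec A c (inv_chart c x) a) (coord_vec A c (inv_chart c x) b)"

definition riemannian_metric ::
  "('a, 'e::euclidean_space) chart set \<Rightarrow> ('a, 'e) metric \<Rightarrow> bool" where
  "riemannian_metric A g \<longleftrightarrow>
     (\<forall>p. \<forall>\<xi>\<in>tangent_space A p. \<forall>\<eta>\<in>tangent_space A p. \<forall>\<zeta>\<in>tangent_space A p. \<forall>r.
        g p \<xi> \<eta> = g p \<eta> \<xi> \<and>
        g p (tadd \<xi> \<eta>) \<zeta> = g p \<xi> \<zeta> + g p \<eta> \<zeta> \<and>
        g p (tscale r \<xi>) \<eta> = r * g p \<xi> \<eta> \<and>
        (\<xi> \<noteq> tzero \<longrightarrow> 0 < g p \<xi> \<xi>)) \<and>
     (\<forall>c\<in>A. \<forall>a b. smooth_on (snd c ` dom_chart c) (\<lambda>x. metric_coord A g c x a b))"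

definition riemannian_manifold ::
  "('a::topological_space, 'e::euclidean_space) chart set \<Rightarrow> ('a, 'e) metric \<Rightarrow> bool" where
  "riemannian_manifold A g \<longleftrightarrow> smooth_atlas A \<and> riemannian_metric A g"

text \<open>Koszul formula for constant coordinate fields \<open>a\<close>, \<open>b\<close>: the Levi-Civita connection
  satisfies \<open>\<nabla>\<^sub>a b = christoffel A g c x a b\<close>, i.e. its value on the coordinate fields with
  indices \<open>i\<close>, \<open>j\<close> is the vector with components \<open>\<Gamma>\<^sup>k\<^sub>i\<^sub>j\<close>.\<close>

definition christoffel ::
  "('a, 'e::euclidean_space) chart set \<Rightarrow> ('a, 'e) metric \<Rightarrow> ('a, 'e) chart \<Rightarrow>
   'e \<Rightarrow> 'e \<Rightarrow> 'e \<Rightarrow> 'e" where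
  "christoffel A g c x a b = (THE w. \<forall>e. metric_coord A g c x w e =
     (frechet_derivative (\<lambda>y. metric_coord A g c y b e) (at x) a
    + frechet_derivative (\<lambda>y. metric_coord A g c y a e) (at x) b
    - frechet_derivative (\<lambda>y. metric_coord A g c y a b) (at x) e) / 2)"

text \<open>The coordinate expression of \<open>\<nabla>\<^sub>\<gamma>\<^sub>' \<gamma>'\<close>.\<close>

definition covariant_acceleration ::
  "('a, 'e::euclidean_space) chart set \<Rightarrow> ('a, 'e) metric \<Rightarrow> ('a, 'e) chart \<Rightarrow>
   (real \<Rightarrow> 'a) \<Rightarrow> real \<Rightarrow> 'e" where
  "covariant_acceleration A g c \<gamma> t =
     (let x = snd c \<circ> \<gamma>; x' = (\<lambda>s. vector_derivative x (at s))
      in vector_derivative x' (at t) + christoffel A g c (x t) (x' t) (x' t))"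

definition geodesic_on ::
  "('a::topological_space, 'e::euclidean_space) chart set \<Rightarrow> ('a, 'e) metric \<Rightarrow>
   real set \<Rightarrow> (real \<Rightarrow> 'a) \<Rightarrow> bool" where
  "geodesic_on A g S \<gamma> \<longleftrightarrow> smooth_map euclid_atlas A S \<gamma> \<and>
     (\<forall>t\<in>S. \<forall>c\<in>A. \<gamma> t \<in> dom_chart c \<longrightarrow> covariant_acceleration A g c \<gamma> t = 0)"

definition geodesic_from ::
  "('a::topological_space, 'e::euclidean_space) chart set \<Rightarrow> ('a, 'e) metric \<Rightarrow>
   'a \<Rightarrow> ('a, 'e) tvec \<Rightarrow> (real \<Rightarrow> 'a) \<Rightarrow> bool" where
  "geodesic_from A g p \<xi> \<gamma> \<longleftrightarrow>
     (\<exists>\<epsilon>>0. geodesic_on A g {-\<epsilon><..<1 + \<epsilon>} \<gamma>) \<and> \<gamma> 0 = p \<and> velocity A \<gamma> 0 = \<xi>"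

text \<open>\<open>M\<close> need not be complete, so \<open>exp\<^sub>p\<close> is only meaningful on \<open>exp_domain A g p\<close>.\<close>

definition exp_domain ::
  "('a::topological_space, 'e::euclidean_space) chart set \<Rightarrow> ('a, 'e) metric \<Rightarrow>
   'a \<Rightarrow> ('a, 'e) tvec set" where
  "exp_domain A g p = {\<xi> \<in> tangent_space A p. \<exists>\<gamma>. geodesic_from A g p \<xi> \<gamma>}"

definition exp_map ::
  "('a::topological_space, 'e::euclidean_space) chart set \<Rightarrow> ('a, 'e) metric \<Rightarrow>
   'a \<Rightarrow> ('a, 'e) tvec \<Rightarrow> 'a" where
  "exp_map A g p \<xi> = (THE q. \<exists>\<gamma>. geodesic_from A g p \<xi> \<gamma> \<and> q = \<gamma> 1)"

definition riemannian_isometry ::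
  "('a::topological_space, 'e::euclidean_space) chart set \<Rightarrow> ('a, 'e) metric \<Rightarrow>
   ('a \<Rightarrow> 'a) \<Rightarrow> bool" where
  "riemannian_isometry A g F \<longleftrightarrow>
     bij F \<and> smooth_map A A UNIV F \<and> smooth_map A A UNIV (inv F) \<and>
     (\<forall>p. \<forall>\<xi>\<in>tangent_space A p. \<forall>\<eta>\<in>tangent_space A p.
        g (F p) (differential A A F p \<xi>) (differential A A F p \<eta>) = g p \<xi> \<eta>)"

definition unit_speed_curve ::
  "('a::topological_space, 'e::euclidean_space) chart set \<Rightarrow> ('a, 'e) metric \<Rightarrow>
   real set \<Rightarrow> (real \<Rightarrow> 'a) \<Rightarrow> bool" where
  "unit_speed_curve A g I \<alpha> \<longleftrightarrow> smooth_map euclid_atlas A I \<alpha> \<and>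
     (\<forall>u\<in>I. g (\<alpha> u) (velocity A \<alpha> u) (velocity A \<alpha> u) = 1)"

text \<open>A smooth field \<open>J\<close> of rotations by \<open>\<pi>/2\<close> of the tangent planes over an open subset \<open>U\<close> of a
  surface: in dimension two, the linear isometries taking every vector to an orthogonal one.\<close>

definition rotation_field ::
  "('a::topological_space, real^2) chart set \<Rightarrow> ('a, real^2) metric \<Rightarrow> 'a set \<Rightarrow>
   ('a \<Rightarrow> ('a, real^2) tvec \<Rightarrow> ('a, real^2) tvec) \<Rightarrow> bool" where
  "rotation_field A g U J \<longleftrightarrow>
     (\<forall>p\<in>U. \<forall>\<xi>\<in>tangent_space A p. \<forall>\<eta>\<in>tangent_space A p. \<forall>r.
        J p \<xi> \<in> tangent_space A p \<and>
        J p (tadd \<xi> \<eta>) = tadd (J p \<xi>) (J p \<eta>) \<and>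
        J p (tscale r \<xi>) = tscale r (J p \<xi>) \<and>
        g p (J p \<xi>) (J p \<eta>) = g p \<xi> \<eta> \<and>
        g p (J p \<xi>) \<xi> = 0) \<and>
     (\<forall>c\<in>A. \<forall>a. smooth_on (snd c ` (U \<inter> dom_chart c))
        (\<lambda>x. J (inv_chart c x) (coord_vec A c (inv_chart c x) a) c))"

subsection \<open>Regular surfaces in a manifold\<close>

text \<open>\<open>X\<close> restricted to the open set \<open>V\<close> is a regular local parametrization of \<open>\<Sigma>\<close> around \<open>p\<close>:
  an immersion which is a homeomorphism onto a neighbourhood of \<open>p\<close> in \<open>\<Sigma>\<close>.\<close>

definition regular_parametrization ::
  "('b::topological_space, 'f::euclidean_space) chart set \<Rightarrow> 'b set \<Rightarrow> 'b \<Rightarrow>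
   (real \<times> real) set \<Rightarrow> (real \<times> real \<Rightarrow> 'b) \<Rightarrow> bool" where
  "regular_parametrization B \<Sigma> p V X \<longleftrightarrow>
     open V \<and> p \<in> X ` V \<and> smooth_map euclid_atlas B V X \<and>
     (\<forall>x\<in>V. inj_on (differential euclid_atlas B X x) (tangent_space euclid_atlas x)) \<and>
     (\<exists>W. open W \<and> X ` V = \<Sigma> \<inter> W) \<and>
     homeomorphism V (X ` V) X (inv_into V X)"

definition regular_surface ::
  "('b::topological_space, 'f::euclidean_space) chart set \<Rightarrow> 'b set \<Rightarrow> bool" where
  "regular_surface B \<Sigma> \<longleftrightarrow> (\<forall>p\<in>\<Sigma>. \<exists>V X. regular_parametrization B \<Sigma> p V X)"

definition surface_tangent ::
  "('b::topological_space, 'f::euclidean_space) chart set \<Rightarrow> 'b set \<Rightarrow> 'b \<Rightarrow>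
   ('b, 'f) tvec set" where
  "surface_tangent B \<Sigma> p = {velocity B \<gamma> 0 | \<gamma> \<epsilon>.
     0 < \<epsilon> \<and> smooth_map euclid_atlas B {-\<epsilon><..<\<epsilon>} \<gamma> \<and> \<gamma> ` {-\<epsilon><..<\<epsilon>} \<subseteq> \<Sigma> \<and> \<gamma> 0 = p}"

definition unit_normal_field ::
  "('b::topological_space, 'f::euclidean_space) chart set \<Rightarrow> ('b, 'f) metric \<Rightarrow>
   'b set \<Rightarrow> 'b set \<Rightarrow> ('b \<Rightarrow> ('b, 'f) tvec) \<Rightarrow> bool" where
  "unit_normal_field B h \<Sigma> W \<nu> \<longleftrightarrow>
     (\<forall>q\<in>\<Sigma> \<inter> W. \<nu> q \<in> tangent_space B q \<and> h q (\<nu> q) (\<nu> q) = 1 \<and>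
        (\<forall>\<xi>\<in>surface_tangent B \<Sigma> q. h q (\<nu> q) \<xi> = 0)) \<and>
     (\<forall>c\<in>B. continuous_on (\<Sigma> \<inter> W \<inter> dom_chart c) (\<lambda>q. \<nu> q c))"

subsection \<open>The Riemannian product \<open>M \<times> \<real>\<close>\<close>

definition prod_metric ::
  "('a, 'e::euclidean_space) chart set \<Rightarrow> ('a, 'e) metric \<Rightarrow> ('a \<times> real, 'e \<times> real) metric" where
  "prod_metric A g q \<xi> \<eta> =
     (let d\<pi> = differential (prod_atlas A) A fst q;
          dt = (\<lambda>\<zeta>. differential (prod_atlas A) euclid_atlas snd q \<zeta> euclid_chart)
      in g (fst q) (d\<pi> \<xi>) (d\<pi> \<eta>) + dt \<xi> * dt \<eta>)"

definition vertical :: "('a, 'e::euclidean_space) chart set \<Rightarrow> 'a \<times> real \<Rightarrow>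
   ('a \<times> real, 'e \<times> real) tvec" where
  "vertical A q = velocity (prod_atlas A) (\<lambda>s. (fst q, s)) (snd q)"

text \<open>An arbitrary isometry of \<open>M \<times> \<real>\<close> need not respect the angle with \<open>\<partial>\<^sub>t\<close> (for flat \<open>M\<close> there
  are rotations mixing the two factors), so \<open>\<partial>\<^sub>t\<close> has to be preserved, up to sign.\<close>

definition vertical_isometry ::
  "('a::topological_space, 'e::euclidean_space) chart set \<Rightarrow> ('a, 'e) metric \<Rightarrow>
   ('a \<times> real \<Rightarrow> 'a \<times> real) \<Rightarrow> bool" where
  "vertical_isometry A g F \<longleftrightarrow>
     riemannian_isometry (prod_atlas A) (prod_metric A g) F \<and>
     (\<exists>\<sigma>\<in>{1, -1}. \<forall>q. differential (prod_atlas A) (prod_atlas A) F q (vertical A q) =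
        tscale \<sigma> (vertical A (F q)))"

text \<open>The unit normal is a local choice: \<open>\<Sigma>\<close> may be one-sided when \<open>cos \<theta> = 0\<close>.\<close>

definition constant_angle ::
  "('a::topological_space, 'e::euclidean_space) chart set \<Rightarrow> ('a, 'e) metric \<Rightarrow>
   ('a \<times> real) set \<Rightarrow> real \<Rightarrow> bool" where
  "constant_angle A g \<Sigma> \<theta> \<longleftrightarrow> (\<forall>p\<in>\<Sigma>. \<exists>W \<nu>. open W \<and> p \<in> W \<and>
     unit_normal_field (prod_atlas A) (prod_metric A g) \<Sigma> W \<nu> \<and>
     (\<forall>q\<in>\<Sigma> \<inter> W. prod_metric A g q (\<nu> q) (vertical A q) = cos \<theta>))"

definition angle_vector ::
  "('a, real^2) chart set \<Rightarrow> real \<Rightarrow> (real \<Rightarrow> 'a) \<Rightarrow>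
   ('a \<Rightarrow> ('a, real^2) tvec \<Rightarrow> ('a, real^2) tvec) \<Rightarrow> real \<Rightarrow> real \<Rightarrow> ('a, real^2) tvec" where
  "angle_vector A \<theta> \<alpha> J u v = tscale (v * cos \<theta>) (J (\<alpha> u) (velocity A \<alpha> u))"

definition angle_parametrization ::
  "('a::topological_space, real^2) chart set \<Rightarrow> ('a, real^2) metric \<Rightarrow> real \<Rightarrow>
   (real \<Rightarrow> 'a) \<Rightarrow> ('a \<Rightarrow> ('a, real^2) tvec \<Rightarrow> ('a, real^2) tvec) \<Rightarrow>
   real \<times> real \<Rightarrow> 'a \<times> real" where
  "angle_parametrization A g \<theta> \<alpha> J = (\<lambda>(u, v).
     (exp_map A g (\<alpha> u) (angle_vector A \<theta> \<alpha> J u v), v * sin \<theta>))"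

end

theory Submission
  imports Defs
begin

text \<open>Write the unit normal of \<open>\<Sigma>\<close> as \<open>(n, cos \<theta>)\<close>; then \<open>n\<close> has length \<open>\<bar>sin \<theta>\<bar>\<close>.

  If \<open>cos \<theta> \<noteq> 0\<close>, the surface is locally a graph over \<open>M\<close>. For \<open>sin \<theta> \<noteq> 0\<close> a multiple \<open>\<psi>\<close> of the height
  function has a gradient \<open>N\<close> of length one, so the integral curves of \<open>N\<close> are geodesics, along which \<open>\<psi>\<close>
  grows at unit rate; \<open>\<alpha>\<close> is an integral curve of \<open>- J N\<close>, that is, a level curve of \<open>\<psi>\<close>. For
  \<open>sin \<theta> = 0\<close> the height is constant and any unit speed curve will do. If \<open>cos \<theta> = 0\<close>, the surface
  is a cylinder over a curve, because the tangential directions of its projection to \<open>M\<close> are orthogonal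
  to \<open>n\<close>. In each case the parametrization has an invertible derivative in local coordinates of the surface.

  Conversely, the geodesics \<open>v \<mapsto> exp (v cos \<theta> J \<alpha>')\<close> all start orthogonally to \<open>\<alpha>\<close> with the same speed, so by
  the Gauss lemma they meet the curves \<open>v = const\<close> orthogonally. Hence \<open>(- sin \<theta> T, cos \<theta>)\<close>,
  with \<open>T\<close> the unit tangent of the geodesics, is normal to the surface; for \<open>cos \<theta> = 0\<close> use \<open>T = J \<alpha>'\<close>.\<close>

section \<open>Calculus of smooth maps\<close>

text \<open>The formula puts the curve \<open>v = 0\<close> at height 0, so the base point must
  first be brought to that height; a vertical translation is the only isometry that the forward
  direction uses. \<open>M\<close> need not be orientable, so \<open>J\<close> is built over the
  domain of a single chart, from the area form of the metric in that chart. Taking \<alpha>' = - J N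
  makes J \<alpha>' = N, because J squared is minus the identity.

  In the converse, the exponential map is known only through one geodesic for each u, defined on its
  own interval, and nothing says how these geodesics vary with u. Smooth dependence therefore has to
  come from the geodesic flow, which exists only locally in a chart. The Gauss lemma is arranged
  accordingly: for one fixed parameter value, differentiability in u of position and velocity is
  carried along [0,1] together with the orthogonality, chart by chart.

  For this the local flow must be smooth in time and initial value jointly, which is why ordinary
  differential equations are treated up to smooth dependence on parameters.\<close>

lemma Ck_on_cong_imp:
  "open S \<Longrightarrow> (\<And>x. x \<in> S \<Longrightarrow> f x = g x) \<Longrightarrow> Ck_on k S f \<Longrightarrow> Ck_on k S g"
proof (induction k arbitrary: f g)
  case 0
  then show ?case by (metis Ck_on.simps(1) continuous_on_cong)
next
  case (Suc k)
  have d: "(g has_derivative frechet_derivative f (at x)) (at x)" if "x \<in> S" for x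
    by (rule has_derivative_transform_within_open[OF _ Suc.prems(1) that Suc.prems(2)])
      (use Suc.prems(3) that in \<open>auto simp: frechet_derivative_works\<close>)
  have "Ck_on k S (\<lambda>x. frechet_derivative g (at x) v)" for v
    by (rule Suc.IH[OF Suc.prems(1), of "\<lambda>x. frechet_derivative f (at x) v"])
      (use Suc.prems(3) in \<open>auto simp: frechet_derivative_at[OF d, symmetric]\<close>)
  then show ?case
    using d by (auto intro: differentiableI)
qed

lemma Ck_on_cong:
  "open S \<Longrightarrow> (\<And>x. x \<in> S \<Longrightarrow> f x = g x) \<Longrightarrow> Ck_on k S f \<longleftrightarrow> Ck_on k S g"
  using Ck_on_cong_imp[of S f g k] Ck_on_cong_imp[of S g f k] by auto

lemma Ck_on_SucI:
  assumes "open S" "\<And>x. x \<in> S \<Longrightarrow> (f has_derivative f' x) (at x)" "\<And>v. Ck_on k S (\<lambda>x. f' x v)"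
  shows "Ck_on (Suc k) S f"
proof -
  have "Ck_on k S (\<lambda>x. frechet_derivative f (at x) v)" for v
    by (rule Ck_on_cong_imp[OF assms(1) _ assms(3)[of v]])
      (simp add: frechet_derivative_at[OF assms(2), symmetric])
  then show ?thesis using assms(2) by (auto intro: differentiableI)
qed

lemma Ck_on_SucD:
  "Ck_on (Suc k) S f \<Longrightarrow> x \<in> S \<Longrightarrow> (f has_derivative frechet_derivative f (at x)) (at x)"
  "Ck_on (Suc k) S f \<Longrightarrow> Ck_on k S (\<lambda>x. frechet_derivative f (at x) v)"
  by (auto simp: frechet_derivative_works)

lemma Ck_on_Suc_imp: "Ck_on (Suc k) S f \<Longrightarrow> Ck_on k S f"
proof (induction k arbitrary: f)
  case 0
  then show ?case
    by (auto intro!: continuous_at_imp_continuous_on differentiable_imp_continuous_within)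
qed auto

lemma Ck_on_mono: "Ck_on m S f \<Longrightarrow> k \<le> m \<Longrightarrow> Ck_on k S f"
  by (induction m) (auto simp: le_Suc_eq intro: Ck_on_Suc_imp simp del: Ck_on.simps)

lemma Ck_on_imp_continuous: "Ck_on k S f \<Longrightarrow> continuous_on S f"
  using Ck_on_mono[of k S f 0] by simp

lemma Ck_on_subset: "Ck_on k S f \<Longrightarrow> T \<subseteq> S \<Longrightarrow> Ck_on k T f"
  by (induction k arbitrary: f) (auto intro: continuous_on_subset)

lemma Ck_on_local:
  "(\<And>x. x \<in> S \<Longrightarrow> \<exists>U. open U \<and> x \<in> U \<and> Ck_on k (U \<inter> S) f) \<Longrightarrow> Ck_on k S f"
proof (induction k arbitrary: f)
  case 0
  have "continuous (at x within S) f" if xS: "x \<in> S" for x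
  proof -
    obtain U where U: "open U" "x \<in> U" "continuous_on (U \<inter> S) f" using 0[OF xS] by auto
    then have "continuous (at x within U \<inter> S) f" using that by (simp add: continuous_on_eq_continuous_within)
    moreover have "at x within U \<inter> S = at x within S"
      using U by (intro at_within_nhd[OF U(2,1)]) auto
    ultimately show ?thesis by simp
  qed
  then show ?case by (simp add: continuous_on_eq_continuous_within)
next
  case (Suc k)
  have "\<forall>x\<in>S. f differentiable (at x)" using Suc.prems by fastforce
  moreover have "Ck_on k S (\<lambda>x. frechet_derivative f (at x) v)" for v
  proof (rule Suc.IH)
    fix x assume "x \<in> S"
    from Suc.prems[OF this] obtain U where "open U" "x \<in> U" "Ck_on (Suc k) (U \<inter> S) f" by blast
    then show "\<exists>U. open U \<and> x \<in> U \<and> Ck_on k (U \<inter> S) (\<lambda>x. frechet_derivative f (at x) v)"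
      by auto
  qed
  ultimately show ?case by simp
qed

lemma Ck_on_const [simp]: "Ck_on k S (\<lambda>x. c)"
proof (induction k arbitrary: c)
  case (Suc k)
  then show ?case by simp
qed simp

lemma Ck_on_linear:
  assumes "open S" "bounded_linear L"
  shows "Ck_on k S f \<Longrightarrow> Ck_on k S (\<lambda>x. L (f x))"
proof (induction k arbitrary: f)
  case 0
  then show ?case using assms by (simp add: linear_continuous_on_compose bounded_linear.linear)
next
  case (Suc k)
  show ?case
    by (rule Ck_on_SucI[OF assms(1) bounded_linear.has_derivative[OF assms(2) Ck_on_SucD(1)[OF Suc.prems]]])
      (auto intro: Suc.IH Ck_on_SucD(2)[OF Suc.prems])
qed

lemma Ck_on_bounded_linear: "open S \<Longrightarrow> bounded_linear L \<Longrightarrow> Ck_on k S L"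
  by (cases k) (auto intro: linear_continuous_on Ck_on_SucI[of _ _ "\<lambda>_. L"] bounded_linear_imp_has_derivative
      simp del: Ck_on.simps(2))

lemma Ck_on_ident: "open S \<Longrightarrow> Ck_on k S (\<lambda>x. x)"
  by (rule Ck_on_bounded_linear) auto

lemma Ck_on_add:
  assumes "open S"
  shows "Ck_on k S f \<Longrightarrow> Ck_on k S g \<Longrightarrow> Ck_on k S (\<lambda>x. f x + g x)"
proof (induction k arbitrary: f g)
  case 0
  then show ?case by (simp add: continuous_on_add)
next
  case (Suc k)
  show ?case
    by (rule Ck_on_SucI[OF assms has_derivative_add[OF Ck_on_SucD(1)[OF Suc.prems(1)] Ck_on_SucD(1)[OF Suc.prems(2)]]])
      (auto intro: Suc.IH Ck_on_SucD(2)[OF Suc.prems(1)] Ck_on_SucD(2)[OF Suc.prems(2)])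
qed

lemma Ck_on_sum:
  assumes "open S" "\<And>i. i \<in> I \<Longrightarrow> Ck_on k S (f i)"
  shows "Ck_on k S (\<lambda>x. \<Sum>i\<in>I. f i x)"
  using assms(2) by (induction I rule: infinite_finite_induct) (auto intro: Ck_on_add assms(1))

lemma Ck_on_bilinear:
  assumes "open S" "bounded_bilinear B"
  shows "Ck_on k S f \<Longrightarrow> Ck_on k S g \<Longrightarrow> Ck_on k S (\<lambda>x. B (f x) (g x))"
proof (induction k arbitrary: f g)
  case 0
  then show ?case using assms by (simp add: bounded_bilinear.continuous_on)
next
  case (Suc k)
  show ?case
    by (rule Ck_on_SucI[OF assms(1) bounded_bilinear.FDERIV[OF assms(2) Ck_on_SucD(1)[OF Suc.prems(1)] Ck_on_SucD(1)[OF Suc.prems(2)]]])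
      (auto intro!: Ck_on_add assms Suc.IH Ck_on_SucD(2)[OF Suc.prems(1)] Ck_on_SucD(2)[OF Suc.prems(2)]
        Ck_on_Suc_imp[OF Suc.prems(1)] Ck_on_Suc_imp[OF Suc.prems(2)])
qed

lemma linear_basis_expansion:
  fixes L :: "'d::euclidean_space \<Rightarrow> 'e::real_vector"
  assumes "linear L"
  shows "L v = (\<Sum>b\<in>Basis. (v \<bullet> b) *\<^sub>R L b)"
proof -
  have "L v = L (\<Sum>b\<in>Basis. (v \<bullet> b) *\<^sub>R b)" by (simp add: euclidean_representation)
  then show ?thesis using assms by (simp add: linear_sum linear_scale)
qed

text \<open>The chain rule differentiates \<open>g\<close> in the direction
  \<open>frechet_derivative f (at x) v\<close>, which moves with \<open>x\<close>, while
  \<open>Ck_on\<close> speaks of fixed directions only. Expanding the moving direction over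
  \<open>Basis\<close> leaves fixed-direction derivatives of \<open>g\<close> with scalar
  coefficients, and the induction hypothesis applies to those.\<close>

lemma Ck_on_compose:
  fixes g :: "'e::euclidean_space \<Rightarrow> 'f::euclidean_space" and f :: "'d::euclidean_space \<Rightarrow> 'e"
  assumes "open S" "open T" "f ` S \<subseteq> T"
  shows "Ck_on k S f \<Longrightarrow> Ck_on k T g \<Longrightarrow> Ck_on k S (\<lambda>x. g (f x))"
proof (induction k arbitrary: g)
  case 0
  then show ?case using continuous_on_compose2[of T g S f] assms(3) by simp
next
  case (Suc k)
  have d: "((\<lambda>x. g (f x)) has_derivative
      (\<lambda>v. \<Sum>b\<in>Basis. (frechet_derivative f (at x) v \<bullet> b) *\<^sub>R frechet_derivative g (at (f x)) b)) (at x)"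
    if "x \<in> S" for x
  proof -
    have 1: "(g has_derivative frechet_derivative g (at (f x))) (at (f x))"
      using Ck_on_SucD(1)[OF Suc.prems(2)] assms that by auto
    have "((\<lambda>x. g (f x)) has_derivative (\<lambda>v. frechet_derivative g (at (f x)) (frechet_derivative f (at x) v))) (at x)"
      using diff_chain_at[OF Ck_on_SucD(1)[OF Suc.prems(1) that] 1] by (simp add: o_def)
    moreover have "(\<lambda>v. frechet_derivative g (at (f x)) (frechet_derivative f (at x) v)) =
        (\<lambda>v. \<Sum>b\<in>Basis. (frechet_derivative f (at x) v \<bullet> b) *\<^sub>R frechet_derivative g (at (f x)) b)"
      by (rule ext, rule linear_basis_expansion[OF has_derivative_linear[OF 1]])
    ultimately show ?thesis by (simp only:)
  qed
  show ?case
  proof (rule Ck_on_SucI[OF assms(1) d], assumption)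
    fix v
    show "Ck_on k S (\<lambda>x. \<Sum>b\<in>Basis. (frechet_derivative f (at x) v \<bullet> b) *\<^sub>R frechet_derivative g (at (f x)) b)"
      by (intro Ck_on_sum assms Ck_on_bilinear[OF _ bounded_bilinear_scaleR]
          Ck_on_linear[OF _ bounded_linear_inner_left] Suc.IH Ck_on_SucD(2)[OF Suc.prems(1)]
          Ck_on_SucD(2)[OF Suc.prems(2)] Ck_on_Suc_imp[OF Suc.prems(1)])
  qed
qed

text \<open>The derivative is a product of two copies of \<open>inverse\<close> itself with a
  constant, so the induction closes on the function being treated.\<close>

lemma Ck_on_inverse: "Ck_on k (- {0}) (inverse :: real \<Rightarrow> real)"
proof (induction k)
  case 0
  then show ?case by (auto intro!: continuous_intros)
next
  case (Suc k)
  have "((inverse :: real \<Rightarrow> real) has_derivative (\<lambda>h. - (inverse x * h * inverse x))) (at x)" if "x \<in> - {0}" for x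
    using has_derivative_inverse'[of x UNIV] that by auto
  then show ?case
    by (rule Ck_on_SucI[rotated])
      (auto intro!: Ck_on_linear[OF _ bounded_linear_minus[OF bounded_linear_ident]]
         Ck_on_bilinear[OF _ bounded_bilinear_mult] Suc)
qed

lemma Ck_on_sqrt: "Ck_on k {0<..} sqrt"
proof (induction k)
  case 0
  then show ?case by (auto intro!: continuous_intros)
next
  case (Suc k)
  have "(sqrt has_derivative (\<lambda>h. (h / 2) * inverse (sqrt x))) (at x)" if "x \<in> {0<..}" for x
  proof -
    have "(sqrt has_derivative (*) (inverse (sqrt x) / 2)) (at x)"
      using DERIV_real_sqrt[of x] that by (simp add: has_field_derivative_def)
    moreover have "(*) (inverse (sqrt x) / 2) = (\<lambda>h. (h / 2) * inverse (sqrt x))" by auto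
    ultimately show ?thesis by simp
  qed
  moreover have "Ck_on k {0<..} (\<lambda>x. (h / 2) * inverse (sqrt x))" for h :: real
    by (intro Ck_on_bilinear[OF _ bounded_bilinear_mult] Ck_on_const
        Ck_on_compose[OF _ _ _ Suc Ck_on_inverse]) auto
  ultimately show ?case
    by (intro Ck_on_SucI) auto
qed

lemma smooth_on_has_derivative:
  "smooth_on S f \<Longrightarrow> x \<in> S \<Longrightarrow> (f has_derivative frechet_derivative f (at x)) (at x)"
  using Ck_on_SucD(1) unfolding smooth_on_def by blast

lemma smooth_on_frechet: "smooth_on S f \<Longrightarrow> smooth_on S (\<lambda>x. frechet_derivative f (at x) v)"
  using Ck_on_SucD(2) unfolding smooth_on_def by blast

lemma smooth_on_continuous: "smooth_on S f \<Longrightarrow> continuous_on S f"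
  using Ck_on_imp_continuous unfolding smooth_on_def by blast

lemma smooth_on_cong: "open S \<Longrightarrow> (\<And>x. x \<in> S \<Longrightarrow> f x = g x) \<Longrightarrow> smooth_on S f \<longleftrightarrow> smooth_on S g"
  unfolding smooth_on_def using Ck_on_cong by blast

lemma smooth_on_subset: "smooth_on S f \<Longrightarrow> T \<subseteq> S \<Longrightarrow> smooth_on T f"
  unfolding smooth_on_def using Ck_on_subset by blast

lemma smooth_on_local:
  assumes "\<And>x. x \<in> S \<Longrightarrow> \<exists>U. open U \<and> x \<in> U \<and> smooth_on (U \<inter> S) f"
  shows "smooth_on S f"
  unfolding smooth_on_def
proof
  fix k show "Ck_on k S f" by (rule Ck_on_local) (use assms in \<open>force simp: smooth_on_def\<close>)
qed

lemma smooth_on_const [simp]: "smooth_on S (\<lambda>x. c)"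
  by (simp add: smooth_on_def)

lemma smooth_on_ident: "open S \<Longrightarrow> smooth_on S (\<lambda>x. x)"
  by (simp add: smooth_on_def Ck_on_ident)

lemma smooth_on_linear: "bounded_linear L \<Longrightarrow> open S \<Longrightarrow> smooth_on S f \<Longrightarrow> smooth_on S (\<lambda>x. L (f x))"
  by (simp add: smooth_on_def Ck_on_linear)

lemma smooth_on_bilinear: "bounded_bilinear B \<Longrightarrow> open S \<Longrightarrow> smooth_on S f \<Longrightarrow> smooth_on S g \<Longrightarrow>
    smooth_on S (\<lambda>x. B (f x) (g x))"
  by (simp add: smooth_on_def Ck_on_bilinear)

lemma smooth_on_add: "open S \<Longrightarrow> smooth_on S f \<Longrightarrow> smooth_on S g \<Longrightarrow> smooth_on S (\<lambda>x. f x + g x)"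
  by (simp add: smooth_on_def Ck_on_add)

lemma smooth_on_minus: "open S \<Longrightarrow> smooth_on S f \<Longrightarrow> smooth_on S (\<lambda>x. - f x)"
  by (rule smooth_on_linear) (auto intro: bounded_linear_minus)

lemma smooth_on_diff: "open S \<Longrightarrow> smooth_on S f \<Longrightarrow> smooth_on S g \<Longrightarrow> smooth_on S (\<lambda>x. f x - g x)"
  using smooth_on_add[of S f "\<lambda>x. - g x"] smooth_on_minus by auto

lemma smooth_on_sum: "open S \<Longrightarrow> (\<And>i. i \<in> I \<Longrightarrow> smooth_on S (f i)) \<Longrightarrow> smooth_on S (\<lambda>x. \<Sum>i\<in>I. f i x)"
  by (simp add: smooth_on_def Ck_on_sum)

lemmas smooth_on_mult = smooth_on_bilinear[OF bounded_bilinear_mult]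
lemmas smooth_on_scaleR = smooth_on_bilinear[OF bounded_bilinear_scaleR]

lemma smooth_on_fst: "open S \<Longrightarrow> smooth_on S f \<Longrightarrow> smooth_on S (\<lambda>x. fst (f x))"
  by (rule smooth_on_linear) (auto intro: bounded_linear_fst)

lemma smooth_on_snd: "open S \<Longrightarrow> smooth_on S f \<Longrightarrow> smooth_on S (\<lambda>x. snd (f x))"
  by (rule smooth_on_linear) (auto intro: bounded_linear_snd)

lemma smooth_on_Pair:
  assumes "open S" "smooth_on S f" "smooth_on S g"
  shows "smooth_on S (\<lambda>x. (f x, g x))"
proof -
  have 1: "smooth_on S (\<lambda>x. (f x, 0))" "smooth_on S (\<lambda>x. (0, g x))"
    by (rule smooth_on_linear; (fact | intro bounded_linear_Pair bounded_linear_ident bounded_linear_zero))+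
  show ?thesis using smooth_on_add[OF assms(1) 1] by simp
qed

lemma smooth_on_nth: "open S \<Longrightarrow> smooth_on S f \<Longrightarrow> smooth_on S (\<lambda>x. f x $ i)"
  by (rule smooth_on_linear) (auto intro: bounded_linear_vec_nth)

lemma smooth_on_compose:
  "open S \<Longrightarrow> open T \<Longrightarrow> f ` S \<subseteq> T \<Longrightarrow> smooth_on S f \<Longrightarrow> smooth_on T g \<Longrightarrow> smooth_on S (\<lambda>x. g (f x))"
  by (simp add: smooth_on_def Ck_on_compose)

lemma smooth_on_inverse:
  fixes f :: "'d::euclidean_space \<Rightarrow> real"
  assumes "open S" "smooth_on S f" "\<And>x. x \<in> S \<Longrightarrow> f x \<noteq> 0"
  shows "smooth_on S (\<lambda>x. inverse (f x))"
  by (rule smooth_on_compose[OF assms(1), of "-{0}" f inverse])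
    (use assms Ck_on_inverse in \<open>auto simp: smooth_on_def\<close>)

lemma smooth_on_divide:
  fixes f :: "'d::euclidean_space \<Rightarrow> real"
  assumes "open S" "smooth_on S f" "smooth_on S g" "\<And>x. x \<in> S \<Longrightarrow> g x \<noteq> 0"
  shows "smooth_on S (\<lambda>x. f x / g x)"
  using smooth_on_mult[OF assms(1,2) smooth_on_inverse[OF assms(1,3,4)]] by (simp add: field_simps)

lemma smooth_on_sqrt:
  assumes "open S" "smooth_on S f" "\<And>x. x \<in> S \<Longrightarrow> f x > 0"
  shows "smooth_on S (\<lambda>x. sqrt (f x))"
  by (rule smooth_on_compose[OF assms(1), of "{0<..}" f sqrt])
    (use assms Ck_on_sqrt in \<open>auto simp: smooth_on_def\<close>)

text \<open>Used to let the vector argument of a derivative, metric or rotation move with the point: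
  linearity expands it over the finite basis, so smoothness for each fixed vector is enough.\<close>

lemma smooth_on_apply_linear:
  assumes "open S" "\<And>v. smooth_on S (\<lambda>x. L x v)" "\<And>x. x \<in> S \<Longrightarrow> linear (L x)" "smooth_on S f"
  shows "smooth_on S (\<lambda>x. L x (f x))"
proof -
  have 1: "smooth_on S (\<lambda>x. \<Sum>b\<in>Basis. (f x \<bullet> b) *\<^sub>R L x b)"
    by (intro smooth_on_sum smooth_on_scaleR smooth_on_linear[OF bounded_linear_inner_left] assms)
  have 2: "L x (f x) = (\<Sum>b\<in>Basis. (f x \<bullet> b) *\<^sub>R L x b)" if "x \<in> S" for x
    by (rule linear_basis_expansion[OF assms(3)[OF that]])
  show ?thesis by (rule iffD2[OF smooth_on_cong[OF assms(1) 2] 1])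
qed

lemma smooth_on_frechet_apply:
  assumes "open S" "open T" "h ` S \<subseteq> T" "smooth_on S h" "smooth_on T f" "smooth_on S w"
  shows "smooth_on S (\<lambda>x. frechet_derivative f (at (h x)) (w x))"
proof (rule smooth_on_apply_linear[where L = "\<lambda>x. frechet_derivative f (at (h x))"])
  fix v show "smooth_on S (\<lambda>x. frechet_derivative f (at (h x)) v)"
    by (rule smooth_on_compose[OF assms(1-4) smooth_on_frechet[OF assms(5)]])
next
  show "linear (frechet_derivative f (at (h x)))" if "x \<in> S" for x
    using has_derivative_linear smooth_on_has_derivative assms that by blast
qed (use assms in auto)

section \<open>Uniform estimates for derivatives on compact convex sets\<close>

lemma onorm_basis_bound:
  fixes L :: "'d::euclidean_space \<Rightarrow> 'e::real_normed_vector"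
  assumes "linear L" "\<And>b. b \<in> Basis \<Longrightarrow> norm (L b) \<le> c b"
  shows "norm (L v) \<le> (\<Sum>b\<in>Basis. c b) * norm v"
proof -
  have "norm (L v) \<le> (\<Sum>b\<in>Basis. norm ((v \<bullet> b) *\<^sub>R L b))"
    by (subst linear_basis_expansion[OF assms(1)]) (rule norm_sum)
  also have "\<dots> \<le> (\<Sum>b\<in>Basis. c b * norm v)"
  proof (rule sum_mono)
    fix b :: 'd assume b: "b \<in> Basis"
    have "norm ((v \<bullet> b) *\<^sub>R L b) \<le> norm v * c b"
      using Basis_le_norm[OF b, of v] assms(2)[OF b] by (simp add: mult_mono)
    then show "norm ((v \<bullet> b) *\<^sub>R L b) \<le> c b * norm v" by (simp add: mult.commute)
  qed
  finally show ?thesis by (simp add: sum_distrib_right)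
qed

text \<open>Each basis derivative is continuous, hence bounded on the compact set; convexity turns
  the resulting bound on the derivative into a Lipschitz bound with the same constant.\<close>

lemma C1_lipschitz_on_compact:
  assumes "Ck_on (Suc 0) S F" "compact K" "convex K" "K \<subseteq> S"
  obtains L where "0 \<le> L" "\<And>x y. x \<in> K \<Longrightarrow> y \<in> K \<Longrightarrow> norm (F x - F y) \<le> L * norm (x - y)"
    "\<And>x v. x \<in> K \<Longrightarrow> norm (frechet_derivative F (at x) v) \<le> L * norm v"
proof -
  have "\<exists>c. \<forall>x\<in>K. norm (frechet_derivative F (at x) b) \<le> c" for b
  proof -
    have "compact ((\<lambda>x. frechet_derivative F (at x) b) ` K)"
      using Ck_on_SucD(2)[OF assms(1), of b] assms by (intro compact_continuous_image) (auto intro: continuous_on_subset)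
    then show ?thesis by (meson bounded_iff compact_imp_bounded image_eqI)
  qed
  then obtain c where c: "\<And>b x. x \<in> K \<Longrightarrow> norm (frechet_derivative F (at x) b) \<le> c b" by metis
  define L where "L = \<bar>\<Sum>b\<in>Basis. c b\<bar>"
  have d: "(F has_derivative frechet_derivative F (at x)) (at x)" if "x \<in> K" for x
    using Ck_on_SucD(1)[OF assms(1)] that assms(4) by blast
  have L: "norm (frechet_derivative F (at x) v) \<le> L * norm v" if "x \<in> K" for x v
  proof -
    have "norm (frechet_derivative F (at x) v) \<le> (\<Sum>b\<in>Basis. c b) * norm v"
      by (rule onorm_basis_bound[OF has_derivative_linear[OF d[OF that]] c[OF that]])
    also have "\<dots> \<le> L * norm v" unfolding L_def by (intro mult_right_mono) auto
    finally show ?thesis .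
  qed
  show thesis
  proof
    show "norm (F x - F y) \<le> L * norm (x - y)" if "x \<in> K" "y \<in> K" for x y
      by (rule differentiable_bound[OF assms(3) has_derivative_at_withinI[OF d] onorm_bound[OF _ L] that])
        (auto simp: L_def)
  qed (use L in \<open>auto simp: L_def\<close>)
qed

text \<open>The finitely many basis derivatives are uniformly continuous on \<open>K\<close>, which
  gives a \<delta> independent of \<open>x\<close>. The linearization estimate is then applied on
  \<open>K \<inter> ball x \<delta>\<close>, a set containing the segment from \<open>x\<close> to
  \<open>y\<close>.\<close>

lemma C1_uniformly_differentiable_on_compact:
  fixes F :: "'d::euclidean_space \<Rightarrow> 'e::euclidean_space"
  assumes "Ck_on (Suc 0) S F" "compact K" "convex K" "K \<subseteq> S" "0 < \<epsilon>"
  obtains \<delta> where "0 < \<delta>"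
    "\<And>x y. x \<in> K \<Longrightarrow> y \<in> K \<Longrightarrow> norm (y - x) < \<delta> \<Longrightarrow>
       norm (F y - F x - frechet_derivative F (at x) (y - x)) \<le> \<epsilon> * norm (y - x)"
proof -
  let ?D = "\<lambda>x. frechet_derivative F (at x)"
  \<comment> \<open>The operator norm is bounded by the sum of the bounds over the basis directions,
    so each direction gets an equal share of \<epsilon>.\<close>
  define \<eta> where "\<eta> = \<epsilon> / DIM('d)"
  have \<eta>: "\<eta> > 0" using assms by (simp add: \<eta>_def)
  have "\<exists>\<delta>>0. \<forall>x\<in>K. \<forall>y\<in>K. dist y x < \<delta> \<longrightarrow> norm (?D y b - ?D x b) < \<eta>" for b
  proof -
    have "uniformly_continuous_on K (\<lambda>x. ?D x b)"
      using Ck_on_SucD(2)[OF assms(1), of b] assms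
      by (intro compact_uniformly_continuous) (auto intro: continuous_on_subset)
    then show ?thesis using \<eta> unfolding uniformly_continuous_on_def by (metis dist_norm)
  qed
  then obtain d where d: "\<And>b. d b > 0" "\<And>b x y. x \<in> K \<Longrightarrow> y \<in> K \<Longrightarrow> dist y x < d b \<Longrightarrow> norm (?D y b - ?D x b) < \<eta>"
    by metis
  define \<delta> where "\<delta> = Min (d ` Basis)"
  have \<delta>: "\<delta> > 0" "\<And>b. b \<in> Basis \<Longrightarrow> \<delta> \<le> d b" using d(1) by (auto simp: \<delta>_def)
  have der: "(F has_derivative ?D x) (at x)" if "x \<in> K" for x
    using Ck_on_SucD(1)[OF assms(1)] that assms(4) by blast
  show thesis
  proof (rule that[OF \<delta>(1)])
    fix x y assume xy: "x \<in> K" "y \<in> K" "norm (y - x) < \<delta>"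
    have seg: "x + t *\<^sub>R (y - x) \<in> K \<inter> ball x \<delta>" if "t \<in> {0..1}" for t
    proof -
      have "x + t *\<^sub>R (y - x) = (1 - t) *\<^sub>R x + t *\<^sub>R y" by (simp add: algebra_simps)
      then have "x + t *\<^sub>R (y - x) \<in> K" using assms(3) xy that by (auto simp: convex_alt)
      moreover have "norm (t *\<^sub>R (y - x)) \<le> 1 * norm (y - x)"
        using that by (simp add: mult_left_le_one_le)
      ultimately show ?thesis using xy(3) by (simp add: dist_norm)
    qed
    have "onorm (?D z - ?D x) \<le> \<epsilon>" if z: "z \<in> K \<inter> ball x \<delta>" for z
    proof (rule onorm_bound)
      have "linear (?D z - ?D x)"
        using has_derivative_linear[OF der] z xy by (auto simp: fun_diff_def intro: linear_compose_sub)
      moreover have "norm ((?D z - ?D x) b) \<le> \<eta>" if "b \<in> Basis" for b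
        using d(2)[of x z b] z xy \<delta>(2)[OF that] by (auto simp: dist_commute less_imp_le)
      ultimately show "norm ((?D z - ?D x) v) \<le> \<epsilon> * norm v" for v
        using onorm_basis_bound[of "?D z - ?D x" "\<lambda>_. \<eta>"] by (simp add: \<eta>_def)
    qed (use assms in auto)
    then show "norm (F y - F x - ?D x (y - x)) \<le> \<epsilon> * norm (y - x)"
      using differentiable_bound_linearization[of x y "K \<inter> ball x \<delta>" F ?D x \<epsilon>] seg der xy \<delta>
      by (auto intro: has_derivative_at_withinI simp: mult.commute)
  qed
qed

text \<open>The quotient is symmetric in \<open>u\<close> and \<open>v\<close>, but the limit
  computed here treats them differently: it differentiates first in direction \<open>u\<close>, then
  in direction \<open>v\<close>. Comparing both orders yields the symmetry of second
  derivatives.\<close>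

lemma second_difference_limit:
  fixes f :: "'d::real_normed_vector \<Rightarrow> 'e::real_normed_vector"
  assumes "open S" "x \<in> S" "\<And>y. y \<in> S \<Longrightarrow> (f has_derivative D y) (at y)"
    and h: "((\<lambda>y. D y u) has_derivative H) (at x)"
  shows "((\<lambda>t. (f (x + t *\<^sub>R u + t *\<^sub>R v) - f (x + t *\<^sub>R u) - f (x + t *\<^sub>R v) + f x) /\<^sub>R t\<^sup>2) \<longlongrightarrow> H v) (at_right 0)"
proof (rule tendstoI)
  fix e :: real assume e: "e > 0"
  \<comment> \<open>Chosen so that all points \<open>s *\<^sub>R u + t *\<^sub>R v\<close> with
    \<open>s\<close> in \<open>{0..t}\<close> have norm at most \<open>t * N\<close>; the summand 1
    keeps \<open>N\<close> positive when both vectors vanish.\<close>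
  define N where "N = 2 * norm u + norm v + 1"
  have N: "N > 0" by (simp add: N_def add_nonneg_pos)
  \<comment> \<open>Two remainders enter below, each at most a third of \<open>e * t\<close>; the
    total of two thirds leaves a strict inequality.\<close>
  have "e / (3 * N) > 0" using e N by simp
  then obtain d where d: "d > 0" "\<And>y. norm (y - x) < d \<Longrightarrow> norm (D y u - D x u - H (y - x)) \<le> e / (3 * N) * norm (y - x)"
    using h unfolding has_derivative_at_alt by metis
  obtain r where r: "r > 0" "ball x r \<subseteq> S" using assms(1,2) openE by blast
  define t0 where "t0 = min d r / N"
  have t0: "t0 > 0" using d r N by (simp add: t0_def)
  interpret H: bounded_linear H using h by (rule has_derivative_bounded_linear)
  have "dist ((f (x + t *\<^sub>R u + t *\<^sub>R v) - f (x + t *\<^sub>R u) - f (x + t *\<^sub>R v) + f x) /\<^sub>R t\<^sup>2) (H v) < e"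
    if t: "0 < t" "t < t0" for t
  proof -
    \<comment> \<open>The increment of \<phi> from 0 to \<open>t\<close> is the second difference
      minus \<open>t\<^sup>2 *\<^sub>R H v\<close>, so the mean value inequality in \<open>s\<close>
      alone estimates the error.\<close>
    define \<phi> where "\<phi> s = f (x + s *\<^sub>R u + t *\<^sub>R v) - f (x + s *\<^sub>R u) - s *\<^sub>R H (t *\<^sub>R v)" for s
    have tN: "t * N < min d r" using t N by (simp add: t0_def field_simps)
    have near: "norm (s *\<^sub>R u + t *\<^sub>R v) \<le> t * N" "norm (s *\<^sub>R u) \<le> t * N" if "s \<in> {0..t}" for s
    proof -
      have su: "s * norm u \<le> t * norm u" "0 \<le> t * norm u" "0 \<le> t * norm v" using that t by (auto intro: mult_right_mono)
      have tN': "t * N = 2 * (t * norm u) + t * norm v + t" unfolding N_def by (simp add: algebra_simps)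
      have "norm (s *\<^sub>R u + t *\<^sub>R v) \<le> s * norm u + t * norm v"
        using norm_triangle_ineq[of "s *\<^sub>R u" "t *\<^sub>R v"] that t by simp
      also have "\<dots> \<le> t * N" using su t tN' by linarith
      finally show "norm (s *\<^sub>R u + t *\<^sub>R v) \<le> t * N" .
      have "norm (s *\<^sub>R u) = s * norm u" using that by simp
      also have "\<dots> \<le> t * N" using su t tN' by linarith
      finally show "norm (s *\<^sub>R u) \<le> t * N" .
    qed
    have inS: "x + s *\<^sub>R u + t *\<^sub>R v \<in> S" "x + s *\<^sub>R u \<in> S" if "s \<in> {0..t}" for s
    proof -
      have *: "x + w \<in> S" if "norm w < r" for w
        using that r(2) by (auto simp: dist_norm subset_iff)
      show "x + s *\<^sub>R u + t *\<^sub>R v \<in> S" "x + s *\<^sub>R u \<in> S"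
        using *[of "s *\<^sub>R u + t *\<^sub>R v"] *[of "s *\<^sub>R u"] near[OF that] tN by (simp_all add: add.assoc)
    qed
    have der: "(\<phi> has_derivative (\<lambda>h. h *\<^sub>R (D (x + s *\<^sub>R u + t *\<^sub>R v) u - D (x + s *\<^sub>R u) u - H (t *\<^sub>R v)))) (at s within {0..t})"
      if s: "s \<in> {0..t}" for s
    proof -
      note D1 = assms(3)[OF inS(1)[OF s]] and D2 = assms(3)[OF inS(2)[OF s]]
      have 1: "((\<lambda>s. f (x + s *\<^sub>R u + t *\<^sub>R v)) has_derivative (\<lambda>h. D (x + s *\<^sub>R u + t *\<^sub>R v) (h *\<^sub>R u))) (at s within {0..t})"
        by (rule has_derivative_compose[where f = "\<lambda>s. x + s *\<^sub>R u + t *\<^sub>R v" and g = f, OF _ D1]) (auto intro!: derivative_eq_intros)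
      have 2: "((\<lambda>s. f (x + s *\<^sub>R u)) has_derivative (\<lambda>h. D (x + s *\<^sub>R u) (h *\<^sub>R u))) (at s within {0..t})"
        by (rule has_derivative_compose[where f = "\<lambda>s. x + s *\<^sub>R u" and g = f, OF _ D2]) (auto intro!: derivative_eq_intros)
      have s: "D (x + s *\<^sub>R u + t *\<^sub>R v) (h *\<^sub>R u) = h *\<^sub>R D (x + s *\<^sub>R u + t *\<^sub>R v) u"
        "D (x + s *\<^sub>R u) (h *\<^sub>R u) = h *\<^sub>R D (x + s *\<^sub>R u) u" for h
        by (rule linear_scale[OF has_derivative_linear] D1 D2)+
      show ?thesis
        unfolding \<phi>_def
        by (rule has_derivative_eq_rhs, rule has_derivative_diff[OF has_derivative_diff[OF 1 2]],
            rule derivative_intros, rule derivative_intros)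
          (auto simp: fun_eq_iff s scaleR_diff_right)
    qed
    have bd: "norm (D (x + s *\<^sub>R u + t *\<^sub>R v) u - D (x + s *\<^sub>R u) u - H (t *\<^sub>R v)) \<le> 2 * (e / (3 * N) * (t * N))"
      if s: "s \<in> {0..t}" for s
    proof -
      have a: "norm (D (x + s *\<^sub>R u + t *\<^sub>R v) u - D x u - H (s *\<^sub>R u + t *\<^sub>R v)) \<le> e / (3 * N) * (t * N)"
      proof -
        have "norm (D (x + s *\<^sub>R u + t *\<^sub>R v) u - D x u - H (s *\<^sub>R u + t *\<^sub>R v)) \<le> e / (3 * N) * norm (s *\<^sub>R u + t *\<^sub>R v)"
          using d(2)[of "x + s *\<^sub>R u + t *\<^sub>R v"] near(1)[OF s] tN by (simp add: add.assoc)
        also have "\<dots> \<le> e / (3 * N) * (t * N)" using near(1)[OF s] e N by (intro mult_left_mono) auto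
        finally show ?thesis .
      qed
      have b: "norm (D (x + s *\<^sub>R u) u - D x u - H (s *\<^sub>R u)) \<le> e / (3 * N) * (t * N)"
      proof -
        have "norm (D (x + s *\<^sub>R u) u - D x u - H (s *\<^sub>R u)) \<le> e / (3 * N) * norm (s *\<^sub>R u)"
          using d(2)[of "x + s *\<^sub>R u"] near(2)[OF s] tN by simp
        also have "\<dots> \<le> e / (3 * N) * (t * N)" using near(2)[OF s] e N by (intro mult_left_mono) auto
        finally show ?thesis .
      qed
      have eq: "D (x + s *\<^sub>R u + t *\<^sub>R v) u - D (x + s *\<^sub>R u) u - H (t *\<^sub>R v) =
        (D (x + s *\<^sub>R u + t *\<^sub>R v) u - D x u - H (s *\<^sub>R u + t *\<^sub>R v)) - (D (x + s *\<^sub>R u) u - D x u - H (s *\<^sub>R u))"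
        by (simp add: H.add)
      show ?thesis unfolding eq mult_2 by (rule order.trans[OF norm_triangle_ineq4 add_mono[OF a b]])
    qed
    have B0: "0 \<le> 2 * (e / (3 * N) * (t * N))" using e N t by simp
    have "norm (\<phi> t - \<phi> 0) \<le> 2 * (e / (3 * N) * (t * N)) * norm (t - 0)"
    proof (rule differentiable_bound[OF _ der])
      show "onorm (\<lambda>h. h *\<^sub>R (D (x + s *\<^sub>R u + t *\<^sub>R v) u - D (x + s *\<^sub>R u) u - H (t *\<^sub>R v))) \<le> 2 * (e / (3 * N) * (t * N))"
        if "s \<in> {0..t}" for s
      proof (rule onorm_bound[OF B0])
        show "norm (h *\<^sub>R (D (x + s *\<^sub>R u + t *\<^sub>R v) u - D (x + s *\<^sub>R u) u - H (t *\<^sub>R v))) \<le> 2 * (e / (3 * N) * (t * N)) * norm h" for h :: real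
          using mult_left_mono[OF bd[OF that], of "\<bar>h\<bar>"] by (simp add: mult.commute)
      qed
    qed (use t in auto)
    then have *: "norm (\<phi> t - \<phi> 0) \<le> (2/3) * e * t\<^sup>2"
      using N t by (simp add: power2_eq_square)
    have "\<phi> t - \<phi> 0 = (f (x + t *\<^sub>R u + t *\<^sub>R v) - f (x + t *\<^sub>R u) - f (x + t *\<^sub>R v) + f x) - t\<^sup>2 *\<^sub>R H v"
      by (simp add: \<phi>_def H.scaleR power2_eq_square algebra_simps)
    then have "(f (x + t *\<^sub>R u + t *\<^sub>R v) - f (x + t *\<^sub>R u) - f (x + t *\<^sub>R v) + f x) /\<^sub>R t\<^sup>2 - H v = (\<phi> t - \<phi> 0) /\<^sub>R t\<^sup>2"
      using t by (simp add: scaleR_diff_right)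
    then have "dist ((f (x + t *\<^sub>R u + t *\<^sub>R v) - f (x + t *\<^sub>R u) - f (x + t *\<^sub>R v) + f x) /\<^sub>R t\<^sup>2) (H v) = norm (\<phi> t - \<phi> 0) / t\<^sup>2"
      by (simp add: dist_norm divide_inverse mult.commute)
    also have "\<dots> \<le> (2/3) * e" using * t by (simp add: divide_le_eq)
    finally show ?thesis using e by simp
  qed
  then show "\<forall>\<^sub>F t in at_right 0. dist ((f (x + t *\<^sub>R u + t *\<^sub>R v) - f (x + t *\<^sub>R u) - f (x + t *\<^sub>R v) + f x) /\<^sub>R t\<^sup>2) (H v) < e"
    unfolding eventually_at_right_field using t0 by (intro exI[of _ t0]) auto
qed

text \<open>Interchanging \<open>u\<close> and \<open>v\<close> leaves the second difference
  quotient unchanged, so its limit has both values.\<close>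

lemma frechet_derivative_symmetric:
  assumes "open S" "smooth_on S f" "x \<in> S"
  shows "frechet_derivative (\<lambda>y. frechet_derivative f (at y) u) (at x) v =
         frechet_derivative (\<lambda>y. frechet_derivative f (at y) v) (at x) u"
proof -
  have 1: "((\<lambda>t. (f (x + t *\<^sub>R u + t *\<^sub>R v) - f (x + t *\<^sub>R u) - f (x + t *\<^sub>R v) + f x) /\<^sub>R t\<^sup>2) \<longlongrightarrow>
      frechet_derivative (\<lambda>y. frechet_derivative f (at y) u) (at x) v) (at_right 0)" for u v
    by (rule second_difference_limit[OF assms(1,3) smooth_on_has_derivative[OF assms(2)]
        smooth_on_has_derivative[OF smooth_on_frechet[OF assms(2)] assms(3)]])
  have eq: "(\<lambda>t. (f (x + t *\<^sub>R u + t *\<^sub>R v) - f (x + t *\<^sub>R u) - f (x + t *\<^sub>R v) + f x) /\<^sub>R t\<^sup>2) =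
        (\<lambda>t. (f (x + t *\<^sub>R v + t *\<^sub>R u) - f (x + t *\<^sub>R v) - f (x + t *\<^sub>R u) + f x) /\<^sub>R t\<^sup>2)"
    by (auto simp: algebra_simps)
  show ?thesis
    by (rule tendsto_unique[OF trivial_limit_at_right_real 1[of u v]]) (unfold eq, rule 1)
qed

text \<open>Cramer's rule. The explicit form is wanted because it exhibits the derivative of an
  inverse map as a rational expression in the derivative of the map.\<close>

lemma linear_plane_inverse:
  fixes T :: "real \<times> real \<Rightarrow> real \<times> real"
  assumes "linear T" "\<And>z. T z = 0 \<Longrightarrow> z = 0"
  defines "\<Delta> \<equiv> fst (T (1,0)) * snd (T (0,1)) - fst (T (0,1)) * snd (T (1,0))"
  shows "\<Delta> \<noteq> 0"
    and "T z = y \<Longrightarrow> z = ((snd (T (0,1)) * fst y - fst (T (0,1)) * snd y) / \<Delta>,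
                        (fst (T (1,0)) * snd y - snd (T (1,0)) * fst y) / \<Delta>)"
proof -
  have T: "T z = fst z *\<^sub>R T (1,0) + snd z *\<^sub>R T (0,1)" for z
    using linear_add[OF assms(1), of "fst z *\<^sub>R (1,0)" "snd z *\<^sub>R (0,1)"]
      linear_scale[OF assms(1), of "fst z" "(1,0)"] linear_scale[OF assms(1), of "snd z" "(0,1)"]
    by simp
  show \<Delta>: "\<Delta> \<noteq> 0"
  proof
    assume "\<Delta> = 0"
    \<comment> \<open>\<open>T\<close> sends these two vectors to (\<Delta>, 0) and (0, -\<Delta>),
      so both lie in the kernel and all entries of \<open>T\<close> vanish.\<close>
    then have "T (snd (T (0,1)), - snd (T (1,0))) = 0" "T (fst (T (0,1)), - fst (T (1,0))) = 0"
      by (auto simp: T[of "(_, - _)"] prod_eq_iff \<Delta>_def algebra_simps)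
    then have "(snd (T (0,1)), - snd (T (1,0))) = 0" "(fst (T (0,1)), - fst (T (1,0))) = 0"
      using assms(2) by blast+
    then have "T (0,1) = 0" by (simp add: prod_eq_iff)
    then show False using assms(2)[of "(0,1)"] by (simp add: zero_prod_def)
  qed
  show "z = ((snd (T (0,1)) * fst y - fst (T (0,1)) * snd y) / \<Delta>,
             (fst (T (1,0)) * snd y - snd (T (1,0)) * fst y) / \<Delta>)" if "T z = y"
    using T[of z] that \<Delta> unfolding prod_eq_iff by (auto simp: field_simps \<Delta>_def)
qed

text \<open>The inverse function theorem makes \<open>g\<close> differentiable. Cramer's rule
  expresses \<open>g' y\<close> through the derivative of \<open>f\<close> at \<open>g y\<close>, so
  if \<open>g\<close> is of class \<open>k\<close>, then so is its derivative, and induction on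
  \<open>k\<close> gives smoothness.\<close>

lemma smooth_inverse_function:
  fixes f :: "real \<times> real \<Rightarrow> real \<times> real"
  assumes "open U" "smooth_on U f" "w \<in> U"
    and inj: "\<And>z. frechet_derivative f (at w) z = 0 \<Longrightarrow> z = 0"
  obtains U' V g where "open U'" "U' \<subseteq> U" "w \<in> U'" "open V" "f w \<in> V" "homeomorphism U' V f g"
    "smooth_on V g"
proof -
  let ?D = "\<lambda>x. frechet_derivative f (at x)"
  have der: "(f has_derivative ?D x) (at x)" if "x \<in> U" for x
    using smooth_on_has_derivative assms that by blast
  define f' where "f' x = Blinfun (?D x)" for x
  have f': "blinfun_apply (f' x) = ?D x" if "x \<in> U" for x
    unfolding f'_def using der[OF that] by (simp add: bounded_linear_Blinfun_apply has_derivative_bounded_linear)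
  have cont: "continuous_on U f'"
  proof (rule continuous_on_blinfun_componentwise)
    fix i :: "real \<times> real"
    have "continuous_on U (\<lambda>x. ?D x i)" using smooth_on_continuous smooth_on_frechet assms by blast
    then show "continuous_on U (\<lambda>x. blinfun_apply (f' x) i)" by (simp cong: continuous_on_cong add: f')
  qed
  have "\<exists>h. h o\<^sub>L f' w = id_blinfun"
  proof -
    have "linear (?D w)" using der assms has_derivative_linear by blast
    moreover have "inj (?D w)" using inj calculation by (simp add: linear_injective_0)
    ultimately obtain h where h: "linear h" "\<And>x. h (?D w x) = x"
      by (metis linear_injective_left_inverse o_apply id_apply)
    have "Blinfun h o\<^sub>L f' w = id_blinfun"
      by (rule blinfun_eqI) (simp add: f' assms h bounded_linear_Blinfun_apply linear_conv_bounded_linear[symmetric])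
    then show ?thesis by blast
  qed
  then obtain h where h: "h o\<^sub>L f' w = id_blinfun" by blast
  obtain U' V g g' where *: "open U'" "U' \<subseteq> U" "w \<in> U'" "open V" "f w \<in> V" "homeomorphism U' V f g"
    "\<And>y. y \<in> V \<Longrightarrow> (g has_derivative (g' y)) (at y)"
    "\<And>y. y \<in> V \<Longrightarrow> g' y = inv (blinfun_apply (f' (g y)))"
    "\<And>y. y \<in> V \<Longrightarrow> bij (blinfun_apply (f' (g y)))"
    by (rule inverse_function_theorem[of U f f' w h, OF assms(1) _ cont assms(3) h])
      (simp add: der f', rule that)
  have gU: "g y \<in> U" if "y \<in> V" for y using * that unfolding homeomorphism_def by blast
  define N where "N v y = (snd (?D (g y) (0,1)) * fst v - fst (?D (g y) (0,1)) * snd v,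
                           fst (?D (g y) (1,0)) * snd v - snd (?D (g y) (1,0)) * fst v)" for v y
  define \<Delta> where "\<Delta> y = fst (?D (g y) (1,0)) * snd (?D (g y) (0,1)) - fst (?D (g y) (0,1)) * snd (?D (g y) (1,0))" for y
  have D: "\<Delta> y \<noteq> 0 \<and> g' y v = inverse (\<Delta> y) *\<^sub>R N v y" if y: "y \<in> V" for y v
  proof -
    have lin: "linear (?D (g y))" using der gU[OF y] has_derivative_linear by blast
    have bij: "bij (?D (g y))" using *(9)[OF y] f'[OF gU[OF y]] by simp
    have 0: "z = 0" if "?D (g y) z = 0" for z
      using bij lin that by (metis bij_is_inj linear_injective_0)
    have "?D (g y) (g' y v) = v"
      using *(8)[OF y] f'[OF gU[OF y]] bij by (simp add: bij_is_surj surj_f_inv_f)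
    from linear_plane_inverse(1)[OF lin 0] linear_plane_inverse(2)[OF lin 0 this]
    show ?thesis by (simp add: N_def \<Delta>_def divide_inverse mult.commute)
  qed
  have "Ck_on k V g" for k
  proof (induction k)
    case 0
    show ?case using * by (simp add: homeomorphism_def)
  next
    case (Suc k)
    have e: "Ck_on k V (\<lambda>y. ?D (g y) b)" for b
      by (rule Ck_on_compose[OF *(4) assms(1) _ Suc]) (use gU smooth_on_frechet[OF assms(2), of b] in \<open>auto simp: smooth_on_def\<close>)
    note fs = Ck_on_linear[OF *(4) bounded_linear_fst e] Ck_on_linear[OF *(4) bounded_linear_snd e]
    have sub: "Ck_on k V (\<lambda>y. p y - q y)" if "Ck_on k V p" "Ck_on k V q" for p q :: "real \<times> real \<Rightarrow> real"
      using Ck_on_add[OF *(4) that(1) Ck_on_linear[OF *(4) bounded_linear_minus[OF bounded_linear_ident] that(2)]] by simp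
    have "Ck_on k V \<Delta>"
      unfolding \<Delta>_def by (intro sub Ck_on_bilinear[OF *(4) bounded_bilinear_mult] fs)
    then have i: "Ck_on k V (\<lambda>y. inverse (\<Delta> y))"
      by (intro Ck_on_compose[OF *(4), of "- {0}" \<Delta> k inverse] Ck_on_inverse) (use D in auto)
    have p: "Ck_on k V (\<lambda>y. (p y, q y))" if "Ck_on k V p" "Ck_on k V q" for p q :: "real \<times> real \<Rightarrow> real"
      using Ck_on_add[OF *(4) Ck_on_linear[OF *(4) bounded_linear_Pair[OF bounded_linear_ident bounded_linear_zero] that(1)]
          Ck_on_linear[OF *(4) bounded_linear_Pair[OF bounded_linear_zero bounded_linear_ident] that(2)]] by simp
    have "Ck_on k V (\<lambda>y. inverse (\<Delta> y) *\<^sub>R N v y)" for v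
      unfolding N_def by (intro Ck_on_bilinear[OF *(4) bounded_bilinear_scaleR] i p sub
          Ck_on_bilinear[OF *(4) bounded_bilinear_mult] fs Ck_on_const)
    moreover have "Ck_on k V (\<lambda>y. g' y v) \<longleftrightarrow> Ck_on k V (\<lambda>y. inverse (\<Delta> y) *\<^sub>R N v y)" for v
      by (rule Ck_on_cong[OF *(4)]) (use D in blast)
    ultimately show ?case using Ck_on_SucI[OF *(4,7)] by blast
  qed
  then show thesis using that[OF *(1-6)] by (simp add: smooth_on_def)
qed

section \<open>Ordinary differential equations\<close>

text \<open>The squared norm is estimated because the norm is not differentiable at zeros of
  \<open>u\<close>. The rate \<open>2 * L + 1\<close> arises from absorbing the mixed term: twice
  \<open>norm (u r) * \<epsilon>\<close> is at most the sum of the squares.\<close>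

lemma gronwall_forward:
  fixes u :: "real \<Rightarrow> 'a::real_inner"
  assumes "s \<le> t" "\<And>r. r \<in> {s..t} \<Longrightarrow> (u has_vector_derivative u' r) (at r within {s..t})"
    "\<And>r. r \<in> {s..t} \<Longrightarrow> norm (u' r) \<le> L * norm (u r) + \<epsilon>" "0 \<le> L" "0 \<le> \<epsilon>"
  shows "(norm (u t))\<^sup>2 \<le> ((norm (u s))\<^sup>2 + \<epsilon>\<^sup>2 * (t - s)) * exp ((2 * L + 1) * (t - s))"
proof -
  define K where "K = 2 * L + 1"
  define \<phi> where "\<phi> r = exp (- K * (r - s)) * (u r \<bullet> u r) - \<epsilon>\<^sup>2 * (r - s)" for r
  have "\<phi> t \<le> \<phi> s"
  proof (rule DERIV_nonpos_imp_decreasing_open[OF assms(1)])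
    fix r assume r: "s < r" "r < t"
    have "(u has_derivative (\<lambda>h. h *\<^sub>R u' r)) (at r)"
      using assms(2)[of r] r by (simp add: has_vector_derivative_def at_within_Icc_at)
    then have "((\<lambda>r. u r \<bullet> u r) has_derivative (\<lambda>h. h * (2 * (u r \<bullet> u' r)))) (at r)"
      by (auto intro!: derivative_eq_intros simp: fun_eq_iff inner_commute)
    then have "((\<lambda>r. u r \<bullet> u r) has_real_derivative 2 * (u r \<bullet> u' r)) (at r)"
      by (rule has_derivative_imp_has_field_derivative) simp
    then have d: "(\<phi> has_real_derivative exp (- K * (r - s)) * (2 * (u r \<bullet> u' r) - K * (u r \<bullet> u r)) - \<epsilon>\<^sup>2) (at r)"
      unfolding \<phi>_def by (auto intro!: derivative_eq_intros simp: algebra_simps)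
    have "u r \<bullet> u' r \<le> norm (u r) * (L * norm (u r) + \<epsilon>)"
      using norm_cauchy_schwarz[of "u r" "u' r"] assms(3)[of r] r
      by (meson atLeastAtMost_iff less_eq_real_def mult_left_mono norm_ge_zero order_trans)
    moreover have "2 * norm (u r) * \<epsilon> \<le> (norm (u r))\<^sup>2 + \<epsilon>\<^sup>2"
      using sum_squares_bound[of "norm (u r)" \<epsilon>] by simp
    ultimately have "2 * (u r \<bullet> u' r) - K * (u r \<bullet> u r) \<le> \<epsilon>\<^sup>2"
      unfolding K_def power2_norm_eq_inner[symmetric] by (simp add: algebra_simps power2_eq_square)
    then have "exp (- K * (r - s)) * (2 * (u r \<bullet> u' r) - K * (u r \<bullet> u r)) \<le> exp (- K * (r - s)) * \<epsilon>\<^sup>2"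
      by (intro mult_left_mono) auto
    also have "\<dots> \<le> 1 * \<epsilon>\<^sup>2"
      using r assms(4) by (intro mult_right_mono) (auto simp: K_def intro!: mult_nonpos_nonneg)
    finally show "\<exists>y. (\<phi> has_real_derivative y) (at r) \<and> y \<le> 0" using d by auto
  next
    have "continuous_on {s..t} u"
      using assms(2) by (meson continuous_on_eq_continuous_within has_vector_derivative_continuous)
    then show "continuous_on {s..t} \<phi>" unfolding \<phi>_def by (intro continuous_intros)
  qed
  then have "exp (- (K * (t - s))) * (norm (u t))\<^sup>2 \<le> (norm (u s))\<^sup>2 + \<epsilon>\<^sup>2 * (t - s)"
    by (simp add: \<phi>_def power2_norm_eq_inner)
  then have h1: "exp (K * (t - s)) * (exp (- (K * (t - s))) * (norm (u t))\<^sup>2) \<le> exp (K * (t - s)) * ((norm (u s))\<^sup>2 + \<epsilon>\<^sup>2 * (t - s))"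
    by (intro mult_left_mono) auto
  have h2: "exp (K * (t - s)) * (exp (- (K * (t - s))) * (norm (u t))\<^sup>2) = (norm (u t))\<^sup>2"
  proof -
    have "exp (K * (t - s)) * exp (- (K * (t - s))) = 1" by (simp flip: exp_add)
    then show ?thesis by (simp only: mult.assoc[symmetric] mult_1)
  qed
  show ?thesis using h1[unfolded h2] by (simp add: K_def mult.commute)
qed

text \<open>The derivative is taken within a set \<open>T\<close> that may be larger than
  \<open>J\<close>; this covers two-sided derivatives as well as derivatives on a compact interval.
  Times before \<open>s\<close> are reached by reversing time.\<close>

lemma gronwall:
  fixes u :: "real \<Rightarrow> 'a::real_inner"
  assumes J: "J \<subseteq> T" "convex J" "s \<in> J" "t \<in> J"
    and u: "\<And>r. r \<in> J \<Longrightarrow> (u has_vector_derivative u' r) (at r within T)"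
    "\<And>r. r \<in> J \<Longrightarrow> norm (u' r) \<le> L * norm (u r) + \<epsilon>" "0 \<le> L" "0 \<le> \<epsilon>"
  shows "(norm (u t))\<^sup>2 \<le> ((norm (u s))\<^sup>2 + \<epsilon>\<^sup>2 * \<bar>t - s\<bar>) * exp ((2 * L + 1) * \<bar>t - s\<bar>)"
proof (cases "s \<le> t")
  case True
  have "{s..t} \<subseteq> J" using closed_segment_subset[OF J(3,4,2)] True by (simp add: closed_segment_eq_real_ivl)
  moreover have "(u has_vector_derivative u' r) (at r within {s..t})" if "r \<in> {s..t}" for r

  proof -
    have "r \<in> J" "{s..t} \<subseteq> T" using \<open>{s..t} \<subseteq> J\<close> that J(1) by auto
    then show ?thesis using has_vector_derivative_within_subset[OF u(1)] by blast
  qed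
  moreover have "norm (u' r) \<le> L * norm (u r) + \<epsilon>" if "r \<in> {s..t}" for r
    using u(2)[of r] \<open>{s..t} \<subseteq> J\<close> that by auto
  ultimately show ?thesis using gronwall_forward[of s t u u' L \<epsilon>] True u by auto
next
  case False
  have sub: "{t..s} \<subseteq> J" using closed_segment_subset[OF J(3,4,2)] False by (simp add: closed_segment_eq_real_ivl)
  have "((\<lambda>r. u (- r)) has_vector_derivative - u' (- r)) (at r within {-s..-t})" if r: "r \<in> {-s..-t}" for r
  proof -
    have "(u has_vector_derivative u' (- r)) (at (- r) within uminus ` {-s..-t})"
    proof (rule has_vector_derivative_within_subset[OF u(1)])
      show "- r \<in> J" using sub r by auto
      show "uminus ` {-s..-t} \<subseteq> T" using sub J(1) by auto
    qed
    moreover have "(uminus has_vector_derivative - 1) (at r within {-s..-t})"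
      by (auto intro!: derivative_eq_intros)
    ultimately show ?thesis using vector_diff_chain_within[of uminus "-1" r "{-s..-t}" u "u' (- r)"] by (simp add: o_def)
  qed
  moreover have "norm (- u' (- r)) \<le> L * norm (u (- r)) + \<epsilon>" if "r \<in> {-s..-t}" for r
  proof -
    have "- r \<in> J" using sub that by auto
    then show ?thesis using u(2) by simp
  qed
  ultimately show ?thesis
    using gronwall_forward[of "-s" "-t" "\<lambda>r. u (- r)" "\<lambda>r. - u' (- r)" L \<epsilon>] False u by simp
qed

text \<open>The supremum norm is weighted by \<open>exp (- \<kappa> * \<bar>t\<bar>)\<close>. With
  \<kappa> large compared with \<open>L\<close>, the integral operator contracts on the entire
  interval, so a solution exists on all of \<open>{-\<tau>..\<tau>}\<close> without
  continuation.\<close>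

lemma picard_lindelof:
  fixes f :: "real \<Rightarrow> 'a::euclidean_space \<Rightarrow> 'a"
  assumes \<tau>: "0 \<le> \<tau>" and cont: "continuous_on ({-\<tau>..\<tau>} \<times> UNIV) (\<lambda>(t,y). f t y)"
    and lip: "\<And>t y z. t \<in> {-\<tau>..\<tau>} \<Longrightarrow> norm (f t y - f t z) \<le> L * norm (y - z)" and L: "0 \<le> L"
  obtains y where "y 0 = y0" "\<And>t. t \<in> {-\<tau>..\<tau>} \<Longrightarrow> (y has_vector_derivative f t (y t)) (at t within {-\<tau>..\<tau>})"
proof -
  \<comment> \<open>Ensures \<open>L / \<kappa> \<le> 1/2\<close>, the contraction factor, and is
    positive even if \<open>L = 0\<close>.\<close>
  define \<kappa> where "\<kappa> = 2 * L + 1"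
  have \<kappa>: "\<kappa> > 0" using L by (simp add: \<kappa>_def)
  \<comment> \<open>Clamping to the interval extends the iterates to bounded continuous functions on
    the whole line, which form a complete space as a type.\<close>
  define c where "c t = max (-\<tau>) (min \<tau> t)" for t :: real
  have c: "c t \<in> {-\<tau>..\<tau>}" for t using \<tau> by (auto simp: c_def)
  have c_id: "c t = t" if "t \<in> {-\<tau>..\<tau>}" for t using that by (auto simp: c_def)
  have c_cont: "continuous_on UNIV c" unfolding c_def by (intro continuous_intros)
  \<comment> \<open>The unknown \<open>v\<close> is the solution times the decaying weight, so the
    plain supremum norm of \<open>v\<close> is the weighted norm of the solution; \<open>Y\<close>
    removes the weight.\<close>
  define Y where "Y v s = exp (\<kappa> * \<bar>s\<bar>) *\<^sub>R apply_bcontfun v s" for v :: "real \<Rightarrow>\<^sub>C 'a" and s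
  define \<phi> where "\<phi> v s = f s (Y v s)" for v s
  \<comment> \<open>The integral from 0 to \<open>t\<close>, written as a difference so that it is
    also correct for negative \<open>t\<close>.\<close>
  define I where "I v t = integral {-\<tau>..t} (\<phi> v) - integral {-\<tau>..0} (\<phi> v)" for v t
  define T where "T v t = exp (- \<kappa> * \<bar>c t\<bar>) *\<^sub>R (y0 + I v (c t))" for v t
  have \<phi>_cont: "continuous_on {-\<tau>..\<tau>} (\<phi> v)" for v
  proof -
    have "continuous_on {-\<tau>..\<tau>} (\<lambda>s. (s, Y v s))" unfolding Y_def by (intro continuous_intros) auto
    then show ?thesis unfolding \<phi>_def using continuous_on_compose2[OF cont, of _ "\<lambda>s. (s, Y v s)"] by auto
  qed
  have I_der: "(I v has_vector_derivative \<phi> v t) (at t within {-\<tau>..\<tau>})" if "t \<in> {-\<tau>..\<tau>}" for v t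
    unfolding I_def using integral_has_vector_derivative[OF \<phi>_cont that]
    by (auto intro!: derivative_eq_intros)
  have I0: "I v 0 = 0" for v by (simp add: I_def)
  have I_cont: "continuous_on {-\<tau>..\<tau>} (I v)" for v
    using I_der by (meson continuous_on_eq_continuous_within has_vector_derivative_continuous)
  have T_bcont: "T v \<in> bcontfun" for v
  proof -
    have *: "continuous_on {-\<tau>..\<tau>} (\<lambda>s. exp (- \<kappa> * \<bar>s\<bar>) *\<^sub>R (y0 + I v s))"
      by (intro continuous_intros I_cont)
    then obtain B where B: "\<And>s. s \<in> {-\<tau>..\<tau>} \<Longrightarrow> norm (exp (- \<kappa> * \<bar>s\<bar>) *\<^sub>R (y0 + I v s)) \<le> B"
      by (metis (no_types, lifting) bounded_iff compact_Icc compact_continuous_image compact_imp_bounded image_eqI)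
    have "continuous_on UNIV (T v)"
      unfolding T_def by (rule continuous_on_compose2[OF * c_cont]) (use c in blast)
    then show ?thesis using B[OF c] by (auto intro!: bcontfun_normI simp: T_def)
  qed
  have est: "norm (I v t - I w t) \<le> L * dist v w * (exp (\<kappa> * \<bar>t\<bar>) / \<kappa>)" if t: "t \<in> {-\<tau>..\<tau>}" for v w t
  proof -
    let ?D = "\<lambda>t. I v t - I w t"
    have der: "(?D has_vector_derivative \<phi> v s - \<phi> w s) (at s within {-\<tau>..\<tau>})" if "s \<in> {-\<tau>..\<tau>}" for s
      by (intro has_vector_derivative_diff I_der that)
    have bd: "norm (\<phi> v s - \<phi> w s) \<le> L * dist v w * exp (\<kappa> * \<bar>s\<bar>)" if "s \<in> {-\<tau>..\<tau>}" for s
    proof -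
      have "norm (\<phi> v s - \<phi> w s) \<le> L * norm (Y v s - Y w s)" unfolding \<phi>_def by (rule lip[OF that])
      also have "norm (Y v s - Y w s) = exp (\<kappa> * \<bar>s\<bar>) * dist (apply_bcontfun v s) (apply_bcontfun w s)"
        by (simp add: Y_def dist_norm flip: scaleR_diff_right)
      also have "\<dots> \<le> exp (\<kappa> * \<bar>s\<bar>) * dist v w" by (intro mult_left_mono dist_bounded) auto
      finally have "norm (\<phi> v s - \<phi> w s) \<le> L * (exp (\<kappa> * \<bar>s\<bar>) * dist v w)"
        using L by (simp add: mult_left_mono)
      then show ?thesis by (simp add: algebra_simps)
    qed
    have cD: "continuous_on {-\<tau>..\<tau>} ?D" by (intro continuous_intros I_cont)
    have at: "(?D has_vector_derivative \<phi> v s - \<phi> w s) (at s)" if "-\<tau> < s" "s < \<tau>" for s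
      using der[of s] that by (simp add: at_within_Icc_at)
    have e0: "0 \<le> L * dist v w / \<kappa>" using L \<kappa> by simp
    show ?thesis
    proof (cases t "0::real" rule: linorder_cases)
      case less
      have "norm (?D 0 - ?D t) \<le> (- (L * dist v w * (exp (- \<kappa> * 0) / \<kappa>))) - (- (L * dist v w * (exp (- \<kappa> * t) / \<kappa>)))"
      proof (rule differentiable_bound_general[OF less])
        fix s assume s: "t < s" "s < 0"
        show "(?D has_vector_derivative \<phi> v s - \<phi> w s) (at s)" using at s t by auto
        have "((\<lambda>s. - (L * dist v w * (exp (- \<kappa> * s) / \<kappa>))) has_real_derivative L * dist v w * exp (- \<kappa> * s)) (at s)"
          using \<kappa> by (auto intro!: derivative_eq_intros)
        then show "((\<lambda>s. - (L * dist v w * (exp (- \<kappa> * s) / \<kappa>))) has_vector_derivative L * dist v w * exp (- \<kappa> * s)) (at s)"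
          by (simp add: has_real_derivative_iff_has_vector_derivative)
        show "norm (\<phi> v s - \<phi> w s) \<le> L * dist v w * exp (- \<kappa> * s)" using bd[of s] s t by auto
      qed (use t less \<kappa> in \<open>auto intro!: continuous_intros continuous_on_subset[OF I_cont]\<close>)
      then show ?thesis using e0 less by (simp add: I0 norm_minus_commute)
    next
      case equal then show ?thesis using e0 by (simp add: I0)
    next
      case greater
      have "norm (?D t - ?D 0) \<le> L * dist v w * (exp (\<kappa> * t) / \<kappa>) - L * dist v w * (exp (\<kappa> * 0) / \<kappa>)"
      proof (rule differentiable_bound_general[OF greater])
        fix s assume s: "0 < s" "s < t"
        show "(?D has_vector_derivative \<phi> v s - \<phi> w s) (at s)" using at s t by auto
        have "((\<lambda>s. L * dist v w * (exp (\<kappa> * s) / \<kappa>)) has_real_derivative L * dist v w * exp (\<kappa> * s)) (at s)"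
          using \<kappa> by (auto intro!: derivative_eq_intros)
        then show "((\<lambda>s. L * dist v w * (exp (\<kappa> * s) / \<kappa>)) has_vector_derivative L * dist v w * exp (\<kappa> * s)) (at s)"
          by (simp add: has_real_derivative_iff_has_vector_derivative)
        show "norm (\<phi> v s - \<phi> w s) \<le> L * dist v w * exp (\<kappa> * s)" using bd[of s] s t by auto
      qed (use t greater \<kappa> in \<open>auto intro!: continuous_intros continuous_on_subset[OF I_cont]\<close>)
      then show ?thesis using e0 greater by (simp add: I0)
    qed
  qed
  have "\<exists>!v. Bcontfun (T v) = v"
  proof (rule banach_fix_type[of "1/2"]; (intro allI)?)
    fix v w :: "real \<Rightarrow>\<^sub>C 'a"
    show "dist (Bcontfun (T v)) (Bcontfun (T w)) \<le> 1/2 * dist v w"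
    proof (rule dist_bound)
      fix t
      have "dist (apply_bcontfun (Bcontfun (T v)) t) (apply_bcontfun (Bcontfun (T w)) t) = norm (T v t - T w t)"
        by (simp add: Bcontfun_inverse T_bcont dist_norm)
      also have "\<dots> = exp (- \<kappa> * \<bar>c t\<bar>) * norm (I v (c t) - I w (c t))"
        by (simp add: T_def flip: scaleR_diff_right)
      also have "\<dots> \<le> exp (- \<kappa> * \<bar>c t\<bar>) * (L * dist v w * (exp (\<kappa> * \<bar>c t\<bar>) / \<kappa>))"
        by (intro mult_left_mono est c) auto
      also have "\<dots> = L / \<kappa> * dist v w" by (simp add: exp_minus field_simps)
      also have "\<dots> \<le> 1/2 * dist v w" using L by (intro mult_right_mono) (auto simp: \<kappa>_def field_simps)
      finally show "dist (apply_bcontfun (Bcontfun (T v)) t) (apply_bcontfun (Bcontfun (T w)) t) \<le> 1/2 * dist v w" .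
    qed
  qed auto
  then obtain v where v: "Bcontfun (T v) = v" by blast
  have Yeq: "Y v t = y0 + I v t" if "t \<in> {-\<tau>..\<tau>}" for t
  proof -
    have "apply_bcontfun v t = T v t" by (metis v Bcontfun_inverse T_bcont)
    then show ?thesis by (simp add: Y_def T_def c_id[OF that] flip: exp_add)
  qed
  show thesis
  proof
    show "Y v 0 = y0" using Yeq[of 0] \<tau> I0 by auto
    fix t assume t: "t \<in> {-\<tau>..\<tau>}"
    have "((\<lambda>t. y0 + I v t) has_vector_derivative f t (Y v t)) (at t within {-\<tau>..\<tau>})"
      using I_der[OF t, of v] by (auto intro!: derivative_eq_intros simp: \<phi>_def)
    then show "(Y v has_vector_derivative f t (Y v t)) (at t within {-\<tau>..\<tau>})"
      by (rule has_vector_derivative_transform[OF t Yeq, rotated])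
  qed
qed

section \<open>Dependence of solutions on time, initial values and parameters\<close>

lemma Ck_on_apply_linear:
  assumes "open S" "\<And>v. Ck_on k S (\<lambda>x. L x v)" "\<And>x. x \<in> S \<Longrightarrow> linear (L x)" "Ck_on k S f"
  shows "Ck_on k S (\<lambda>x. L x (f x))"
proof -
  have 1: "Ck_on k S (\<lambda>x. \<Sum>b\<in>Basis. (f x \<bullet> b) *\<^sub>R L x b)"
    by (intro Ck_on_sum Ck_on_bilinear[OF _ bounded_bilinear_scaleR] Ck_on_linear[OF _ bounded_linear_inner_left] assms)
  have 2: "L x (f x) = (\<Sum>b\<in>Basis. (f x \<bullet> b) *\<^sub>R L x b)" if "x \<in> S" for x
    by (rule linear_basis_expansion[OF assms(3)[OF that]])
  show ?thesis by (rule iffD2[OF Ck_on_cong[OF assms(1) 2] 1])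
qed

lemma continuous_on_frechet_apply:
  assumes "Ck_on (Suc 0) S F" "continuous_on T q" "q ` T \<subseteq> S" "continuous_on T v"
  shows "continuous_on T (\<lambda>t. frechet_derivative F (at (q t)) (v t))"
proof -
  have "continuous_on T (\<lambda>t. frechet_derivative F (at (q t)) b)" for b
    using continuous_on_compose2[OF _ assms(2,3)] Ck_on_SucD(2)[OF assms(1), of b] by simp
  then have 1: "continuous_on T (\<lambda>t. \<Sum>b\<in>Basis. (v t \<bullet> b) *\<^sub>R frechet_derivative F (at (q t)) b)"
    using assms(4) by (intro continuous_intros)
  have 2: "frechet_derivative F (at (q t)) (v t) = (\<Sum>b\<in>Basis. (v t \<bullet> b) *\<^sub>R frechet_derivative F (at (q t)) b)"
    if "t \<in> T" for t
    by (rule linear_basis_expansion) (use has_derivative_linear Ck_on_SucD(1)[OF assms(1)] assms(3) that in blast)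
  show ?thesis by (rule iffD2[OF continuous_on_cong[OF refl 2] 1])
qed

text \<open>Uniform in \<open>t\<close> and linear in the initial error \<delta> and the defect
  \<epsilon>: the form in which solutions for nearby parameters are compared.\<close>

lemma gronwall_symmetric:
  fixes u :: "real \<Rightarrow> 'a::real_inner"
  assumes "\<And>r. r \<in> {-\<tau>..\<tau>} \<Longrightarrow> (u has_vector_derivative u' r) (at r within {-\<tau>..\<tau>})"
    "\<And>r. r \<in> {-\<tau>..\<tau>} \<Longrightarrow> norm (u' r) \<le> L * norm (u r) + \<epsilon>" "0 \<le> L" "0 \<le> \<epsilon>"
    and "norm (u 0) \<le> \<delta>" "t \<in> {-\<tau>..\<tau>}"
  shows "norm (u t) \<le> sqrt ((1 + \<tau>) * exp ((2 * L + 1) * \<tau>)) * (\<delta> + \<epsilon>)"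
proof -
  have \<tau>: "0 \<le> \<tau>" "\<bar>t\<bar> \<le> \<tau>" using assms(6) by auto
  have \<delta>: "0 \<le> \<delta>" using assms(5) norm_ge_zero order_trans by blast
  have "(norm (u t))\<^sup>2 \<le> ((norm (u 0))\<^sup>2 + \<epsilon>\<^sup>2 * \<bar>t - 0\<bar>) * exp ((2 * L + 1) * \<bar>t - 0\<bar>)"
    by (rule gronwall[of "{-\<tau>..\<tau>}" "{-\<tau>..\<tau>}" 0 t u u' L \<epsilon>]) (use assms \<tau> in auto)
  also have "\<dots> \<le> (\<delta>\<^sup>2 + \<epsilon>\<^sup>2 * \<tau>) * exp ((2 * L + 1) * \<tau>)"
    using \<tau> assms \<delta> by (intro mult_mono add_mono power_mono mult_left_mono) (auto intro!: mult_left_mono)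
  also have "\<dots> \<le> ((1 + \<tau>) * (\<delta> + \<epsilon>)\<^sup>2) * exp ((2 * L + 1) * \<tau>)"
  proof (rule mult_right_mono)
    have "\<delta>\<^sup>2 \<le> (\<delta> + \<epsilon>)\<^sup>2" "\<epsilon>\<^sup>2 \<le> (\<delta> + \<epsilon>)\<^sup>2" using \<delta> assms by (auto intro!: power_mono)
    then have "\<delta>\<^sup>2 + \<epsilon>\<^sup>2 * \<tau> \<le> (\<delta> + \<epsilon>)\<^sup>2 + (\<delta> + \<epsilon>)\<^sup>2 * \<tau>" using \<tau> by (intro add_mono mult_right_mono) auto
    then show "\<delta>\<^sup>2 + \<epsilon>\<^sup>2 * \<tau> \<le> (1 + \<tau>) * (\<delta> + \<epsilon>)\<^sup>2" by (simp add: algebra_simps)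
  qed auto
  also have "\<dots> = (sqrt ((1 + \<tau>) * exp ((2 * L + 1) * \<tau>)) * (\<delta> + \<epsilon>))\<^sup>2"
    using \<tau> by (simp add: power_mult_distrib)
  finally show ?thesis
    by (rule power2_le_imp_le) (use \<tau> \<delta> assms in auto)
qed

text \<open>\<open>W t x y\<close> solves the variational equation, the linearization of the
  equation along the solution, with initial value the derivative of \<open>z0\<close>. The remainder
  of \<open>z t\<close> after subtracting \<open>W\<close> satisfies the same linear equation up to
  a defect that is small relative to the parameter increment, so the Gronwall estimate makes
  \<open>W t x\<close> the derivative in \<open>x\<close>. Shrinking the time to \<tau> < a gives a
  compact interval and with it uniform constants.\<close>

lemma ode_param_differentiable:
  fixes H :: "real \<times> 'b::euclidean_space \<times> 'a::euclidean_space \<Rightarrow> 'a" and z :: "real \<Rightarrow> 'b \<Rightarrow> 'a"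
  assumes \<tau>: "0 < \<tau>" "\<tau> < a" and B: "open B" and U: "open U" "convex U"
    and H: "Ck_on (Suc 0) ({-a<..<a} \<times> B \<times> U) H" and z0: "Ck_on (Suc 0) B z0"
    and zc: "continuous_on ({-a<..<a} \<times> B) (\<lambda>p. z (fst p) (snd p))"
    and zU: "\<And>t x. t \<in> {-a<..<a} \<Longrightarrow> x \<in> B \<Longrightarrow> z t x \<in> U"
    and zd: "\<And>t x. t \<in> {-a<..<a} \<Longrightarrow> x \<in> B \<Longrightarrow> ((\<lambda>s. z s x) has_vector_derivative H (t, x, z t x)) (at t)"
    and zi: "\<And>x. x \<in> B \<Longrightarrow> z 0 x = z0 x"
  obtains W where
    "\<And>t x. t \<in> {-\<tau><..<\<tau>} \<Longrightarrow> x \<in> B \<Longrightarrow> ((\<lambda>p. z (fst p) (snd p)) has_derivative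
        (\<lambda>q. fst q *\<^sub>R H (t, x, z t x) + W t x (snd q))) (at (t, x))"
    "\<And>t x y. t \<in> {-\<tau><..<\<tau>} \<Longrightarrow> x \<in> B \<Longrightarrow>
        ((\<lambda>s. W s x y) has_vector_derivative frechet_derivative H (at (t, x, z t x)) (0, y, W t x y)) (at t)"
    "\<And>x y. x \<in> B \<Longrightarrow> W 0 x y = frechet_derivative z0 (at x) y"
    "\<And>y. continuous_on ({-\<tau><..<\<tau>} \<times> B) (\<lambda>p. W (fst p) (snd p) y)"
proof -
  define S where "S = {-a<..<a} \<times> B \<times> U"
  define J where "J = {-\<tau>..\<tau>}"
  define q where "q t x = (t, x, z t x)" for t x
  define DH where "DH p = frechet_derivative H (at p)" for p
  define Dz where "Dz x = frechet_derivative z0 (at x)" for x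
  have J: "compact J" "0 \<in> J" "J \<subseteq> {-a<..<a}" "{-\<tau><..<\<tau>} \<subseteq> J" using \<tau> by (auto simp: J_def)
  have S: "open S" using B U by (auto simp: S_def intro: open_Times)
  have HS: "Ck_on (Suc 0) S H" using H by (simp add: S_def)
  have lin: "linear (DH p)" if "p \<in> S" for p
    unfolding DH_def using has_derivative_linear Ck_on_SucD(1)[OF HS that] by blast
  have linz: "linear (Dz x)" if "x \<in> B" for x
    unfolding Dz_def using has_derivative_linear Ck_on_SucD(1)[OF z0 that] by blast
  have qS: "q t x \<in> S" if "t \<in> J" "x \<in> B" for t x
    using that J zU by (auto simp: q_def S_def)
  have q_cont: "continuous_on (J \<times> B) (\<lambda>p. q (fst p) (snd p))"
    unfolding q_def by (intro continuous_intros continuous_on_subset[OF zc]) (use J in auto)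
  have zdJ: "((\<lambda>s. z s x) has_vector_derivative H (q t x)) (at t within J)" if "t \<in> J" "x \<in> B" for t x
    unfolding q_def by (rule has_vector_derivative_at_within[OF zd]) (use that J in auto)
  have norm0: "norm (0::real, 0::'b, w) = norm w" for w :: 'a by (simp add: norm_Pair)
  have normq: "norm (q t x - q t x') \<le> norm (x - x') + norm (z t x - z t x')" for t x x'
    using norm_Pair_le[of "x - x'" "z t x - z t x'"] by (simp add: q_def norm_Pair)
  \<comment> \<open>Bundles what the estimates near one parameter \<open>x\<close> need: a radius, a
    compact convex set containing all arguments at which \<open>H\<close> is evaluated, and a common
    Lipschitz constant.\<close>
  define P where "P x r L Q \<longleftrightarrow> 0 < r \<and> cball x r \<subseteq> B \<and> compact Q \<and> convex Q \<and> Q \<subseteq> S \<and>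
      (\<forall>t\<in>J. \<forall>x'\<in>cball x r. q t x' \<in> Q) \<and> 0 \<le> L \<and>
      (\<forall>p\<in>Q. \<forall>p'\<in>Q. norm (H p - H p') \<le> L * norm (p - p')) \<and> (\<forall>p\<in>Q. \<forall>v. norm (DH p v) \<le> L * norm v)"
    for x r L Q
  have "\<exists>r L Q. P x r L Q" if x: "x \<in> B" for x
  proof -
    obtain r where r: "r > 0" "cball x r \<subseteq> B" using B x open_contains_cball by blast
    define Z where "Z = (\<lambda>p. z (fst p) (snd p)) ` (J \<times> cball x r)"
    have "compact Z" unfolding Z_def
      by (intro compact_continuous_image continuous_on_subset[OF zc] compact_Times J compact_cball) (use J r in auto)
    then have K: "compact (convex hull Z)" by (rule compact_convex_hull)
    \<comment> \<open>The values of \<open>z\<close> need not form a convex set, but the mean value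
      inequality asks for one; convexity of \<open>U\<close> keeps the hull inside the domain of
      \<open>H\<close>.\<close>
    have ZU: "convex hull Z \<subseteq> U"
    proof (rule hull_minimal[where S = convex, OF _ U(2)])
      show "Z \<subseteq> U" unfolding Z_def
      proof clarify
        fix t x' assume "t \<in> J" "x' \<in> cball x r"
        then show "z (fst (t, x')) (snd (t, x')) \<in> U" using zU[of t x'] J r by (simp add: subset_iff)
      qed
    qed
    define Q where "Q = J \<times> cball x r \<times> (convex hull Z)"
    have Q: "compact Q" "convex Q" "Q \<subseteq> S"
      using K ZU J r by (auto simp: Q_def S_def J_def intro!: compact_Times convex_Times)
    have qQ: "\<forall>t\<in>J. \<forall>x'\<in>cball x r. q t x' \<in> Q"
      by (auto simp: q_def Q_def Z_def intro!: hull_inc image_eqI[where x = "(t, x')" for t x'])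
    from C1_lipschitz_on_compact[OF HS Q] obtain L where "0 \<le> L"
      "\<And>p p'. p \<in> Q \<Longrightarrow> p' \<in> Q \<Longrightarrow> norm (H p - H p') \<le> L * norm (p - p')"
      "\<And>p v. p \<in> Q \<Longrightarrow> norm (frechet_derivative H (at p) v) \<le> L * norm v" by metis
    then have "P x r L Q" using r Q qQ unfolding DH_def P_def by blast
    then show ?thesis by blast
  qed
  then obtain r L Q where "\<And>x. x \<in> B \<Longrightarrow> P x (r x) (L x) (Q x)" by metis
  note rQ' = this[unfolded P_def]
  have rQ: "\<And>x. x \<in> B \<Longrightarrow> 0 < r x" "\<And>x. x \<in> B \<Longrightarrow> cball x (r x) \<subseteq> B"
    "\<And>x. x \<in> B \<Longrightarrow> compact (Q x)" "\<And>x. x \<in> B \<Longrightarrow> convex (Q x)" "\<And>x. x \<in> B \<Longrightarrow> Q x \<subseteq> S"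
    "\<And>x t x'. x \<in> B \<Longrightarrow> t \<in> J \<Longrightarrow> x' \<in> cball x (r x) \<Longrightarrow> q t x' \<in> Q x"
    "\<And>x. x \<in> B \<Longrightarrow> 0 \<le> L x"
    "\<And>x p p'. x \<in> B \<Longrightarrow> p \<in> Q x \<Longrightarrow> p' \<in> Q x \<Longrightarrow> norm (H p - H p') \<le> L x * norm (p - p')"
    "\<And>x p v. x \<in> B \<Longrightarrow> p \<in> Q x \<Longrightarrow> norm (DH p v) \<le> L x * norm v"
    using rQ' by blast+
  have qQ: "q t x \<in> Q x" if "x \<in> B" "t \<in> J" for x t using rQ that by (simp add: less_imp_le)
  have "\<exists>w. w 0 = Dz x y \<and> (\<forall>t\<in>J. (w has_vector_derivative DH (q t x) (0, y, w t)) (at t within J))"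
    if x: "x \<in> B" for x y
  proof -
    have "continuous_on (J \<times> UNIV) (\<lambda>p. DH (q (fst p) x) (0, y, snd p))"
      unfolding DH_def
    proof (rule continuous_on_frechet_apply[OF HS])
      show "continuous_on (J \<times> UNIV) (\<lambda>p. q (fst p) x)"
        by (rule continuous_on_compose2[OF q_cont, of _ "\<lambda>p. (fst p, x)", simplified])
          (use x in \<open>auto intro!: continuous_intros\<close>)
    qed (use qS x in \<open>auto intro!: continuous_intros\<close>)
    then have c: "continuous_on ({-\<tau>..\<tau>} \<times> UNIV) (\<lambda>(t, w). DH (q t x) (0, y, w))"
      by (simp add: J_def case_prod_beta')
    have l: "norm (DH (q t x) (0, y, w) - DH (q t x) (0, y, w')) \<le> L x * norm (w - w')" if "t \<in> {-\<tau>..\<tau>}" for t w w'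
      using rQ(9)[OF x qQ[OF x], of t "(0, 0, w - w')"] that linear_diff[OF lin[OF qS[OF _ x]], of t "(0,y,w)" "(0,y,w')"]
      by (simp add: norm0 J_def)
    obtain w where "w 0 = Dz x y" "\<And>t. t \<in> {-\<tau>..\<tau>} \<Longrightarrow> (w has_vector_derivative DH (q t x) (0, y, w t)) (at t within {-\<tau>..\<tau>})"
      using picard_lindelof[OF _ c l rQ(7)[OF x]] \<tau> by (metis less_imp_le)
    then show ?thesis by (auto simp: J_def)
  qed
  then obtain W where W: "\<And>x y. x \<in> B \<Longrightarrow> W x y 0 = Dz x y"
    "\<And>x y t. x \<in> B \<Longrightarrow> t \<in> J \<Longrightarrow> (W x y has_vector_derivative DH (q t x) (0, y, W x y t)) (at t within J)" by metis
  define E where "E x = sqrt ((1 + \<tau>) * exp ((2 * L x + 1) * \<tau>))" for x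
  have E0: "0 \<le> E x" for x using \<tau> by (simp add: E_def)
  have gron: "norm (u t) \<le> E x * (\<delta> + \<epsilon>)"
    if "x \<in> B" "\<And>t. t \<in> J \<Longrightarrow> (u has_vector_derivative u' t) (at t within J)"
      "\<And>t. t \<in> J \<Longrightarrow> norm (u' t) \<le> L x * norm (u t) + \<epsilon>" "0 \<le> \<epsilon>" "norm (u 0) \<le> \<delta>" "t \<in> J"
    for u u' :: "real \<Rightarrow> 'a" and x \<epsilon> \<delta> t
    unfolding E_def by (rule gronwall_symmetric) (use that rQ(7) in \<open>auto simp: J_def\<close>)
  \<comment> \<open>The difference of both sides solves the homogeneous linear equation with initial
    value 0, so the Gronwall estimate forces it to vanish.\<close>
  have Wlin1: "W x (c *\<^sub>R y + y') t = c *\<^sub>R W x y t + W x y' t" if x: "x \<in> B" and t: "t \<in> J" for x c y y' t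
  proof -
    let ?u = "\<lambda>t. W x (c *\<^sub>R y + y') t - (c *\<^sub>R W x y t + W x y' t)"
    have "norm (?u t) \<le> E x * (0 + 0)"
    proof (rule gron[OF x, where u = ?u and u' = "\<lambda>t. DH (q t x) (0, 0, ?u t)"])
      fix t assume t: "t \<in> J"
      note lin = lin[OF qS[OF t x]]
      have "DH (q t x) (0, 0, ?u t) = DH (q t x) (0, c *\<^sub>R y + y', W x (c *\<^sub>R y + y') t)
          - (c *\<^sub>R DH (q t x) (0, y, W x y t) + DH (q t x) (0, y', W x y' t))"
        by (simp flip: linear_diff[OF lin] linear_add[OF lin] linear_scale[OF lin])
      then show "(?u has_vector_derivative DH (q t x) (0, 0, ?u t)) (at t within J)"
        by (auto intro!: derivative_eq_intros W(2)[OF x t])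
      show "norm (DH (q t x) (0, 0, ?u t)) \<le> L x * norm (?u t) + 0"
        using rQ(9)[OF x qQ[OF x t], of "(0, 0, ?u t)"] by (simp add: norm0)
    next
      show "norm (?u 0) \<le> 0"
        using W(1)[OF x] linz[OF x] by (simp add: linear_add linear_scale)
    qed (use t in auto)
    then show ?thesis by simp
  qed
  have Wlin: "linear (\<lambda>y. W x y t)" if "x \<in> B" "t \<in> J" for x t
  proof -
    have 0: "W x 0 t = 0" using Wlin1[OF that, of 1 0 0] by simp
    show ?thesis
      by (rule linearI) (use Wlin1[OF that, of 1] Wlin1[OF that, of _ _ 0] 0 in auto)
  qed
  have dx: "((\<lambda>x'. z t x') has_derivative (\<lambda>y. W x y t)) (at x)" if x: "x \<in> B" and t: "t \<in> J" for x t
  proof -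
    obtain L0 where L0: "0 \<le> L0" "\<And>x' x''. x' \<in> cball x (r x) \<Longrightarrow> x'' \<in> cball x (r x) \<Longrightarrow> norm (z0 x' - z0 x'') \<le> L0 * norm (x' - x'')"
      using C1_lipschitz_on_compact[OF z0 compact_cball convex_cball rQ(2)[OF x]] by metis
    \<comment> \<open>Becomes a Lipschitz constant of the solution in the parameter, uniform in
      time.\<close>
    define C where "C = E x * (L0 + L x)"
    have C0: "0 \<le> C" using E0 L0 rQ(7)[OF x] by (simp add: C_def)
    have lip: "norm (z t x' - z t x) \<le> C * norm (x' - x)" if x': "x' \<in> cball x (r x)" and t: "t \<in> J" for x' t
    proof -
      have x'B: "x' \<in> B" using x' rQ(2)[OF x] by blast
      have xc: "x \<in> cball x (r x)" using rQ(1)[OF x] by simp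
      have "norm (z t x' - z t x) \<le> E x * (L0 * norm (x' - x) + L x * norm (x' - x))"
      proof (rule gron[OF x])
        show "((\<lambda>t. z t x' - z t x) has_vector_derivative H (q t x') - H (q t x)) (at t within J)" if "t \<in> J" for t
          by (intro has_vector_derivative_diff zdJ that x x'B)
        show "norm (H (q t x') - H (q t x)) \<le> L x * norm (z t x' - z t x) + L x * norm (x' - x)" if "t \<in> J" for t
        proof -
          have "norm (H (q t x') - H (q t x)) \<le> L x * norm (q t x' - q t x)"
            by (rule rQ(8)[OF x rQ(6)[OF x that x'] qQ[OF x that]])
          also have "\<dots> \<le> L x * (norm (x' - x) + norm (z t x' - z t x))"
            by (intro mult_left_mono normq rQ(7) x)
          finally show ?thesis by (simp add: algebra_simps)
        qed
        show "norm (z 0 x' - z 0 x) \<le> L0 * norm (x' - x)" using L0(2)[OF x' xc] zi x x'B by simp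
      qed (use rQ(7)[OF x] t in auto)
      then show ?thesis by (simp add: C_def algebra_simps)
    qed
    show ?thesis unfolding has_derivative_at_alt
    proof (intro conjI allI impI)
      show "bounded_linear (\<lambda>y. W x y t)" using Wlin[OF x t] by (simp add: linear_conv_bounded_linear)
      fix \<epsilon> :: real assume \<epsilon>: "0 < \<epsilon>"
      \<comment> \<open>The final estimate is
        \<open>E x * (\<eta> * n + \<eta> * ((1 + C) * n))\<close>, one term from the initial value
        and one from the defect; adding 1 avoids division by 0.\<close>
      define \<eta> where "\<eta> = \<epsilon> / (E x * (2 + C) + 1)"
      have pos: "0 < E x * (2 + C) + 1" using E0 C0 by (simp add: add_nonneg_pos)
      have \<eta>: "0 < \<eta>" "E x * (2 + C) * \<eta> \<le> \<epsilon>"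
        using \<epsilon> pos by (auto simp: \<eta>_def field_simps)
      obtain \<delta>1 where \<delta>1: "0 < \<delta>1" "\<And>p p'. p \<in> Q x \<Longrightarrow> p' \<in> Q x \<Longrightarrow> norm (p' - p) < \<delta>1 \<Longrightarrow>
          norm (H p' - H p - DH p (p' - p)) \<le> \<eta> * norm (p' - p)"
        using C1_uniformly_differentiable_on_compact[OF HS rQ(3-5)[OF x] \<eta>(1)] unfolding DH_def by metis
      obtain \<delta>2 where \<delta>2: "0 < \<delta>2" "\<And>x'. norm (x' - x) < \<delta>2 \<Longrightarrow> norm (z0 x' - z0 x - Dz x (x' - x)) \<le> \<eta> * norm (x' - x)"
        using Ck_on_SucD(1)[OF z0 x] \<eta>(1) unfolding has_derivative_at_alt Dz_def by metis
      \<comment> \<open>The arguments \<open>q t x'\<close> and \<open>q t x\<close> differ by at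
        most \<open>1 + C\<close> times the distance of the parameters; this factor is divided out
        of \<delta>1.\<close>
      define \<delta> where "\<delta> = min (r x) (min \<delta>2 (\<delta>1 / (1 + C)))"
      have "norm (z t x' - z t x - W x (x' - x) t) \<le> \<epsilon> * norm (x' - x)" if d: "norm (x' - x) < \<delta>" for x'
      proof -
        define n where "n = norm (x' - x)"
        have n: "n < r x" "n < \<delta>2" "(1 + C) * n < \<delta>1" "0 \<le> n"
          using d C0 by (auto simp: \<delta>_def n_def field_simps)
        have x': "x' \<in> cball x (r x)" using n by (simp add: n_def dist_norm norm_minus_commute)
        have x'B: "x' \<in> B" using x' rQ(2)[OF x] by blast
        let ?\<rho> = "\<lambda>t. z t x' - z t x - W x (x' - x) t"
        have "norm (?\<rho> t) \<le> E x * (\<eta> * n + \<eta> * ((1 + C) * n))"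
        proof (rule gron[OF x])
          fix t assume t: "t \<in> J"
          show "(?\<rho> has_vector_derivative H (q t x') - H (q t x) - DH (q t x) (0, x' - x, W x (x' - x) t)) (at t within J)"
            by (intro has_vector_derivative_diff zdJ W t x x'B)
          have nq: "norm (q t x' - q t x) \<le> (1 + C) * n"
            using normq[of t x' x] lip[OF x' t] by (simp add: n_def algebra_simps)
          have R: "norm (H (q t x') - H (q t x) - DH (q t x) (q t x' - q t x)) \<le> \<eta> * ((1 + C) * n)"
            by (rule order.trans[OF \<delta>1(2)[OF qQ[OF x t] rQ(6)[OF x t x']] mult_left_mono[OF nq]])
              (use nq n \<eta> in auto)
          have eq: "H (q t x') - H (q t x) - DH (q t x) (0, x' - x, W x (x' - x) t) =
              DH (q t x) (0, 0, ?\<rho> t) + (H (q t x') - H (q t x) - DH (q t x) (q t x' - q t x))"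
            using linear_diff[OF lin[OF qS[OF t x]], of "q t x' - q t x" "(0, x' - x, W x (x' - x) t)"]
            by (simp add: q_def)
          have "norm (DH (q t x) (0, 0, ?\<rho> t)) \<le> L x * norm (?\<rho> t)"
            using rQ(9)[OF x qQ[OF x t], of "(0, 0, ?\<rho> t)"] by (simp add: norm0)
          then show "norm (H (q t x') - H (q t x) - DH (q t x) (0, x' - x, W x (x' - x) t)) \<le> L x * norm (?\<rho> t) + \<eta> * ((1 + C) * n)"
            unfolding eq by (rule order.trans[OF norm_triangle_ineq add_mono[OF _ R]])
        next
          show "norm (?\<rho> 0) \<le> \<eta> * n" using \<delta>2(2)[of x'] n zi x x'B W(1)[OF x] by (simp add: n_def)
        qed (use \<eta> C0 n t in auto)
        also have "\<dots> = E x * (2 + C) * \<eta> * n" by (simp add: algebra_simps)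
        also have "\<dots> \<le> \<epsilon> * n" using \<eta> n by (intro mult_right_mono) auto
        finally show ?thesis by (simp add: n_def)
      qed
      moreover have "0 < \<delta>" using rQ(1)[OF x] \<delta>1 \<delta>2 C0 by (simp add: \<delta>_def)
      ultimately show "\<exists>\<delta>>0. \<forall>x'. norm (x' - x) < \<delta> \<longrightarrow> norm (z t x' - z t x - W x (x' - x) t) \<le> \<epsilon> * norm (x' - x)" by blast
    qed
  qed
  have Wc: "continuous_on J (W x y)" if "x \<in> B" for x y
    using W(2)[OF that] by (meson continuous_on_eq_continuous_within has_vector_derivative_continuous)
  \<comment> \<open>Continuity in the parameter, uniform in time. Together with continuity in time
    for a fixed parameter it gives the joint continuity claimed for \<open>W\<close>.\<close>
  have W_unif: "\<exists>\<delta>>0. \<forall>x'\<in>B. dist x' x < \<delta> \<longrightarrow> (\<forall>t\<in>J. norm (W x' y t - W x y t) \<le> \<epsilon>)"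
    if x: "x \<in> B" and \<epsilon>: "0 < \<epsilon>" for x y \<epsilon>
  proof -
    define \<eta> where "\<eta> = \<epsilon> / (2 * E x + 1)"
    have pos: "0 < 2 * E x + 1" using E0[of x] by simp
    have "\<eta> * (2 * E x + 1) = \<epsilon>" "0 < \<eta>" using \<epsilon> pos by (auto simp: \<eta>_def)
    then have \<eta>: "0 < \<eta>" "E x * (\<eta> + \<eta>) \<le> \<epsilon>" by (auto simp: algebra_simps)
    have "continuous_on (J \<times> cball x (r x)) (\<lambda>p. DH (q (fst p) (snd p)) (0, y, W x y (fst p)))"
      unfolding DH_def
    proof (rule continuous_on_frechet_apply[OF HS])
      show "continuous_on (J \<times> cball x (r x)) (\<lambda>p. q (fst p) (snd p))"
        by (rule continuous_on_subset[OF q_cont]) (use rQ(2)[OF x] in auto)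
      show "continuous_on (J \<times> cball x (r x)) (\<lambda>p. (0, y, W x y (fst p)))"
        by (intro continuous_on_Pair continuous_on_const
            continuous_on_compose2[OF Wc[OF x] continuous_on_fst[OF continuous_on_id]]) auto
    qed (use qS rQ(2)[OF x] in auto)
    then have "uniformly_continuous_on (J \<times> cball x (r x)) (\<lambda>p. DH (q (fst p) (snd p)) (0, y, W x y (fst p)))"
      by (intro compact_uniformly_continuous compact_Times J compact_cball)
    then obtain \<delta>1 where \<delta>1: "0 < \<delta>1" "\<And>p p'. p \<in> J \<times> cball x (r x) \<Longrightarrow> p' \<in> J \<times> cball x (r x) \<Longrightarrow> dist p' p < \<delta>1 \<Longrightarrow>
        dist (DH (q (fst p') (snd p')) (0, y, W x y (fst p'))) (DH (q (fst p) (snd p)) (0, y, W x y (fst p))) < \<eta>"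
      using \<eta>(1) unfolding uniformly_continuous_on_def by metis
    have "continuous_on B (\<lambda>x. Dz x y)" using Ck_on_SucD(2)[OF z0, of y] by (simp add: Dz_def)
    then obtain \<delta>2 where \<delta>2: "0 < \<delta>2" "\<And>x'. x' \<in> B \<Longrightarrow> dist x' x < \<delta>2 \<Longrightarrow> dist (Dz x' y) (Dz x y) < \<eta>"
      using x \<eta>(1) unfolding continuous_on_iff by metis
    define \<delta> where "\<delta> = min (r x) (min \<delta>1 \<delta>2)"
    have "norm (W x' y t - W x y t) \<le> \<epsilon>" if x': "x' \<in> B" "dist x' x < \<delta>" and t: "t \<in> J" for x' t
    proof -
      have xr: "x' \<in> cball x (r x)" "x \<in> cball x (r x)" using x' rQ(1)[OF x] by (auto simp: \<delta>_def dist_commute)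
      have "norm (W x' y t - W x y t) \<le> E x * (\<eta> + \<eta>)"
      proof (rule gron[OF x])
        fix t assume t: "t \<in> J"
        show "((\<lambda>t. W x' y t - W x y t) has_vector_derivative DH (q t x') (0, y, W x' y t) - DH (q t x) (0, y, W x y t)) (at t within J)"
          by (intro has_vector_derivative_diff W t x x')
        have eq: "DH (q t x') (0, y, W x' y t) - DH (q t x) (0, y, W x y t) =
            DH (q t x') (0, 0, W x' y t - W x y t) + (DH (q t x') (0, y, W x y t) - DH (q t x) (0, y, W x y t))"
          using linear_diff[OF lin[OF qS[OF t x'(1)]], of "(0, y, W x' y t)" "(0, y, W x y t)"] by simp
        have 1: "norm (DH (q t x') (0, 0, W x' y t - W x y t)) \<le> L x * norm (W x' y t - W x y t)"
          using rQ(9)[OF x rQ(6)[OF x t xr(1)], of "(0, 0, W x' y t - W x y t)"] by (simp add: norm0)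
        have "dist (t, x') (t, x) < \<delta>1" using x'(2) by (simp add: \<delta>_def dist_Pair_Pair)
        then have 2: "norm (DH (q t x') (0, y, W x y t) - DH (q t x) (0, y, W x y t)) \<le> \<eta>"
          using \<delta>1(2)[of "(t, x)" "(t, x')"] t xr by (simp add: dist_norm)
        show "norm (DH (q t x') (0, y, W x' y t) - DH (q t x) (0, y, W x y t)) \<le> L x * norm (W x' y t - W x y t) + \<eta>"
          unfolding eq by (rule order.trans[OF norm_triangle_ineq add_mono[OF 1 2]])
      next
        show "norm (W x' y 0 - W x y 0) \<le> \<eta>"
          using \<delta>2(2)[of x'] x' x W(1) by (simp add: \<delta>_def dist_norm)
      qed (use \<eta> t in auto)
      then show ?thesis using \<eta> by simp
    qed
    moreover have "0 < \<delta>" using rQ(1)[OF x] \<delta>1 \<delta>2 by (simp add: \<delta>_def)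
    ultimately show ?thesis by blast
  qed
  show thesis
  proof (rule that[of "\<lambda>t x y. W x y t"])
    show "((\<lambda>s. W x y s) has_vector_derivative frechet_derivative H (at (t, x, z t x)) (0, y, W x y t)) (at t)"
      if "t \<in> {-\<tau><..<\<tau>}" "x \<in> B" for t x y
      using W(2)[of x t y] that J by (auto simp: DH_def q_def J_def at_within_Icc_at)
    show "W x y 0 = frechet_derivative z0 (at x) y" if "x \<in> B" for x y
      using W(1)[OF that] by (simp add: Dz_def)
    show "continuous_on ({-\<tau><..<\<tau>} \<times> B) (\<lambda>p. W (snd p) y (fst p))" for y
      unfolding continuous_on_iff
    proof (intro ballI allI impI)
      fix p and \<epsilon> :: real assume p: "p \<in> {-\<tau><..<\<tau>} \<times> B" and \<epsilon>: "0 < \<epsilon>"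
      obtain t x where [simp]: "p = (t, x)" by (cases p)
      have tx: "t \<in> J" "x \<in> B" using p J by auto
      obtain \<delta>1 where \<delta>1: "0 < \<delta>1" "\<And>x' t. x' \<in> B \<Longrightarrow> dist x' x < \<delta>1 \<Longrightarrow> t \<in> J \<Longrightarrow> norm (W x' y t - W x y t) \<le> \<epsilon> / 2"
        using W_unif[OF tx(2), of "\<epsilon>/2" y] \<epsilon> by auto
      obtain \<delta>2 where \<delta>2: "0 < \<delta>2" "\<And>t'. t' \<in> J \<Longrightarrow> dist t' t < \<delta>2 \<Longrightarrow> dist (W x y t') (W x y t) < \<epsilon> / 2"
        using Wc[OF tx(2), of y] tx(1) \<epsilon> unfolding continuous_on_iff by (metis half_gt_zero)
      show "\<exists>\<delta>>0. \<forall>p'\<in>{-\<tau><..<\<tau>} \<times> B. dist p' p < \<delta> \<longrightarrow> dist (W (snd p') y (fst p')) (W (snd p) y (fst p)) < \<epsilon>"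
      proof (intro exI[of _ "min \<delta>1 \<delta>2"] conjI ballI impI)
        fix p' assume p': "p' \<in> {-\<tau><..<\<tau>} \<times> B" "dist p' p < min \<delta>1 \<delta>2"
        obtain t' x' where [simp]: "p' = (t', x')" by (cases p')
        have "dist x' x < \<delta>1" "dist t' t < \<delta>2"
          using p'(2) dist_snd_le[of p' p] dist_fst_le[of p' p] by auto
        then show "dist (W (snd p') y (fst p')) (W (snd p) y (fst p)) < \<epsilon>"
          using \<delta>1(2)[of x' t'] \<delta>2(2)[of t'] p'(1) J(4) dist_triangle[of "W x' y t'" "W x y t" "W x y t'"]
          by (auto simp: dist_norm)
      qed (use \<delta>1 \<delta>2 in auto)
    qed
    fix t x assume tx: "t \<in> {-\<tau><..<\<tau>}" "x \<in> B"
    \<comment> \<open>Continuity of the partial derivative in time, together with differentiability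
      in the parameter, yields the total derivative. The criterion takes the pair in the order (x,
      t), hence the swap at the end.\<close>
    have Hc: "continuous_on (B \<times> {-\<tau><..<\<tau>}) (\<lambda>(x, t). blinfun_scaleR_left (H (t, x, z t x)))"
    proof -
      have "continuous_on (B \<times> {-\<tau><..<\<tau>}) (\<lambda>p. q (snd p) (fst p))"
        by (rule continuous_on_compose2[OF q_cont, of _ "\<lambda>p. (snd p, fst p)", simplified])
          (use J in \<open>auto intro!: continuous_intros\<close>)
      then have "continuous_on (B \<times> {-\<tau><..<\<tau>}) (\<lambda>p. H (q (snd p) (fst p)))"
        by (rule continuous_on_compose2[OF Ck_on_imp_continuous[OF HS]]) (use qS J in auto)
      then show ?thesis
        using bounded_linear.continuous_on[OF bounded_linear_blinfun_scaleR_left] by (simp add: q_def case_prod_beta')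
    qed
    have "((\<lambda>(x, t). z t x) has_derivative (\<lambda>(y, s). W x y t + blinfun_apply (blinfun_scaleR_left (H (t, x, z t x))) s)) (at (x, t) within B \<times> {-\<tau><..<\<tau>})"
    proof (rule has_derivative_partialsI[where f = "\<lambda>x t. z t x" and fy = "\<lambda>x t. blinfun_scaleR_left (H (t, x, z t x))"])
      show "((\<lambda>x. z t x) has_derivative (\<lambda>y. W x y t)) (at x within B)"
        by (rule has_derivative_at_withinI[OF dx[OF tx(2)]]) (use tx J in auto)
      show "((\<lambda>t. z t x) has_derivative blinfun_apply (blinfun_scaleR_left (H (t, x, z t x)))) (at t within {-\<tau><..<\<tau>})"
        if "x \<in> B" "t \<in> {-\<tau><..<\<tau>}" for x t
      proof (rule has_derivative_at_withinI)
        show "((\<lambda>t. z t x) has_derivative blinfun_apply (blinfun_scaleR_left (H (t, x, z t x)))) (at t)"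
          using zd[of t x] that \<tau> by (simp add: has_vector_derivative_def)
      qed
      show "continuous (at (x, t) within B \<times> {-\<tau><..<\<tau>}) (\<lambda>(x, t). blinfun_scaleR_left (H (t, x, z t x)))"
        using Hc tx by (simp add: continuous_on_eq_continuous_within)
    qed (use tx in auto)
    then have D: "((\<lambda>(x, t). z t x) has_derivative (\<lambda>(y, s). W x y t + s *\<^sub>R H (t, x, z t x))) (at (snd (t, x), fst (t, x)))"
      using tx B by (simp add: at_within_open[of _ "B \<times> {-\<tau><..<\<tau>}"] open_Times)
    have sw: "((\<lambda>p. (snd p, fst p)) has_derivative (\<lambda>p. (snd p, fst p))) (at (t, x))"
      by (auto intro!: derivative_eq_intros)
    from diff_chain_at[OF sw D]
    show "((\<lambda>p. z (fst p) (snd p)) has_derivative (\<lambda>q. fst q *\<^sub>R H (t, x, z t x) + W x (snd q) t)) (at (t, x))"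
      by (simp add: o_def add.commute)
  qed
qed

lemma Ck_on_Pair:
  assumes "open S" "Ck_on k S f" "Ck_on k S g"
  shows "Ck_on k S (\<lambda>x. (f x, g x))"
  using Ck_on_add[OF assms(1) Ck_on_linear[OF assms(1) bounded_linear_Pair[OF bounded_linear_ident bounded_linear_zero] assms(2)]
      Ck_on_linear[OF assms(1) bounded_linear_Pair[OF bounded_linear_zero bounded_linear_ident] assms(3)]] by simp

text \<open>Induction on \<open>k\<close>, applied to the variational equation: its right-hand side
  is of class \<open>k\<close> because \<open>H\<close> is of class \<open>k + 1\<close> and
  \<open>z\<close> is already known to be of class \<open>k\<close>. Hence \<open>W\<close> is of
  class \<open>k\<close>, and so is the derivative of \<open>z\<close>. The state space of the
  variational equation is the whole space and its time interval is shorter, so \<open>U\<close> and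
  \<open>a\<close> have to vary in the induction.\<close>

lemma ode_param_Ck:
  fixes H :: "real \<times> 'b::euclidean_space \<times> 'a::euclidean_space \<Rightarrow> 'a" and z :: "real \<Rightarrow> 'b \<Rightarrow> 'a"
  assumes B: "open B"
  shows "0 < a \<Longrightarrow> open U \<Longrightarrow> convex U \<Longrightarrow> Ck_on k ({-a<..<a} \<times> B \<times> U) H \<Longrightarrow> Ck_on k B z0 \<Longrightarrow>
    continuous_on ({-a<..<a} \<times> B) (\<lambda>p. z (fst p) (snd p)) \<Longrightarrow>
    (\<And>t x. t \<in> {-a<..<a} \<Longrightarrow> x \<in> B \<Longrightarrow> z t x \<in> U) \<Longrightarrow>
    (\<And>t x. t \<in> {-a<..<a} \<Longrightarrow> x \<in> B \<Longrightarrow> ((\<lambda>s. z s x) has_vector_derivative H (t, x, z t x)) (at t)) \<Longrightarrow>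
    (\<And>x. x \<in> B \<Longrightarrow> z 0 x = z0 x) \<Longrightarrow>
    Ck_on k ({-a<..<a} \<times> B) (\<lambda>p. z (fst p) (snd p))"
proof (induction k arbitrary: a U H z0 z)
  case 0
  then show ?case by simp
next
  case (Suc k)
  note U = Suc.prems(2,3) and H = Suc.prems(4) and z0 = Suc.prems(5) and zc = Suc.prems(6)
    and zU = Suc.prems(7) and zd = Suc.prems(8) and zi = Suc.prems(9)
  have zk: "Ck_on k ({-a<..<a} \<times> B) (\<lambda>p. z (fst p) (snd p))"
    by (rule Suc.IH[OF Suc.prems(1) U Ck_on_Suc_imp[OF H] Ck_on_Suc_imp[OF z0] zc zU zd zi])
  let ?DH = "\<lambda>p. frechet_derivative H (at p)"
  have main: "Ck_on (Suc k) ({-\<tau><..<\<tau>} \<times> B) (\<lambda>p. z (fst p) (snd p))" if \<tau>: "0 < \<tau>" "\<tau> < a" for \<tau>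
  proof -
    have 1: "Ck_on (Suc 0) ({-a<..<a} \<times> B \<times> U) H" "Ck_on (Suc 0) B z0"
      by (rule Ck_on_mono[OF H] Ck_on_mono[OF z0]; simp)+
    obtain W where W: "\<And>t x. t \<in> {-\<tau><..<\<tau>} \<Longrightarrow> x \<in> B \<Longrightarrow> ((\<lambda>p. z (fst p) (snd p)) has_derivative
        (\<lambda>q. fst q *\<^sub>R H (t, x, z t x) + W t x (snd q))) (at (t, x))"
      "\<And>t x y. t \<in> {-\<tau><..<\<tau>} \<Longrightarrow> x \<in> B \<Longrightarrow>
        ((\<lambda>s. W s x y) has_vector_derivative frechet_derivative H (at (t, x, z t x)) (0, y, W t x y)) (at t)"
      "\<And>x y. x \<in> B \<Longrightarrow> W 0 x y = frechet_derivative z0 (at x) y"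
      "\<And>y. continuous_on ({-\<tau><..<\<tau>} \<times> B) (\<lambda>p. W (fst p) (snd p) y)"
      by (rule ode_param_differentiable[OF \<tau> B U 1 zc zU zd zi]) (assumption | rule that)+
    have N: "open ({-\<tau><..<\<tau>} \<times> B)" and N3: "open ({-\<tau><..<\<tau>} \<times> B \<times> (UNIV :: 'a set))"
      and S: "open ({-a<..<a} \<times> B \<times> U)" and NB: "open ({-a<..<a} \<times> B)"
      using B U by (auto intro!: open_Times)
    have zN: "Ck_on k ({-\<tau><..<\<tau>} \<times> B) (\<lambda>p. z (fst p) (snd p))"
      by (rule Ck_on_subset[OF zk]) (use \<tau> in auto)
    have "Ck_on k ({-\<tau><..<\<tau>} \<times> B) (\<lambda>p. (fst p, snd p, z (fst p) (snd p)))"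
      by (intro Ck_on_Pair N zN Ck_on_bounded_linear bounded_linear_fst bounded_linear_snd)
    then have Hk: "Ck_on k ({-\<tau><..<\<tau>} \<times> B) (\<lambda>p. H (fst p, snd p, z (fst p) (snd p)))"
      by (rule Ck_on_compose[OF N S, rotated, OF _ Ck_on_Suc_imp[OF H]]) (use \<tau> zU in auto)
    have "Ck_on k ({-\<tau><..<\<tau>} \<times> B \<times> (UNIV :: 'a set)) (\<lambda>r. (fst r, fst (snd r)))"
      by (intro Ck_on_bounded_linear N3 bounded_linear_Pair bounded_linear_fst
          bounded_linear_compose[OF bounded_linear_fst bounded_linear_snd])
    then have "Ck_on k ({-\<tau><..<\<tau>} \<times> B \<times> (UNIV :: 'a set)) (\<lambda>r. z (fst (fst r, fst (snd r))) (snd (fst r, fst (snd r))))"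
      by (rule Ck_on_compose[OF N3 NB, rotated, OF _ zk]) (use \<tau> in auto)
    then have "Ck_on k ({-\<tau><..<\<tau>} \<times> B \<times> (UNIV :: 'a set)) (\<lambda>r. z (fst r) (fst (snd r)))" by simp
    then have q: "Ck_on k ({-\<tau><..<\<tau>} \<times> B \<times> (UNIV :: 'a set)) (\<lambda>r. (fst r, fst (snd r), z (fst r) (fst (snd r))))"
      by (intro Ck_on_Pair[OF N3 Ck_on_bounded_linear[OF N3 bounded_linear_fst] Ck_on_Pair[OF N3
          Ck_on_bounded_linear[OF N3 bounded_linear_compose[OF bounded_linear_fst bounded_linear_snd]]]])
    have qS: "(t, x, z t x) \<in> {-a<..<a} \<times> B \<times> U" if "t \<in> {-\<tau><..<\<tau>}" "x \<in> B" for t x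
      using that \<tau> zU by auto
    have qi: "(\<lambda>r. (fst r, fst (snd r), z (fst r) (fst (snd r)))) ` ({-\<tau><..<\<tau>} \<times> B \<times> (UNIV :: 'a set)) \<subseteq> {-a<..<a} \<times> B \<times> U"
      using qS by auto
    have Wk: "Ck_on k ({-\<tau><..<\<tau>} \<times> B) (\<lambda>p. W (fst p) (snd p) y)" for y
    proof (rule Suc.IH[of \<tau> UNIV "\<lambda>r. ?DH (fst r, fst (snd r), z (fst r) (fst (snd r))) (0, y, snd (snd r))"
          "\<lambda>x. frechet_derivative z0 (at x) y" "\<lambda>t x. W t x y"])
      show "Ck_on k ({-\<tau><..<\<tau>} \<times> B \<times> (UNIV :: 'a set)) (\<lambda>r. ?DH (fst r, fst (snd r), z (fst r) (fst (snd r))) (0, y, snd (snd r)))"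
      proof (rule Ck_on_apply_linear[OF N3, where L = "\<lambda>r. ?DH (fst r, fst (snd r), z (fst r) (fst (snd r)))"])
        show "Ck_on k ({-\<tau><..<\<tau>} \<times> B \<times> (UNIV :: 'a set)) (\<lambda>r. ?DH (fst r, fst (snd r), z (fst r) (fst (snd r))) v)" for v
          by (rule Ck_on_compose[OF N3 S qi q Ck_on_SucD(2)[OF H, of v]])
        show "linear (?DH (fst r, fst (snd r), z (fst r) (fst (snd r))))" if "r \<in> {-\<tau><..<\<tau>} \<times> B \<times> (UNIV :: 'a set)" for r
          using has_derivative_linear[OF Ck_on_SucD(1)[OF H qS]] that by auto
        show "Ck_on k ({-\<tau><..<\<tau>} \<times> B \<times> (UNIV :: 'a set)) (\<lambda>r. (0, y, snd (snd r)))"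
          by (intro Ck_on_Pair N3 Ck_on_const Ck_on_bounded_linear
              bounded_linear_compose[OF bounded_linear_snd bounded_linear_snd])
      qed
    qed (use \<tau> W(2,3,4) Ck_on_SucD(2)[OF z0] in auto)
    show ?thesis
    proof (rule Ck_on_SucI[OF N])
      fix p assume "p \<in> {-\<tau><..<\<tau>} \<times> B"
      then show "((\<lambda>p. z (fst p) (snd p)) has_derivative
          (\<lambda>q. fst q *\<^sub>R H (fst p, snd p, z (fst p) (snd p)) + W (fst p) (snd p) (snd q))) (at p)"
        using W(1)[of "fst p" "snd p"] by auto
    next
      show "Ck_on k ({-\<tau><..<\<tau>} \<times> B) (\<lambda>p. fst v *\<^sub>R H (fst p, snd p, z (fst p) (snd p)) + W (fst p) (snd p) (snd v))" for v
        by (intro Ck_on_add N Wk Ck_on_linear[OF N bounded_linear_scaleR_right Hk])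
    qed
  qed
  show ?case
  proof (rule Ck_on_local)
    fix p assume p: "p \<in> {-a<..<a} \<times> B"
    \<comment> \<open>Halfway between the time of \<open>p\<close> and the end of the interval, so
      that the shorter interval still contains a neighbourhood of \<open>p\<close>.\<close>
    define \<tau> where "\<tau> = (\<bar>fst p\<bar> + a) / 2"
    have \<tau>: "0 < \<tau>" "\<tau> < a" "\<bar>fst p\<bar> < \<tau>" using p by (auto simp: \<tau>_def)
    have "({-\<tau><..<\<tau>} \<times> B) \<inter> ({-a<..<a} \<times> B) = {-\<tau><..<\<tau>} \<times> B" using \<tau> by auto
    then show "\<exists>V. open V \<and> p \<in> V \<and> Ck_on (Suc k) (V \<inter> ({-a<..<a} \<times> B)) (\<lambda>p. z (fst p) (snd p))"
      using main[OF \<tau>(1,2)] \<tau> p B by (intro exI[of _ "{-\<tau><..<\<tau>} \<times> B"]) (auto simp: open_Times)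
  qed
qed

text \<open>Composing \<open>F\<close> with the closest point map of a ball produces a globally
  Lipschitz field, whose solutions exist on a fixed interval. Solutions starting near the centre
  stay in the ball for a short time, where the modified field agrees with \<open>F\<close>.\<close>

theorem smooth_local_flow:
  fixes F :: "'a::euclidean_space \<Rightarrow> 'a"
  assumes S: "open S" and F: "smooth_on S F" and x0: "x0 \<in> S"
  obtains a r \<Phi> where "0 < a" "0 < r" "ball x0 r \<subseteq> S"
    "smooth_on ({-a<..<a} \<times> ball x0 r) (\<lambda>p. \<Phi> (fst p) (snd p))"
    "\<And>x. x \<in> ball x0 r \<Longrightarrow> \<Phi> 0 x = x"
    "\<And>t x. t \<in> {-a<..<a} \<Longrightarrow> x \<in> ball x0 r \<Longrightarrow> \<Phi> t x \<in> S"
    "\<And>t x. t \<in> {-a<..<a} \<Longrightarrow> x \<in> ball x0 r \<Longrightarrow> ((\<lambda>s. \<Phi> s x) has_vector_derivative F (\<Phi> t x)) (at t)"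
proof -
  obtain R where R: "0 < R" "cball x0 R \<subseteq> S" using S x0 open_contains_cball by blast
  have F1: "Ck_on (Suc 0) S F" using F by (simp add: smooth_on_def del: Ck_on.simps)
  obtain L where L: "0 \<le> L" "\<And>x y. x \<in> cball x0 R \<Longrightarrow> y \<in> cball x0 R \<Longrightarrow> norm (F x - F y) \<le> L * norm (x - y)"
    using C1_lipschitz_on_compact[OF F1 compact_cball convex_cball R(2)] by metis
  define M where "M = norm (F x0) + L * R"
  have M0: "0 \<le> M" using L R by (simp add: M_def)
  have M: "norm (F x) \<le> M" if "x \<in> cball x0 R" for x
  proof -
    have "norm (F x - F x0) \<le> L * norm (x - x0)" using L(2) that R by auto
    also have "\<dots> \<le> L * R" using that L by (intro mult_left_mono) (auto simp: dist_norm norm_minus_commute)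
    finally show ?thesis using norm_triangle_sub[of "F x" "F x0"] by (simp add: M_def)
  qed
  \<comment> \<open>The speed is at most \<open>M\<close>, so a solution moves by at most
    \<open>R / 4\<close> in this time; starting within \<open>R / 4\<close> of the centre it remains
    within \<open>R\<close>.\<close>
  define \<tau> where "\<tau> = R / (4 * (M + 1))"
  have \<tau>: "0 < \<tau>" "M * \<tau> \<le> R / 4" using R M0 by (auto simp: \<tau>_def field_simps)
  define cp where "cp = closest_point (cball x0 R)"
  have cp: "cp y \<in> cball x0 R" for y
    unfolding cp_def by (rule closest_point_in_set) (use R in auto)
  have cp_id: "cp y = y" if "y \<in> cball x0 R" for y using that by (simp add: cp_def closest_point_self)
  have lip: "norm (F (cp y) - F (cp y')) \<le> L * norm (y - y')" for y y'
  proof -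
    have "norm (F (cp y) - F (cp y')) \<le> L * norm (cp y - cp y')" by (rule L(2)[OF cp cp])
    also have "\<dots> \<le> L * norm (y - y')"
      unfolding cp_def using closest_point_lipschitz[of "cball x0 R" y y'] R L
      by (intro mult_left_mono) (auto simp: dist_norm)
    finally show ?thesis .
  qed
  have cont: "continuous_on (UNIV) (\<lambda>y. F (cp y))"
    by (rule lipschitz_on_continuous_on[of L]) (auto intro!: lipschitz_onI simp: dist_norm lip L)
  have c: "continuous_on ({-\<tau>..\<tau>} \<times> UNIV) (\<lambda>(t::real, y). F (cp y))"
    unfolding case_prod_beta' by (rule continuous_on_compose2[OF cont]) (auto intro: continuous_intros)
  have "\<exists>y. y 0 = x \<and> (\<forall>t\<in>{-\<tau>..\<tau>}. (y has_vector_derivative F (cp (y t))) (at t within {-\<tau>..\<tau>}))" for x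
    using picard_lindelof[OF _ c lip L(1), of x] \<tau> by (metis less_imp_le)
  then obtain \<phi> where \<phi>: "\<And>x. \<phi> x 0 = x"
    "\<And>x t. t \<in> {-\<tau>..\<tau>} \<Longrightarrow> (\<phi> x has_vector_derivative F (cp (\<phi> x t))) (at t within {-\<tau>..\<tau>})" by metis
  have tlip: "norm (\<phi> x t - \<phi> x t') \<le> M * norm (t - t')" if "t \<in> {-\<tau>..\<tau>}" "t' \<in> {-\<tau>..\<tau>}" for x t t'
  proof (rule differentiable_bound[OF convex_real_interval(5)[of "-\<tau>" \<tau>] _ _ that])
    fix s assume s: "s \<in> {-\<tau>..\<tau>}"
    show "(\<phi> x has_derivative (\<lambda>h. h *\<^sub>R F (cp (\<phi> x s)))) (at s within {-\<tau>..\<tau>})"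
      using \<phi>(2)[OF s] by (simp add: has_vector_derivative_def)
    show "onorm (\<lambda>h. h *\<^sub>R F (cp (\<phi> x s))) \<le> M"
      by (rule onorm_bound[OF M0]) (use mult_left_mono[OF M[OF cp]] in \<open>simp add: mult.commute[of M]\<close>)
  qed
  have stay: "\<phi> x t \<in> ball x0 R" if x: "x \<in> ball x0 (R/4)" and t: "t \<in> {-\<tau>..\<tau>}" for x t
  proof -
    have "norm (\<phi> x t - x) \<le> M * norm (t - 0)" using tlip[OF t, of 0 x] \<phi>(1) \<tau> by auto
    also have "\<dots> \<le> M * \<tau>" using t M0 by (intro mult_left_mono) auto
    finally have "dist (\<phi> x t) x \<le> R / 4" using \<tau> by (simp add: dist_norm)
    moreover have "dist x0 x < R / 4" using x by simp
    ultimately show ?thesis using dist_triangle[of x0 "\<phi> x t" x] R by (simp add: dist_commute)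
  qed
  have xlip: "norm (\<phi> x t - \<phi> x' t) \<le> sqrt ((1 + \<tau>) * exp ((2 * L + 1) * \<tau>)) * (norm (x - x') + 0)"
    if t: "t \<in> {-\<tau>..\<tau>}" for x x' t
    by (rule gronwall_symmetric[OF has_vector_derivative_diff[OF \<phi>(2) \<phi>(2)]])
      (use lip L \<phi>(1) t in auto)
  define E where "E = sqrt ((1 + \<tau>) * exp ((2 * L + 1) * \<tau>))"
  have E0: "0 \<le> E" using \<tau> by (simp add: E_def)
  have pc: "continuous_on ({-\<tau><..<\<tau>} \<times> ball x0 (R/4)) (\<lambda>p. \<phi> (snd p) (fst p))"
  proof (rule lipschitz_on_continuous_on[of "E + M"], rule lipschitz_onI)
    fix p p' assume p: "p \<in> {-\<tau><..<\<tau>} \<times> ball x0 (R/4)" "p' \<in> {-\<tau><..<\<tau>} \<times> ball x0 (R/4)"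
    have "dist (\<phi> (snd p) (fst p)) (\<phi> (snd p') (fst p')) \<le>
        norm (\<phi> (snd p) (fst p) - \<phi> (snd p') (fst p)) + norm (\<phi> (snd p') (fst p) - \<phi> (snd p') (fst p'))"
      unfolding dist_norm using norm_triangle_ineq[of "\<phi> (snd p) (fst p) - \<phi> (snd p') (fst p)" "\<phi> (snd p') (fst p) - \<phi> (snd p') (fst p')"]
      by simp
    also have "\<dots> \<le> E * norm (snd p - snd p') + M * norm (fst p - fst p')"
      using xlip[of "fst p" "snd p" "snd p'"] tlip[of "fst p" "fst p'" "snd p'"] p
      by (intro add_mono) (auto simp: E_def mem_Times_iff)
    also have "\<dots> \<le> E * dist p p' + M * dist p p'"
      using E0 M0 dist_fst_le[of p p'] dist_snd_le[of p p'] by (intro add_mono mult_left_mono) (auto simp: dist_norm)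
    finally show "dist (\<phi> (snd p) (fst p)) (\<phi> (snd p') (fst p')) \<le> (E + M) * dist p p'"
      by (simp add: algebra_simps)
  qed (use E0 M0 in auto)
  have der: "((\<lambda>s. \<phi> x s) has_vector_derivative F (\<phi> x t)) (at t)"
    if t: "t \<in> {-\<tau><..<\<tau>}" and x: "x \<in> ball x0 (R/4)" for t x
  proof -
    have "cp (\<phi> x t) = \<phi> x t" using cp_id stay[OF x, of t] t by (simp add: less_imp_le)
    then show ?thesis using \<phi>(2)[of t x] t by (simp add: at_within_Icc_at)
  qed
  have smooth: "smooth_on ({-\<tau><..<\<tau>} \<times> ball x0 (R/4)) (\<lambda>p. \<phi> (snd p) (fst p))"
    unfolding smooth_on_def
  proof
    fix k
    have "Ck_on k ({-\<tau><..<\<tau>} \<times> ball x0 (R/4) \<times> ball x0 R) (\<lambda>r. F (snd (snd r)))"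
      by (rule Ck_on_compose[OF _ S _ Ck_on_bounded_linear[OF _ bounded_linear_compose[OF bounded_linear_snd bounded_linear_snd]]])
        (use F R in \<open>auto simp: smooth_on_def intro!: open_Times\<close>)
    then show "Ck_on k ({-\<tau><..<\<tau>} \<times> ball x0 (R/4)) (\<lambda>p. \<phi> (snd p) (fst p))"
      using ode_param_Ck[of "ball x0 (R/4)" \<tau> "ball x0 R" k "\<lambda>r. F (snd (snd r))" "\<lambda>x. x" "\<lambda>t x. \<phi> x t"]
        \<tau> pc stay der \<phi>(1) by (auto simp: Ck_on_ident)
  qed
  show thesis
  proof (rule that[of \<tau> "R/4" "\<lambda>t x. \<phi> x t"])
    show "ball x0 (R/4) \<subseteq> S"
      by (rule order.trans[OF _ R(2)]) (use R in auto)
    show "\<phi> x t \<in> S" if "t \<in> {-\<tau><..<\<tau>}" "x \<in> ball x0 (R/4)" for t x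
      using stay[OF that(2), of t] that(1) R by (auto simp: subset_iff)
  qed (use \<tau> R smooth \<phi>(1) der in auto)
qed

text \<open>Near \<open>t0\<close> both solutions stay in a compact ball on which \<open>F\<close>
  is Lipschitz, and the Gronwall estimate without defect makes them equal there.\<close>

lemma ode_unique_local:
  fixes F :: "'a::euclidean_space \<Rightarrow> 'a"
  assumes S: "open S" and F: "smooth_on S F" and T: "open T" "t0 \<in> T"
    and u: "\<And>t. t \<in> T \<Longrightarrow> u t \<in> S" "\<And>t. t \<in> T \<Longrightarrow> (u has_vector_derivative F (u t)) (at t)"
    and v: "\<And>t. t \<in> T \<Longrightarrow> v t \<in> S" "\<And>t. t \<in> T \<Longrightarrow> (v has_vector_derivative F (v t)) (at t)"
    and eq: "u t0 = v t0"
  obtains \<delta> where "0 < \<delta>" "\<And>t. \<bar>t - t0\<bar> < \<delta> \<Longrightarrow> u t = v t"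
proof -
  obtain R where R: "0 < R" "cball (u t0) R \<subseteq> S" using S u T open_contains_cball by blast
  have F1: "Ck_on (Suc 0) S F" using F by (simp add: smooth_on_def del: Ck_on.simps)
  obtain L where L: "0 \<le> L" "\<And>x y. x \<in> cball (u t0) R \<Longrightarrow> y \<in> cball (u t0) R \<Longrightarrow> norm (F x - F y) \<le> L * norm (x - y)"
    using C1_lipschitz_on_compact[OF F1 compact_cball convex_cball R(2)] by metis
  have "continuous_on T u" "continuous_on T v"
    by (auto intro!: continuous_at_imp_continuous_on has_vector_derivative_continuous u v)
  then have "open (T \<inter> u -` ball (u t0) R)" "open (T \<inter> v -` ball (u t0) R)"
    using T by (auto intro: continuous_open_preimage)
  then have "open ((T \<inter> u -` ball (u t0) R) \<inter> (T \<inter> v -` ball (u t0) R))" by (rule open_Int)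
  moreover have "t0 \<in> (T \<inter> u -` ball (u t0) R) \<inter> (T \<inter> v -` ball (u t0) R)" using T R eq by auto
  ultimately obtain \<delta> where \<delta>: "0 < \<delta>" "ball t0 \<delta> \<subseteq> (T \<inter> u -` ball (u t0) R) \<inter> (T \<inter> v -` ball (u t0) R)"
    using open_contains_ball by blast
  have "u t = v t" if t: "\<bar>t - t0\<bar> < \<delta>" for t
  proof -
    have "(norm (u t - v t))\<^sup>2 \<le> ((norm (u t0 - v t0))\<^sup>2 + 0\<^sup>2 * \<bar>t - t0\<bar>) * exp ((2 * L + 1) * \<bar>t - t0\<bar>)"
    proof (rule gronwall[of "ball t0 \<delta>" UNIV])
      fix s assume "s \<in> ball t0 \<delta>"
      then have s: "s \<in> T" "u s \<in> cball (u t0) R" "v s \<in> cball (u t0) R" using \<delta>(2) by (auto simp: less_imp_le)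
      show "((\<lambda>t. u t - v t) has_vector_derivative F (u s) - F (v s)) (at s within UNIV)"
        by (intro has_vector_derivative_diff u v s)
      show "norm (F (u s) - F (v s)) \<le> L * norm (u s - v s) + 0" using L(2)[OF s(2,3)] by simp
    qed (use t \<delta> L in \<open>auto simp: dist_norm abs_minus_commute\<close>)
    then show ?thesis using eq by simp
  qed
  then show thesis using that \<delta>(1) by blast
qed

section \<open>Charts, tangent vectors and differentials\<close>

lemma chart_facts:
  assumes "is_chart c"
  shows chart_open_dom: "open (dom_chart c)"
    and chart_open_image: "open (snd c ` dom_chart c)"
    and chart_continuous: "continuous_on (dom_chart c) (snd c)"
    and chart_inv_continuous: "continuous_on (snd c ` dom_chart c) (inv_chart c)"
    and chart_inv: "p \<in> dom_chart c \<Longrightarrow> inv_chart c (snd c p) = p"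
    and chart_inv_dom: "x \<in> snd c ` dom_chart c \<Longrightarrow> inv_chart c x \<in> dom_chart c"
    and chart_image_inv: "x \<in> snd c ` dom_chart c \<Longrightarrow> snd c (inv_chart c x) = x"
  using assms unfolding is_chart_def homeomorphism_def by auto

lemma chart_open_map:
  assumes "is_chart c" "open U"
  shows "open (snd c ` (dom_chart c \<inter> U))"
proof -
  have "snd c ` (dom_chart c \<inter> U) = snd c ` dom_chart c \<inter> inv_chart c -` U"
    using chart_inv[OF assms(1)] chart_inv_dom[OF assms(1)] chart_image_inv[OF assms(1)] by (auto 0 4 simp: image_iff)
  then show ?thesis
    using continuous_open_preimage[OF chart_inv_continuous[OF assms(1)] chart_open_image[OF assms(1)] assms(2)] by simp
qed

lemma atlas_chart: "smooth_atlas A \<Longrightarrow> c \<in> A \<Longrightarrow> is_chart c"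
  by (simp add: smooth_atlas_def)

lemma atlas_cover:
  assumes "smooth_atlas A" obtains c where "c \<in> A" "p \<in> dom_chart c"
  using assms unfolding smooth_atlas_def by blast

text \<open>The coordinate expression of \<open>f\<close>; with \<open>id\<close> it is the
  transition map from \<open>c\<close> to \<open>d\<close>.\<close>

definition rep :: "('a, 'e) chart \<Rightarrow> ('b, 'f) chart \<Rightarrow> ('a \<Rightarrow> 'b) \<Rightarrow> 'e \<Rightarrow> 'f" where
  "rep c d f = snd d \<circ> f \<circ> inv_chart c"

lemma rep_id: "snd d \<circ> inv_chart c = rep c d id"
  by (simp add: rep_def)

lemma open_domain_restrict:
  "open S \<Longrightarrow> continuous_on S f \<Longrightarrow> open T \<Longrightarrow> open (S \<inter> f -` T)"
  by (rule continuous_open_preimage)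

lemma rep_open_domain:
  assumes "is_chart c" "open S" "continuous_on S f" "is_chart d"
  shows "open (snd c ` (S \<inter> dom_chart c \<inter> f -` dom_chart d))"
proof -
  have "S \<inter> dom_chart c \<inter> f -` dom_chart d = dom_chart c \<inter> (S \<inter> f -` dom_chart d)" by auto
  then show ?thesis
    using chart_open_map[OF assms(1) open_domain_restrict[OF assms(2,3) chart_open_dom[OF assms(4)]]] by simp
qed

lemma smooth_map_rep:
  assumes "smooth_map A B S f" "c \<in> A" "d \<in> B"
  shows "smooth_on (snd c ` (S \<inter> dom_chart c \<inter> f -` dom_chart d)) (rep c d f)"
  using assms unfolding smooth_map_def rep_def by blast

lemma smooth_map_continuous: "smooth_map A B S f \<Longrightarrow> continuous_on S f"
  by (simp add: smooth_map_def)

lemma smooth_map_has_derivative: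
  assumes "smooth_map A B S f" "c \<in> A" "d \<in> B" "p \<in> S" "p \<in> dom_chart c" "f p \<in> dom_chart d"
  shows "(rep c d f has_derivative frechet_derivative (rep c d f) (at (snd c p))) (at (snd c p))"
  by (rule smooth_on_has_derivative[OF smooth_map_rep[OF assms(1-3)]]) (use assms in auto)

lemma smooth_map_subset:
  assumes f: "smooth_map A B S f" and T: "T \<subseteq> S"
  shows "smooth_map A B T f"
proof -
  have "continuous_on T f"
    by (rule continuous_on_subset[OF smooth_map_continuous[OF f] T])
  moreover have "smooth_on (snd c ` (T \<inter> dom_chart c \<inter> f -` dom_chart d)) (snd d \<circ> f \<circ> inv_chart c)"
    if "c \<in> A" "d \<in> B" for c d
    by (rule smooth_on_subset[of "snd c ` (S \<inter> dom_chart c \<inter> f -` dom_chart d)"])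
      (use f T that in \<open>auto simp: smooth_map_def\<close>)
  ultimately show ?thesis by (simp add: smooth_map_def)
qed

lemma smooth_map_id: "smooth_atlas A \<Longrightarrow> smooth_map A A UNIV id"
  unfolding smooth_map_def smooth_atlas_def by (simp add: vimage_def)

text \<open>\<open>inv_chart\<close> has arbitrary values off the image of the chart, so coordinate
  expressions compose only on an open set around the point. For derivatives this is enough.\<close>

lemma rep_comp_eventually:
  assumes "is_chart c" "is_chart d" "open S" "p \<in> S" "p \<in> dom_chart c" "f p \<in> dom_chart d" "continuous_on S f"
  obtains V where "open V" "snd c p \<in> V" "V \<subseteq> snd c ` dom_chart c"
    "\<And>x. x \<in> V \<Longrightarrow> rep c e (h \<circ> f) x = rep d e h (rep c d f x)"
    "\<And>x. x \<in> V \<Longrightarrow> inv_chart c x \<in> S \<and> f (inv_chart c x) \<in> dom_chart d"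
proof (rule that[OF rep_open_domain[OF assms(1,3,7,2)]])
  fix x assume "x \<in> snd c ` (S \<inter> dom_chart c \<inter> f -` dom_chart d)"
  then obtain q where q: "q \<in> S" "q \<in> dom_chart c" "f q \<in> dom_chart d" "x = snd c q" by auto
  show "rep c e (h \<circ> f) x = rep d e h (rep c d f x)"
    using q chart_inv[OF assms(1)] chart_inv[OF assms(2)] by (simp add: rep_def)
  show "inv_chart c x \<in> S \<and> f (inv_chart c x) \<in> dom_chart d"
    using q chart_inv[OF assms(1)] by simp
qed (use assms in auto)

lemma rep_at: "is_chart c \<Longrightarrow> p \<in> dom_chart c \<Longrightarrow> rep c d f (snd c p) = snd d (f p)"
  by (simp add: rep_def chart_inv)

lemma rep_comp_has_derivative:
  assumes "is_chart c" "is_chart d" "open S" "p \<in> S" "p \<in> dom_chart c" "f p \<in> dom_chart d" "continuous_on S f"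
    and f: "(rep c d f has_derivative f') (at (snd c p))"
    and h: "(rep d e h has_derivative h') (at (snd d (f p)))"
  shows "(rep c e (h \<circ> f) has_derivative (\<lambda>v. h' (f' v))) (at (snd c p))"
proof -
  obtain V where V: "open V" "snd c p \<in> V" "\<And>x. x \<in> V \<Longrightarrow> rep c e (h \<circ> f) x = rep d e h (rep c d f x)"
    using rep_comp_eventually[OF assms(1-7)] by metis
  have h2: "(rep d e h has_derivative h') (at (rep c d f (snd c p)))"
    using h by (simp add: rep_at[OF assms(1,5)])
  have "((\<lambda>x. rep d e h (rep c d f x)) has_derivative (\<lambda>v. h' (f' v))) (at (snd c p))"
    using diff_chain_at[OF f h2] by (simp add: o_def)
  then show ?thesis
    by (rule has_derivative_transform_within_open[OF _ V(1,2)]) (simp add: V(3))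
qed

lemma rep_transition_has_derivative:
  assumes "is_chart c" "is_chart d" "p \<in> dom_chart c" "p \<in> dom_chart d"
    and "(rep c d id has_derivative f') (at (snd c p))" "(rep d e h has_derivative h') (at (snd d p))"
  shows "(rep c e h has_derivative (\<lambda>v. h' (f' v))) (at (snd c p))"
  using rep_comp_has_derivative[of c d UNIV p id f' e h h'] assms by (simp add: continuous_on_id)

lemma transition_has_derivative:
  assumes "smooth_atlas A" "c \<in> A" "d \<in> A" "p \<in> dom_chart c" "p \<in> dom_chart d"
  shows "(rep c d id has_derivative frechet_derivative (rep c d id) (at (snd c p))) (at (snd c p))"
  by (rule smooth_map_has_derivative[OF smooth_map_id[OF assms(1)] assms(2,3)]) (use assms in auto)

lemma transition_self:
  assumes "is_chart c" "p \<in> dom_chart c"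
  shows "frechet_derivative (rep c c id) (at (snd c p)) = (\<lambda>v. v)"
proof -
  have "((\<lambda>x. x) has_derivative (\<lambda>v. v)) (at (snd c p))" by simp
  then have "(rep c c id has_derivative (\<lambda>v. v)) (at (snd c p))"
    by (rule has_derivative_transform_within_open[OF _ chart_open_image[OF assms(1)]])
      (use assms in \<open>simp_all add: rep_def chart_image_inv[OF assms(1)]\<close>)
  then show ?thesis by (rule frechet_derivative_at[symmetric])
qed

section \<open>Tangent vectors and differentials through one chart\<close>

lemma tangent_space_chart:
  assumes "\<xi> \<in> tangent_space A p" "c \<in> A" "d \<in> A" "p \<in> dom_chart c" "p \<in> dom_chart d"
  shows "\<xi> d = frechet_derivative (rep c d id) (at (snd c p)) (\<xi> c)"
  using assms unfolding tangent_space_def rep_id by blast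

lemma tangent_space_zero: "\<xi> \<in> tangent_space A p \<Longrightarrow> \<not> (c \<in> A \<and> p \<in> dom_chart c) \<Longrightarrow> \<xi> c = 0"
  unfolding tangent_space_def by blast

text \<open>The transition derivatives recover every representation from a single one, so equations
  between tangent vectors are checked in one convenient chart.\<close>

lemma tangent_eqI:
  assumes "\<xi> \<in> tangent_space A p" "\<eta> \<in> tangent_space A p" "c \<in> A" "p \<in> dom_chart c" "\<xi> c = \<eta> c"
  shows "\<xi> = \<eta>"
proof
  fix d
  show "\<xi> d = \<eta> d"
  proof (cases "d \<in> A \<and> p \<in> dom_chart d")
    case True
    then have "\<xi> d = frechet_derivative (rep c d id) (at (snd c p)) (\<xi> c)"
      "\<eta> d = frechet_derivative (rep c d id) (at (snd c p)) (\<eta> c)"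
      using tangent_space_chart[OF assms(1,3) _ assms(4)] tangent_space_chart[OF assms(2,3) _ assms(4)] by blast+
    then show ?thesis by (simp only: assms(5))
  next
    case False
    then show ?thesis using tangent_space_zero[OF assms(1)] tangent_space_zero[OF assms(2)] by metis
  qed
qed

lemma tangent_spaceI:
  assumes "\<And>c. \<not> (c \<in> A \<and> p \<in> dom_chart c) \<Longrightarrow> \<xi> c = 0"
    "\<And>c d. c \<in> A \<Longrightarrow> d \<in> A \<Longrightarrow> p \<in> dom_chart c \<Longrightarrow> p \<in> dom_chart d \<Longrightarrow>
      \<xi> d = frechet_derivative (rep c d id) (at (snd c p)) (\<xi> c)"
  shows "\<xi> \<in> tangent_space A p"
  using assms unfolding tangent_space_def rep_id by blast

lemma tangent_space_tadd:
  assumes "smooth_atlas A" "\<xi> \<in> tangent_space A p" "\<eta> \<in> tangent_space A p"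
  shows "tadd \<xi> \<eta> \<in> tangent_space A p"
proof (rule tangent_spaceI)
  fix c d assume *: "c \<in> A" "d \<in> A" "p \<in> dom_chart c" "p \<in> dom_chart d"
  show "tadd \<xi> \<eta> d = frechet_derivative (rep c d id) (at (snd c p)) (tadd \<xi> \<eta> c)"
    unfolding tadd_def using tangent_space_chart[OF assms(2) *] tangent_space_chart[OF assms(3) *]
      linear_add[OF has_derivative_linear[OF transition_has_derivative[OF assms(1) *]]] by simp
qed (use tangent_space_zero[OF assms(2)] tangent_space_zero[OF assms(3)] in \<open>auto simp: tadd_def\<close>)

lemma tangent_space_tscale:
  assumes "smooth_atlas A" "\<xi> \<in> tangent_space A p"
  shows "tscale r \<xi> \<in> tangent_space A p"
proof (rule tangent_spaceI)
  fix c d assume *: "c \<in> A" "d \<in> A" "p \<in> dom_chart c" "p \<in> dom_chart d"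
  show "tscale r \<xi> d = frechet_derivative (rep c d id) (at (snd c p)) (tscale r \<xi> c)"
    unfolding tscale_def using tangent_space_chart[OF assms(2) *]
      linear_scale[OF has_derivative_linear[OF transition_has_derivative[OF assms(1) *]]] by simp
qed (use tangent_space_zero[OF assms(2)] in \<open>auto simp: tscale_def\<close>)

lemma coord_vec_rep: "coord_vec A c p a = (\<lambda>d. if d \<in> A \<and> p \<in> dom_chart d
     then frechet_derivative (rep c d id) (at (snd c p)) a else 0)"
  unfolding coord_vec_def rep_id ..

lemma coord_vec_chart: "is_chart c \<Longrightarrow> c \<in> A \<Longrightarrow> p \<in> dom_chart c \<Longrightarrow> coord_vec A c p a c = a"
  by (simp add: coord_vec_rep transition_self)

lemma coord_vec_tangent:
  assumes "smooth_atlas A" "c \<in> A" "p \<in> dom_chart c"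
  shows "coord_vec A c p a \<in> tangent_space A p"
proof (rule tangent_spaceI)
  fix d e assume *: "d \<in> A" "e \<in> A" "p \<in> dom_chart d" "p \<in> dom_chart e"
  note ch = atlas_chart[OF assms(1)]
  have "(rep c e id has_derivative (\<lambda>v. frechet_derivative (rep d e id) (at (snd d p))
      (frechet_derivative (rep c d id) (at (snd c p)) v))) (at (snd c p))"
    by (rule rep_transition_has_derivative[OF ch[OF assms(2)] ch[OF *(1)] assms(3) *(3)
          transition_has_derivative[OF assms(1,2) *(1) assms(3) *(3)] transition_has_derivative[OF assms(1) *]])
  then have "frechet_derivative (rep c e id) (at (snd c p)) = (\<lambda>v. frechet_derivative (rep d e id) (at (snd d p))
      (frechet_derivative (rep c d id) (at (snd c p)) v))"
    using frechet_derivative_at by fastforce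
  then show "coord_vec A c p a e = frechet_derivative (rep d e id) (at (snd d p)) (coord_vec A c p a d)"
    using * by (simp add: coord_vec_rep)
qed (auto simp: coord_vec_def)

lemma coord_vec_tangent_eq:
  assumes "smooth_atlas A" "c \<in> A" "p \<in> dom_chart c" "\<xi> \<in> tangent_space A p"
  shows "coord_vec A c p (\<xi> c) = \<xi>"
  by (rule tangent_eqI[OF coord_vec_tangent[OF assms(1-3)] assms(4,2,3)])
    (simp add: coord_vec_chart[OF atlas_chart[OF assms(1,2)] assms(2,3)])

lemma tadd_coord_vec:
  assumes "smooth_atlas A" "c \<in> A" "p \<in> dom_chart c"
  shows "tadd (coord_vec A c p a) (coord_vec A c p b) = coord_vec A c p (a + b)"
  by (rule tangent_eqI[OF tangent_space_tadd[OF assms(1) coord_vec_tangent[OF assms] coord_vec_tangent[OF assms]]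
        coord_vec_tangent[OF assms] assms(2,3)])
    (simp add: tadd_def coord_vec_chart[OF atlas_chart[OF assms(1,2)] assms(2,3)])

lemma tscale_coord_vec:
  assumes "smooth_atlas A" "c \<in> A" "p \<in> dom_chart c"
  shows "tscale r (coord_vec A c p a) = coord_vec A c p (r *\<^sub>R a)"
  by (rule tangent_eqI[OF tangent_space_tscale[OF assms(1) coord_vec_tangent[OF assms]]
        coord_vec_tangent[OF assms] assms(2,3)])
    (simp add: tscale_def coord_vec_chart[OF atlas_chart[OF assms(1,2)] assms(2,3)])

text \<open>\<open>differential\<close> evaluates in a chart picked by \<open>SOME\<close>. The
  transition map from that chart to \<open>c\<close> is absorbed by the chain rule and the
  compatibility of \<xi>.\<close>

lemma differential_chart:
  assumes A: "smooth_atlas A" and B: "smooth_atlas B" and f: "smooth_map A B S f" and S: "open S" "p \<in> S"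
    and \<xi>: "\<xi> \<in> tangent_space A p" and c: "c \<in> A" "p \<in> dom_chart c" and d: "d \<in> B" "f p \<in> dom_chart d"
  shows "differential A B f p \<xi> d = frechet_derivative (rep c d f) (at (snd c p)) (\<xi> c)"
proof -
  define c' where "c' = (SOME c. c \<in> A \<and> p \<in> dom_chart c)"
  have c': "c' \<in> A" "p \<in> dom_chart c'" using someI[of "\<lambda>c. c \<in> A \<and> p \<in> dom_chart c" c] c by (auto simp: c'_def)
  note ch = atlas_chart[OF A]
  have "(rep c' d f has_derivative (\<lambda>v. frechet_derivative (rep c d f) (at (snd c p))
      (frechet_derivative (rep c' c id) (at (snd c' p)) v))) (at (snd c' p))"
    by (rule rep_transition_has_derivative[OF ch[OF c'(1)] ch[OF c(1)] c'(2) c(2)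
          transition_has_derivative[OF A c'(1) c(1) c'(2) c(2)] smooth_map_has_derivative[OF f c(1) d(1) S(2) c(2) d(2)]])
  then have "frechet_derivative (rep c' d f) (at (snd c' p)) = (\<lambda>v. frechet_derivative (rep c d f) (at (snd c p))
      (frechet_derivative (rep c' c id) (at (snd c' p)) v))"
    using frechet_derivative_at by fastforce
  then show ?thesis
    using tangent_space_chart[OF \<xi> c'(1) c(1) c'(2) c(2)] d
    unfolding differential_def c'_def[symmetric] rep_def[symmetric] Let_def by simp
qed

lemma differential_tangent:
  assumes A: "smooth_atlas A" and B: "smooth_atlas B" and f: "smooth_map A B S f" and S: "open S" "p \<in> S"
    and \<xi>: "\<xi> \<in> tangent_space A p"
  shows "differential A B f p \<xi> \<in> tangent_space B (f p)"
proof (rule tangent_spaceI)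
  fix d e assume *: "d \<in> B" "e \<in> B" "f p \<in> dom_chart d" "f p \<in> dom_chart e"
  obtain c where c: "c \<in> A" "p \<in> dom_chart c" using atlas_cover[OF A] .
  have "(rep c e (id \<circ> f) has_derivative (\<lambda>v. frechet_derivative (rep d e id) (at (snd d (f p)))
      (frechet_derivative (rep c d f) (at (snd c p)) v))) (at (snd c p))"
    by (rule rep_comp_has_derivative[OF atlas_chart[OF A c(1)] atlas_chart[OF B *(1)] S c(2) *(3) smooth_map_continuous[OF f]
          smooth_map_has_derivative[OF f c(1) *(1) S(2) c(2) *(3)] transition_has_derivative[OF B *]])
  then have "frechet_derivative (rep c e f) (at (snd c p)) = (\<lambda>v. frechet_derivative (rep d e id) (at (snd d (f p)))
      (frechet_derivative (rep c d f) (at (snd c p)) v))"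
    using frechet_derivative_at by fastforce
  then show "differential A B f p \<xi> e = frechet_derivative (rep d e id) (at (snd d (f p))) (differential A B f p \<xi> d)"
    using differential_chart[OF A B f S \<xi> c *(1,3)] differential_chart[OF A B f S \<xi> c *(2,4)] by simp
qed (auto simp: differential_def)

lemma differential_comp:
  assumes A: "smooth_atlas A" and B: "smooth_atlas B" and C: "smooth_atlas C"
    and f: "smooth_map A B UNIV f" and h: "smooth_map B C UNIV h" and hf: "smooth_map A C UNIV (h \<circ> f)"
    and \<xi>: "\<xi> \<in> tangent_space A p"
  shows "differential B C h (f p) (differential A B f p \<xi>) = differential A C (h \<circ> f) p \<xi>"
proof -
  obtain c where c: "c \<in> A" "p \<in> dom_chart c" using atlas_cover[OF A] .
  obtain d where d: "d \<in> B" "f p \<in> dom_chart d" using atlas_cover[OF B] .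
  obtain e where e: "e \<in> C" "h (f p) \<in> dom_chart e" using atlas_cover[OF C] .
  have *: "(rep c e (h \<circ> f) has_derivative (\<lambda>v. frechet_derivative (rep d e h) (at (snd d (f p)))
      (frechet_derivative (rep c d f) (at (snd c p)) v))) (at (snd c p))"
    by (rule rep_comp_has_derivative[OF atlas_chart[OF A c(1)] atlas_chart[OF B d(1)] open_UNIV UNIV_I c(2) d(2) smooth_map_continuous[OF f]
          smooth_map_has_derivative[OF f c(1) d(1) UNIV_I c(2) d(2)] smooth_map_has_derivative[OF h d(1) e(1) UNIV_I d(2) e(2)]])
  note t1 = differential_tangent[OF A B f open_UNIV UNIV_I \<xi>]
  show ?thesis
  proof (rule tangent_eqI[OF _ _ e])
    show "differential B C h (f p) (differential A B f p \<xi>) \<in> tangent_space C (h (f p))"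
      by (rule differential_tangent[OF B C h open_UNIV UNIV_I t1])
    show "differential A C (h \<circ> f) p \<xi> \<in> tangent_space C (h (f p))"
      using differential_tangent[OF A C hf open_UNIV UNIV_I \<xi>] by simp
    show "differential B C h (f p) (differential A B f p \<xi>) e = differential A C (h \<circ> f) p \<xi> e"
      using differential_chart[OF B C h open_UNIV UNIV_I t1 d e] differential_chart[OF A B f open_UNIV UNIV_I \<xi> c d]
        differential_chart[OF A C hf open_UNIV UNIV_I \<xi> c, of e] e frechet_derivative_at[OF *] by (metis o_apply)
  qed
qed

lemma differential_id:
  assumes A: "smooth_atlas A" and \<xi>: "\<xi> \<in> tangent_space A p"
  shows "differential A A id p \<xi> = \<xi>"
proof -
  obtain c where c: "c \<in> A" "p \<in> dom_chart c" using atlas_cover[OF A] .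
  have "differential A A id p \<xi> \<in> tangent_space A p"
    using differential_tangent[OF A A smooth_map_id[OF A] open_UNIV UNIV_I \<xi>] by simp
  then show ?thesis
    by (rule tangent_eqI[OF _ \<xi> c])
      (use differential_chart[OF A A smooth_map_id[OF A] open_UNIV UNIV_I \<xi> c c(1)] c
        transition_self[OF atlas_chart[OF A c(1)] c(2)] in simp)
qed

subsection \<open>Maps from and to Euclidean spaces\<close>

lemma euclid_chart_simps [simp]: "fst euclid_chart = UNIV" "snd euclid_chart = id" "inv_chart euclid_chart = id"
  "euclid_chart \<in> euclid_atlas"
  by (auto simp: euclid_chart_def euclid_atlas_def inv_id)

lemma is_chart_euclid: "is_chart euclid_chart"
  by (auto simp: is_chart_def homeomorphism_def continuous_on_id)

lemma smooth_atlas_euclid: "smooth_atlas euclid_atlas"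
  using is_chart_euclid by (auto simp: smooth_atlas_def euclid_atlas_def smooth_on_ident id_def[symmetric])
    (simp add: id_def smooth_on_ident)

lemma rep_euclid: "rep euclid_chart d f = snd d \<circ> f" "rep c euclid_chart h = h \<circ> inv_chart c"
  by (simp_all add: rep_def fun.map_id0)

lemma smooth_map_euclid:
  "smooth_map euclid_atlas B S f \<longleftrightarrow>
    continuous_on S f \<and> (\<forall>d\<in>B. smooth_on (S \<inter> f -` dom_chart d) (snd d \<circ> f))"
  by (simp add: smooth_map_def euclid_atlas_def)

lemma smooth_map_euclidD:
  assumes "smooth_map euclid_atlas B S f" "d \<in> B"
  shows "smooth_on (S \<inter> f -` dom_chart d) (snd d \<circ> f)"
  using assms by (simp add: smooth_map_euclid)

text \<open>A single smooth coordinate expression covering the whole image suffices, since every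
  other one arises from it by composing with a smooth transition map.\<close>

lemma smooth_map_in_chart:
  assumes B: "smooth_atlas B" and c: "c \<in> B" and S: "open S" and X: "smooth_on S X" "X ` S \<subseteq> snd c ` dom_chart c"
    and f: "\<And>x. x \<in> S \<Longrightarrow> f x = inv_chart c (X x)"
  shows "smooth_map euclid_atlas B S f"
  unfolding smooth_map_euclid
proof (intro conjI ballI)
  note ch = atlas_chart[OF B c]
  have "continuous_on S (\<lambda>x. inv_chart c (X x))"
    by (rule continuous_on_compose2[OF chart_inv_continuous[OF ch] smooth_on_continuous[OF X(1)] X(2)])
  then show fc: "continuous_on S f" using f by (simp cong: continuous_on_cong)
  fix d assume d: "d \<in> B"
  have o: "open (S \<inter> f -` dom_chart d)"
    by (rule open_domain_restrict[OF S fc chart_open_dom[OF atlas_chart[OF B d]]])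
  have "smooth_on (snd c ` (dom_chart c \<inter> dom_chart d)) (snd d \<circ> inv_chart c)"
    using B c d by (simp add: smooth_atlas_def)
  moreover have "open (snd c ` (dom_chart c \<inter> dom_chart d))"
    by (rule chart_open_map[OF ch chart_open_dom[OF atlas_chart[OF B d]]])
  moreover have "X ` (S \<inter> f -` dom_chart d) \<subseteq> snd c ` (dom_chart c \<inter> dom_chart d)"
  proof clarify
    fix x assume x: "x \<in> S" "f x \<in> dom_chart d"
    have "X x \<in> snd c ` dom_chart c" using X(2) x by auto
    then have "X x = snd c (f x)" "f x \<in> dom_chart c"
      using chart_image_inv[OF ch] chart_inv_dom[OF ch] f[OF x(1)] by auto
    then show "X x \<in> snd c ` (dom_chart c \<inter> dom_chart d)" using x by auto
  qed
  ultimately have "smooth_on (S \<inter> f -` dom_chart d) (\<lambda>x. (snd d \<circ> inv_chart c) (X x))"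
    using smooth_on_compose[OF o _ _ smooth_on_subset[OF X(1)]] by blast
  then show "smooth_on (S \<inter> f -` dom_chart d) (snd d \<circ> f)"
    using smooth_on_cong[OF o, of "snd d \<circ> f" "\<lambda>x. (snd d \<circ> inv_chart c) (X x)"] f by simp
qed

lemma smooth_map_compose:
  assumes A: "smooth_atlas A" and f: "smooth_map euclid_atlas A S f" and S: "open S"
    and h: "smooth_map A B UNIV h" and B: "smooth_atlas B"
  shows "smooth_map euclid_atlas B S (h \<circ> f)"
  unfolding smooth_map_euclid
proof (intro conjI ballI)
  have fc: "continuous_on S f" and hc: "continuous_on UNIV h"
    using f h by (auto simp: smooth_map_def)
  show hfc: "continuous_on S (h \<circ> f)"
    by (rule continuous_on_compose[OF fc continuous_on_subset[OF hc]]) auto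
  fix d assume d: "d \<in> B"
  show "smooth_on (S \<inter> (h \<circ> f) -` dom_chart d) (snd d \<circ> (h \<circ> f))"
  proof (rule smooth_on_local)
    fix x assume x: "x \<in> S \<inter> (h \<circ> f) -` dom_chart d"
    obtain c where c: "c \<in> A" "f x \<in> dom_chart c" using atlas_cover[OF A] .
    note cc = atlas_chart[OF A c(1)] and cd = atlas_chart[OF B d]
    define V where "V = (S \<inter> f -` dom_chart c) \<inter> (S \<inter> (h \<circ> f) -` dom_chart d)"
    have V: "open V" "x \<in> V"
      unfolding V_def by (intro open_Int open_domain_restrict[OF S] fc hfc chart_open_dom cc cd) (use x c in auto)
    have o: "open (snd c ` (UNIV \<inter> dom_chart c \<inter> h -` dom_chart d))"
      by (rule rep_open_domain[OF cc open_UNIV hc cd])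
    have "smooth_on V (\<lambda>x. rep c d h ((snd c \<circ> f) x))"
      by (rule smooth_on_compose[OF V(1) o _ smooth_on_subset[OF smooth_map_euclidD[OF f c(1)]] smooth_map_rep[OF h c(1) d]])
        (auto simp: V_def)
    then have "smooth_on V (snd d \<circ> (h \<circ> f))"
      by (subst smooth_on_cong[OF V(1)]) (auto simp: V_def rep_def chart_inv[OF cc])
    then show "\<exists>U. open U \<and> x \<in> U \<and> smooth_on (U \<inter> (S \<inter> (h \<circ> f) -` dom_chart d)) (snd d \<circ> (h \<circ> f))"
      using V by (intro exI[of _ V]) (auto intro: smooth_on_subset)
  qed
qed

section \<open>Velocities of curves and immersions\<close>

lemma curve_has_vector_derivative:
  assumes "smooth_map euclid_atlas A S \<gamma>" "t \<in> S" "c \<in> A" "\<gamma> t \<in> dom_chart c"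
  shows "((snd c \<circ> \<gamma>) has_vector_derivative velocity A \<gamma> t c) (at t)"
proof -
  have "((snd c \<circ> \<gamma>) has_derivative frechet_derivative (snd c \<circ> \<gamma>) (at t)) (at t)"
    by (rule smooth_on_has_derivative[OF smooth_map_euclidD[OF assms(1,3)]]) (use assms in auto)
  then have "((snd c \<circ> \<gamma>) has_vector_derivative vector_derivative (snd c \<circ> \<gamma>) (at t)) (at t)"
    using vector_derivative_works differentiableI by blast
  then show ?thesis using assms by (simp add: velocity_def)
qed

lemma velocity_eqI:
  assumes "((snd c \<circ> \<gamma>) has_vector_derivative v) (at t)" "c \<in> A" "\<gamma> t \<in> dom_chart c"
  shows "velocity A \<gamma> t c = v"
  using assms by (simp add: velocity_def vector_derivative_at)

lemma velocity_comp:
  assumes A: "smooth_atlas A" and B: "smooth_atlas B" and \<gamma>: "smooth_map euclid_atlas A S \<gamma>" "open S" "t \<in> S"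
    and f: "smooth_map A B T f" "open T" "\<gamma> t \<in> T" and c: "c \<in> A" "\<gamma> t \<in> dom_chart c" and d: "d \<in> B" "f (\<gamma> t) \<in> dom_chart d"
  shows "velocity B (f \<circ> \<gamma>) t d = frechet_derivative (rep c d f) (at (snd c (\<gamma> t))) (velocity A \<gamma> t c)"
proof (rule velocity_eqI)
  have D: "((snd c \<circ> \<gamma>) has_derivative (\<lambda>h. h *\<^sub>R velocity A \<gamma> t c)) (at t)"
    using curve_has_vector_derivative[OF \<gamma>(1,3) c] by (simp add: has_vector_derivative_def)
  have E: "(rep c d f has_derivative frechet_derivative (rep c d f) (at (snd c (\<gamma> t)))) (at ((snd c \<circ> \<gamma>) t))"
    using smooth_map_has_derivative[OF f(1) c(1) d(1) f(3) c(2) d(2)] by simp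
  have o: "open (S \<inter> \<gamma> -` dom_chart c)"
    by (rule open_domain_restrict[OF \<gamma>(2) smooth_map_continuous[OF \<gamma>(1)] chart_open_dom[OF atlas_chart[OF A c(1)]]])
  have "((snd d \<circ> (f \<circ> \<gamma>)) has_derivative (\<lambda>h. frechet_derivative (rep c d f) (at (snd c (\<gamma> t))) (h *\<^sub>R velocity A \<gamma> t c))) (at t)"
  proof (rule has_derivative_transform_within_open[OF _ o])
    show "(rep c d f \<circ> (snd c \<circ> \<gamma>) has_derivative (\<lambda>h. frechet_derivative (rep c d f) (at (snd c (\<gamma> t))) (h *\<^sub>R velocity A \<gamma> t c))) (at t)"
      using diff_chain_at[OF D E] by (simp add: o_def)
  qed (use c \<gamma> chart_inv[OF atlas_chart[OF A c(1)]] in \<open>auto simp: rep_def\<close>)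
  then show "((snd d \<circ> (f \<circ> \<gamma>)) has_vector_derivative frechet_derivative (rep c d f) (at (snd c (\<gamma> t))) (velocity A \<gamma> t c)) (at t)"
    by (simp add: has_vector_derivative_def linear_scale[OF has_derivative_linear[OF E]])
qed (use d in auto)

lemma velocity_tangent:
  assumes A: "smooth_atlas A" and \<gamma>: "smooth_map euclid_atlas A S \<gamma>" "open S" "t \<in> S"
  shows "velocity A \<gamma> t \<in> tangent_space A (\<gamma> t)"
proof (rule tangent_spaceI)
  fix c d assume *: "c \<in> A" "d \<in> A" "\<gamma> t \<in> dom_chart c" "\<gamma> t \<in> dom_chart d"
  show "velocity A \<gamma> t d = frechet_derivative (rep c d id) (at (snd c (\<gamma> t))) (velocity A \<gamma> t c)"
    using velocity_comp[OF A A \<gamma> smooth_map_id[OF A] open_UNIV UNIV_I *(1,3,2)] *(4) by simp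
qed (auto simp: velocity_def)

lemma differential_velocity:
  assumes A: "smooth_atlas A" and B: "smooth_atlas B" and \<gamma>: "smooth_map euclid_atlas A S \<gamma>" "open S" "t \<in> S"
    and f: "smooth_map A B UNIV f"
  shows "differential A B f (\<gamma> t) (velocity A \<gamma> t) = velocity B (f \<circ> \<gamma>) t"
proof -
  obtain c where c: "c \<in> A" "\<gamma> t \<in> dom_chart c" using atlas_cover[OF A] .
  obtain d where d: "d \<in> B" "f (\<gamma> t) \<in> dom_chart d" using atlas_cover[OF B] .
  note v = velocity_tangent[OF A \<gamma>]
  show ?thesis
  proof (rule tangent_eqI[OF _ _ d])
    show "velocity B (f \<circ> \<gamma>) t \<in> tangent_space B (f (\<gamma> t))"
      using velocity_tangent[OF B smooth_map_compose[OF A \<gamma>(1,2) f B] \<gamma>(2,3)] by simp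
    show "differential A B f (\<gamma> t) (velocity A \<gamma> t) d = velocity B (f \<circ> \<gamma>) t d"
      using differential_chart[OF A B f open_UNIV UNIV_I v c d] velocity_comp[OF A B \<gamma> f open_UNIV UNIV_I c d] by simp
  qed (rule differential_tangent[OF A B f open_UNIV UNIV_I v])
qed

lemma tangent_space_euclid: "tangent_space euclid_atlas x = {\<xi>. \<forall>c. c \<noteq> euclid_chart \<longrightarrow> \<xi> c = 0}"
proof -
  have "frechet_derivative (snd euclid_chart \<circ> inv_chart euclid_chart) (at (snd euclid_chart x)) = (\<lambda>v. v)"
    by (simp add: fun_eq_iff)
  then show ?thesis by (auto simp: tangent_space_def euclid_atlas_def)
qed

text \<open>Turns the immersion condition into a statement on the kernel of a coordinate Jacobian.
  Tangent vectors of a Euclidean space are families supported on the one chart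
  \<open>euclid_chart\<close>, so they amount to plain vectors.\<close>

lemma inj_differential_euclid:
  fixes X :: "'d::euclidean_space \<Rightarrow> 'b::topological_space"
  assumes B: "smooth_atlas B" and X: "smooth_map euclid_atlas B V X" "open V" "x \<in> V" and d: "d \<in> B" "X x \<in> dom_chart d"
  shows "inj_on (differential euclid_atlas B X x) (tangent_space euclid_atlas x) \<longleftrightarrow>
    (\<forall>v. frechet_derivative (snd d \<circ> X) (at x) v = 0 \<longrightarrow> v = 0)" (is "?L \<longleftrightarrow> ?R")
proof -
  let ?D = "frechet_derivative (snd d \<circ> X) (at x)"
  note E = smooth_atlas_euclid
  have lin: "linear ?D"
    using has_derivative_linear[OF smooth_map_has_derivative[OF X(1) _ d(1) X(3) _ d(2), of euclid_chart]]
    by (simp add: rep_euclid)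
  have dc: "differential euclid_atlas B X x \<xi> d = ?D (\<xi> euclid_chart)" if "\<xi> \<in> tangent_space euclid_atlas x" for \<xi>
    using differential_chart[OF E B X that _ _ d, of euclid_chart] by (simp add: rep_euclid)
  have eq: "differential euclid_atlas B X x \<xi> = differential euclid_atlas B X x \<eta> \<longleftrightarrow> ?D (\<xi> euclid_chart) = ?D (\<eta> euclid_chart)"
    if "\<xi> \<in> tangent_space euclid_atlas x" "\<eta> \<in> tangent_space euclid_atlas x" for \<xi> \<eta>
    using tangent_eqI[OF differential_tangent[OF E B X that(1)] differential_tangent[OF E B X that(2)] d] dc that by metis
  show ?thesis
  proof
    assume ?L
    show ?R
    proof (intro allI impI)
      fix v assume v: "?D v = 0"
      let ?\<xi> = "\<lambda>(v::'d) (c::('d, 'd) chart). if c = euclid_chart then v else 0"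
      have t: "?\<xi> v \<in> tangent_space euclid_atlas x" for v by (simp add: tangent_space_euclid)
      have "differential euclid_atlas B X x (?\<xi> v) = differential euclid_atlas B X x (?\<xi> 0)"
        using eq[OF t t, of v 0] v linear_0[OF lin] by simp
      then have "?\<xi> v = ?\<xi> 0" by (rule inj_onD[OF \<open>?L\<close> _ t t])
      then have "?\<xi> v euclid_chart = ?\<xi> 0 euclid_chart" by (rule fun_cong)
      then show "v = 0" by simp
    qed
  next
    assume R: ?R
    show ?L
    proof (rule inj_onI)
      fix \<xi> \<eta> assume t: "\<xi> \<in> tangent_space euclid_atlas x" "\<eta> \<in> tangent_space euclid_atlas x"
        and "differential euclid_atlas B X x \<xi> = differential euclid_atlas B X x \<eta>"
      then have "?D (\<xi> euclid_chart - \<eta> euclid_chart) = 0" using eq[OF t] by (simp add: linear_diff[OF lin])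
      then have "\<xi> euclid_chart = \<eta> euclid_chart" using R by auto
      moreover have "\<xi> c = \<eta> c" if "c \<noteq> euclid_chart" for c
      proof -
        have "\<xi> c = 0" "\<eta> c = 0" using t that unfolding tangent_space_euclid by blast+
        then show ?thesis by simp
      qed
      ultimately show "\<xi> = \<eta>" by (metis ext)
    qed
  qed
qed

subsection \<open>The product with the real line\<close>

lemma prod_chart_simps [simp]:
  "fst (prod_chart c) = fst c \<times> UNIV"
  "snd (prod_chart c) q = (snd c (fst q), snd q)"
  by (auto simp: prod_chart_def split: prod.splits)

lemma prod_chart_image: "snd (prod_chart c) ` fst (prod_chart c) = (snd c ` fst c) \<times> UNIV"
  by (auto simp: image_iff)

lemma prod_chart_in_atlas: "c \<in> A \<Longrightarrow> prod_chart c \<in> prod_atlas A"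
  by (simp add: prod_atlas_def)

lemma prod_atlasE:
  assumes "d \<in> prod_atlas A" obtains c where "c \<in> A" "d = prod_chart c"
  using assms by (auto simp: prod_atlas_def)

lemma inv_prod_chart:
  assumes "is_chart c" "fst y \<in> snd c ` fst c"
  shows "inv_chart (prod_chart c) y = (inv_chart c (fst y), snd y)"
proof (rule inv_into_f_eq)
  show "inj_on (snd (prod_chart c)) (fst (prod_chart c))"
  proof (rule inj_onI)
    fix p q assume "p \<in> fst (prod_chart c)" "q \<in> fst (prod_chart c)" "snd (prod_chart c) p = snd (prod_chart c) q"
    then have "fst p \<in> fst c" "fst q \<in> fst c" "snd c (fst p) = snd c (fst q)" "snd p = snd q" by auto
    then show "p = q" using chart_inv[OF assms(1)] by (metis prod_eqI)
  qed
qed (use assms chart_inv_dom[OF assms(1) assms(2)] chart_image_inv[OF assms(1) assms(2)] in auto)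

lemma is_chart_prod:
  assumes "is_chart c"
  shows "is_chart (prod_chart c)"
proof -
  note inv = inv_prod_chart[OF assms]
  have "continuous_on ((snd c ` fst c) \<times> UNIV) (\<lambda>y. (inv_chart c (fst y), snd y))"
    by (intro continuous_on_Pair continuous_on_snd continuous_on_id
        continuous_on_compose2[OF chart_inv_continuous[OF assms] continuous_on_fst[OF continuous_on_id]]) auto
  then have 1: "continuous_on ((snd c ` fst c) \<times> UNIV) (inv_chart (prod_chart c))"
    by (rule iffD2[OF continuous_on_cong[OF refl], rotated]) (use inv in auto)
  have 2: "continuous_on (fst c \<times> UNIV) (snd (prod_chart c))"
    unfolding prod_chart_simps(2)[abs_def]
    by (intro continuous_on_Pair continuous_on_snd continuous_on_id
        continuous_on_compose2[OF chart_continuous[OF assms] continuous_on_fst[OF continuous_on_id]]) auto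
  have 3: "inv_chart (prod_chart c) ` ((snd c ` fst c) \<times> UNIV) = fst c \<times> UNIV"
  proof
    show "inv_chart (prod_chart c) ` ((snd c ` fst c) \<times> UNIV) \<subseteq> fst c \<times> UNIV"
      using inv chart_inv_dom[OF assms] by fastforce
    show "fst c \<times> UNIV \<subseteq> inv_chart (prod_chart c) ` ((snd c ` fst c) \<times> UNIV)"
    proof
      fix q :: "'a \<times> real" assume "q \<in> fst c \<times> UNIV"
      then have q: "fst q \<in> fst c" by auto
      then have "q = inv_chart (prod_chart c) (snd c (fst q), snd q)"
        using inv[of "(snd c (fst q), snd q)"] chart_inv[OF assms q] by simp
      then show "q \<in> inv_chart (prod_chart c) ` ((snd c ` fst c) \<times> UNIV)"
        using q by blast
    qed
  qed
  show ?thesis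
    unfolding is_chart_def homeomorphism_def prod_chart_image unfolding prod_chart_simps(1)
    using 1 2 3 chart_open_dom[OF assms] chart_open_image[OF assms] prod_chart_image[of c]
      chart_inv[OF assms] chart_image_inv[OF assms] inv
    by (auto simp: open_Times)
qed

lemma prod_chart_restrict_image:
  "snd (prod_chart c) ` (P \<times> UNIV) = (snd c ` P) \<times> UNIV"
  by (auto simp: image_iff)

lemma transition_smooth:
  assumes "smooth_atlas A" "c \<in> A" "d \<in> A"
  shows "open (snd c ` (fst c \<inter> fst d))" "smooth_on (snd c ` (fst c \<inter> fst d)) (\<lambda>x. snd d (inv_chart c x))"
  using chart_open_map[OF atlas_chart[OF assms(1,2)] chart_open_dom[OF atlas_chart[OF assms(1,3)]]] assms
  by (auto simp: smooth_atlas_def o_def)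

lemma transition_smooth_prod:
  assumes "smooth_atlas A" "c \<in> A" "d \<in> A"
  shows "smooth_on ((snd c ` (fst c \<inter> fst d)) \<times> (UNIV :: real set)) (\<lambda>y. snd d (inv_chart c (fst y)))"
proof -
  have o: "open ((snd c ` (fst c \<inter> fst d)) \<times> (UNIV :: real set))"
    using transition_smooth(1)[OF assms] by (simp add: open_Times)
  show ?thesis
    by (rule smooth_on_compose[OF o transition_smooth(1)[OF assms] _ smooth_on_fst[OF o smooth_on_ident[OF o]]
          transition_smooth(2)[OF assms]]) auto
qed

lemmas inv_prod_chart' = inv_prod_chart[unfolded prod_chart_simps(1)]

lemma smooth_atlas_prod:
  assumes "smooth_atlas A"
  shows "smooth_atlas (prod_atlas A)"
  unfolding smooth_atlas_def
proof (intro conjI ballI)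
  show "is_chart c" if "c \<in> prod_atlas A" for c
    using that is_chart_prod atlas_chart[OF assms] by (auto elim!: prod_atlasE)
  show "(\<Union>c\<in>prod_atlas A. dom_chart c) = UNIV"
  proof -
    have "q \<in> (\<Union>c\<in>prod_atlas A. dom_chart c)" for q :: "'a \<times> real"
    proof -
      obtain c where "c \<in> A" "fst q \<in> dom_chart c" using atlas_cover[OF assms] .
      then show ?thesis by (intro UN_I[OF prod_chart_in_atlas]) (auto simp: mem_Times_iff)
    qed
    then show ?thesis by auto
  qed
  fix c' d' :: "('a \<times> real, 'b \<times> real) chart" assume "c' \<in> prod_atlas A" "d' \<in> prod_atlas A"
  then obtain c d where c: "c \<in> A" "c' = prod_chart c" and d: "d \<in> A" "d' = prod_chart d"
    by (auto elim!: prod_atlasE)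
  let ?P = "(snd c ` (fst c \<inter> fst d)) \<times> (UNIV :: real set)"
  have o: "open ?P" using transition_smooth(1)[OF assms c(1) d(1)] by (simp add: open_Times)
  have eq: "dom_chart c' \<inter> dom_chart d' = (fst c \<inter> fst d) \<times> UNIV" using c d by auto
  have P: "snd c' ` (dom_chart c' \<inter> dom_chart d') = ?P"
    unfolding eq unfolding c(2) by (rule prod_chart_restrict_image)
  have "smooth_on ?P (\<lambda>y. (snd d (inv_chart c (fst y)), snd y))"
    by (intro smooth_on_Pair o transition_smooth_prod[OF assms c(1) d(1)] smooth_on_snd smooth_on_ident)
  then show "smooth_on (snd c' ` (dom_chart c' \<inter> dom_chart d')) (snd d' \<circ> inv_chart c')"
    unfolding P
    by (rule iffD2[OF smooth_on_cong[OF o], rotated])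
      (auto simp: c d inv_prod_chart'[OF atlas_chart[OF assms c(1)]])
qed

lemma rep_fst:
  assumes "is_chart c" "fst y \<in> snd c ` fst c"
  shows "rep (prod_chart c) d fst y = snd d (inv_chart c (fst y))"
  by (simp add: rep_def inv_prod_chart'[OF assms])

lemma smooth_map_fst:
  assumes "smooth_atlas A"
  shows "smooth_map (prod_atlas A) A UNIV fst"
  unfolding smooth_map_def
proof (intro conjI ballI)
  fix c' d assume "c' \<in> prod_atlas A" and d: "d \<in> A"
  then obtain c where c: "c \<in> A" "c' = prod_chart c" by (auto elim!: prod_atlasE)
  have o: "open ((snd c ` (fst c \<inter> fst d)) \<times> (UNIV :: real set))"
    using transition_smooth(1)[OF assms c(1) d] by (simp add: open_Times)
  have eq: "UNIV \<inter> dom_chart c' \<inter> fst -` dom_chart d = (fst c \<inter> fst d) \<times> UNIV" using c by auto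
  show "smooth_on (snd c' ` (UNIV \<inter> dom_chart c' \<inter> fst -` dom_chart d)) (snd d \<circ> fst \<circ> inv_chart c')"
    unfolding eq unfolding c(2) prod_chart_restrict_image
    by (rule iffD2[OF smooth_on_cong[OF o] transition_smooth_prod[OF assms c(1) d]])
      (auto simp: inv_prod_chart'[OF atlas_chart[OF assms c(1)]])
qed (auto intro: continuous_on_fst continuous_on_id)

lemma smooth_map_snd:
  assumes "smooth_atlas A"
  shows "smooth_map (prod_atlas A) euclid_atlas UNIV snd"
  unfolding smooth_map_def
proof (intro conjI ballI)
  fix c' and d :: "(real, real) chart" assume "c' \<in> prod_atlas A" and "d \<in> euclid_atlas"
  then have d: "d = euclid_chart" by (simp add: euclid_atlas_def)
  obtain c where c: "c \<in> A" "c' = prod_chart c" using \<open>c' \<in> prod_atlas A\<close> by (auto elim!: prod_atlasE)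
  have o: "open ((snd c ` fst c) \<times> (UNIV :: real set))"
    using chart_open_image[OF atlas_chart[OF assms c(1)]] by (simp add: open_Times)
  have eq: "UNIV \<inter> dom_chart c' \<inter> snd -` dom_chart d = fst c \<times> UNIV" using c d by auto
  show "smooth_on (snd c' ` (UNIV \<inter> dom_chart c' \<inter> snd -` dom_chart d)) (snd d \<circ> snd \<circ> inv_chart c')"
    unfolding eq unfolding c(2) d prod_chart_restrict_image
    by (rule iffD2[OF smooth_on_cong[OF o] smooth_on_snd[OF o smooth_on_ident[OF o]]])
      (auto simp: inv_prod_chart'[OF atlas_chart[OF assms c(1)]])
qed (auto intro: continuous_on_snd continuous_on_id)

lemma differential_fst:
  assumes A: "smooth_atlas A" and c: "c \<in> A" "fst q \<in> dom_chart c" and \<xi>: "\<xi> \<in> tangent_space (prod_atlas A) q"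
  shows "differential (prod_atlas A) A fst q \<xi> c = fst (\<xi> (prod_chart c))"
proof -
  note ch = atlas_chart[OF A c(1)]
  have o: "open ((snd c ` fst c) \<times> (UNIV :: real set))"
    using chart_open_image[OF ch] by (simp add: open_Times)
  have "(fst has_derivative fst) (at (snd (prod_chart c) q))" by (auto intro!: derivative_eq_intros)
  then have "(rep (prod_chart c) c fst has_derivative fst) (at (snd (prod_chart c) q))"
    by (rule has_derivative_transform_within_open[OF _ o]) (use c in \<open>auto simp: chart_image_inv[OF ch] rep_fst[OF ch]\<close>)
  then have "frechet_derivative (rep (prod_chart c) c fst) (at (snd (prod_chart c) q)) = fst"
    by (rule frechet_derivative_at[symmetric])
  then show ?thesis
    using differential_chart[OF smooth_atlas_prod[OF A] A smooth_map_fst[OF A] open_UNIV UNIV_I \<xi> prod_chart_in_atlas[OF c(1)] _ c] c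
    by (auto simp: mem_Times_iff)
qed

lemma differential_snd:
  assumes A: "smooth_atlas A" and c: "c \<in> A" "fst q \<in> dom_chart c" and \<xi>: "\<xi> \<in> tangent_space (prod_atlas A) q"
  shows "differential (prod_atlas A) euclid_atlas snd q \<xi> euclid_chart = snd (\<xi> (prod_chart c))"
proof -
  note ch = atlas_chart[OF A c(1)]
  have o: "open ((snd c ` fst c) \<times> (UNIV :: real set))"
    using chart_open_image[OF ch] by (simp add: open_Times)
  have "(snd has_derivative snd) (at (snd (prod_chart c) q))" by (auto intro!: derivative_eq_intros)
  then have "(rep (prod_chart c) euclid_chart snd has_derivative snd) (at (snd (prod_chart c) q))"
    by (rule has_derivative_transform_within_open[OF _ o]) (use c in \<open>auto simp: rep_def inv_prod_chart'[OF ch]\<close>)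
  then have "frechet_derivative (rep (prod_chart c) euclid_chart snd) (at (snd (prod_chart c) q)) = snd"
    by (rule frechet_derivative_at[symmetric])
  then show ?thesis
    using differential_chart[OF smooth_atlas_prod[OF A] smooth_atlas_euclid smooth_map_snd[OF A] open_UNIV UNIV_I \<xi> prod_chart_in_atlas[OF c(1)]] c
    by (auto simp: mem_Times_iff)
qed

lemma metric_in_chart:
  assumes "smooth_atlas A" "c \<in> A" "p \<in> dom_chart c" "\<xi> \<in> tangent_space A p" "\<eta> \<in> tangent_space A p"
  shows "g p \<xi> \<eta> = metric_coord A g c (snd c p) (\<xi> c) (\<eta> c)"
  unfolding metric_coord_def using assms
  by (simp add: chart_inv[OF atlas_chart[OF assms(1,2)]] coord_vec_tangent_eq)

lemma prod_metric_in_chart: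
  assumes A: "smooth_atlas A" and c: "c \<in> A" "fst q \<in> dom_chart c"
    and \<xi>: "\<xi> \<in> tangent_space (prod_atlas A) q" and \<eta>: "\<eta> \<in> tangent_space (prod_atlas A) q"
  shows "prod_metric A g q \<xi> \<eta> =
    metric_coord A g c (snd c (fst q)) (fst (\<xi> (prod_chart c))) (fst (\<eta> (prod_chart c))) + snd (\<xi> (prod_chart c)) * snd (\<eta> (prod_chart c))"
  unfolding prod_metric_def Let_def
  using metric_in_chart[OF A c differential_tangent[OF smooth_atlas_prod[OF A] A smooth_map_fst[OF A] open_UNIV UNIV_I \<xi>]
      differential_tangent[OF smooth_atlas_prod[OF A] A smooth_map_fst[OF A] open_UNIV UNIV_I \<eta>], of g]
    differential_fst[OF A c \<xi>] differential_fst[OF A c \<eta>] differential_snd[OF A c \<xi>] differential_snd[OF A c \<eta>] by simp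

lemma smooth_map_vertical_line:
  assumes "smooth_atlas A"
  shows "smooth_map euclid_atlas (prod_atlas A) UNIV (\<lambda>s. (p, s + r))"
proof -
  obtain c where c: "c \<in> A" "p \<in> dom_chart c" using atlas_cover[OF assms] .
  have e: "inv_chart (prod_chart c) (snd c p, s) = (p, s)" for s
    using inv_prod_chart[OF atlas_chart[OF assms c(1)], of "(snd c p, s)"] c(2) chart_inv[OF atlas_chart[OF assms c(1)] c(2)]
    by (simp del: prod_chart_simps)
  show ?thesis
    by (rule smooth_map_in_chart[OF smooth_atlas_prod[OF assms] prod_chart_in_atlas[OF c(1)] open_UNIV, of "\<lambda>s. (snd c p, s + r)"])
      (use c in \<open>auto intro!: smooth_on_Pair smooth_on_add smooth_on_ident
        simp: e[unfolded prod_chart_simps(1)] image_iff\<close>)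
qed

lemma vertical_line_velocity:
  assumes "c \<in> A" "p \<in> dom_chart c"
  shows "velocity (prod_atlas A) (\<lambda>s. (p, s + r)) t (prod_chart c) = (0, 1)"
  by (rule velocity_eqI[OF _ prod_chart_in_atlas[OF assms(1)]])
    (use assms in \<open>auto intro!: derivative_eq_intros has_vector_derivative_Pair simp: o_def\<close>)

lemma vertical_tangent: "smooth_atlas A \<Longrightarrow> vertical A q \<in> tangent_space (prod_atlas A) q"
  using velocity_tangent[OF smooth_atlas_prod smooth_map_vertical_line[of A "fst q" 0], of "snd q"]
  by (simp add: vertical_def)

lemma vertical_in_chart: "c \<in> A \<Longrightarrow> fst q \<in> dom_chart c \<Longrightarrow> vertical A q (prod_chart c) = (0, 1)"
  using vertical_line_velocity[of c A "fst q" 0] by (simp add: vertical_def)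

section \<open>Vertical translations as isometries preserving the vertical field\<close>

definition vertical_translation :: "real \<Rightarrow> 'a \<times> real \<Rightarrow> 'a \<times> real" where
  "vertical_translation r q = (fst q, snd q + r)"

lemma smooth_map_vertical_translation:
  assumes "smooth_atlas A"
  shows "smooth_map (prod_atlas A) (prod_atlas A) UNIV (vertical_translation r)"
  unfolding smooth_map_def
proof (intro conjI ballI)
  show "continuous_on UNIV (vertical_translation r :: 'a \<times> real \<Rightarrow> 'a \<times> real)"
    unfolding vertical_translation_def by (intro continuous_intros)
  fix c' d' :: "('a \<times> real, 'b \<times> real) chart" assume "c' \<in> prod_atlas A" "d' \<in> prod_atlas A"
  then obtain c d where c: "c \<in> A" "c' = prod_chart c" and d: "d \<in> A" "d' = prod_chart d"
    by (auto elim!: prod_atlasE)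
  have o: "open ((snd c ` (fst c \<inter> fst d)) \<times> (UNIV :: real set))"
    using transition_smooth(1)[OF assms c(1) d(1)] by (simp add: open_Times)
  have eq: "UNIV \<inter> dom_chart c' \<inter> vertical_translation r -` dom_chart d' = (fst c \<inter> fst d) \<times> UNIV"
    using c d by (auto simp: vertical_translation_def)
  have "smooth_on ((snd c ` (fst c \<inter> fst d)) \<times> (UNIV :: real set)) (\<lambda>y. (snd d (inv_chart c (fst y)), snd y + r))"
    by (intro smooth_on_Pair o transition_smooth_prod[OF assms c(1) d(1)] smooth_on_add smooth_on_snd smooth_on_ident smooth_on_const)
  then show "smooth_on (snd c' ` (UNIV \<inter> dom_chart c' \<inter> vertical_translation r -` dom_chart d')) (snd d' \<circ> vertical_translation r \<circ> inv_chart c')"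
    unfolding eq unfolding c(2) d(2) prod_chart_restrict_image
    by (rule iffD2[OF smooth_on_cong[OF o], rotated])
      (auto simp: inv_prod_chart'[OF atlas_chart[OF assms c(1)]] vertical_translation_def)
qed

lemma vertical_translation_inverse [simp]:
  "vertical_translation (- r) (vertical_translation r q) = q"
  "vertical_translation r (vertical_translation (- r) q) = q"
  by (simp_all add: vertical_translation_def)

lemma bij_vertical_translation: "bij (vertical_translation r)"
  by (rule o_bij[of "vertical_translation (- r)"]) (auto simp: fun_eq_iff)

lemma inv_vertical_translation: "inv (vertical_translation r) = vertical_translation (- r)"
  by (rule inv_unique_comp) (auto simp: fun_eq_iff)

lemma differential_vertical_translation:
  assumes A: "smooth_atlas A" and c: "c \<in> A" "fst q \<in> dom_chart c" and \<xi>: "\<xi> \<in> tangent_space (prod_atlas A) q"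
  shows "differential (prod_atlas A) (prod_atlas A) (vertical_translation r) q \<xi> (prod_chart c) = \<xi> (prod_chart c)"
proof -
  note ch = atlas_chart[OF A c(1)]
  let ?T = "vertical_translation r"
  have o: "open ((snd c ` fst c) \<times> (UNIV :: real set))"
    using chart_open_image[OF ch] by (simp add: open_Times)
  have "((\<lambda>y. (fst y, snd y + r)) has_derivative (\<lambda>v. v)) (at (snd (prod_chart c) q))"
    by (auto intro!: derivative_eq_intros)
  then have "(rep (prod_chart c) (prod_chart c) ?T has_derivative (\<lambda>v. v)) (at (snd (prod_chart c) q))"
    by (rule has_derivative_transform_within_open[OF _ o])
      (use c in \<open>auto simp: rep_def vertical_translation_def inv_prod_chart'[OF ch] chart_image_inv[OF ch] chart_inv[OF ch]\<close>)
  then have "frechet_derivative (rep (prod_chart c) (prod_chart c) ?T) (at (snd (prod_chart c) q)) = (\<lambda>v. v)"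
    by (rule frechet_derivative_at[symmetric])
  then show ?thesis
    using differential_chart[OF smooth_atlas_prod[OF A] smooth_atlas_prod[OF A] smooth_map_vertical_translation[OF A] open_UNIV UNIV_I \<xi>
        prod_chart_in_atlas[OF c(1)] _ prod_chart_in_atlas[OF c(1)]] c
    by (auto simp: mem_Times_iff vertical_translation_def)
qed

lemma vertical_isometry_translation:
  fixes A :: "('a::topological_space, 'e::euclidean_space) chart set"
  assumes A: "smooth_atlas A"
  shows "vertical_isometry A g (vertical_translation r)"
proof -
  let ?T = "vertical_translation r :: 'a \<times> real \<Rightarrow> 'a \<times> real"
  note P = smooth_atlas_prod[OF A]
  have met: "prod_metric A g (?T q) (differential (prod_atlas A) (prod_atlas A) ?T q \<xi>) (differential (prod_atlas A) (prod_atlas A) ?T q \<eta>)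
      = prod_metric A g q \<xi> \<eta>" if \<xi>: "\<xi> \<in> tangent_space (prod_atlas A) q" and \<eta>: "\<eta> \<in> tangent_space (prod_atlas A) q" for q \<xi> \<eta>
  proof -
    obtain c where c: "c \<in> A" "fst q \<in> dom_chart c" using atlas_cover[OF A] .
    have c': "fst (?T q) \<in> dom_chart c" using c by (simp add: vertical_translation_def)
    note dt = differential_tangent[OF P P smooth_map_vertical_translation[OF A] open_UNIV UNIV_I]
    show ?thesis
      using prod_metric_in_chart[OF A c(1) c' dt[OF \<xi>] dt[OF \<eta>]] prod_metric_in_chart[OF A c \<xi> \<eta>]
        differential_vertical_translation[OF A c \<xi>] differential_vertical_translation[OF A c \<eta>]
      by (simp add: vertical_translation_def)
  qed
  have vert: "differential (prod_atlas A) (prod_atlas A) ?T q (vertical A q) = tscale 1 (vertical A (?T q))" for q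
  proof -
    obtain c where c: "c \<in> A" "fst q \<in> dom_chart c" using atlas_cover[OF A] .
    have c': "fst (?T q) \<in> dom_chart c" using c by (simp add: vertical_translation_def)
    show ?thesis
    proof (rule tangent_eqI[OF differential_tangent[OF P P smooth_map_vertical_translation[OF A] open_UNIV UNIV_I vertical_tangent[OF A]]
            tangent_space_tscale[OF P vertical_tangent[OF A]] prod_chart_in_atlas[OF c(1)]])
      show "differential (prod_atlas A) (prod_atlas A) ?T q (vertical A q) (prod_chart c) = tscale 1 (vertical A (?T q)) (prod_chart c)"
        using differential_vertical_translation[OF A c vertical_tangent[OF A]] vertical_in_chart[OF c] vertical_in_chart[OF c(1) c']
        by (simp add: tscale_def)
    qed (use c' in \<open>auto simp: mem_Times_iff\<close>)
  qed
  show ?thesis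
    unfolding vertical_isometry_def riemannian_isometry_def inv_vertical_translation
    using bij_vertical_translation smooth_map_vertical_translation[OF A] met vert by blast
qed

section \<open>Riemannian surfaces in coordinates\<close>

lemma bilinear_basis_expansion:
  fixes B :: "'d::euclidean_space \<Rightarrow> 'e::euclidean_space \<Rightarrow> 'f::real_vector"
  assumes "bilinear B"
  shows "B a b = (\<Sum>i\<in>Basis. \<Sum>j\<in>Basis. ((a \<bullet> i) * (b \<bullet> j)) *\<^sub>R B i j)"
proof -
  have "B a b = (\<Sum>i\<in>Basis. (a \<bullet> i) *\<^sub>R B i b)"
    using linear_basis_expansion[of "\<lambda>a. B a b" a] assms by (simp add: bilinear_def)
  also have "\<dots> = (\<Sum>i\<in>Basis. (a \<bullet> i) *\<^sub>R (\<Sum>j\<in>Basis. (b \<bullet> j) *\<^sub>R B i j))"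
    using linear_basis_expansion[of "B i" b for i] assms by (simp add: bilinear_def)
  finally show ?thesis by (simp add: scaleR_sum_right)
qed

lemma bilinear_basis_sum:
  fixes K :: "'d::euclidean_space \<Rightarrow> 'e::euclidean_space \<Rightarrow> 'f::real_vector"
  shows "bilinear (\<lambda>a b. \<Sum>i\<in>Basis. \<Sum>j\<in>Basis. ((a \<bullet> i) * (b \<bullet> j)) *\<^sub>R K i j)"
  unfolding bilinear_def
  by (intro conjI allI linearI)
    (simp_all only: inner_add_left inner_scaleR_left distrib_left distrib_right scaleR_add_left sum.distrib
      scaleR_sum_right scaleR_scaleR mult.assoc mult.left_commute)

text \<open>The product rule for a metric evaluated on moving vectors. Differentiability is known
  only for fixed arguments \<open>a\<close> and \<open>b\<close>; expanding over the bases leaves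
  finitely many such coefficients, and by the same expansion the derivative of the form is again
  bilinear.\<close>

lemma parametric_bilinear_has_derivative:
  fixes H :: "'x::euclidean_space \<Rightarrow> 'd::euclidean_space \<Rightarrow> 'e::euclidean_space \<Rightarrow> 'f::euclidean_space"
    and X :: "'z::euclidean_space \<Rightarrow> 'x"
  assumes S: "open S" and bil: "\<And>x. x \<in> S \<Longrightarrow> bilinear (H x)"
    and H': "\<And>a b. ((\<lambda>x. H x a b) has_derivative H' a b) (at (X z))"
    and X: "(X has_derivative X') (at z)" "X z \<in> S"
    and P: "(P has_derivative P') (at z)" and Q: "(Q has_derivative Q') (at z)"
  shows "((\<lambda>z. H (X z) (P z) (Q z)) has_derivative
    (\<lambda>h. H' (P z) (Q z) (X' h) + H (X z) (P' h) (Q z) + H (X z) (P z) (Q' h))) (at z)"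
    and "bilinear (\<lambda>a b. H' a b e)"
proof -
  have exp': "H' a b e = (\<Sum>i\<in>Basis. \<Sum>j\<in>Basis. ((a \<bullet> i) * (b \<bullet> j)) *\<^sub>R H' i j e)" for a b e
  proof -
    have "((\<lambda>x. \<Sum>i\<in>Basis. \<Sum>j\<in>Basis. ((a \<bullet> i) * (b \<bullet> j)) *\<^sub>R H x i j) has_derivative
        (\<lambda>e. \<Sum>i\<in>Basis. \<Sum>j\<in>Basis. ((a \<bullet> i) * (b \<bullet> j)) *\<^sub>R H' i j e)) (at (X z))"
      by (intro has_derivative_sum has_derivative_scaleR_right H')
    then have "((\<lambda>x. H x a b) has_derivative (\<lambda>e. \<Sum>i\<in>Basis. \<Sum>j\<in>Basis. ((a \<bullet> i) * (b \<bullet> j)) *\<^sub>R H' i j e)) (at (X z))"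
      by (rule has_derivative_transform_within_open[OF _ S X(2)]) (rule bilinear_basis_expansion[OF bil, symmetric])
    then show ?thesis using has_derivative_unique[OF H'] by (metis (no_types, lifting))
  qed
  show "bilinear (\<lambda>a b. H' a b e)"
    by (subst exp') (rule bilinear_basis_sum)
  have HX: "((\<lambda>z. H (X z) i j) has_derivative (\<lambda>h. H' i j (X' h))) (at z)" for i j
    using diff_chain_at[OF X(1) H'] by (simp add: o_def)
  have PQ: "((\<lambda>z. (P z \<bullet> i) * (Q z \<bullet> j)) has_derivative (\<lambda>h. (P z \<bullet> i) * (Q' h \<bullet> j) + (P' h \<bullet> i) * (Q z \<bullet> j))) (at z)" for i j
    by (intro has_derivative_mult has_derivative_inner_left P Q)
  have "((\<lambda>z. \<Sum>i\<in>Basis. \<Sum>j\<in>Basis. ((P z \<bullet> i) * (Q z \<bullet> j)) *\<^sub>R H (X z) i j) has_derivative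
    (\<lambda>h. \<Sum>i\<in>Basis. \<Sum>j\<in>Basis. ((P z \<bullet> i) * (Q z \<bullet> j)) *\<^sub>R H' i j (X' h) +
      ((P z \<bullet> i) * (Q' h \<bullet> j) + (P' h \<bullet> i) * (Q z \<bullet> j)) *\<^sub>R H (X z) i j)) (at z)" (is "(?F has_derivative ?F') _")
    by (intro has_derivative_sum has_derivative_scaleR PQ HX)
  moreover have "?F' = (\<lambda>h. H' (P z) (Q z) (X' h) + H (X z) (P' h) (Q z) + H (X z) (P z) (Q' h))"
  proof
    fix h
    show "?F' h = H' (P z) (Q z) (X' h) + H (X z) (P' h) (Q z) + H (X z) (P z) (Q' h)"
      unfolding exp'[of "P z" "Q z" "X' h"] bilinear_basis_expansion[OF bil[OF X(2)], of "P' h" "Q z"]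
        bilinear_basis_expansion[OF bil[OF X(2)], of "P z" "Q' h"]
      by (simp only: sum.distrib scaleR_add_left add_ac)
  qed
  ultimately have d: "(?F has_derivative (\<lambda>h. H' (P z) (Q z) (X' h) + H (X z) (P' h) (Q z) + H (X z) (P z) (Q' h))) (at z)"
    by simp
  have "continuous (at z) X" using X(1) by (rule has_derivative_continuous)
  moreover obtain e where e: "0 < e" "ball (X z) e \<subseteq> S" using S X(2) open_contains_ball by blast
  ultimately obtain d where "0 < d" "\<And>z'. dist z' z < d \<Longrightarrow> dist (X z') (X z) < e"
    unfolding continuous_at_eps_delta by blast
  then have V: "open (ball z d)" "z \<in> ball z d" "\<And>z'. z' \<in> ball z d \<Longrightarrow> X z' \<in> S"
    using e(2) by (auto simp: dist_commute subset_iff)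
  show "((\<lambda>z. H (X z) (P z) (Q z)) has_derivative
    (\<lambda>h. H' (P z) (Q z) (X' h) + H (X z) (P' h) (Q z) + H (X z) (P z) (Q' h))) (at z)"
    by (rule has_derivative_transform_within_open[OF d V(1,2)]) (rule bilinear_basis_expansion[OF bil[OF V(3)], symmetric])
qed

lemma has_vector_derivative_linear_image:
  "(f has_derivative f') (at (x t)) \<Longrightarrow> (x has_vector_derivative x') (at t) \<Longrightarrow>
   ((\<lambda>t. f (x t)) has_vector_derivative f' x') (at t)"
  unfolding has_vector_derivative_def
  using diff_chain_at[of x "\<lambda>h. h *\<^sub>R x'" t f f'] by (simp add: o_def linear_scale[OF has_derivative_linear])

abbreviation img :: "('a, 'e) chart \<Rightarrow> 'e set" where "img c \<equiv> snd c ` fst c"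

locale riemannian_surface =
  fixes A :: "('a::{t2_space, second_countable_topology}, real^2) chart set" and g :: "('a, real^2) metric"
  assumes M: "riemannian_manifold A g"
begin

lemma atlas: "smooth_atlas A" and metric: "riemannian_metric A g"
  using M by (auto simp: riemannian_manifold_def)

lemma chart: "c \<in> A \<Longrightarrow> is_chart c"
  using atlas atlas_chart by blast

lemma open_img: "c \<in> A \<Longrightarrow> open (img c)"
  using chart chart_open_image by blast

abbreviation G where "G \<equiv> metric_coord A g"

lemma metric_facts:
  assumes "\<xi> \<in> tangent_space A p" "\<eta> \<in> tangent_space A p" "\<zeta> \<in> tangent_space A p"
  shows "g p \<xi> \<eta> = g p \<eta> \<xi>" "g p (tadd \<xi> \<eta>) \<zeta> = g p \<xi> \<zeta> + g p \<eta> \<zeta>" "g p (tscale r \<xi>) \<eta> = r * g p \<xi> \<eta>"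
    "\<xi> \<noteq> tzero \<Longrightarrow> 0 < g p \<xi> \<xi>"
  using metric assms unfolding riemannian_metric_def by blast+

lemma G_facts:
  assumes c: "c \<in> A" "x \<in> img c"
  shows G_sym: "G c x a b = G c x b a"
    and G_add: "G c x (a + a') b = G c x a b + G c x a' b"
    and G_scale: "G c x (r *\<^sub>R a) b = r * G c x a b"
    and G_pos: "a \<noteq> 0 \<Longrightarrow> 0 < G c x a a"
proof -
  have p: "inv_chart c x \<in> fst c" using chart_inv_dom[OF chart] c by blast
  note cv = coord_vec_tangent[OF atlas c(1) p]
  show "G c x a b = G c x b a" unfolding metric_coord_def by (rule metric_facts(1)[OF cv cv cv])
  show "G c x (a + a') b = G c x a b + G c x a' b" unfolding metric_coord_def
    using metric_facts(2)[OF cv cv cv] tadd_coord_vec[OF atlas c(1) p] by metis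
  show "G c x (r *\<^sub>R a) b = r * G c x a b" unfolding metric_coord_def
    using metric_facts(3)[OF cv cv cv] tscale_coord_vec[OF atlas c(1) p] by metis
  show "0 < G c x a a" if "a \<noteq> 0" unfolding metric_coord_def
  proof (rule metric_facts(4)[OF cv cv cv])
    show "coord_vec A c (inv_chart c x) a \<noteq> tzero"
      using coord_vec_chart[OF chart[OF c(1)] c(1) p, of a] that by (auto simp: tzero_def)
  qed
qed

lemma G_bilinear:
  assumes c: "c \<in> A" "x \<in> img c"
  shows "bilinear (G c x)"
  unfolding bilinear_def
proof (intro conjI allI linearI)
  fix a b b' :: "real^2" and r :: real
  show "G c x a (b + b') = G c x a b + G c x a b'" "G c x a (r *\<^sub>R b) = r *\<^sub>R G c x a b"
    using G_add[OF c, of b b' a] G_scale[OF c, of r b a]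
    by (simp_all add: G_sym[OF c, of a b] G_sym[OF c, of a b'] G_sym[OF c, of a "b + b'"] G_sym[OF c, of a "r *\<^sub>R b"])
qed (simp_all add: G_add[OF c] G_scale[OF c])

lemma G_smooth: "c \<in> A \<Longrightarrow> smooth_on (img c) (\<lambda>x. G c x a b)"
  using metric unfolding riemannian_metric_def by blast

lemmas G_bil = bilinear_ladd[OF G_bilinear] bilinear_radd[OF G_bilinear] bilinear_lmul[OF G_bilinear]
  bilinear_rmul[OF G_bilinear] bilinear_lneg[OF G_bilinear] bilinear_rneg[OF G_bilinear]
  bilinear_lzero[OF G_bilinear] bilinear_rzero[OF G_bilinear] bilinear_lsub[OF G_bilinear] bilinear_rsub[OF G_bilinear]

lemma G_eqI: "c \<in> A \<Longrightarrow> x \<in> img c \<Longrightarrow> (\<And>e. G c x v e = G c x w e) \<Longrightarrow> v = w"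
  using G_pos[of c x "v - w"] G_bil(9)[of c x v w "v - w"] by fastforce

lemma metric_chart:
  "c \<in> A \<Longrightarrow> p \<in> fst c \<Longrightarrow> \<xi> \<in> tangent_space A p \<Longrightarrow> \<eta> \<in> tangent_space A p \<Longrightarrow> g p \<xi> \<eta> = G c (snd c p) (\<xi> c) (\<eta> c)"
  by (rule metric_in_chart[OF atlas])

text \<open>Both sides are the value of \<open>g\<close> on the same pair of tangent vectors at
  \<open>p\<close>.\<close>

lemma G_change:
  assumes "c \<in> A" "d \<in> A" "p \<in> fst c" "p \<in> fst d"
  defines "D \<equiv> frechet_derivative (rep c d id) (at (snd c p))"
  shows "G d (snd d p) (D a) (D b) = G c (snd c p) a b"
proof -
  note cv = coord_vec_tangent[OF atlas assms(1,3)]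
  have "coord_vec A c p a d = D a" for a using assms by (simp add: coord_vec_rep)
  moreover have "coord_vec A c p a c = a" for a by (rule coord_vec_chart[OF chart[OF assms(1)] assms(1,3)])
  ultimately show ?thesis
    using metric_chart[OF assms(1,3) cv cv, of a b] metric_chart[OF assms(2,4) cv cv, of a b] by simp
qed

definition DG :: "('a, real^2) chart \<Rightarrow> real^2 \<Rightarrow> real^2 \<Rightarrow> real^2 \<Rightarrow> real^2 \<Rightarrow> real" where
  "DG c x a b e = frechet_derivative (\<lambda>y. G c y a b) (at x) e"

lemma G_derivative: "c \<in> A \<Longrightarrow> x \<in> img c \<Longrightarrow> ((\<lambda>y. G c y a b) has_derivative DG c x a b) (at x)"
  using smooth_on_has_derivative[OF G_smooth] unfolding DG_def by blast

lemma DG_linear: "c \<in> A \<Longrightarrow> x \<in> img c \<Longrightarrow> linear (DG c x a b)"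
  using has_derivative_linear[OF G_derivative] .

lemma DG_bilinear: "c \<in> A \<Longrightarrow> x \<in> img c \<Longrightarrow> bilinear (\<lambda>a b. DG c x a b e)"
  by (rule parametric_bilinear_has_derivative(2)[where H = "G c" and S = "img c" and X = "\<lambda>x. x" and z = x and P = "\<lambda>x. x" and Q = "\<lambda>x. x"])
    (auto intro!: open_img G_bilinear G_derivative derivative_eq_intros)

lemma DG_algebra:
  assumes c: "c \<in> A" "x \<in> img c"
  shows "DG c x (a + a') b e = DG c x a b e + DG c x a' b e" "DG c x a (b + b') e = DG c x a b e + DG c x a b' e"
    "DG c x a b (e + e') = DG c x a b e + DG c x a b e'" "DG c x (r *\<^sub>R a) b e = r * DG c x a b e"
    "DG c x a (r *\<^sub>R b) e = r * DG c x a b e" "DG c x a b (r *\<^sub>R e) = r * DG c x a b e"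
  using bilinear_ladd[OF DG_bilinear[OF c]] bilinear_radd[OF DG_bilinear[OF c]] linear_add[OF DG_linear[OF c]]
    bilinear_lmul[OF DG_bilinear[OF c]] bilinear_rmul[OF DG_bilinear[OF c]] linear_scale[OF DG_linear[OF c]]
  by simp_all

lemma DG_sym: "c \<in> A \<Longrightarrow> x \<in> img c \<Longrightarrow> DG c x a b e = DG c x b a e"
proof -
  assume c: "c \<in> A" "x \<in> img c"
  have "((\<lambda>y. G c y b a) has_derivative DG c x a b) (at x)"
    by (rule has_derivative_transform_within_open[OF G_derivative[OF c] open_img[OF c(1)] c(2)]) (rule G_sym[OF c(1)])
  then show ?thesis using has_derivative_unique G_derivative[OF c] by metis
qed

lemma G_comp_derivative:
  fixes X :: "'z::euclidean_space \<Rightarrow> real^2"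
  assumes "c \<in> A" "(X has_derivative X') (at z)" "X z \<in> img c"
    "(P has_derivative P') (at z)" "(Q has_derivative Q') (at z)"
  shows "((\<lambda>z. G c (X z) (P z) (Q z)) has_derivative
    (\<lambda>h. DG c (X z) (P z) (Q z) (X' h) + G c (X z) (P' h) (Q z) + G c (X z) (P z) (Q' h))) (at z)"
  by (rule parametric_bilinear_has_derivative(1)[OF open_img[OF assms(1)] G_bilinear[OF assms(1)] G_derivative[OF assms(1,3)] assms(2-5)])

lemma G_comp_smooth:
  assumes "c \<in> A" "open T" "smooth_on T X" "X ` T \<subseteq> img c" "smooth_on T P" "smooth_on T Q"
  shows "smooth_on T (\<lambda>z. G c (X z) (P z) (Q z))"
proof -
  have 1: "smooth_on T (\<lambda>z. G c (X z) a b)" for a b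
    by (rule smooth_on_compose[OF assms(2) open_img[OF assms(1)] assms(4,3) G_smooth[OF assms(1)]])
  have bil: "bilinear (G c (X z))" if "z \<in> T" for z using G_bilinear assms that by blast
  have 2: "smooth_on T (\<lambda>z. G c (X z) (P z) b)" for b
    by (rule smooth_on_apply_linear[where L = "\<lambda>z a. G c (X z) a b", OF assms(2) 1 _ assms(5)])
      (use bil in \<open>simp add: bilinear_def\<close>)
  show ?thesis
    by (rule smooth_on_apply_linear[where L = "\<lambda>z b. G c (X z) (P z) b", OF assms(2) 2 _ assms(6)])
      (use bil in \<open>simp add: bilinear_def\<close>)
qed

lemma DG_comp_smooth:
  assumes "c \<in> A" "open T" "smooth_on T X" "X ` T \<subseteq> img c" "smooth_on T P" "smooth_on T Q" "smooth_on T V"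
  shows "smooth_on T (\<lambda>z. DG c (X z) (P z) (Q z) (V z))"
proof -
  have 0: "smooth_on T (\<lambda>z. DG c (X z) a b e)" for a b e
    unfolding DG_def
    by (rule smooth_on_compose[OF assms(2) open_img[OF assms(1)] assms(4,3) smooth_on_frechet[OF G_smooth[OF assms(1)]]])
  have Xz: "X z \<in> img c" if "z \<in> T" for z using assms that by blast
  have 1: "smooth_on T (\<lambda>z. DG c (X z) a b (V z))" for a b
    by (rule smooth_on_apply_linear[where L = "\<lambda>z e. DG c (X z) a b e", OF assms(2) 0 _ assms(7)])
      (use DG_linear[OF assms(1) Xz] in simp)
  have 2: "smooth_on T (\<lambda>z. DG c (X z) (P z) b (V z))" for b
    by (rule smooth_on_apply_linear[where L = "\<lambda>z a. DG c (X z) a b (V z)", OF assms(2) 1 _ assms(5)])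
      (use DG_bilinear[OF assms(1) Xz] in \<open>simp add: bilinear_def\<close>)
  show ?thesis
    by (rule smooth_on_apply_linear[where L = "\<lambda>z b. DG c (X z) (P z) b (V z)", OF assms(2) 2 _ assms(6)])
      (use DG_bilinear[OF assms(1) Xz] in \<open>simp add: bilinear_def\<close>)
qed

subsection \<open>Raising indices and the Levi-Civita connection\<close>

definition G_det :: "('a, real^2) chart \<Rightarrow> real^2 \<Rightarrow> real" where
  "G_det c x = G c x (axis 1 1) (axis 1 1) * G c x (axis 2 1) (axis 2 1) - (G c x (axis 1 1) (axis 2 1))\<^sup>2"

text \<open>The inverse Gram matrix applied to the covector \<open>l\<close>. Written out as
  quotients, it is visibly smooth wherever the metric coefficients are.\<close>

definition sharp :: "('a, real^2) chart \<Rightarrow> real^2 \<Rightarrow> (real^2 \<Rightarrow> real) \<Rightarrow> real^2" where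
  "sharp c x l =
     ((G c x (axis 2 1) (axis 2 1) * l (axis 1 1) - G c x (axis 1 1) (axis 2 1) * l (axis 2 1)) / G_det c x) *\<^sub>R axis 1 1 +
     ((G c x (axis 1 1) (axis 1 1) * l (axis 2 1) - G c x (axis 1 1) (axis 2 1) * l (axis 1 1)) / G_det c x) *\<^sub>R axis 2 1"

lemma plane_expansion: "(v :: real^2) = (v $ 1) *\<^sub>R axis 1 1 + (v $ 2) *\<^sub>R axis 2 1"
  by (simp add: vec_eq_iff forall_2 axis_def)

text \<open>The Gram-Schmidt vector \<open>v\<close> orthogonal to the first basis vector has
  squared length equal to the determinant times the squared length of that basis vector.\<close>

lemma G_det_pos:
  assumes c: "c \<in> A" "x \<in> img c"
  shows "0 < G_det c x"
proof -
  let ?e = "axis 1 1 :: real^2" and ?f = "axis 2 1 :: real^2"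
  define v where "v = G c x ?e ?e *\<^sub>R ?f - G c x ?e ?f *\<^sub>R ?e"
  have e: "0 < G c x ?e ?e" by (rule G_pos[OF c]) (simp add: axis_eq_0_iff)
  have "v $ 2 = G c x ?e ?e" by (simp add: v_def axis_def)
  then have "v \<noteq> 0" using e by auto
  then have "0 < G c x v v" by (rule G_pos[OF c])
  also have "G c x v v = G c x ?e ?e * G_det c x"
    unfolding v_def G_det_def using G_sym[OF c, of ?f ?e]
    by (simp add: G_bil[OF c] power2_eq_square algebra_simps)
  finally show ?thesis using e by (simp add: zero_less_mult_iff)
qed

lemma G_sharp:
  assumes c: "c \<in> A" "x \<in> img c" and l: "linear l"
  shows "G c x (sharp c x l) e = l e"
proof -
  let ?e = "axis 1 1 :: real^2" and ?f = "axis 2 1 :: real^2"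
  have d: "G_det c x \<noteq> 0" using G_det_pos[OF c] by simp
  have 1: "G c x (sharp c x l) ?e = l ?e"
  proof -
    have "G_det c x * G c x (sharp c x l) ?e = G_det c x * l ?e"
      unfolding sharp_def using d G_sym[OF c, of ?f ?e]
      by (simp add: G_bil[OF c] distrib_left) (simp add: G_det_def power2_eq_square algebra_simps)
    then show ?thesis using d by simp
  qed
  have 2: "G c x (sharp c x l) ?f = l ?f"
  proof -
    have "G_det c x * G c x (sharp c x l) ?f = G_det c x * l ?f"
      unfolding sharp_def using d G_sym[OF c, of ?f ?e]
      by (simp add: G_bil[OF c] distrib_left) (simp add: G_det_def power2_eq_square algebra_simps)
    then show ?thesis using d by simp
  qed
  show ?thesis
    by (subst (1 2) plane_expansion[of e]) (simp only: G_bil[OF c] 1 2 linear_add[OF l] linear_scale[OF l] real_scaleR_def)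
qed

lemma sharp_unique:
  assumes c: "c \<in> A" "x \<in> img c" and l: "linear l" and w: "\<And>e. G c x w e = l e"
  shows "w = sharp c x l"
  by (rule G_eqI[OF c]) (simp add: w G_sharp[OF c l])

lemma sharp_smooth:
  assumes c: "c \<in> A" and T: "open T" and X: "smooth_on T X" "X ` T \<subseteq> img c" and l: "\<And>e. smooth_on T (\<lambda>z. l z e)"
  shows "smooth_on T (\<lambda>z. sharp c (X z) (l z))"
proof -
  have G: "smooth_on T (\<lambda>z. G c (X z) a b)" for a b
    by (rule G_comp_smooth[OF c T X]) simp_all
  have d: "smooth_on T (\<lambda>z. G_det c (X z))"
    unfolding G_det_def power2_eq_square by (intro smooth_on_diff smooth_on_mult T G)
  show ?thesis unfolding sharp_def
    by (intro smooth_on_add smooth_on_scaleR smooth_on_divide smooth_on_diff smooth_on_mult T G d l smooth_on_const)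
      (use G_det_pos[OF c] X(2) in \<open>fastforce\<close>)+
qed

definition koszul :: "('a, real^2) chart \<Rightarrow> real^2 \<Rightarrow> real^2 \<Rightarrow> real^2 \<Rightarrow> real^2 \<Rightarrow> real" where
  "koszul c x a b e = (DG c x b e a + DG c x a e b - DG c x a b e) / 2"

lemma koszul_linear: "c \<in> A \<Longrightarrow> x \<in> img c \<Longrightarrow> linear (koszul c x a b)"
  unfolding koszul_def
  by (intro linearI) (simp_all add: DG_algebra add_divide_distrib diff_divide_distrib algebra_simps)

text \<open>Raising the index of the Koszul covector produces a vector satisfying the description in
  \<open>christoffel\<close>, and nondegeneracy of the metric makes it the only one.\<close>

lemma christoffel_sharp:
  assumes c: "c \<in> A" "x \<in> img c"
  shows "christoffel A g c x a b = sharp c x (koszul c x a b)"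
  unfolding christoffel_def
  by (rule the_equality)
    (use G_sharp[OF c koszul_linear[OF c]] sharp_unique[OF c koszul_linear[OF c]] in \<open>auto simp: koszul_def DG_def\<close>)

lemma G_christoffel:
  assumes c: "c \<in> A" "x \<in> img c"
  shows "G c x (christoffel A g c x a b) e = koszul c x a b e"
  by (simp add: christoffel_sharp[OF c] G_sharp[OF c koszul_linear[OF c]])

text \<open>The Euler-Lagrange form of the geodesic equation: tested against \<open>e\<close>, it
  involves only the metric and its first derivatives. All later computations with Christoffel
  symbols of a single velocity go through pairings of this kind.\<close>

lemma acceleration_identity:
  assumes c: "c \<in> A" "x \<in> img c"
  shows "G c x (w + christoffel A g c x y y) e = G c x w e + DG c x y e y - DG c x y y e / 2"
  by (simp add: G_bil[OF c] G_christoffel[OF c] koszul_def diff_divide_distrib)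

lemma christoffel_scale:
  assumes c: "c \<in> A" "x \<in> img c"
  shows "christoffel A g c x (r *\<^sub>R y) (r *\<^sub>R y) = r\<^sup>2 *\<^sub>R christoffel A g c x y y"
proof (rule G_eqI[OF c])
  show "G c x (christoffel A g c x (r *\<^sub>R y) (r *\<^sub>R y)) e = G c x (r\<^sup>2 *\<^sub>R christoffel A g c x y y) e" for e
    by (simp add: G_bil[OF c] G_christoffel[OF c] koszul_def DG_algebra[OF c] power2_eq_square algebra_simps)
qed

text \<open>The geodesic spray in coordinates: the second order equation as a first order system for
  position and velocity.\<close>

definition geo_field :: "('a, real^2) chart \<Rightarrow> (real^2) \<times> (real^2) \<Rightarrow> (real^2) \<times> (real^2)" where
  "geo_field c z = (snd z, - christoffel A g c (fst z) (snd z) (snd z))"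

lemma geo_field_smooth:
  assumes c: "c \<in> A"
  shows "smooth_on (img c \<times> UNIV) (geo_field c)"
proof -
  let ?T = "img c \<times> (UNIV :: (real^2) set)"
  have T: "open ?T" using open_img[OF c] by (simp add: open_Times)
  have f: "smooth_on ?T fst" and s: "smooth_on ?T snd"
    using smooth_on_fst[OF T smooth_on_ident[OF T]] smooth_on_snd[OF T smooth_on_ident[OF T]] by simp_all
  have k: "smooth_on ?T (\<lambda>z. koszul c (fst z) (snd z) (snd z) e)" for e
    unfolding koszul_def
    by (intro smooth_on_divide smooth_on_diff smooth_on_add T DG_comp_smooth[OF c T f] s smooth_on_const) auto
  have "smooth_on ?T (\<lambda>z. sharp c (fst z) (koszul c (fst z) (snd z) (snd z)))"
    by (rule sharp_smooth[OF c T f _ k]) auto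
  then have "smooth_on ?T (\<lambda>z. (snd z, - sharp c (fst z) (koszul c (fst z) (snd z) (snd z))))"
    by (intro smooth_on_Pair smooth_on_minus T s)
  then show ?thesis
    by (rule iffD2[OF smooth_on_cong[OF T], rotated]) (auto simp: geo_field_def christoffel_sharp[OF c])
qed

subsection \<open>Geodesics\<close>

lemma rep_inverse_derivative:
  assumes "c \<in> A" "d \<in> A" "p \<in> fst c" "p \<in> fst d"
  shows "frechet_derivative (rep c d id) (at (snd c p)) (frechet_derivative (rep d c id) (at (snd d p)) v) = v"
proof -
  have "(rep d d id has_derivative (\<lambda>v. frechet_derivative (rep c d id) (at (snd c p)) (frechet_derivative (rep d c id) (at (snd d p)) v))) (at (snd d p))"
    by (rule rep_transition_has_derivative[OF chart[OF assms(2)] chart[OF assms(1)] assms(4,3)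
          transition_has_derivative[OF atlas assms(2,1,4,3)] transition_has_derivative[OF atlas assms]])
  then show ?thesis
    using frechet_derivative_at transition_self[OF chart[OF assms(2)] assms(4)] by metis
qed

text \<open>Both sides are tested against \<open>D e\<close>; the second derivatives of the transition map cancel
  because they are symmetric.\<close>

lemma acceleration_change:
  assumes c: "c \<in> A" and d: "d \<in> A" and p: "p \<in> fst c" "p \<in> fst d"
    and zero: "w + christoffel A g c (snd c p) y y = 0"
  defines "D \<equiv> \<lambda>x. frechet_derivative (rep c d id) (at x)"
  shows "(frechet_derivative (\<lambda>x. D x y) (at (snd c p)) y + D (snd c p) w)
    + christoffel A g d (snd d p) (D (snd c p) y) (D (snd c p) y) = 0"
proof -
  let ?x = "snd c p"
  let ?P = "snd c ` (fst c \<inter> fst d)"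
  define D2 where "D2 a v = frechet_derivative (\<lambda>x. D x a) (at ?x) v" for a v
  have o: "open ?P" and sm: "smooth_on ?P (rep c d id)"
    using transition_smooth[OF atlas c d] by (simp_all add: rep_def o_def)
  have xP: "?x \<in> ?P" using p by auto
  have xi: "?x \<in> img c" "snd d p \<in> img d" using p by auto
  have rep_x: "rep c d id ?x = snd d p" using rep_at[OF chart[OF c] p(1), of d id] by simp
  have sym: "D2 a v = D2 v a" for a v
    unfolding D2_def D_def by (rule frechet_derivative_symmetric[OF o sm xP])
  have lD: "linear (D ?x)" unfolding D_def by (rule has_derivative_linear[OF smooth_on_has_derivative[OF sm xP]])
  have repd: "(rep c d id has_derivative D ?x) (at ?x)" unfolding D_def by (rule smooth_on_has_derivative[OF sm xP])
  have Dd: "((\<lambda>x. D x a) has_derivative D2 a) (at ?x)" for a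
    unfolding D2_def[abs_def] D_def by (rule smooth_on_has_derivative[OF smooth_on_frechet[OF sm] xP])
  \<comment> \<open>The transformation law of the metric, differentiated in the direction
    \<open>v\<close>.\<close>
  have id: "DG d (snd d p) (D ?x a) (D ?x b) (D ?x v) + G d (snd d p) (D2 a v) (D ?x b) + G d (snd d p) (D ?x a) (D2 b v)
      = DG c ?x a b v" for a b v
  proof -
    have "((\<lambda>x. G d (rep c d id x) (D x a) (D x b)) has_derivative
      (\<lambda>h. DG d (rep c d id ?x) (D ?x a) (D ?x b) (D ?x h) + G d (rep c d id ?x) (D2 a h) (D ?x b) + G d (rep c d id ?x) (D ?x a) (D2 b h))) (at ?x)"
      by (rule G_comp_derivative[OF d repd _ Dd Dd]) (simp add: rep_x xi)
    then have "((\<lambda>x. G c x a b) has_derivative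
      (\<lambda>h. DG d (rep c d id ?x) (D ?x a) (D ?x b) (D ?x h) + G d (rep c d id ?x) (D2 a h) (D ?x b) + G d (rep c d id ?x) (D ?x a) (D2 b h))) (at ?x)"
    proof (rule has_derivative_transform_within_open[OF _ o xP])
      fix x assume "x \<in> ?P"
      then obtain q where q: "q \<in> fst c" "q \<in> fst d" "x = snd c q" by auto
      show "G d (rep c d id x) (D x a) (D x b) = G c x a b"
        using G_change[OF c d q(1,2)] rep_at[OF chart[OF c] q(1), of d id] by (simp add: q(3) D_def)
    qed
    from fun_cong[OF has_derivative_unique[OF this G_derivative[OF c xi(1)]], of v]
    show ?thesis by (simp add: rep_x)
  qed
  show ?thesis
  proof (rule G_eqI[OF d xi(2)])
    fix E
    define e where "e = frechet_derivative (rep d c id) (at (snd d p)) E"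
    have E: "D ?x e = E" unfolding D_def e_def by (rule rep_inverse_derivative[OF c d p])
    let ?y = "D ?x y"
    have "G d (snd d p) ((D2 y y + D ?x w) + christoffel A g d (snd d p) ?y ?y) E
        = G d (snd d p) (D2 y y) E + G d (snd d p) (D ?x w) E + DG d (snd d p) ?y E ?y - DG d (snd d p) ?y ?y E / 2"
      unfolding acceleration_identity[OF d xi(2), of "D2 y y + D ?x w"] unfolding G_bil(1)[OF d xi(2)] ..
    also have "\<dots> = G c ?x w e + DG c ?x y e y - DG c ?x y y e / 2"
    proof -
      have 1: "DG d (snd d p) ?y E ?y + G d (snd d p) (D2 y y) E + G d (snd d p) ?y (D2 y e) = DG c ?x y e y"
        using id[of y e y] unfolding E sym[of e y] .
      have 2: "DG d (snd d p) ?y ?y E + G d (snd d p) ?y (D2 y e) + G d (snd d p) ?y (D2 y e) = DG c ?x y y e"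
        using id[of y y e] unfolding E G_sym[OF d xi(2), of "D2 y e" ?y] .
      have 3: "G d (snd d p) (D ?x w) E = G c ?x w e"
        using G_change[OF c d p, of w e] E by (simp add: D_def)
      show ?thesis using 1 2 3 by argo
    qed
    also have "\<dots> = G c ?x (w + christoffel A g c ?x y y) e" by (rule acceleration_identity[OF c xi(1), symmetric])
    also have "\<dots> = 0" by (simp add: zero G_bil[OF c xi(1)])
    finally show "G d (snd d p) (frechet_derivative (\<lambda>x. D x y) (at ?x) y + D ?x w + christoffel A g d (snd d p) ?y ?y) E = G d (snd d p) 0 E"
      by (simp add: D2_def G_bil[OF d xi(2)])
  qed
qed

lemma covariant_acceleration_eq:
  assumes T: "open T" "t \<in> T" and x: "\<And>s. s \<in> T \<Longrightarrow> ((snd c \<circ> \<gamma>) has_vector_derivative y s) (at s)"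
    and y: "(y has_vector_derivative w) (at t)"
  shows "covariant_acceleration A g c \<gamma> t = w + christoffel A g c (snd c (\<gamma> t)) (y t) (y t)"
proof -
  have e: "vector_derivative (snd c \<circ> \<gamma>) (at s) = y s" if "s \<in> T" for s by (rule vector_derivative_at[OF x[OF that]])
  have "((\<lambda>s. vector_derivative (snd c \<circ> \<gamma>) (at s)) has_vector_derivative w) (at t)"
    by (rule has_vector_derivative_transform_within_open[OF y T]) (simp add: e)
  then show ?thesis
    unfolding covariant_acceleration_def Let_def using e[OF T(2)] by (simp add: vector_derivative_at)
qed

text \<open>Solving the equation in one chart suffices: in any other chart the velocity is the image
  under the transition derivative, and \<open>acceleration_change\<close> shows that vanishing
  acceleration is preserved.\<close>

lemma geodesic_in_chart:
  assumes c: "c \<in> A" and T: "open T" and x: "smooth_on T x" "x ` T \<subseteq> img c"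
    and z: "\<And>t. t \<in> T \<Longrightarrow> ((\<lambda>s. (x s, y s)) has_vector_derivative geo_field c (x t, y t)) (at t)"
    and \<gamma>: "\<And>t. t \<in> T \<Longrightarrow> \<gamma> t = inv_chart c (x t)"
  shows "geodesic_on A g T \<gamma>" "\<And>t. t \<in> T \<Longrightarrow> velocity A \<gamma> t = coord_vec A c (\<gamma> t) (y t)"
proof -
  note ch = chart[OF c]
  have xd: "(x has_vector_derivative y t) (at t)" if "t \<in> T" for t
    using has_vector_derivative_linear_image[OF bounded_linear_imp_has_derivative[OF bounded_linear_fst] z[OF that]]
    by (simp add: geo_field_def)
  have yd: "(y has_vector_derivative - christoffel A g c (x t) (y t) (y t)) (at t)" if "t \<in> T" for t
    using has_vector_derivative_linear_image[OF bounded_linear_imp_has_derivative[OF bounded_linear_snd] z[OF that]]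
    by (simp add: geo_field_def)
  have sm: "smooth_map euclid_atlas A T \<gamma>" by (rule smooth_map_in_chart[OF atlas c T x \<gamma>])
  have xi: "x t \<in> img c" if "t \<in> T" for t using x that by blast
  have \<gamma>c: "\<gamma> t \<in> fst c" "snd c (\<gamma> t) = x t" if "t \<in> T" for t
    using \<gamma>[OF that] chart_inv_dom[OF ch xi[OF that]] chart_image_inv[OF ch xi[OF that]] by simp_all
  show "velocity A \<gamma> t = coord_vec A c (\<gamma> t) (y t)" if t: "t \<in> T" for t
  proof (rule tangent_eqI[OF velocity_tangent[OF atlas sm T t] coord_vec_tangent[OF atlas c \<gamma>c(1)[OF t]] c \<gamma>c(1)[OF t]])
    have "((snd c \<circ> \<gamma>) has_vector_derivative y t) (at t)"
      by (rule has_vector_derivative_transform_within_open[OF xd[OF t] T t]) (simp add: \<gamma>c)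
    then show "velocity A \<gamma> t c = coord_vec A c (\<gamma> t) (y t) c"
      using velocity_eqI[where \<gamma> = \<gamma> and t = t, OF _ c \<gamma>c(1)[OF t]] coord_vec_chart[OF ch c \<gamma>c(1)[OF t]] by simp
  qed
  have "covariant_acceleration A g d \<gamma> t = 0" if t: "t \<in> T" and d: "d \<in> A" "\<gamma> t \<in> fst d" for t d
  proof -
    let ?D = "\<lambda>x. frechet_derivative (rep c d id) (at x)"
    let ?P = "snd c ` (fst c \<inter> fst d)"
    have o: "open ?P" and smr: "smooth_on ?P (rep c d id)"
      using transition_smooth[OF atlas c d(1)] by (simp_all add: rep_def o_def)
    have T': "open (T \<inter> \<gamma> -` fst d)"
      by (rule open_domain_restrict[OF T smooth_map_continuous[OF sm] chart_open_dom[OF chart[OF d(1)]]])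
    have xP: "x s \<in> ?P" if "s \<in> T \<inter> \<gamma> -` fst d" for s
      using \<gamma>c[of s] that by (intro image_eqI[of _ _ "\<gamma> s"]) auto
    have 1: "((snd d \<circ> \<gamma>) has_vector_derivative ?D (x s) (y s)) (at s)" if s: "s \<in> T \<inter> \<gamma> -` fst d" for s
    proof (rule has_vector_derivative_transform_within_open[OF _ T' s])
      show "((\<lambda>s. rep c d id (x s)) has_vector_derivative ?D (x s) (y s)) (at s)"
        using has_vector_derivative_linear_image[OF smooth_on_has_derivative[OF smr xP[OF s]] xd] s by blast
      show "rep c d id (x r) = (snd d \<circ> \<gamma>) r" if "r \<in> T \<inter> \<gamma> -` fst d" for r
        using that \<gamma> by (simp add: rep_def)
    qed
    have t': "t \<in> T \<inter> \<gamma> -` fst d" using t d by simp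
    have 2: "((\<lambda>s. ?D (x s) (y s)) has_vector_derivative
        frechet_derivative (\<lambda>x. ?D x (y t)) (at (x t)) (y t) + ?D (x t) (- christoffel A g c (x t) (y t) (y t))) (at t)"
    proof -
      have bil: "linear (?D (x t))" by (rule has_derivative_linear[OF smooth_on_has_derivative[OF smr xP[OF t']]])
      have ei: "?D (x s) (y s) = (\<Sum>i\<in>Basis. (y s \<bullet> i) *\<^sub>R ?D (x s) i)" if "s \<in> T \<inter> \<gamma> -` fst d" for s
        by (rule linear_basis_expansion[OF has_derivative_linear[OF smooth_on_has_derivative[OF smr xP[OF that]]]])
      have D2: "((\<lambda>s. ?D (x s) i) has_vector_derivative frechet_derivative (\<lambda>x. ?D x i) (at (x t)) (y t)) (at t)" for i
        using has_vector_derivative_linear_image[OF smooth_on_has_derivative[OF smooth_on_frechet[OF smr] xP[OF t']] xd[OF t]] .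
      have yi: "((\<lambda>s. y s \<bullet> i) has_real_derivative (- christoffel A g c (x t) (y t) (y t)) \<bullet> i) (at t)" for i
        using has_vector_derivative_linear_image[OF bounded_linear_imp_has_derivative[OF bounded_linear_inner_left] yd[OF t]]
        by (simp add: has_real_derivative_iff_has_vector_derivative)
      have "((\<lambda>s. \<Sum>i\<in>Basis. (y s \<bullet> i) *\<^sub>R ?D (x s) i) has_vector_derivative
        (\<Sum>i\<in>Basis. (y t \<bullet> i) *\<^sub>R frechet_derivative (\<lambda>x. ?D x i) (at (x t)) (y t) + ((- christoffel A g c (x t) (y t) (y t)) \<bullet> i) *\<^sub>R ?D (x t) i)) (at t)"
        by (intro has_vector_derivative_sum has_vector_derivative_scaleR yi D2)
      moreover have "(\<Sum>i\<in>Basis. ((- christoffel A g c (x t) (y t) (y t)) \<bullet> i) *\<^sub>R ?D (x t) i) = ?D (x t) (- christoffel A g c (x t) (y t) (y t))"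
        by (rule linear_basis_expansion[OF bil, symmetric])
      moreover have "(\<Sum>i\<in>Basis. (y t \<bullet> i) *\<^sub>R frechet_derivative (\<lambda>x. ?D x i) (at (x t)) (y t)) = frechet_derivative (\<lambda>x. ?D x (y t)) (at (x t)) (y t)"
      proof -
        have "((\<lambda>x. \<Sum>i\<in>Basis. (y t \<bullet> i) *\<^sub>R ?D x i) has_derivative (\<lambda>h. \<Sum>i\<in>Basis. (y t \<bullet> i) *\<^sub>R frechet_derivative (\<lambda>x. ?D x i) (at (x t)) h)) (at (x t))"
          by (intro has_derivative_sum has_derivative_scaleR_right smooth_on_has_derivative[OF smooth_on_frechet[OF smr] xP[OF t']])
        then have "((\<lambda>x. ?D x (y t)) has_derivative (\<lambda>h. \<Sum>i\<in>Basis. (y t \<bullet> i) *\<^sub>R frechet_derivative (\<lambda>x. ?D x i) (at (x t)) h)) (at (x t))"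
          by (rule has_derivative_transform_within_open[OF _ o xP[OF t']])
            (rule linear_basis_expansion[OF has_derivative_linear[OF smooth_on_has_derivative[OF smr]], symmetric])
        from fun_cong[OF frechet_derivative_at[OF this], of "y t"] show ?thesis .
      qed
      ultimately have "((\<lambda>s. \<Sum>i\<in>Basis. (y s \<bullet> i) *\<^sub>R ?D (x s) i) has_vector_derivative
        frechet_derivative (\<lambda>x. ?D x (y t)) (at (x t)) (y t) + ?D (x t) (- christoffel A g c (x t) (y t) (y t))) (at t)"
        by (simp only: sum.distrib)
      then show ?thesis
        by (rule has_vector_derivative_transform_within_open[OF _ T' t']) (rule ei[symmetric])
    qed
    have z0: "- christoffel A g c (snd c (\<gamma> t)) (y t) (y t) + christoffel A g c (snd c (\<gamma> t)) (y t) (y t) = 0" by simp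
    show ?thesis
      using covariant_acceleration_eq[OF T' t' 1 2] acceleration_change[OF c d(1) \<gamma>c(1)[OF t] d(2) z0] \<gamma>c(2)[OF t]
      by simp
  qed
  then show "geodesic_on A g T \<gamma>" using sm by (simp add: geodesic_on_def)
qed

text \<open>Vanishing of \<open>covariant_acceleration\<close> is stated with
  \<open>vector_derivative\<close>, which has a value even where no derivative exists. Smoothness of
  \<gamma> supplies the derivative of the velocity, and then the equation becomes the first order
  system.\<close>

lemma geodesic_on_chart:
  assumes \<gamma>: "geodesic_on A g S \<gamma>" "open S" and c: "c \<in> A" and t: "t \<in> S" "\<gamma> t \<in> fst c"
  shows "((\<lambda>s. (snd c (\<gamma> s), velocity A \<gamma> s c)) has_vector_derivative geo_field c (snd c (\<gamma> t), velocity A \<gamma> t c)) (at t)"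
proof -
  have sm: "smooth_map euclid_atlas A S \<gamma>" using \<gamma> by (simp add: geodesic_on_def)
  define T where "T = S \<inter> \<gamma> -` fst c"
  have T: "open T" "t \<in> T" unfolding T_def
    using open_domain_restrict[OF \<gamma>(2) smooth_map_continuous[OF sm] chart_open_dom[OF chart[OF c]]] t by auto
  have smT: "smooth_on T (snd c \<circ> \<gamma>)" unfolding T_def by (rule smooth_map_euclidD[OF sm c])
  have x: "((snd c \<circ> \<gamma>) has_vector_derivative velocity A \<gamma> s c) (at s)" if "s \<in> T" for s
    by (rule curve_has_vector_derivative[OF sm _ c]) (use that in \<open>auto simp: T_def\<close>)
  have v: "velocity A \<gamma> s c = frechet_derivative (snd c \<circ> \<gamma>) (at s) 1" if "s \<in> T" for s
    using frechet_derivative_at[OF x[OF that, unfolded has_vector_derivative_def]] by (metis scaleR_one)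
  have "smooth_on T (\<lambda>s. velocity A \<gamma> s c)"
    by (rule iffD2[OF smooth_on_cong[OF T(1) v] smooth_on_frechet[OF smT]])
  then have "(\<lambda>s. velocity A \<gamma> s c) differentiable (at t)"
    using smooth_on_has_derivative[OF _ T(2)] differentiableI by blast
  then obtain w where w: "((\<lambda>s. velocity A \<gamma> s c) has_vector_derivative w) (at t)"
    using vector_derivative_works by blast
  have "w = - christoffel A g c (snd c (\<gamma> t)) (velocity A \<gamma> t c) (velocity A \<gamma> t c)"
    using covariant_acceleration_eq[OF T x w] \<gamma> t c unfolding geodesic_on_def by (simp add: eq_neg_iff_add_eq_0)
  then show ?thesis
    using has_vector_derivative_Pair[OF x[OF T(2)] w] by (simp add: geo_field_def o_def)
qed

end

section \<open>Uniqueness, reparametrization and speed of geodesics\<close>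

context riemannian_surface
begin

lemma geodesic_smooth: "geodesic_on A g S \<gamma> \<Longrightarrow> smooth_map euclid_atlas A S \<gamma>"
  by (simp add: geodesic_on_def)

lemma geodesic_on_subset: "geodesic_on A g S \<gamma> \<Longrightarrow> T \<subseteq> S \<Longrightarrow> geodesic_on A g T \<gamma>"
  unfolding geodesic_on_def using smooth_map_subset by blast

text \<open>The set \<open>E\<close> of times at which positions and velocities agree is open by
  uniqueness for the system in a chart. Its complement is open too: if the positions differ, by the
  Hausdorff property; if only the velocities differ, by continuity of the coordinates in a common
  chart. Connectedness of \<open>S\<close> finishes the argument.\<close>

lemma geodesic_unique:
  assumes \<gamma>: "geodesic_on A g S \<gamma>" and \<delta>: "geodesic_on A g S \<delta>" and S: "open S" "connected S"
    and a: "a \<in> S" "\<gamma> a = \<delta> a" "velocity A \<gamma> a = velocity A \<delta> a" and t: "t \<in> S"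
  shows "\<gamma> t = \<delta> t \<and> velocity A \<gamma> t = velocity A \<delta> t"
proof -
  note s\<gamma> = geodesic_smooth[OF \<gamma>] and s\<delta> = geodesic_smooth[OF \<delta>]
  note c\<gamma> = smooth_map_continuous[OF s\<gamma>] and c\<delta> = smooth_map_continuous[OF s\<delta>]
  note t\<gamma> = velocity_tangent[OF atlas s\<gamma> S(1)] and t\<delta> = velocity_tangent[OF atlas s\<delta> S(1)]
  define E where "E = {s \<in> S. \<gamma> s = \<delta> s \<and> velocity A \<gamma> s = velocity A \<delta> s}"
  define T where "T c = (S \<inter> \<gamma> -` fst c) \<inter> (S \<inter> \<delta> -` fst c)" for c :: "('a, real^2) chart"
  define u where "u c s = (snd c (\<gamma> s), velocity A \<gamma> s c)" for c s
  define v where "v c s = (snd c (\<delta> s), velocity A \<delta> s c)" for c s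
  have T: "open (T c)" if "c \<in> A" for c
    unfolding T_def by (intro open_Int open_domain_restrict S c\<gamma> c\<delta> chart_open_dom chart that)
  have du: "(u c has_vector_derivative geo_field c (u c s)) (at s)" if "c \<in> A" "s \<in> T c" for c s
    unfolding u_def by (rule geodesic_on_chart[OF \<gamma> S(1) that(1)]) (use that in \<open>auto simp: T_def\<close>)
  have dv: "(v c has_vector_derivative geo_field c (v c s)) (at s)" if "c \<in> A" "s \<in> T c" for c s
    unfolding v_def by (rule geodesic_on_chart[OF \<delta> S(1) that(1)]) (use that in \<open>auto simp: T_def\<close>)
  have eq: "s \<in> E" if c: "c \<in> A" "s \<in> T c" "u c s = v c s" for c s
  proof -
    have s: "s \<in> S" "\<gamma> s \<in> fst c" "\<delta> s \<in> fst c" using c by (auto simp: T_def)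
    have "\<gamma> s = \<delta> s" using c(3) s chart_inv[OF chart[OF c(1)]] unfolding u_def v_def by (metis prod.inject)
    moreover have "velocity A \<gamma> s = velocity A \<delta> s"
      by (rule tangent_eqI[OF t\<gamma>[OF s(1)] _ c(1) s(2)]) (use t\<delta>[OF s(1)] calculation c(3) in \<open>simp_all add: u_def v_def\<close>)
    ultimately show ?thesis using s by (simp add: E_def)
  qed
  have "open E"
  proof (subst open_subopen, rule ballI)
    fix s assume s: "s \<in> E"
    obtain c where c: "c \<in> A" "\<gamma> s \<in> fst c" using atlas_cover[OF atlas] .
    have sT: "s \<in> T c" and uv: "u c s = v c s" using s c by (auto simp: E_def T_def u_def v_def)
    have "open (img c \<times> (UNIV :: (real^2) set))" using open_img[OF c(1)] by (simp add: open_Times)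
    from ode_unique_local[OF this geo_field_smooth[OF c(1)] T[OF c(1)] sT _ du[OF c(1)] _ dv[OF c(1)] uv]
    obtain \<epsilon> where \<epsilon>: "0 < \<epsilon>" "\<And>r. \<bar>r - s\<bar> < \<epsilon> \<Longrightarrow> u c r = v c r"
      by (auto simp: u_def v_def T_def)
    have "open (T c \<inter> ball s \<epsilon>)" using T[OF c(1)] by auto
    moreover have "T c \<inter> ball s \<epsilon> \<subseteq> E"
      using eq[OF c(1)] \<epsilon>(2) by (auto simp: dist_norm abs_minus_commute)
    ultimately show "\<exists>T. open T \<and> s \<in> T \<and> T \<subseteq> E" using sT \<epsilon>(1) by (intro exI[of _ "T c \<inter> ball s \<epsilon>"]) auto
  qed
  moreover have "open (S - E)"
  proof (subst open_subopen, rule ballI)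
    fix s assume s: "s \<in> S - E"
    show "\<exists>T. open T \<and> s \<in> T \<and> T \<subseteq> S - E"
    proof (cases "\<gamma> s = \<delta> s")
      case False
      then obtain P Q where PQ: "open P" "open Q" "\<gamma> s \<in> P" "\<delta> s \<in> Q" "P \<inter> Q = {}"
        using hausdorff by metis
      have "open ((S \<inter> \<gamma> -` P) \<inter> (S \<inter> \<delta> -` Q))"
        by (intro open_Int open_domain_restrict S c\<gamma> c\<delta> PQ)
      moreover have "(S \<inter> \<gamma> -` P) \<inter> (S \<inter> \<delta> -` Q) \<subseteq> S - E" using PQ(5) by (auto simp: E_def)
      ultimately show ?thesis using s PQ by (intro exI[of _ "(S \<inter> \<gamma> -` P) \<inter> (S \<inter> \<delta> -` Q)"]) auto
    next
      case True
      obtain c where c: "c \<in> A" "\<gamma> s \<in> fst c" using atlas_cover[OF atlas] .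
      have sT: "s \<in> T c" using s c True by (auto simp: T_def)
      have "u c s \<noteq> v c s" using eq[OF c(1) sT] s by blast
      have "continuous_on (T c) (\<lambda>s. u c s - v c s)"
        by (intro continuous_on_diff continuous_at_imp_continuous_on ballI has_vector_derivative_continuous[OF du[OF c(1)]]
            has_vector_derivative_continuous[OF dv[OF c(1)]])
      then have "open (T c \<inter> (\<lambda>s. u c s - v c s) -` (- {0}))"
        by (rule open_domain_restrict[OF T[OF c(1)]]) auto
      moreover have "T c \<inter> (\<lambda>s. u c s - v c s) -` (- {0}) \<subseteq> S - E"
        by (auto simp: E_def T_def u_def v_def zero_prod_def)
      ultimately show ?thesis using sT \<open>u c s \<noteq> v c s\<close>
        by (intro exI[of _ "T c \<inter> (\<lambda>s. u c s - v c s) -` (- {0})"]) auto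
    qed
  qed
  ultimately have "E \<inter> S = {} \<or> (S - E) \<inter> S = {}"
    using connectedD[OF S(2), of E "S - E"] by auto
  moreover have "a \<in> E" using a by (simp add: E_def)
  ultimately have "t \<in> E" using t a by blast
  then show ?thesis by (simp add: E_def)
qed

text \<open>Two geodesics with the same initial data agree on the smaller of their two open
  intervals around [0,1], hence at time 1; so the description defining \<open>exp_map\<close> has a
  unique solution.\<close>

lemma exp_map_eq:
  assumes "geodesic_from A g p \<xi> \<gamma>"
  shows "exp_map A g p \<xi> = \<gamma> 1"
  unfolding exp_map_def
proof (rule the_equality)
  fix q assume "\<exists>\<delta>. geodesic_from A g p \<xi> \<delta> \<and> q = \<delta> 1"
  then obtain \<delta> where \<delta>: "geodesic_from A g p \<xi> \<delta>" "q = \<delta> 1" by blast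
  obtain e where e: "0 < e" "geodesic_on A g {-e<..<1+e} \<gamma>" "\<gamma> 0 = p" "velocity A \<gamma> 0 = \<xi>"
    using assms by (auto simp: geodesic_from_def)
  obtain e' where e': "0 < e'" "geodesic_on A g {-e'<..<1+e'} \<delta>" "\<delta> 0 = p" "velocity A \<delta> 0 = \<xi>"
    using \<delta>(1) by (auto simp: geodesic_from_def)
  define m where "m = min e e'"
  have m: "geodesic_on A g {-m<..<1+m} \<gamma>" "geodesic_on A g {-m<..<1+m} \<delta>"
    by (rule geodesic_on_subset[OF e(2)] geodesic_on_subset[OF e'(2)]; force simp: m_def)+
  have "\<gamma> 1 = \<delta> 1 \<and> velocity A \<gamma> 1 = velocity A \<delta> 1"
    by (rule geodesic_unique[where \<gamma> = \<gamma> and \<delta> = \<delta> and S = "{-m<..<1+m}" and a = 0])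
      (use m e e' in \<open>auto simp: m_def\<close>)
  then show "q = \<gamma> 1" using \<delta> by simp
qed (use assms in auto)

lemma curve_affine_velocity:
  assumes "smooth_map euclid_atlas A S \<gamma>" "r * t + b \<in> S"
  shows "velocity A (\<lambda>t. \<gamma> (r * t + b)) t = tscale r (velocity A \<gamma> (r * t + b))"
proof
  fix c
  show "velocity A (\<lambda>t. \<gamma> (r * t + b)) t c = tscale r (velocity A \<gamma> (r * t + b)) c"
  proof (cases "c \<in> A \<and> \<gamma> (r * t + b) \<in> fst c")
    case True
    have "((snd c \<circ> \<gamma>) has_vector_derivative velocity A \<gamma> (r * t + b) c) (at (r * t + b))"
      by (rule curve_has_vector_derivative[OF assms]) (use True in auto)
    then have "(((snd c \<circ> \<gamma>) \<circ> (\<lambda>t. r * t + b)) has_vector_derivative r *\<^sub>R velocity A \<gamma> (r * t + b) c) (at t)"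
      by (intro vector_diff_chain_at) (auto intro!: derivative_eq_intros)
    then have "((snd c \<circ> (\<lambda>t. \<gamma> (r * t + b))) has_vector_derivative r *\<^sub>R velocity A \<gamma> (r * t + b) c) (at t)"
      by (simp add: o_def)
    then show ?thesis using True by (intro velocity_eqI[THEN trans]) (auto simp: tscale_def)
  qed (auto simp: velocity_def tscale_def)
qed

lemma geodesic_affine:
  assumes \<gamma>: "geodesic_on A g S \<gamma>" and S: "open S"
  shows "geodesic_on A g {t. r * t + b \<in> S} (\<lambda>t. \<gamma> (r * t + b))"
proof -
  note sm = geodesic_smooth[OF \<gamma>]
  let ?T = "{t. r * t + b \<in> S}"
  have cr: "continuous_on UNIV (\<lambda>t. r * t + b)" by (intro continuous_intros)
  have T: "open ?T" using open_vimage[OF S cr] by (simp add: vimage_def)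
  have sm': "smooth_map euclid_atlas A ?T (\<lambda>t. \<gamma> (r * t + b))"
    unfolding smooth_map_euclid
  proof (intro conjI ballI)
    show cT: "continuous_on ?T (\<lambda>t. \<gamma> (r * t + b))"
      by (rule continuous_on_compose2[OF smooth_map_continuous[OF sm] continuous_on_subset[OF cr]]) auto
    fix d assume d: "d \<in> A"
    have 1: "open (?T \<inter> (\<lambda>t. \<gamma> (r * t + b)) -` fst d)" by (rule open_domain_restrict[OF T cT chart_open_dom[OF chart[OF d]]])
    have 2: "open (S \<inter> \<gamma> -` fst d)"
      by (rule open_domain_restrict[OF S smooth_map_continuous[OF sm] chart_open_dom[OF chart[OF d]]])
    have "smooth_on (?T \<inter> (\<lambda>t. \<gamma> (r * t + b)) -` fst d) (\<lambda>t. (snd d \<circ> \<gamma>) (r * t + b))"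
      by (rule smooth_on_compose[OF 1 2 _ smooth_on_add[OF 1 smooth_on_mult[OF 1 smooth_on_const smooth_on_ident[OF 1]] smooth_on_const] smooth_map_euclidD[OF sm d]]) auto
    then show "smooth_on (?T \<inter> (\<lambda>t. \<gamma> (r * t + b)) -` fst d) (snd d \<circ> (\<lambda>t. \<gamma> (r * t + b)))" by (simp add: o_def)
  qed
  have "covariant_acceleration A g c (\<lambda>t. \<gamma> (r * t + b)) t = 0" if t: "r * t + b \<in> S" and c: "c \<in> A" "\<gamma> (r * t + b) \<in> fst c" for t c
  proof -
    define T' where "T' = ?T \<inter> (\<lambda>t. \<gamma> (r * t + b)) -` fst c"
    have T': "open T'" "t \<in> T'" unfolding T'_def
      using open_domain_restrict[OF T smooth_map_continuous[OF sm'] chart_open_dom[OF chart[OF c(1)]]] t c by auto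
    have x: "((snd c \<circ> (\<lambda>t. \<gamma> (r * t + b))) has_vector_derivative r *\<^sub>R velocity A \<gamma> (r * s + b) c) (at s)" if "s \<in> T'" for s
      using curve_has_vector_derivative[OF sm' _ c(1), of s] curve_affine_velocity[OF sm, of r s] that
      by (simp add: T'_def tscale_def)
    let ?x = "snd c (\<gamma> (r * t + b))" and ?y = "velocity A \<gamma> (r * t + b) c"
    have "((\<lambda>s. velocity A \<gamma> s c) has_vector_derivative - christoffel A g c ?x ?y ?y) (at (r * t + b))"
      using has_vector_derivative_linear_image[OF bounded_linear_imp_has_derivative[OF bounded_linear_snd] geodesic_on_chart[OF \<gamma> S c(1) t c(2)]]
      by (simp add: geo_field_def)
    then have "(((\<lambda>s. velocity A \<gamma> s c) \<circ> (\<lambda>t. r * t + b)) has_vector_derivative r *\<^sub>R (- christoffel A g c ?x ?y ?y)) (at t)"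
      by (intro vector_diff_chain_at) (auto intro!: derivative_eq_intros)
    then have "((\<lambda>s. r *\<^sub>R velocity A \<gamma> (r * s + b) c) has_vector_derivative r *\<^sub>R (r *\<^sub>R (- christoffel A g c ?x ?y ?y))) (at t)"
      unfolding o_def by (rule has_vector_derivative_linear_image[OF bounded_linear_imp_has_derivative[OF bounded_linear_scaleR_right]])
    from covariant_acceleration_eq[OF T' x this]
    show ?thesis
      using christoffel_scale[OF c(1), of ?x r ?y] c(2) by (simp add: power2_eq_square)
  qed
  then show ?thesis using sm' by (simp add: geodesic_on_def)
qed

text \<open>Scaling time by \<open>r\<close> scales the initial velocity, so a geodesic run up to
  parameter \<open>r\<close> realizes the exponential of \<open>r\<close> times its initial
  velocity. It is applied with negative \<open>r\<close> as well.\<close>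

lemma geodesic_from_scale:
  assumes \<gamma>: "geodesic_on A g S \<gamma>" and S: "open S" "is_interval S" and mem: "0 \<in> S" "r \<in> S"
  shows "geodesic_from A g (\<gamma> 0) (tscale r (velocity A \<gamma> 0)) (\<lambda>t. \<gamma> (r * t))"
proof -
  obtain \<rho>1 where \<rho>1: "0 < \<rho>1" "ball 0 \<rho>1 \<subseteq> S" using S mem openE by blast
  obtain \<rho>2 where \<rho>2: "0 < \<rho>2" "ball r \<rho>2 \<subseteq> S" using S mem openE by blast
  define \<rho> where "\<rho> = min \<rho>1 \<rho>2"
  have \<rho>: "0 < \<rho>" "ball 0 \<rho> \<subseteq> S" "ball r \<rho> \<subseteq> S" using \<rho>1 \<rho>2 by (auto simp: \<rho>_def)
  \<comment> \<open>For \<open>t\<close> less than \<open>e\<close> outside [0,1], the point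
    \<open>r * t\<close> is within \<rho> of 0 or of \<open>r\<close>, where \<rho>-balls lie in
    \<open>S\<close>.\<close>
  define e where "e = \<rho> / (1 + \<bar>r\<bar>)"
  have e: "0 < e" "\<bar>r\<bar> * e < \<rho>" using \<rho> by (auto simp: e_def field_simps)
  have "r * t \<in> S" if t: "t \<in> {-e<..<1+e}" for t
  proof -
    consider "t < 0" | "0 \<le> t" "t \<le> 1" | "1 < t" by linarith
    then show ?thesis
    proof cases
      case 1
      have "\<bar>r * t\<bar> \<le> \<bar>r\<bar> * e" using 1 t unfolding abs_mult by (intro mult_left_mono) auto
      then show ?thesis using e \<rho>(2) by (auto simp: subset_iff)
    next
      case 2
      have "closed_segment 0 r \<subseteq> S" using closed_segment_subset[OF mem] S(2) is_interval_convex by blast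
      moreover have "r * t \<in> closed_segment 0 r" using 2 by (auto simp: in_segment intro!: exI[of _ t])
      ultimately show ?thesis by blast
    next
      case 3
      have "\<bar>r * t - r\<bar> = \<bar>r\<bar> * \<bar>t - 1\<bar>" by (simp add: algebra_simps flip: abs_mult)
      also have "\<dots> \<le> \<bar>r\<bar> * e" using 3 t by (intro mult_left_mono) auto
      finally show ?thesis using e \<rho>(3) by (auto simp: subset_iff dist_norm abs_minus_commute)
    qed
  qed
  then have "geodesic_on A g {-e<..<1+e} (\<lambda>t. \<gamma> (r * t))"
    using geodesic_on_subset[OF geodesic_affine[OF \<gamma> S(1), of r 0], of "{-e<..<1+e}"] by fastforce
  then show ?thesis
    using e(1) curve_affine_velocity[OF geodesic_smooth[OF \<gamma>], of r 0 0] mem by (auto simp: geodesic_from_def)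
qed

text \<open>In the derivative of the squared speed, the Koszul formula turns the two Christoffel
  terms into minus the derivative of the metric along the velocity, and everything cancels.\<close>

lemma geodesic_speed_constant:
  assumes \<gamma>: "geodesic_on A g S \<gamma>" and S: "open S" "connected S" and st: "s \<in> S" "t \<in> S"
  shows "g (\<gamma> s) (velocity A \<gamma> s) (velocity A \<gamma> s) = g (\<gamma> t) (velocity A \<gamma> t) (velocity A \<gamma> t)"
proof (rule has_derivative_zero_unique_connected[OF S _ st])
  fix s assume s: "s \<in> S"
  note sm = geodesic_smooth[OF \<gamma>]
  obtain c where c: "c \<in> A" "\<gamma> s \<in> fst c" using atlas_cover[OF atlas] .
  have o: "open (S \<inter> \<gamma> -` fst c)"
    by (rule open_domain_restrict[OF S(1) smooth_map_continuous[OF sm] chart_open_dom[OF chart[OF c(1)]]])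
  let ?x = "snd c (\<gamma> s)" and ?y = "velocity A \<gamma> s c"
  have xi: "?x \<in> img c" using c by auto
  let ?k = "christoffel A g c ?x ?y ?y"
  note d = geodesic_on_chart[OF \<gamma> S(1) c(1) s c(2)]
  have dx: "((\<lambda>s. snd c (\<gamma> s)) has_derivative (\<lambda>h. h *\<^sub>R ?y)) (at s)"
    using has_vector_derivative_linear_image[OF bounded_linear_imp_has_derivative[OF bounded_linear_fst] d]
    by (simp add: geo_field_def has_vector_derivative_def)
  have dy: "((\<lambda>s. velocity A \<gamma> s c) has_derivative (\<lambda>h. h *\<^sub>R (- ?k))) (at s)"
    using has_vector_derivative_linear_image[OF bounded_linear_imp_has_derivative[OF bounded_linear_snd] d]
    by (simp add: geo_field_def has_vector_derivative_def)
  have z: "DG c ?x ?y ?y (h *\<^sub>R ?y) + G c ?x (h *\<^sub>R (- ?k)) ?y + G c ?x ?y (h *\<^sub>R (- ?k)) = 0" for h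
  proof -
    have k: "G c ?x ?k ?y = DG c ?x ?y ?y ?y / 2"
      using G_christoffel[OF c(1) xi, of ?y ?y ?y] by (simp add: koszul_def)
    then have k': "G c ?x ?y ?k = DG c ?x ?y ?y ?y / 2" using G_sym[OF c(1) xi, of ?y ?k] by (simp only:)
    show ?thesis
      unfolding DG_algebra(6)[OF c(1) xi] G_bil(3,4)[OF c(1) xi] G_bil(5,6)[OF c(1) xi] k k' by simp
  qed
  have "((\<lambda>s. G c (snd c (\<gamma> s)) (velocity A \<gamma> s c) (velocity A \<gamma> s c)) has_derivative (\<lambda>h. 0)) (at s)"
    using G_comp_derivative[OF c(1) dx xi dy dy] z by simp
  then show "((\<lambda>s. g (\<gamma> s) (velocity A \<gamma> s) (velocity A \<gamma> s)) has_derivative (\<lambda>h. 0)) (at s)"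
  proof (rule has_derivative_transform_within_open[OF _ o])
    fix r assume "r \<in> S \<inter> \<gamma> -` fst c"
    then have r: "r \<in> S" "\<gamma> r \<in> fst c" by auto
    show "G c (snd c (\<gamma> r)) (velocity A \<gamma> r c) (velocity A \<gamma> r c) = g (\<gamma> r) (velocity A \<gamma> r) (velocity A \<gamma> r)"
      using metric_chart[OF c(1) r(2)] velocity_tangent[OF atlas sm S(1) r(1)] by simp
  qed (use s c in auto)
qed

subsection \<open>The rotation field of a chart\<close>

definition area :: "real^2 \<Rightarrow> real^2 \<Rightarrow> real" where
  "area a b = a $ 1 * b $ 2 - a $ 2 * b $ 1"

text \<open>\<open>sqrt (G_det c x)\<close> times \<open>area\<close> is the Riemannian area form
  for the orientation of the chart; the rotated vector is the one whose metric pairing with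
  \<open>e\<close> is the area spanned by \<open>a\<close> and \<open>e\<close>.\<close>

definition chart_rotation :: "('a, real^2) chart \<Rightarrow> real^2 \<Rightarrow> real^2 \<Rightarrow> real^2" where
  "chart_rotation c x a = sharp c x (\<lambda>e. sqrt (G_det c x) * area a e)"

lemma area_linear: "linear (\<lambda>e. r * area a e)"
  by (rule linearI) (simp_all add: area_def algebra_simps)

lemma G_rotation:
  assumes c: "c \<in> A" "x \<in> img c"
  shows "G c x (chart_rotation c x a) e = sqrt (G_det c x) * area a e"
  unfolding chart_rotation_def by (rule G_sharp[OF c area_linear])

text \<open>Complements \<open>G_rotation\<close>: one identity turns metric into area, the other
  turns area back into metric. Applied in succession they show that the rotation is an isometry and
  that its square is minus the identity.\<close>

lemma area_rotation:
  assumes c: "c \<in> A" "x \<in> img c"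
  shows "sqrt (G_det c x) * area a (chart_rotation c x b) = G c x a b"
proof -
  let ?e = "axis 1 1 :: real^2" and ?f = "axis 2 1 :: real^2"
  define q where "q = sqrt (G_det c x)"
  have q: "q * q = G_det c x" "q \<noteq> 0" using G_det_pos[OF c] by (auto simp: q_def)
  have 1: "chart_rotation c x b $ 1 = (- (G c x ?f ?f * b $ 2) - G c x ?e ?f * b $ 1) / q"
    using q(2) unfolding chart_rotation_def sharp_def q_def[symmetric] unfolding q(1)[symmetric]
    by (simp add: area_def axis_def field_simps)
  have 2: "chart_rotation c x b $ 2 = (G c x ?e ?e * b $ 1 + G c x ?e ?f * b $ 2) / q"
    using q(2) unfolding chart_rotation_def sharp_def q_def[symmetric] unfolding q(1)[symmetric]
    by (simp add: area_def axis_def field_simps)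
  have "G c x a b = a $ 1 * b $ 1 * G c x ?e ?e + (a $ 1 * b $ 2 + a $ 2 * b $ 1) * G c x ?e ?f + a $ 2 * b $ 2 * G c x ?f ?f"
    by (subst plane_expansion[of a], subst plane_expansion[of b])
      (simp only: G_bil[OF c] G_sym[OF c, of ?f ?e] real_scaleR_def, simp add: algebra_simps)
  then show ?thesis
    using q(2) unfolding area_def 1 2 q_def[symmetric] by (simp add: field_simps)
qed

lemma chart_rotation_isometry:
  assumes c: "c \<in> A" "x \<in> img c"
  shows "G c x (chart_rotation c x a) (chart_rotation c x b) = G c x a b"
  by (simp add: G_rotation[OF c] area_rotation[OF c])

lemma chart_rotation_orthogonal:
  assumes c: "c \<in> A" "x \<in> img c"
  shows "G c x (chart_rotation c x a) a = 0"
  by (simp add: G_rotation[OF c] area_def)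

lemma chart_rotation_rotation:
  assumes c: "c \<in> A" "x \<in> img c"
  shows "chart_rotation c x (chart_rotation c x a) = - a"
proof (rule G_eqI[OF c])
  fix e
  have "area (chart_rotation c x a) e = - area e (chart_rotation c x a)" by (simp add: area_def)
  then show "G c x (chart_rotation c x (chart_rotation c x a)) e = G c x (- a) e"
    using area_rotation[OF c, of e a] G_sym[OF c, of a e] by (simp add: G_rotation[OF c] G_bil[OF c])
qed

lemma chart_rotation_linear:
  assumes c: "c \<in> A" "x \<in> img c"
  shows "linear (chart_rotation c x)"
proof (rule linearI; rule G_eqI[OF c])
  show "G c x (chart_rotation c x (a + b)) e = G c x (chart_rotation c x a + chart_rotation c x b) e" for a b e
    by (simp add: G_rotation[OF c] G_bil[OF c] area_def algebra_simps)
  show "G c x (chart_rotation c x (r *\<^sub>R a)) e = G c x (r *\<^sub>R chart_rotation c x a) e" for a r e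
    by (simp add: G_rotation[OF c] G_bil[OF c] area_def algebra_simps)
qed

lemma chart_rotation_smooth:
  assumes c: "c \<in> A" and T: "open T" and X: "smooth_on T X" "X ` T \<subseteq> img c" and P: "smooth_on T P"
  shows "smooth_on T (\<lambda>z. chart_rotation c (X z) (P z))"
proof -
  have Gs: "smooth_on T (\<lambda>z. G c (X z) a b)" for a b
    by (rule G_comp_smooth[OF c T X]) simp_all
  have d: "smooth_on T (\<lambda>z. G_det c (X z))"
    unfolding G_det_def power2_eq_square by (intro smooth_on_diff smooth_on_mult T Gs)
  have "smooth_on T (\<lambda>z. sqrt (G_det c (X z)))"
    by (rule smooth_on_sqrt[OF T d]) (use G_det_pos[OF c] X in blast)
  then show ?thesis
    unfolding chart_rotation_def area_def
    by (intro sharp_smooth[OF c T X] smooth_on_mult smooth_on_diff smooth_on_nth T P smooth_on_const)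
qed

definition rotation_of_chart :: "('a, real^2) chart \<Rightarrow> 'a \<Rightarrow> ('a, real^2) tvec \<Rightarrow> ('a, real^2) tvec" where
  "rotation_of_chart c p \<xi> = coord_vec A c p (chart_rotation c (snd c p) (\<xi> c))"

text \<open>The algebraic properties are read off in the chart \<open>c\<close>. In another chart
  \<open>d\<close> the field is \<open>chart_rotation\<close> between two transition derivatives,
  which gives its smoothness there.\<close>

lemma rotation_field_of_chart:
  assumes c: "c \<in> A"
  shows "rotation_field A g (fst c) (rotation_of_chart c)"
  unfolding rotation_field_def
proof (intro conjI ballI allI)
  note ch = chart[OF c]
  fix p \<xi> \<eta> and r :: real
  assume p: "p \<in> fst c" and \<xi>: "\<xi> \<in> tangent_space A p" and \<eta>: "\<eta> \<in> tangent_space A p"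
  have x: "snd c p \<in> img c" using p by auto
  note cv = coord_vec_tangent[OF atlas c p] and cc = coord_vec_chart[OF ch c p]
  show "rotation_of_chart c p \<xi> \<in> tangent_space A p" unfolding rotation_of_chart_def by (rule cv)
  show "rotation_of_chart c p (tadd \<xi> \<eta>) = tadd (rotation_of_chart c p \<xi>) (rotation_of_chart c p \<eta>)"
    unfolding rotation_of_chart_def tadd_coord_vec[OF atlas c p]
    by (simp add: tadd_def linear_add[OF chart_rotation_linear[OF c x]])
  show "rotation_of_chart c p (tscale r \<xi>) = tscale r (rotation_of_chart c p \<xi>)"
    unfolding rotation_of_chart_def tscale_coord_vec[OF atlas c p]
    by (simp add: tscale_def linear_scale[OF chart_rotation_linear[OF c x]])
  show "g p (rotation_of_chart c p \<xi>) (rotation_of_chart c p \<eta>) = g p \<xi> \<eta>"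
    unfolding rotation_of_chart_def metric_chart[OF c p cv cv] cc chart_rotation_isometry[OF c x]
    using metric_chart[OF c p \<xi> \<eta>] by simp
  show "g p (rotation_of_chart c p \<xi>) \<xi> = 0"
    unfolding rotation_of_chart_def metric_chart[OF c p cv \<xi>] cc by (rule chart_rotation_orthogonal[OF c x])
next
  fix d a assume d: "d \<in> A"
  note cd = chart[OF d] and ch = chart[OF c]
  let ?P = "snd d ` (fst c \<inter> fst d)"
  have P: "open ?P" "smooth_on ?P (rep d c id)"
    using transition_smooth[OF atlas d c] by (simp_all add: rep_def o_def Int_commute)
  have Q: "open (snd c ` (fst c \<inter> fst d))" "smooth_on (snd c ` (fst c \<inter> fst d)) (rep c d id)"
    using transition_smooth[OF atlas c d] by (simp_all add: rep_def o_def)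
  have PQ: "rep d c id ` ?P \<subseteq> snd c ` (fst c \<inter> fst d)"
    using rep_at[OF cd, of _ c id] by auto
  have "smooth_on ?P (\<lambda>x. frechet_derivative (rep c d id) (at (rep d c id x))
      (chart_rotation c (rep d c id x) (frechet_derivative (rep d c id) (at x) a)))"
    by (rule smooth_on_frechet_apply[OF P(1) Q(1) PQ P(2) Q(2)])
      (rule chart_rotation_smooth[OF c P _ smooth_on_frechet[OF P(2)]], use PQ in blast)
  then show "smooth_on ?P (\<lambda>x. rotation_of_chart c (inv_chart d x) (coord_vec A d (inv_chart d x) a) d)"
  proof (rule iffD2[OF smooth_on_cong[OF P(1)], rotated])
    fix x assume "x \<in> ?P"
    then obtain q where q: "q \<in> fst c" "q \<in> fst d" "x = snd d q" by auto
    show "rotation_of_chart c (inv_chart d x) (coord_vec A d (inv_chart d x) a) d =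
      frechet_derivative (rep c d id) (at (rep d c id x))
      (chart_rotation c (rep d c id x) (frechet_derivative (rep d c id) (at x) a))"
      using q d c rep_at[OF cd q(2), of c id]
      by (simp add: rotation_of_chart_def coord_vec_rep chart_inv[OF cd])
  qed
qed

end

lemma eventually_nhds_continuous:
  assumes "continuous (at x) f" "open Q" "f x \<in> Q"
  shows "\<forall>\<^sub>F y in nhds x. f y \<in> Q"
proof -
  obtain S where "open S" "x \<in> S" "\<forall>y\<in>S. f y \<in> Q"
    using assms unfolding continuous_at_open by blast
  then show ?thesis unfolding eventually_nhds by blast
qed

context riemannian_surface
begin

subsection \<open>The Gauss lemma\<close>

text \<open>The local flow of \<open>geo_field\<close>, with each trajectory identified as a
  geodesic of the manifold together with its velocity.\<close>

lemma geodesic_flow_chart: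
  assumes c: "c \<in> A" and z0: "fst z0 \<in> img c"
  obtains a r \<Phi> where "0 < a" "0 < r" "ball z0 r \<subseteq> img c \<times> UNIV"
    "smooth_on ({-a<..<a} \<times> ball z0 r) (\<lambda>p. \<Phi> (fst p) (snd p))"
    "\<And>z. z \<in> ball z0 r \<Longrightarrow> \<Phi> 0 z = z"
    "\<And>t z. t \<in> {-a<..<a} \<Longrightarrow> z \<in> ball z0 r \<Longrightarrow> fst (\<Phi> t z) \<in> img c"
    "\<And>t z. t \<in> {-a<..<a} \<Longrightarrow> z \<in> ball z0 r \<Longrightarrow> ((\<lambda>s. \<Phi> s z) has_vector_derivative geo_field c (\<Phi> t z)) (at t)"
    "\<And>z. z \<in> ball z0 r \<Longrightarrow> geodesic_on A g {-a<..<a} (\<lambda>t. inv_chart c (fst (\<Phi> t z)))"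
    "\<And>t z. t \<in> {-a<..<a} \<Longrightarrow> z \<in> ball z0 r \<Longrightarrow>
      velocity A (\<lambda>t. inv_chart c (fst (\<Phi> t z))) t = coord_vec A c (inv_chart c (fst (\<Phi> t z))) (snd (\<Phi> t z))"
proof -
  have S: "open (img c \<times> (UNIV :: (real^2) set))" using open_img[OF c] by (simp add: open_Times)
  have zS: "z0 \<in> img c \<times> UNIV" using z0 by (simp add: mem_Times_iff)
  obtain a r \<Phi> where *: "0 < a" "0 < r" "ball z0 r \<subseteq> img c \<times> UNIV"
    "smooth_on ({-a<..<a} \<times> ball z0 r) (\<lambda>p. \<Phi> (fst p) (snd p))"
    "\<And>z. z \<in> ball z0 r \<Longrightarrow> \<Phi> 0 z = z"
    "\<And>t z. t \<in> {-a<..<a} \<Longrightarrow> z \<in> ball z0 r \<Longrightarrow> \<Phi> t z \<in> img c \<times> UNIV"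
    "\<And>t z. t \<in> {-a<..<a} \<Longrightarrow> z \<in> ball z0 r \<Longrightarrow> ((\<lambda>s. \<Phi> s z) has_vector_derivative geo_field c (\<Phi> t z)) (at t)"
    by (rule smooth_local_flow[OF S geo_field_smooth[OF c] zS]) (assumption | rule that)+
  have o: "open ({-a<..<a} \<times> ball z0 r)" by (simp add: open_Times)
  have img: "fst (\<Phi> t z) \<in> img c" if "t \<in> {-a<..<a}" "z \<in> ball z0 r" for t z
    using *(6)[OF that] by (simp add: mem_Times_iff)
  have sm: "smooth_on {-a<..<a} (\<lambda>t. fst (\<Phi> t z))" if z: "z \<in> ball z0 r" for z
  proof -
    have "smooth_on {-a<..<a} (\<lambda>t. (t, z))" by (intro smooth_on_Pair smooth_on_ident smooth_on_const) auto
    then have "smooth_on {-a<..<a} (\<lambda>t. \<Phi> (fst (t, z)) (snd (t, z)))"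
      by (rule smooth_on_compose[OF _ o, rotated 2, OF _ *(4)]) (use z in auto)
    then show ?thesis by (simp add: smooth_on_fst)
  qed
  have g: "geodesic_on A g {-a<..<a} (\<lambda>t. inv_chart c (fst (\<Phi> t z)))" if z: "z \<in> ball z0 r" for z
    by (rule geodesic_in_chart(1)[OF c _ sm[OF z], where y = "\<lambda>t. snd (\<Phi> t z)"])
      (use img[OF _ z] *(7)[OF _ z] in auto)
  have v: "velocity A (\<lambda>t. inv_chart c (fst (\<Phi> t z))) t = coord_vec A c (inv_chart c (fst (\<Phi> t z))) (snd (\<Phi> t z))"
    if t: "t \<in> {-a<..<a}" and z: "z \<in> ball z0 r" for t z
    by (rule geodesic_in_chart(2)[OF c _ sm[OF z], where y = "\<lambda>t. snd (\<Phi> t z)"])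
      (use img[OF _ z] *(7)[OF _ z] t in auto)
  show thesis
    by (rule that[of a r \<Phi>]) (assumption | rule *(1-5,7) img g v)+
qed

text \<open>The variation \<xi> of the position is orthogonal to the geodesic at time
  \<open>s\<close>. Differentiability of the velocity in the parameter is part of the condition
  because position and velocity together are the initial data from which the flow reaches later
  times.\<close>

definition orthogonal_variation :: "(real \<Rightarrow> real \<Rightarrow> 'a) \<Rightarrow> real \<Rightarrow> ('a, real^2) chart \<Rightarrow> real \<Rightarrow> bool" where
  "orthogonal_variation \<gamma> u c s \<longleftrightarrow> \<gamma> u s \<in> fst c \<and> (\<forall>\<^sub>F w in nhds u. \<gamma> w s \<in> fst c) \<and>
    (\<exists>\<xi> \<eta>. ((\<lambda>w. (snd c (\<gamma> w s), velocity A (\<gamma> w) s c)) has_vector_derivative (\<xi>, \<eta>)) (at u) \<and>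
      G c (snd c (\<gamma> u s)) \<xi> (velocity A (\<gamma> u) s c) = 0)"

text \<open>Positions and velocities in the new chart arise from the old ones by the smooth map (x,
  y) to (\<phi>(x), D\<phi>(x) y) with \<phi> the transition map, and D\<phi> preserves the
  metric.\<close>

lemma orthogonal_variation_chart_change:
  fixes \<gamma> :: "real \<Rightarrow> real \<Rightarrow> 'a" and S :: "real \<Rightarrow> real set"
  assumes U: "open U" "m \<in> U"
    and S: "\<And>u. u \<in> U \<Longrightarrow> open (S u)" "\<And>u. u \<in> U \<Longrightarrow> is_interval (S u)" "\<And>u. u \<in> U \<Longrightarrow> {0..1} \<subseteq> S u"
    and \<gamma>: "\<And>u. u \<in> U \<Longrightarrow> geodesic_on A g (S u) (\<gamma> u)"
    and s: "s \<in> {0..1}" and c1: "c \<in> A" and d: "d \<in> A" "\<gamma> m s \<in> fst d" and P: "orthogonal_variation \<gamma> m c s"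
  shows "orthogonal_variation \<gamma> m d s"
proof -
    obtain \<xi> \<eta> where c0: "\<gamma> m s \<in> fst c" and
      der: "((\<lambda>u. (snd c (\<gamma> u s), velocity A (\<gamma> u) s c)) has_vector_derivative (\<xi>, \<eta>)) (at m)" and
      G0: "G c (snd c (\<gamma> m s)) \<xi> (velocity A (\<gamma> m) s c) = 0" and
      ev: "\<forall>\<^sub>F u in nhds m. \<gamma> u s \<in> fst c"
      using P unfolding orthogonal_variation_def by blast
    note c = c1 c0
    let ?D = "\<lambda>x. frechet_derivative (rep c d id) (at x)"
    let ?Q = "snd c ` (fst c \<inter> fst d)"
    let ?x = "snd c (\<gamma> m s)" and ?y = "velocity A (\<gamma> m) s c"
    have o: "open ?Q" and sm: "smooth_on ?Q (rep c d id)"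
      using transition_smooth[OF atlas c(1) d(1)] by (simp_all add: rep_def o_def)
    have o2: "open (?Q \<times> (UNIV :: (real^2) set))" using o by (simp add: open_Times)
    have f: "smooth_on (?Q \<times> (UNIV :: (real^2) set)) fst" and sd: "smooth_on (?Q \<times> (UNIV :: (real^2) set)) snd"
      using smooth_on_fst[OF o2 smooth_on_ident[OF o2]] smooth_on_snd[OF o2 smooth_on_ident[OF o2]] by simp_all
    have xQ: "?x \<in> ?Q" using c d by auto
    have sm1: "smooth_on (?Q \<times> (UNIV :: (real^2) set)) (\<lambda>z. rep c d id (fst z))"
      by (rule smooth_on_compose[OF o2 o _ f sm]) auto
    have sm2: "smooth_on (?Q \<times> (UNIV :: (real^2) set)) (\<lambda>z. ?D (fst z) (snd z))"
      by (rule smooth_on_frechet_apply[OF o2 o _ f sm sd]) auto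
    have mem: "(?x, ?y) \<in> ?Q \<times> UNIV" using xQ by simp
    obtain M where M: "((\<lambda>z. ?D (fst z) (snd z)) has_derivative M) (at (?x, ?y))"
      using smooth_on_has_derivative[OF sm2 mem] by blast
    have "((\<lambda>z. rep c d id (fst z)) has_derivative (\<lambda>h. ?D ?x (fst h))) (at (?x, ?y))"
    proof -
      have "(rep c d id has_derivative ?D ?x) (at (fst (?x, ?y)))" using smooth_on_has_derivative[OF sm xQ] by simp
      from diff_chain_at[OF bounded_linear_imp_has_derivative[OF bounded_linear_fst] this]
      show ?thesis by (simp add: o_def)
    qed
    from has_derivative_Pair[OF this M]
    have "((\<lambda>u. (rep c d id (snd c (\<gamma> u s)), ?D (snd c (\<gamma> u s)) (velocity A (\<gamma> u) s c))) has_vector_derivative (?D ?x \<xi>, M (\<xi>, \<eta>))) (at m)"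
      using has_vector_derivative_linear_image[where x = "\<lambda>u. (snd c (\<gamma> u s), velocity A (\<gamma> u) s c)" and t = m and x' = "(\<xi>, \<eta>)"
          and f = "\<lambda>z. (rep c d id (fst z), ?D (fst z) (snd z))" and f' = "\<lambda>h. (?D ?x (fst h), M h)"] der by simp
    \<comment> \<open>Continuity places the coordinates in the open image of the overlap;
      injectivity of the chart on its domain then places the point itself in both charts.\<close>
    moreover have ev2: "\<forall>\<^sub>F u in nhds m. u \<in> U \<and> \<gamma> u s \<in> fst c \<and> \<gamma> u s \<in> fst d"
    proof -
      have "continuous (at m) (\<lambda>u. fst (snd c (\<gamma> u s), velocity A (\<gamma> u) s c))"
        by (intro continuous_fst has_vector_derivative_continuous[OF der])
      then have "\<forall>\<^sub>F u in nhds m. snd c (\<gamma> u s) \<in> ?Q"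
        using eventually_nhds_continuous[OF _ o] xQ by simp
      moreover have "\<forall>\<^sub>F u in nhds m. u \<in> U" using U by (rule eventually_nhds_in_open)
      ultimately show ?thesis using ev
      proof eventually_elim
        case (elim u)
        then obtain q where q: "q \<in> fst c" "q \<in> fst d" "snd c (\<gamma> u s) = snd c q" by auto
        then have "\<gamma> u s = q" using chart_inv[OF chart[OF c(1)]] elim(3) by metis
        then show ?case using q elim by simp
      qed
    qed
    have evd: "\<forall>\<^sub>F u in nhds m. (rep c d id (snd c (\<gamma> u s)), ?D (snd c (\<gamma> u s)) (velocity A (\<gamma> u) s c)) = (snd d (\<gamma> u s), velocity A (\<gamma> u) s d)"
      using ev2
    proof eventually_elim
      case (elim u)
      have su: "s \<in> S u" using S(3) elim s by blast
      have "velocity A (\<gamma> u) s d = ?D (snd c (\<gamma> u s)) (velocity A (\<gamma> u) s c)"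
        by (rule tangent_space_chart[OF velocity_tangent[OF atlas geodesic_smooth[OF \<gamma>] S(1) su] c(1) d(1)]) (use elim in auto)
      then show ?case using rep_at[OF chart[OF c(1)], of "\<gamma> u s" d id] elim by simp
    qed
    ultimately have "((\<lambda>u. (snd d (\<gamma> u s), velocity A (\<gamma> u) s d)) has_vector_derivative (?D ?x \<xi>, M (\<xi>, \<eta>))) (at m)"
    proof -
      assume D: "((\<lambda>u. (rep c d id (snd c (\<gamma> u s)), ?D (snd c (\<gamma> u s)) (velocity A (\<gamma> u) s c))) has_vector_derivative (?D ?x \<xi>, M (\<xi>, \<eta>))) (at m)"
      obtain V where V: "open V" "m \<in> V" "\<And>u. u \<in> V \<Longrightarrow> (rep c d id (snd c (\<gamma> u s)), ?D (snd c (\<gamma> u s)) (velocity A (\<gamma> u) s c)) = (snd d (\<gamma> u s), velocity A (\<gamma> u) s d)"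
        using evd unfolding eventually_nhds by blast
      show ?thesis by (rule has_vector_derivative_transform_within_open[OF D V])
    qed
    moreover have "G d (snd d (\<gamma> m s)) (?D ?x \<xi>) (velocity A (\<gamma> m) s d) = 0"
    proof -
      have "velocity A (\<gamma> m) s d = ?D ?x ?y"
        using evd[THEN eventually_nhds_x_imp_x] by simp
      then show ?thesis using G_change[OF c(1) d(1) c(2) d(2), of \<xi> ?y] G0 by simp
    qed
    moreover have "\<forall>\<^sub>F u in nhds m. \<gamma> u s \<in> fst d" using ev2 by (rule eventually_mono) auto
    ultimately show ?thesis using d unfolding orthogonal_variation_def by blast
qed

text \<open>Near \<open>t\<close>, the geodesic for each parameter at time \<open>s2\<close> is the
  flow for time \<open>s2 - s1\<close> applied to its data at \<open>s1\<close>; smoothness of the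
  flow thus transports differentiability in the parameter. The pairing of the variation with the
  velocity stays constant: its time derivative equals half the parameter derivative of the squared
  speed, which is zero because all geodesics have the same speed.\<close>

lemma orthogonal_variation_propagate:
  fixes \<gamma> :: "real \<Rightarrow> real \<Rightarrow> 'a" and S :: "real \<Rightarrow> real set"
  assumes U: "open U" "m \<in> U"
    and S: "\<And>u. u \<in> U \<Longrightarrow> open (S u)" "\<And>u. u \<in> U \<Longrightarrow> is_interval (S u)" "\<And>u. u \<in> U \<Longrightarrow> {0..1} \<subseteq> S u"
    and \<gamma>: "\<And>u. u \<in> U \<Longrightarrow> geodesic_on A g (S u) (\<gamma> u)"
    and speed: "\<And>u. u \<in> U \<Longrightarrow> g (\<gamma> u 0) (velocity A (\<gamma> u) 0) (velocity A (\<gamma> u) 0) = \<kappa>"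
    and t: "t \<in> {0..1}" and c: "c \<in> A" "\<gamma> m t \<in> fst c"
  obtains T where "open T" "t \<in> T" "\<And>s. s \<in> T \<inter> {0..1} \<Longrightarrow> \<gamma> m s \<in> fst c"
    "\<And>s1 s2. s1 \<in> T \<inter> {0..1} \<Longrightarrow> s2 \<in> T \<inter> {0..1} \<Longrightarrow> orthogonal_variation \<gamma> m c s1 \<Longrightarrow> orthogonal_variation \<gamma> m c s2"
proof -
  note ch = chart[OF c(1)]
  have S0: "open (S m)" and tS: "t \<in> S m" using S U t by blast+
  note sm0 = geodesic_smooth[OF \<gamma>[OF U(2)]]
  define w where "w s = (snd c (\<gamma> m s), velocity A (\<gamma> m) s c)" for s
  have wimg: "fst (w t) \<in> img c" using c by (simp add: w_def)
  obtain a r \<Phi> where \<Phi>: "0 < a" "0 < r" "ball (w t) r \<subseteq> img c \<times> UNIV"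
    "smooth_on ({-a<..<a} \<times> ball (w t) r) (\<lambda>p. \<Phi> (fst p) (snd p))"
    "\<And>z. z \<in> ball (w t) r \<Longrightarrow> \<Phi> 0 z = z"
    "\<And>s z. s \<in> {-a<..<a} \<Longrightarrow> z \<in> ball (w t) r \<Longrightarrow> fst (\<Phi> s z) \<in> img c"
    "\<And>s z. s \<in> {-a<..<a} \<Longrightarrow> z \<in> ball (w t) r \<Longrightarrow> ((\<lambda>s. \<Phi> s z) has_vector_derivative geo_field c (\<Phi> s z)) (at s)"
    "\<And>z. z \<in> ball (w t) r \<Longrightarrow> geodesic_on A g {-a<..<a} (\<lambda>s. inv_chart c (fst (\<Phi> s z)))"
    "\<And>s z. s \<in> {-a<..<a} \<Longrightarrow> z \<in> ball (w t) r \<Longrightarrow>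
      velocity A (\<lambda>s. inv_chart c (fst (\<Phi> s z))) s = coord_vec A c (inv_chart c (fst (\<Phi> s z))) (snd (\<Phi> s z))"
    by (rule geodesic_flow_chart[OF c(1) wimg]) (assumption | rule that)+
  let ?N = "{-a<..<a} \<times> ball (w t) r"
  have oN: "open ?N" by (simp add: open_Times)
  have o1: "open (S m \<inter> \<gamma> m -` fst c)"
    by (rule open_domain_restrict[OF S0 smooth_map_continuous[OF sm0] chart_open_dom[OF ch]])
  have "continuous_on (S m \<inter> \<gamma> m -` fst c) w"
    unfolding w_def
    by (intro continuous_at_imp_continuous_on ballI has_vector_derivative_continuous[OF geodesic_on_chart[OF \<gamma>[OF U(2)] S0 c(1)]]) auto
  then have o2: "open ((S m \<inter> \<gamma> m -` fst c) \<inter> w -` ball (w t) r)"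
    by (rule open_domain_restrict[OF o1]) auto
  \<comment> \<open>Two times in \<open>T\<close> differ by less than \<open>a\<close>, so the flow
    time \<open>s2 - s1\<close> is admissible; the data of the central geodesic stay in the ball of
    initial values.\<close>
  define T where "T = ((S m \<inter> \<gamma> m -` fst c) \<inter> w -` ball (w t) r) \<inter> ball t (a / 2)"
  have T: "open T" "t \<in> T" unfolding T_def using o2 tS c \<Phi> by auto
  have step: "orthogonal_variation \<gamma> m c s2"
    if s1: "s1 \<in> T \<inter> {0..1}" and s2: "s2 \<in> T \<inter> {0..1}" and P: "orthogonal_variation \<gamma> m c s1" for s1 s2
  proof -
    obtain \<xi> \<eta> where der: "((\<lambda>u. (snd c (\<gamma> u s1), velocity A (\<gamma> u) s1 c)) has_vector_derivative (\<xi>, \<eta>)) (at m)" and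
      G0: "G c (snd c (\<gamma> m s1)) \<xi> (velocity A (\<gamma> m) s1 c) = 0" and
      ev: "\<forall>\<^sub>F u in nhds m. \<gamma> u s1 \<in> fst c"
      using P unfolding orthogonal_variation_def by blast
    define Z where "Z u = (snd c (\<gamma> u s1), velocity A (\<gamma> u) s1 c)" for u
    have dZ: "(Z has_vector_derivative (\<xi>, \<eta>)) (at m)" using der by (simp add: Z_def[abs_def])
    have Z0: "Z m = w s1" by (simp add: Z_def w_def)
    have Z0b: "Z m \<in> ball (w t) r" using s1 by (simp add: Z0 T_def)
    have "\<bar>t - s1\<bar> < a / 2" "\<bar>t - s2\<bar> < a / 2" using s1 s2 by (simp_all add: T_def dist_real_def)
    then have \<sigma>: "s2 - s1 \<in> {-a<..<a}" unfolding greaterThanLessThan_iff by argo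
    have "continuous (at m) Z" by (rule has_vector_derivative_continuous[OF dZ])
    then have "\<forall>\<^sub>F u in nhds m. Z u \<in> ball (w t) r"
      using eventually_nhds_continuous[OF _ open_ball] Z0b by blast
    moreover have "\<forall>\<^sub>F u in nhds m. u \<in> U" using U by (rule eventually_nhds_in_open)
    ultimately have "\<forall>\<^sub>F u in nhds m. u \<in> U \<and> \<gamma> u s1 \<in> fst c \<and> Z u \<in> ball (w t) r"
      using ev by eventually_elim auto
    then obtain V where V: "open V" "m \<in> V" "\<And>u. u \<in> V \<Longrightarrow> u \<in> U" "\<And>u. u \<in> V \<Longrightarrow> \<gamma> u s1 \<in> fst c"
      "\<And>u. u \<in> V \<Longrightarrow> Z u \<in> ball (w t) r" unfolding eventually_nhds by blast
    let ?\<delta> = "\<lambda>u s. inv_chart c (fst (\<Phi> s (Z u)))"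
    have \<delta>0: "?\<delta> u 0 = \<gamma> u s1" "velocity A (?\<delta> u) 0 c = velocity A (\<gamma> u) s1 c" "velocity A (?\<delta> u) 0 = velocity A (\<gamma> u) s1"
      if u: "u \<in> V" for u
    proof -
      have s1S: "s1 \<in> S u" using S(3)[OF V(3)[OF u]] s1 by auto
      show 1: "?\<delta> u 0 = \<gamma> u s1" using \<Phi>(5)[OF V(5)[OF u]] chart_inv[OF ch V(4)[OF u]] by (simp add: Z_def)
      have "velocity A (?\<delta> u) 0 = coord_vec A c (\<gamma> u s1) (velocity A (\<gamma> u) s1 c)"
        using \<Phi>(9)[OF _ V(5)[OF u], of 0] \<Phi>(1) \<Phi>(5)[OF V(5)[OF u]] 1 by (simp add: Z_def)
      also have "\<dots> = velocity A (\<gamma> u) s1"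
        by (rule coord_vec_tangent_eq[OF atlas c(1) V(4)[OF u] velocity_tangent[OF atlas geodesic_smooth[OF \<gamma>] S(1) s1S]])
          (use V(3)[OF u] in auto)
      finally show "velocity A (?\<delta> u) 0 = velocity A (\<gamma> u) s1" .
      then show "velocity A (?\<delta> u) 0 c = velocity A (\<gamma> u) s1 c" by simp
    qed
    \<comment> \<open>The geodesic shifted by \<open>s1\<close> and the flow trajectory have the
      same data at 0, hence agree on the intersection of their intervals.\<close>
    have eq: "\<gamma> u s2 \<in> fst c \<and> (snd c (\<gamma> u s2), velocity A (\<gamma> u) s2 c) = \<Phi> (s2 - s1) (Z u)" if u: "u \<in> V" for u
    proof -
      let ?S = "{s. s + s1 \<in> S u} \<inter> {-a<..<a}"
      have uU: "u \<in> U" by (rule V(3)[OF u])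
      have gs: "geodesic_on A g {s. s + s1 \<in> S u} (\<lambda>s. \<gamma> u (s + s1))"
        using geodesic_affine[OF \<gamma>[OF uU] S(1)[OF uU], of 1 s1] by simp
      have gv: "velocity A (\<lambda>s. \<gamma> u (s + s1)) s = velocity A (\<gamma> u) (s + s1)" if "s + s1 \<in> S u" for s
        using curve_affine_velocity[OF geodesic_smooth[OF \<gamma>[OF uU]], of 1 s s1] that by (simp add: tscale_def)
      have int: "is_interval {s. s + s1 \<in> S u}"
        using S(2)[OF uU] unfolding is_interval_1 by (metis add_le_cancel_right mem_Collect_eq)
      have "open ?S"
        by (intro open_Int open_greaterThanLessThan)
          (use open_vimage[OF S(1)[OF uU], of "\<lambda>s. s + s1"] in \<open>simp add: vimage_def continuous_intros\<close>)
      moreover have "connected ?S"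
        using int is_interval_Int[OF int, of "{-a<..<a}"] is_interval_connected by (simp add: is_interval_oo)
      moreover have "0 \<in> ?S" "s2 - s1 \<in> ?S" using S(3)[OF uU] s1 s2 \<Phi>(1) \<sigma> by auto
      moreover have "\<gamma> u (0 + s1) = ?\<delta> u 0" "velocity A (\<lambda>s. \<gamma> u (s + s1)) 0 = velocity A (?\<delta> u) 0"
        using \<delta>0[OF u] gv[of 0] S(3)[OF uU] s1 by auto
      ultimately have "\<gamma> u (s2 - s1 + s1) = ?\<delta> u (s2 - s1) \<and> velocity A (\<lambda>s. \<gamma> u (s + s1)) (s2 - s1) = velocity A (?\<delta> u) (s2 - s1)"
        by (intro geodesic_unique[where S = ?S and a = 0 and \<gamma> = "\<lambda>s. \<gamma> u (s + s1)" and \<delta> = "?\<delta> u" and t = "s2 - s1"]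
            geodesic_on_subset[OF gs] geodesic_on_subset[OF \<Phi>(8)[OF V(5)[OF u]]]) auto
      then have 1: "\<gamma> u s2 = ?\<delta> u (s2 - s1)" "velocity A (\<gamma> u) s2 = velocity A (?\<delta> u) (s2 - s1)"
        using gv[of "s2 - s1"] S(3)[OF uU] s2 by auto
      have 2: "fst (\<Phi> (s2 - s1) (Z u)) \<in> img c" by (rule \<Phi>(6)[OF \<sigma> V(5)[OF u]])
      show ?thesis
        using 1 \<Phi>(9)[OF \<sigma> V(5)[OF u]] chart_inv_dom[OF ch 2] chart_image_inv[OF ch 2]
          coord_vec_chart[OF ch c(1) chart_inv_dom[OF ch 2]] by (simp add: prod_eq_iff)
    qed
    define D\<Phi> where "D\<Phi> p = frechet_derivative (\<lambda>p. \<Phi> (fst p) (snd p)) (at p)" for p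
    have d\<Phi>: "((\<lambda>p. \<Phi> (fst p) (snd p)) has_derivative D\<Phi> (\<tau>, z)) (at (\<tau>, z))" if "\<tau> \<in> {-a<..<a}" "z \<in> ball (w t) r" for \<tau> z
      unfolding D\<Phi>_def by (rule smooth_on_has_derivative[OF \<Phi>(4)]) (use that in auto)
    \<comment> \<open>The Jacobi field in coordinates: its first component is the variation of the
      position, its second that of the velocity.\<close>
    define \<psi> where "\<psi> \<tau> = D\<Phi> (\<tau>, Z m) (0, \<xi>, \<eta>)" for \<tau>
    have d\<Phi>Z: "((\<lambda>u. \<Phi> \<tau> (Z u)) has_vector_derivative \<psi> \<tau>) (at m)" if \<tau>: "\<tau> \<in> {-a<..<a}" for \<tau>
    proof -
      have "((\<lambda>u. (\<tau>, Z u)) has_vector_derivative (0, \<xi>, \<eta>)) (at m)"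
        by (intro has_vector_derivative_Pair has_vector_derivative_const dZ)
      then show ?thesis
        using has_vector_derivative_linear_image[where x = "\<lambda>u. (\<tau>, Z u)" and t = m, OF d\<Phi>[OF \<tau> Z0b]] by (simp add: \<psi>_def)
    qed
    define x where "x \<tau> = fst (\<Phi> \<tau> (Z m))" for \<tau>
    define y where "y \<tau> = snd (\<Phi> \<tau> (Z m))" for \<tau>
    have \<Phi>xy: "\<Phi> \<tau> (Z m) = (x \<tau>, y \<tau>)" for \<tau> by (simp add: x_def y_def)
    have xi: "x \<tau> \<in> img c" if "\<tau> \<in> {-a<..<a}" for \<tau> using \<Phi>(6)[OF that Z0b] by (simp add: x_def)
    have dxy: "((\<lambda>\<tau>. (x \<tau>, y \<tau>)) has_vector_derivative geo_field c (x \<tau>, y \<tau>)) (at \<tau>)" if "\<tau> \<in> {-a<..<a}" for \<tau>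
      using \<Phi>(7)[OF that Z0b] by (simp add: \<Phi>xy)
    have dx: "(x has_derivative (\<lambda>h. h *\<^sub>R y \<tau>)) (at \<tau>)"
      and dy: "(y has_derivative (\<lambda>h. h *\<^sub>R (- christoffel A g c (x \<tau>) (y \<tau>) (y \<tau>)))) (at \<tau>)" if "\<tau> \<in> {-a<..<a}" for \<tau>
      using has_vector_derivative_linear_image[OF bounded_linear_imp_has_derivative[OF bounded_linear_fst] dxy[OF that]]
        has_vector_derivative_linear_image[OF bounded_linear_imp_has_derivative[OF bounded_linear_snd] dxy[OF that]]
      by (simp_all add: geo_field_def has_vector_derivative_def)
    \<comment> \<open>Time and parameter derivatives of the flow commute, and the position component
      moves with the velocity.\<close>
    have d\<psi>: "((\<lambda>\<tau>. fst (\<psi> \<tau>)) has_derivative (\<lambda>h. h *\<^sub>R snd (\<psi> \<tau>))) (at \<tau>)" if \<tau>: "\<tau> \<in> {-a<..<a}" for \<tau>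
    proof -
      have pN: "(\<tau>, Z m) \<in> ?N" using \<tau> Z0b by simp
      have "((\<lambda>p. D\<Phi> p (0, \<xi>, \<eta>)) has_derivative frechet_derivative (\<lambda>p. D\<Phi> p (0, \<xi>, \<eta>)) (at (\<tau>, Z m))) (at (\<tau>, Z m))"
        unfolding D\<Phi>_def by (rule smooth_on_has_derivative[OF smooth_on_frechet[OF \<Phi>(4)] pN])
      moreover have "((\<lambda>\<tau>. (\<tau>, Z m)) has_vector_derivative (1, 0)) (at \<tau>)"
        by (auto intro!: derivative_eq_intros has_vector_derivative_Pair)
      ultimately have "(\<psi> has_vector_derivative frechet_derivative (\<lambda>p. D\<Phi> p (0, \<xi>, \<eta>)) (at (\<tau>, Z m)) (1, 0)) (at \<tau>)"
        unfolding \<psi>_def using has_vector_derivative_linear_image[where x = "\<lambda>\<tau>. (\<tau>, Z m)" and t = \<tau>] by blast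
      then have 1: "((\<lambda>\<tau>. fst (\<psi> \<tau>)) has_vector_derivative fst (frechet_derivative (\<lambda>p. D\<Phi> p (0, \<xi>, \<eta>)) (at (\<tau>, Z m)) (1, 0))) (at \<tau>)"
        by (rule has_vector_derivative_linear_image[OF bounded_linear_imp_has_derivative[OF bounded_linear_fst]])
      have "frechet_derivative (\<lambda>p. D\<Phi> p (0, \<xi>, \<eta>)) (at (\<tau>, Z m)) (1, 0) = frechet_derivative (\<lambda>p. D\<Phi> p (1, 0)) (at (\<tau>, Z m)) (0, \<xi>, \<eta>)"
        unfolding D\<Phi>_def by (rule frechet_derivative_symmetric[OF oN \<Phi>(4) pN])
      moreover have D1: "fst (D\<Phi> p (1, 0)) = snd (\<Phi> (fst p) (snd p))" if p: "p \<in> ?N" for p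
      proof -
        obtain \<tau> z where [simp]: "p = (\<tau>, z)" by (cases p)
        have "((\<lambda>\<tau>. (\<tau>, z)) has_vector_derivative (1, 0)) (at \<tau>)"
          by (auto intro!: derivative_eq_intros has_vector_derivative_Pair)
        then have "((\<lambda>\<tau>. \<Phi> \<tau> z) has_vector_derivative D\<Phi> (\<tau>, z) (1, 0)) (at \<tau>)"
          using has_vector_derivative_linear_image[where x = "\<lambda>\<tau>. (\<tau>, z)" and t = \<tau>, OF d\<Phi>] p by simp
        then have "D\<Phi> (\<tau>, z) (1, 0) = geo_field c (\<Phi> \<tau> z)"
          using \<Phi>(7)[of \<tau> z] p vector_derivative_unique_at by auto
        then show ?thesis by (simp add: geo_field_def)
      qed
      have "fst (frechet_derivative (\<lambda>p. D\<Phi> p (1, 0)) (at (\<tau>, Z m)) (0, \<xi>, \<eta>)) = snd (\<psi> \<tau>)"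
      proof -
        have "((\<lambda>p. D\<Phi> p (1, 0)) has_derivative frechet_derivative (\<lambda>p. D\<Phi> p (1, 0)) (at (\<tau>, Z m))) (at (\<tau>, Z m))"
          unfolding D\<Phi>_def by (rule smooth_on_has_derivative[OF smooth_on_frechet[OF \<Phi>(4)] pN])
        then have "((\<lambda>p. fst (D\<Phi> p (1, 0))) has_derivative (\<lambda>h. fst (frechet_derivative (\<lambda>p. D\<Phi> p (1, 0)) (at (\<tau>, Z m)) h))) (at (\<tau>, Z m))"
          by (rule has_derivative_fst)
        then have A1: "((\<lambda>p. snd (\<Phi> (fst p) (snd p))) has_derivative (\<lambda>h. fst (frechet_derivative (\<lambda>p. D\<Phi> p (1, 0)) (at (\<tau>, Z m)) h))) (at (\<tau>, Z m))"
          by (rule has_derivative_transform_within_open[OF _ oN pN]) (rule D1)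
        have A2: "((\<lambda>p. snd (\<Phi> (fst p) (snd p))) has_derivative (\<lambda>h. snd (D\<Phi> (\<tau>, Z m) h))) (at (\<tau>, Z m))"
          by (rule has_derivative_snd[OF d\<Phi>[OF \<tau> Z0b]])
        from fun_cong[OF has_derivative_unique[OF A1 A2], of "(0, \<xi>, \<eta>)"] show ?thesis by (simp add: \<psi>_def)
      qed
      ultimately show ?thesis using 1 by (simp add: has_vector_derivative_def)
    qed
    \<comment> \<open>Constancy of the squared speed in the parameter, differentiated at
      \<open>m\<close>.\<close>
    have energy: "DG c (x \<tau>) (y \<tau>) (y \<tau>) (fst (\<psi> \<tau>)) + 2 * G c (x \<tau>) (snd (\<psi> \<tau>)) (y \<tau>) = 0" if \<tau>: "\<tau> \<in> {-a<..<a}" for \<tau>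
    proof -
      have e: "G c (fst (\<Phi> \<tau> (Z u))) (snd (\<Phi> \<tau> (Z u))) (snd (\<Phi> \<tau> (Z u))) = \<kappa>" if u: "u \<in> V" for u
      proof -
        have uU: "u \<in> U" by (rule V(3)[OF u])
        note geo = \<Phi>(8)[OF V(5)[OF u]]
        have im: "fst (\<Phi> \<tau> (Z u)) \<in> img c" by (rule \<Phi>(6)[OF \<tau> V(5)[OF u]])
        have vt: "velocity A (?\<delta> u) \<tau> \<in> tangent_space A (?\<delta> u \<tau>)"
          by (rule velocity_tangent[OF atlas geodesic_smooth[OF geo] _ \<tau>]) auto
        have "G c (fst (\<Phi> \<tau> (Z u))) (snd (\<Phi> \<tau> (Z u))) (snd (\<Phi> \<tau> (Z u))) = g (?\<delta> u \<tau>) (velocity A (?\<delta> u) \<tau>) (velocity A (?\<delta> u) \<tau>)"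
          using metric_chart[OF c(1) chart_inv_dom[OF ch im] vt vt] \<Phi>(9)[OF \<tau> V(5)[OF u]]
            coord_vec_chart[OF ch c(1) chart_inv_dom[OF ch im]] chart_image_inv[OF ch im] by simp
        also have "\<dots> = g (?\<delta> u 0) (velocity A (?\<delta> u) 0) (velocity A (?\<delta> u) 0)"
          by (rule geodesic_speed_constant[OF geo]) (use \<tau> \<Phi>(1) in auto)
        also have "\<dots> = g (\<gamma> u s1) (velocity A (\<gamma> u) s1) (velocity A (\<gamma> u) s1)"
          by (simp only: \<delta>0[OF u])
        also have "\<dots> = g (\<gamma> u 0) (velocity A (\<gamma> u) 0) (velocity A (\<gamma> u) 0)"
          by (rule geodesic_speed_constant[OF \<gamma>[OF uU] S(1)[OF uU] is_interval_connected[OF S(2)[OF uU]]]) (use S(3)[OF uU] s1 in auto)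
        finally show ?thesis using speed[OF uU] by simp
      qed
      have d1: "((\<lambda>u. fst (\<Phi> \<tau> (Z u))) has_derivative (\<lambda>h. h *\<^sub>R fst (\<psi> \<tau>))) (at m)"
        and d2: "((\<lambda>u. snd (\<Phi> \<tau> (Z u))) has_derivative (\<lambda>h. h *\<^sub>R snd (\<psi> \<tau>))) (at m)"
        using has_vector_derivative_linear_image[OF bounded_linear_imp_has_derivative[OF bounded_linear_fst] d\<Phi>Z[OF \<tau>]]
          has_vector_derivative_linear_image[OF bounded_linear_imp_has_derivative[OF bounded_linear_snd] d\<Phi>Z[OF \<tau>]]
        by (simp_all add: has_vector_derivative_def)
      have "((\<lambda>u. G c (fst (\<Phi> \<tau> (Z u))) (snd (\<Phi> \<tau> (Z u))) (snd (\<Phi> \<tau> (Z u)))) has_derivative (\<lambda>h. DG c (x \<tau>) (y \<tau>) (y \<tau>) (h *\<^sub>R fst (\<psi> \<tau>)) +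
          G c (x \<tau>) (h *\<^sub>R snd (\<psi> \<tau>)) (y \<tau>) + G c (x \<tau>) (y \<tau>) (h *\<^sub>R snd (\<psi> \<tau>)))) (at m)"
        using G_comp_derivative[OF c(1) d1 \<Phi>(6)[OF \<tau> Z0b] d2 d2] by (simp add: x_def y_def)
      moreover have "((\<lambda>u. G c (fst (\<Phi> \<tau> (Z u))) (snd (\<Phi> \<tau> (Z u))) (snd (\<Phi> \<tau> (Z u)))) has_derivative (\<lambda>h. 0)) (at m)"
        by (rule has_derivative_transform_within_open[OF has_derivative_const[of \<kappa>] V(1,2)]) (simp add: e)
      ultimately have "(\<lambda>h. DG c (x \<tau>) (y \<tau>) (y \<tau>) (h *\<^sub>R fst (\<psi> \<tau>)) +
          G c (x \<tau>) (h *\<^sub>R snd (\<psi> \<tau>)) (y \<tau>) + G c (x \<tau>) (y \<tau>) (h *\<^sub>R snd (\<psi> \<tau>))) = (\<lambda>h. 0)" by (rule has_derivative_unique)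
      from fun_cong[OF this, of 1] show ?thesis using G_sym[OF c(1) xi[OF \<tau>], of "y \<tau>" "snd (\<psi> \<tau>)"] by simp
    qed
    \<comment> \<open>The derivative in \<tau> consists of the metric derivative, the variation of
      the velocity and a Christoffel term; inserting the Koszul formula leaves half of
      \<open>energy\<close>.\<close>
    have "G c (x (s2 - s1)) (fst (\<psi> (s2 - s1))) (y (s2 - s1)) = G c (x 0) (fst (\<psi> 0)) (y 0)"
    proof (rule has_derivative_zero_unique_connected[of "{-a<..<a}" "\<lambda>\<tau>. G c (x \<tau>) (fst (\<psi> \<tau>)) (y \<tau>)"])
      fix \<tau> assume \<tau>: "\<tau> \<in> {-a<..<a}"
      let ?k = "christoffel A g c (x \<tau>) (y \<tau>) (y \<tau>)"
      have k: "G c (x \<tau>) (fst (\<psi> \<tau>)) ?k = DG c (x \<tau>) (fst (\<psi> \<tau>)) (y \<tau>) (y \<tau>) - DG c (x \<tau>) (y \<tau>) (y \<tau>) (fst (\<psi> \<tau>)) / 2"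
        using G_christoffel[OF c(1) xi[OF \<tau>], of "y \<tau>" "y \<tau>" "fst (\<psi> \<tau>)"] G_sym[OF c(1) xi[OF \<tau>], of "fst (\<psi> \<tau>)" ?k]
          DG_sym[OF c(1) xi[OF \<tau>], of "fst (\<psi> \<tau>)" "y \<tau>" "y \<tau>"] by (simp add: koszul_def)
      have "DG c (x \<tau>) (fst (\<psi> \<tau>)) (y \<tau>) (h *\<^sub>R y \<tau>) + G c (x \<tau>) (h *\<^sub>R snd (\<psi> \<tau>)) (y \<tau>) + G c (x \<tau>) (fst (\<psi> \<tau>)) (h *\<^sub>R (- ?k)) = 0" for h
      proof -
        have "DG c (x \<tau>) (fst (\<psi> \<tau>)) (y \<tau>) (h *\<^sub>R y \<tau>) + G c (x \<tau>) (h *\<^sub>R snd (\<psi> \<tau>)) (y \<tau>) + G c (x \<tau>) (fst (\<psi> \<tau>)) (h *\<^sub>R (- ?k))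
          = h * (DG c (x \<tau>) (fst (\<psi> \<tau>)) (y \<tau>) (y \<tau>) + G c (x \<tau>) (snd (\<psi> \<tau>)) (y \<tau>) - G c (x \<tau>) (fst (\<psi> \<tau>)) ?k)"
          by (simp add: DG_algebra[OF c(1) xi[OF \<tau>]] G_bil[OF c(1) xi[OF \<tau>]] algebra_simps)
        also have "DG c (x \<tau>) (fst (\<psi> \<tau>)) (y \<tau>) (y \<tau>) + G c (x \<tau>) (snd (\<psi> \<tau>)) (y \<tau>) - G c (x \<tau>) (fst (\<psi> \<tau>)) ?k = 0"
          using k energy[OF \<tau>] by simp
        finally show ?thesis by simp
      qed
      then show "((\<lambda>\<tau>. G c (x \<tau>) (fst (\<psi> \<tau>)) (y \<tau>)) has_derivative (\<lambda>x. 0)) (at \<tau>)"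
        using G_comp_derivative[OF c(1) dx[OF \<tau>] xi[OF \<tau>] d\<psi>[OF \<tau>] dy[OF \<tau>]] by simp
    qed (use \<sigma> \<Phi>(1) in auto)
    moreover have "\<psi> 0 = (\<xi>, \<eta>)"
    proof (rule vector_derivative_unique_at[OF d\<Phi>Z])
      show "((\<lambda>u. \<Phi> 0 (Z u)) has_vector_derivative (\<xi>, \<eta>)) (at m)"
        by (rule has_vector_derivative_transform_within_open[OF dZ V(1,2)]) (rule sym, rule \<Phi>(5), rule V(5))
    qed (use \<Phi>(1) in auto)
    moreover have "\<Phi> 0 (Z m) = Z m" by (rule \<Phi>(5)[OF Z0b])
    ultimately have final: "G c (x (s2 - s1)) (fst (\<psi> (s2 - s1))) (y (s2 - s1)) = 0"
      using G0 by (simp add: x_def y_def Z_def)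
    have d2: "((\<lambda>u. (snd c (\<gamma> u s2), velocity A (\<gamma> u) s2 c)) has_vector_derivative \<psi> (s2 - s1)) (at m)"
      by (rule has_vector_derivative_transform_within_open[OF d\<Phi>Z[OF \<sigma>] V(1,2)]) (use eq in metis)
    have "\<forall>\<^sub>F u in nhds m. \<gamma> u s2 \<in> fst c" unfolding eventually_nhds using V eq by blast
    moreover have "(snd c (\<gamma> m s2), velocity A (\<gamma> m) s2 c) = (x (s2 - s1), y (s2 - s1))"
      using eq[OF V(2)] by (simp add: \<Phi>xy)
    moreover have "((\<lambda>u. (snd c (\<gamma> u s2), velocity A (\<gamma> u) s2 c)) has_vector_derivative
        (fst (\<psi> (s2 - s1)), snd (\<psi> (s2 - s1)))) (at m)" using d2 by simp
    moreover have "G c (snd c (\<gamma> m s2)) (fst (\<psi> (s2 - s1))) (velocity A (\<gamma> m) s2 c) = 0"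
      using final calculation(2) by simp
    ultimately show ?thesis
      unfolding orthogonal_variation_def using eq[OF V(2)] by blast
  qed
  show thesis
    by (rule that[OF T _ step]) (auto simp: T_def)
qed

text \<open>Orthogonality in every chart around the point is shown to be locally constant along
  [0,1]: within one chart by propagation, between charts by the change of charts. Connectedness
  carries it from 0 to \<open>s\<close>.\<close>

lemma gauss_lemma:
  fixes \<gamma> :: "real \<Rightarrow> real \<Rightarrow> 'a" and S :: "real \<Rightarrow> real set"
  assumes U: "open U" "m \<in> U"
    and S: "\<And>u. u \<in> U \<Longrightarrow> open (S u)" "\<And>u. u \<in> U \<Longrightarrow> is_interval (S u)" "\<And>u. u \<in> U \<Longrightarrow> {0..1} \<subseteq> S u"
    and \<gamma>: "\<And>u. u \<in> U \<Longrightarrow> geodesic_on A g (S u) (\<gamma> u)"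
    and speed: "\<And>u. u \<in> U \<Longrightarrow> g (\<gamma> u 0) (velocity A (\<gamma> u) 0) (velocity A (\<gamma> u) 0) = \<kappa>"
    and c0: "c0 \<in> A" "orthogonal_variation \<gamma> m c0 0"
    and s: "s \<in> {0..1}" and c: "c \<in> A" "\<gamma> m s \<in> fst c"
  shows "orthogonal_variation \<gamma> m c s"
proof -
  note change = orthogonal_variation_chart_change[where \<gamma> = \<gamma> and S = S and U = U and m = m, OF U S \<gamma>]
  define Q where "Q s \<longleftrightarrow> (\<forall>c\<in>A. \<gamma> m s \<in> fst c \<longrightarrow> orthogonal_variation \<gamma> m c s)" for s
  have "Q s"
  proof (rule connected_induction_simple[where S = "{0..1::real}" and a = 0 and b = s and P = Q])
    show "Q 0" unfolding Q_def using change[where s = 0 and c = c0] c0 by auto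
    fix t :: real assume t: "t \<in> {0..1}"
    obtain c where c: "c \<in> A" "\<gamma> m t \<in> fst c" using atlas_cover[OF atlas] .
    obtain T where T: "open T" "t \<in> T" "\<And>s. s \<in> T \<inter> {0..1} \<Longrightarrow> \<gamma> m s \<in> fst c"
      "\<And>s1 s2. s1 \<in> T \<inter> {0..1} \<Longrightarrow> s2 \<in> T \<inter> {0..1} \<Longrightarrow> orthogonal_variation \<gamma> m c s1 \<Longrightarrow> orthogonal_variation \<gamma> m c s2"
      using orthogonal_variation_propagate[where \<gamma> = \<gamma> and S = S and U = U and m = m and \<kappa> = \<kappa> and t = t and c = c,
          OF U S \<gamma> speed t c] by blast
    have "Q s2" if "s1 \<in> T \<inter> {0..1}" "s2 \<in> T \<inter> {0..1}" "Q s1" for s1 s2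
    proof -
      have "orthogonal_variation \<gamma> m c s1" using that T(3) c unfolding Q_def by blast
      then have "orthogonal_variation \<gamma> m c s2" using T(4) that by blast
      then show ?thesis unfolding Q_def using change[where s = s2 and c = c] c(1) that(2) by blast
    qed
    moreover have "openin (top_of_set {0..1}) ({0..1} \<inter> T)" using T(1) by (rule openin_open_Int)
    ultimately show "\<exists>T. openin (top_of_set {0..1}) T \<and> t \<in> T \<and> (\<forall>x\<in>T. \<forall>y\<in>T. Q x \<longrightarrow> Q y)"
      using t T(2) by (intro exI[of _ "{0..1} \<inter> T"]) blast
  qed (use s in auto)
  then show ?thesis using c by (simp add: Q_def)
qed

end

section \<open>The parametrized surfaces have constant angle\<close>

lemma prod_chart_inject: "prod_chart c = prod_chart d \<Longrightarrow> c = d"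
proof (rule prod_eqI)
  assume eq: "prod_chart c = prod_chart d"
  have "fst c \<times> (UNIV :: real set) = fst d \<times> UNIV" using arg_cong[OF eq, of fst] by simp
  then show "fst c = fst d" by (auto simp: times_eq_iff)
  have "snd (prod_chart c) (p, 0) = snd (prod_chart d) (p, 0)" for p using eq by simp
  then show "snd c = snd d" by (auto simp: fun_eq_iff)
qed

text \<open>The vector with component \<xi> along \<open>M\<close> and component \<open>s\<close>
  along the line, as a family over product charts. The \<open>THE\<close> recovers the factor chart,
  which is unique by \<open>prod_chart_inject\<close>.\<close>

definition lift_vec :: "('a, 'e::euclidean_space) chart set \<Rightarrow> 'a \<times> real \<Rightarrow> ('a, 'e) tvec \<Rightarrow> real \<Rightarrow> ('a \<times> real, 'e \<times> real) tvec" where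
  "lift_vec A q \<xi> s = (\<lambda>d. if d \<in> prod_atlas A \<and> q \<in> dom_chart d then (\<xi> (THE c. d = prod_chart c), s) else 0)"

lemma lift_vec_chart: "c \<in> A \<Longrightarrow> fst q \<in> fst c \<Longrightarrow> lift_vec A q \<xi> s (prod_chart c) = (\<xi> c, s)"
proof -
  assume "c \<in> A" "fst q \<in> fst c"
  moreover have "(THE c'. prod_chart c = prod_chart c') = c" by (rule the_equality) (auto dest: prod_chart_inject)
  ultimately show ?thesis by (simp add: lift_vec_def prod_chart_in_atlas mem_Times_iff)
qed

lemma rep_prod_id_derivative:
  assumes A: "smooth_atlas A" and c: "c \<in> A" "fst q \<in> fst c" and d: "d \<in> A" "fst q \<in> fst d"
  shows "frechet_derivative (rep (prod_chart c) (prod_chart d) id) (at (snd (prod_chart c) q)) v =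
    (frechet_derivative (rep c d id) (at (snd c (fst q))) (fst v), snd v)"
proof -
  note ch = atlas_chart[OF A c(1)]
  have o: "open (snd c ` fst c \<times> (UNIV :: real set))" using chart_open_image[OF ch] by (simp add: open_Times)
  have r: "(rep c d id has_derivative frechet_derivative (rep c d id) (at (snd c (fst q)))) (at (fst (snd (prod_chart c) q)))"
    using transition_has_derivative[OF A c(1) d(1) c(2) d(2)] by simp
  have "((\<lambda>y. rep c d id (fst y)) has_derivative (\<lambda>v. frechet_derivative (rep c d id) (at (snd c (fst q))) (fst v))) (at (snd (prod_chart c) q))"
    using diff_chain_at[OF bounded_linear_imp_has_derivative[OF bounded_linear_fst] r] by (simp add: o_def)
  from has_derivative_Pair[OF this bounded_linear_imp_has_derivative[OF bounded_linear_snd]]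
  have "(rep (prod_chart c) (prod_chart d) id has_derivative (\<lambda>v. (frechet_derivative (rep c d id) (at (snd c (fst q))) (fst v), snd v))) (at (snd (prod_chart c) q))"
    by (rule has_derivative_transform_within_open[OF _ o]) (use c in \<open>auto simp: rep_def inv_prod_chart'[OF ch]\<close>)
  from fun_cong[OF frechet_derivative_at[OF this], of v] show ?thesis by simp
qed

lemma lift_vec_tangent:
  assumes A: "smooth_atlas A" and \<xi>: "\<xi> \<in> tangent_space A (fst q)"
  shows "lift_vec A q \<xi> s \<in> tangent_space (prod_atlas A) q"
proof (rule tangent_spaceI)
  fix c' d' assume *: "c' \<in> prod_atlas A" "d' \<in> prod_atlas A" "q \<in> dom_chart c'" "q \<in> dom_chart d'"
  obtain c d where c: "c \<in> A" "c' = prod_chart c" and d: "d \<in> A" "d' = prod_chart d" using * by (auto elim!: prod_atlasE)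
  have q: "fst q \<in> fst c" "fst q \<in> fst d" using * c d by (auto simp: mem_Times_iff)
  show "lift_vec A q \<xi> s d' = frechet_derivative (rep c' d' id) (at (snd c' q)) (lift_vec A q \<xi> s c')"
    unfolding c(2) d(2) rep_prod_id_derivative[OF A c(1) q(1) d(1) q(2)] lift_vec_chart[OF c(1) q(1)] lift_vec_chart[OF d(1) q(2)]
    using tangent_space_chart[OF \<xi> c(1) d(1) q] by simp
qed (auto simp: lift_vec_def)

text \<open>A curve in the surface has surface coordinates \<omega> that are only known to be
  continuous. An injective linear map is bounded below, so \<omega>(t) - \<omega>(0) is at most a
  multiple of t, and the remainder in the derivative of \<open>Y\<close> is negligible. The vectors
  \<open>L ((1 / t) *\<^sub>R e t)\<close> then converge to \<open>y'\<close>, and the range of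
  \<open>L\<close> is closed.\<close>

lemma tangent_direction_in_range:
  fixes Y :: "'d::euclidean_space \<Rightarrow> 'e::euclidean_space" and \<omega> :: "real \<Rightarrow> 'd"
  assumes Y: "(Y has_derivative L) (at (\<omega> 0))" and inj: "\<And>v. L v = 0 \<Longrightarrow> v = 0"
    and \<omega>: "continuous (at 0) \<omega>" and y: "(y has_vector_derivative y') (at 0)"
    and eq: "\<forall>\<^sub>F t in nhds 0. Y (\<omega> t) = y t"
  shows "y' \<in> range L"
proof -
  have lin: "linear L" using Y by (rule has_derivative_linear)
  interpret L: bounded_linear L using Y by (rule has_derivative_bounded_linear)
  have "inj L" using inj linear_injective_0[OF lin] by blast
  then obtain B where B: "B > 0" "\<And>v. B * norm v \<le> norm (L v)"
    using linear_inj_bounded_below_pos[OF lin] by metis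
  define e where "e t = \<omega> t - \<omega> 0" for t
  have "(\<omega> \<longlongrightarrow> \<omega> 0) (at 0)" using \<omega> by (simp add: continuous_at)
  then have et: "(e \<longlongrightarrow> 0) (at 0)" unfolding e_def[abs_def] by (rule LIM_zero)
  have eq0: "Y (\<omega> 0) = y 0" using eventually_nhds_x_imp_x[OF eq] by simp
  \<comment> \<open>Half of \<open>B * norm (e t)\<close> is absorbed by the remainder of
    \<open>Y\<close>; the other half is bounded by the increment of \<open>y\<close>, which is at
    most \<open>(norm y' + 1) * norm t\<close> near 0.\<close>
  define C where "C = (2 / B) * (norm y' + 1)"
  have C: "0 \<le> C" using B by (simp add: C_def)
  have rem: "\<forall>\<^sub>F t in at 0. norm (Y (\<omega> t) - Y (\<omega> 0) - L (e t)) \<le> \<epsilon> * norm (e t)" if \<epsilon>: "\<epsilon> > 0" for \<epsilon>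
  proof -
    obtain d where d: "d > 0" "\<And>z. norm (z - \<omega> 0) < d \<Longrightarrow> norm (Y z - Y (\<omega> 0) - L (z - \<omega> 0)) \<le> \<epsilon> * norm (z - \<omega> 0)"
      using Y \<epsilon> unfolding has_derivative_at_alt by metis
    have "\<forall>\<^sub>F t in at 0. norm (e t) < d" using et d(1) by (simp add: tendsto_iff)
    then show ?thesis by (rule eventually_mono) (use d(2) in \<open>auto simp: e_def\<close>)
  qed
  have yr: "\<forall>\<^sub>F t in at 0. norm (y t - y 0 - t *\<^sub>R y') \<le> \<epsilon> * norm t" if \<epsilon>: "\<epsilon> > 0" for \<epsilon>
  proof -
    obtain d where d: "d > 0" "\<And>t. norm (t - 0) < d \<Longrightarrow> norm (y t - y 0 - (t - 0) *\<^sub>R y') \<le> \<epsilon> * norm (t - 0)"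
      using y \<epsilon> unfolding has_vector_derivative_def has_derivative_at_alt by metis
    then show ?thesis unfolding eventually_at by (intro exI[of _ d]) (auto simp: dist_norm)
  qed
  have eq': "\<forall>\<^sub>F t in at 0. Y (\<omega> t) = y t" using eq by (simp add: eventually_nhds_conv_at)
  have bound: "\<forall>\<^sub>F t in at 0. norm (e t) \<le> C * norm t"
    using rem[OF half_gt_zero[OF B(1)]] yr[OF zero_less_one] eq'
  proof eventually_elim
    case (elim t)
    have "B * norm (e t) \<le> norm (L (e t))" by (rule B(2))
    also have "\<dots> \<le> norm (y t - y 0) + B / 2 * norm (e t)"
      using elim eq0 norm_triangle_ineq4[of "Y (\<omega> t) - Y (\<omega> 0)" "Y (\<omega> t) - Y (\<omega> 0) - L (e t)"] by simp
    finally have 1: "B / 2 * norm (e t) \<le> norm (y t - y 0)" by simp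
    have "norm (y t - y 0) \<le> norm (t *\<^sub>R y') + norm (y t - y 0 - t *\<^sub>R y')"
      using norm_triangle_ineq[of "t *\<^sub>R y'" "y t - y 0 - t *\<^sub>R y'"] by simp
    also have "\<dots> \<le> (norm y' + 1) * norm t" using elim by (simp add: algebra_simps)
    finally show ?case using 1 B by (simp add: C_def field_simps)
  qed
  have lim: "((\<lambda>t. L ((1 / t) *\<^sub>R e t)) \<longlongrightarrow> y') (at 0)"
  proof (rule tendstoI)
    fix \<epsilon> :: real assume \<epsilon>: "0 < \<epsilon>"
    define \<eta> where "\<eta> = \<epsilon> / (2 * (C + 1))"
    have C1: "0 < C + 1" using C by linarith
    then have \<eta>': "\<eta> * (C + 1) = \<epsilon> / 2" by (simp add: \<eta>_def field_simps)
    have \<eta>: "0 < \<eta>" "\<eta> * (C + 1) < \<epsilon>" unfolding \<eta>' using \<epsilon> C1 by (simp_all add: \<eta>_def)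
    have "\<forall>\<^sub>F t in at (0::real). t \<noteq> 0" by (simp add: eventually_at_filter)
    then show "\<forall>\<^sub>F t in at 0. dist (L ((1 / t) *\<^sub>R e t)) y' < \<epsilon>"
      using rem[OF \<eta>(1)] yr[OF \<eta>(1)] bound eq'
    proof eventually_elim
      case (elim t)
      have "norm (L (e t) - t *\<^sub>R y') \<le> norm (y t - y 0 - t *\<^sub>R y') + norm (Y (\<omega> t) - Y (\<omega> 0) - L (e t))"
        using norm_triangle_ineq4[of "y t - y 0 - t *\<^sub>R y'" "Y (\<omega> t) - Y (\<omega> 0) - L (e t)"] elim(5) eq0
        by (simp add: algebra_simps)
      also have "\<dots> \<le> \<eta> * norm t + \<eta> * (C * norm t)"
        using elim(2,3) mult_left_mono[OF elim(4), of \<eta>] \<eta>(1) by linarith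
      also have "\<dots> = (\<eta> * (C + 1)) * norm t" by (simp add: algebra_simps)
      also have "\<dots> < \<epsilon> * norm t" using \<eta>(2) elim(1) by (intro mult_strict_right_mono) auto
      finally have 1: "norm (L (e t) - t *\<^sub>R y') < \<epsilon> * norm t" .
      have "L ((1 / t) *\<^sub>R e t) - y' = (1 / t) *\<^sub>R (L (e t) - t *\<^sub>R y')"
        using elim(1) by (simp add: L.scaleR scaleR_diff_right)
      then have "dist (L ((1 / t) *\<^sub>R e t)) y' = norm (L (e t) - t *\<^sub>R y') / norm t"
        by (simp add: dist_norm)
      then show ?case using 1 elim(1) by (simp add: divide_less_eq)
    qed
  qed
  have "closed (range L)" by (rule closed_subspace) (use lin linear_subspace_image subspace_UNIV in blast)
  then show ?thesis
    by (rule Lim_in_closed_set[OF _ _ _ lim]) (auto simp: trivial_limit_at)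
qed

section \<open>Unit normals of parametrized surfaces\<close>

context riemannian_surface
begin

lemma prod_atlas_smooth: "smooth_atlas (prod_atlas A)"
  by (rule smooth_atlas_prod[OF atlas])

lemma prod_metric_chart:
  "c \<in> A \<Longrightarrow> fst q \<in> fst c \<Longrightarrow> \<xi> \<in> tangent_space (prod_atlas A) q \<Longrightarrow> \<eta> \<in> tangent_space (prod_atlas A) q \<Longrightarrow>
   prod_metric A g q \<xi> \<eta> = G c (snd c (fst q)) (fst (\<xi> (prod_chart c))) (fst (\<eta> (prod_chart c))) + snd (\<xi> (prod_chart c)) * snd (\<eta> (prod_chart c))"
  by (rule prod_metric_in_chart[OF atlas])

lemma prod_metric_tscale:
  assumes "\<xi> \<in> tangent_space (prod_atlas A) q" "\<eta> \<in> tangent_space (prod_atlas A) q"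
  shows "prod_metric A g q (tscale r \<xi>) \<eta> = r * prod_metric A g q \<xi> \<eta>"
    and "prod_metric A g q \<eta> (tscale r \<xi>) = r * prod_metric A g q \<eta> \<xi>"
proof -
  obtain c where c: "c \<in> A" "fst q \<in> fst c" using atlas_cover[OF atlas] .
  have x: "snd c (fst q) \<in> img c" using c by auto
  note t = tangent_space_tscale[OF prod_atlas_smooth assms(1), of r]
  show "prod_metric A g q (tscale r \<xi>) \<eta> = r * prod_metric A g q \<xi> \<eta>"
    unfolding prod_metric_chart[OF c t assms(2)] prod_metric_chart[OF c assms]
    by (simp add: tscale_def G_bil[OF c(1) x] algebra_simps)
  show "prod_metric A g q \<eta> (tscale r \<xi>) = r * prod_metric A g q \<eta> \<xi>"
    unfolding prod_metric_chart[OF c assms(2) t] prod_metric_chart[OF c assms(2,1)]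
    by (simp add: tscale_def G_bil[OF c(1) x] algebra_simps)
qed

text \<open>The normal is carried back by the inverse of \<open>F\<close> and multiplied by the sign
  \<sigma> with which \<open>F\<close> acts on the vertical field, so that its product with the
  vertical field keeps the value \<open>k\<close>, not merely its absolute value.\<close>

lemma unit_normal_pull_back:
  fixes F :: "'a \<times> real \<Rightarrow> 'a \<times> real"
  assumes F: "vertical_isometry A g F" and W: "open W"
    and \<nu>: "unit_normal_field (prod_atlas A) (prod_metric A g) (F ` \<Sigma>) W \<nu>"
    and k: "\<And>q. q \<in> F ` \<Sigma> \<inter> W \<Longrightarrow> prod_metric A g q (\<nu> q) (vertical A q) = k"
  obtains \<mu> where "unit_normal_field (prod_atlas A) (prod_metric A g) \<Sigma> (F -` W) \<mu>"
    "\<And>q. q \<in> \<Sigma> \<inter> F -` W \<Longrightarrow> prod_metric A g q (\<mu> q) (vertical A q) = k" "open (F -` W)"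
proof -
  let ?B = "prod_atlas A" and ?h = "prod_metric A g"
  note B = prod_atlas_smooth
  have iso: "bij F" "smooth_map ?B ?B UNIV F" "smooth_map ?B ?B UNIV (inv F)"
    and met: "\<And>p \<xi> \<eta>. \<xi> \<in> tangent_space ?B p \<Longrightarrow> \<eta> \<in> tangent_space ?B p \<Longrightarrow>
      ?h (F p) (differential ?B ?B F p \<xi>) (differential ?B ?B F p \<eta>) = ?h p \<xi> \<eta>"
    using F unfolding vertical_isometry_def riemannian_isometry_def by blast+
  obtain \<sigma> where \<sigma>: "\<sigma> \<in> {1, -1::real}" "\<And>q. differential ?B ?B F q (vertical A q) = tscale \<sigma> (vertical A (F q))"
    using F unfolding vertical_isometry_def by blast
  have \<sigma>2: "\<sigma> * \<sigma> = 1" using \<sigma>(1) by auto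
  have invF: "inv F (F q) = q" "F (inv F q) = q" for q
    using iso(1) by (simp_all add: bij_is_inj bij_is_surj surj_f_inv_f)
  have Fc: "continuous_on UNIV F" using iso(2) smooth_map_continuous by blast
  define \<eta> where "\<eta> q = differential ?B ?B (inv F) (F q) (\<nu> (F q))" for q
  have \<nu>t: "\<nu> (F q) \<in> tangent_space ?B (F q)" "?h (F q) (\<nu> (F q)) (\<nu> (F q)) = 1"
    "\<And>\<zeta>. \<zeta> \<in> surface_tangent ?B (F ` \<Sigma>) (F q) \<Longrightarrow> ?h (F q) (\<nu> (F q)) \<zeta> = 0" if "q \<in> \<Sigma> \<inter> F -` W" for q
    using \<nu> that unfolding unit_normal_field_def by auto
  have \<eta>t: "\<eta> q \<in> tangent_space ?B q" if "q \<in> \<Sigma> \<inter> F -` W" for q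
    using differential_tangent[OF B B iso(3) open_UNIV UNIV_I \<nu>t(1)[OF that]] by (simp add: \<eta>_def invF)
  have F\<eta>: "differential ?B ?B F q (\<eta> q) = \<nu> (F q)" if q: "q \<in> \<Sigma> \<inter> F -` W" for q
  proof -
    have id: "F \<circ> inv F = id" by (simp add: fun_eq_iff invF)
    show ?thesis
      using differential_comp[OF B B B iso(3) iso(2) _ \<nu>t(1)[OF q]] smooth_map_id[OF B] differential_id[OF B \<nu>t(1)[OF q]]
      by (simp add: id \<eta>_def invF)
  qed
  have h\<eta>: "?h q (\<eta> q) \<zeta> = ?h (F q) (\<nu> (F q)) (differential ?B ?B F q \<zeta>)" if "q \<in> \<Sigma> \<inter> F -` W" "\<zeta> \<in> tangent_space ?B q" for q \<zeta>
    using met[OF \<eta>t[OF that(1)] that(2)] F\<eta>[OF that(1)] by simp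
  define \<mu> where "\<mu> q = tscale \<sigma> (\<eta> q)" for q
  have \<mu>t: "\<mu> q \<in> tangent_space ?B q" if "q \<in> \<Sigma> \<inter> F -` W" for q
    unfolding \<mu>_def by (rule tangent_space_tscale[OF B \<eta>t[OF that]])
  have h\<mu>: "?h q (\<mu> q) \<zeta> = \<sigma> * ?h (F q) (\<nu> (F q)) (differential ?B ?B F q \<zeta>)" if "q \<in> \<Sigma> \<inter> F -` W" "\<zeta> \<in> tangent_space ?B q" for q \<zeta>
    using prod_metric_tscale(1)[OF \<eta>t[OF that(1)] that(2), of \<sigma>] h\<eta>[OF that] by (simp add: \<mu>_def)
  have oW: "open (F -` W)" using open_vimage[OF W Fc] .
  have vert: "?h q (\<mu> q) (vertical A q) = k" if q: "q \<in> \<Sigma> \<inter> F -` W" for q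
  proof -
    have "?h q (\<mu> q) (vertical A q) = \<sigma> * ?h (F q) (\<nu> (F q)) (tscale \<sigma> (vertical A (F q)))"
      using h\<mu>[OF q vertical_tangent[OF atlas]] \<sigma>(2) by simp
    also have "\<dots> = \<sigma> * (\<sigma> * k)"
      using prod_metric_tscale(2)[OF vertical_tangent[OF atlas] \<nu>t(1)[OF q], of \<sigma>] k[of "F q"] q by auto
    finally show ?thesis using \<sigma>2 by (simp add: mult.assoc[symmetric])
  qed
  have unit: "?h q (\<mu> q) (\<mu> q) = 1" if q: "q \<in> \<Sigma> \<inter> F -` W" for q
  proof -
    have "?h q (\<mu> q) (\<mu> q) = \<sigma> * (\<sigma> * ?h q (\<eta> q) (\<eta> q))"
      unfolding \<mu>_def using prod_metric_tscale[OF \<eta>t[OF q] tangent_space_tscale[OF B \<eta>t[OF q], of \<sigma>], of \<sigma>]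
        prod_metric_tscale(2)[OF \<eta>t[OF q] \<eta>t[OF q], of \<sigma>] by simp
    also have "?h q (\<eta> q) (\<eta> q) = 1" using h\<eta>[OF q \<eta>t[OF q]] F\<eta>[OF q] \<nu>t(2)[OF q] by simp
    finally show ?thesis using \<sigma>2 by simp
  qed
  have orth: "?h q (\<mu> q) \<zeta> = 0" if q: "q \<in> \<Sigma> \<inter> F -` W" and \<zeta>: "\<zeta> \<in> surface_tangent ?B \<Sigma> q" for q \<zeta>
  proof -
    obtain \<gamma> \<epsilon> where \<gamma>: "\<zeta> = velocity ?B \<gamma> 0" "0 < \<epsilon>" "smooth_map euclid_atlas ?B {-\<epsilon><..<\<epsilon>} \<gamma>" "\<gamma> ` {-\<epsilon><..<\<epsilon>} \<subseteq> \<Sigma>" "\<gamma> 0 = q"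
      using \<zeta> unfolding surface_tangent_def by blast
    have \<zeta>t: "\<zeta> \<in> tangent_space ?B q" using velocity_tangent[OF B \<gamma>(3), of 0] \<gamma> by simp
    have "differential ?B ?B F q \<zeta> = velocity ?B (F \<circ> \<gamma>) 0"
      using differential_velocity[OF B B \<gamma>(3) _ _ iso(2), of 0] \<gamma> by simp
    moreover have "velocity ?B (F \<circ> \<gamma>) 0 \<in> surface_tangent ?B (F ` \<Sigma>) (F q)"
      unfolding surface_tangent_def
      using \<gamma> smooth_map_compose[OF B \<gamma>(3) _ iso(2) B] by (intro CollectI exI[of _ "F \<circ> \<gamma>"] exI[of _ \<epsilon>]) auto
    ultimately show ?thesis using h\<mu>[OF q \<zeta>t] \<nu>t(3)[OF q] by simp
  qed
  have cont: "continuous_on (\<Sigma> \<inter> F -` W \<inter> dom_chart d) (\<lambda>q. \<mu> q d)" if d: "d \<in> ?B" for d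
    unfolding continuous_on_eq_continuous_within
  proof
    fix p assume p: "p \<in> \<Sigma> \<inter> F -` W \<inter> dom_chart d"
    obtain e where e: "e \<in> ?B" "F p \<in> dom_chart e" using atlas_cover[OF B] .
    let ?f = "rep e d (inv F)"
    let ?E = "snd e ` (UNIV \<inter> dom_chart e \<inter> inv F -` dom_chart d)"
    let ?T = "\<Sigma> \<inter> F -` W \<inter> dom_chart d \<inter> F -` dom_chart e"
    have smf: "smooth_on ?E ?f" by (rule smooth_map_rep[OF iso(3) e(1) d])
    have cF: "continuous_on ?T F" using Fc continuous_on_subset by blast
    have "continuous_on (F ` \<Sigma> \<inter> W \<inter> dom_chart e) (\<lambda>q. \<nu> q e)" using \<nu> e unfolding unit_normal_field_def by blast
    then have 1: "continuous_on ?T (\<lambda>q. \<nu> (F q) e)"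
      by (rule continuous_on_compose2[OF _ cF]) auto
    have 2: "continuous_on ?T (\<lambda>q. snd e (F q))"
      by (rule continuous_on_compose2[OF chart_continuous[OF atlas_chart[OF B e(1)]] cF]) auto
    have f1: "Ck_on (Suc 0) ?E ?f" using smf by (simp add: smooth_on_def del: Ck_on.simps)
    have "continuous_on ?T (\<lambda>q. frechet_derivative ?f (at (snd e (F q))) (\<nu> (F q) e))"
      by (rule continuous_on_frechet_apply[OF f1 2 _ 1], rule image_subsetI) (auto simp: invF intro!: imageI)
    then have "continuous_on ?T (\<lambda>q. \<sigma> *\<^sub>R frechet_derivative ?f (at (snd e (F q))) (\<nu> (F q) e))"
      by (intro continuous_intros)
    moreover have "\<mu> q d = \<sigma> *\<^sub>R frechet_derivative ?f (at (snd e (F q))) (\<nu> (F q) e)" if "q \<in> ?T" for q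
      using differential_chart[OF B B iso(3) open_UNIV UNIV_I \<nu>t(1) e(1) _ d, of q] that
      by (simp add: \<mu>_def \<eta>_def tscale_def invF)
    ultimately have "continuous_on ?T (\<lambda>q. \<mu> q d)" by (rule iffD2[OF continuous_on_cong[OF refl], rotated])
    then have "continuous (at p within ?T) (\<lambda>q. \<mu> q d)"
      using p e by (simp add: continuous_on_eq_continuous_within)
    moreover have "at p within ?T = at p within (\<Sigma> \<inter> F -` W \<inter> dom_chart d)"
      by (rule at_within_nhd[of p "F -` dom_chart e"])
        (use e open_vimage[OF chart_open_dom[OF atlas_chart[OF B e(1)]] Fc] in auto)
    ultimately show "continuous (at p within \<Sigma> \<inter> F -` W \<inter> dom_chart d) (\<lambda>q. \<mu> q d)" by simp
  qed
  have "unit_normal_field ?B ?h \<Sigma> (F -` W) \<mu>"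
    unfolding unit_normal_field_def using \<mu>t unit orth cont by blast
  then show thesis using that vert oW by blast
qed

lemma smooth_map_slice:
  fixes I K :: "real set"
  assumes B: "smooth_atlas B" and f: "smooth_map euclid_atlas B (I \<times> K) f" and IK: "open I" "open K"
  shows "u \<in> I \<Longrightarrow> smooth_map euclid_atlas B K (\<lambda>v. f (u, v))" "v \<in> K \<Longrightarrow> smooth_map euclid_atlas B I (\<lambda>u. f (u, v))"
proof -
  have gen: "smooth_map euclid_atlas B T (\<lambda>t. f (l t))"
    if T: "open T" and l: "smooth_on T l" "l ` T \<subseteq> I \<times> K" for T and l :: "real \<Rightarrow> real \<times> real"
    unfolding smooth_map_euclid
  proof (intro conjI ballI)
    show c: "continuous_on T (\<lambda>t. f (l t))"
      by (rule continuous_on_compose2[OF smooth_map_continuous[OF f] smooth_on_continuous[OF l(1)] l(2)])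
    fix d assume d: "d \<in> B"
    have o1: "open (T \<inter> (\<lambda>t. f (l t)) -` fst d)"
      by (rule open_domain_restrict[OF T c chart_open_dom[OF atlas_chart[OF B d]]])
    have o2: "open (I \<times> K \<inter> f -` fst d)"
      by (rule open_domain_restrict[OF open_Times[OF IK] smooth_map_continuous[OF f] chart_open_dom[OF atlas_chart[OF B d]]])
    have "smooth_on (T \<inter> (\<lambda>t. f (l t)) -` fst d) (\<lambda>t. (snd d \<circ> f) (l t))"
      by (rule smooth_on_compose[OF o1 o2 _ smooth_on_subset[OF l(1)] smooth_map_euclidD[OF f d]]) (use l in auto)
    then show "smooth_on (T \<inter> (\<lambda>t. f (l t)) -` fst d) (snd d \<circ> (\<lambda>t. f (l t)))" by (simp add: o_def)
  qed
  show "smooth_map euclid_atlas B K (\<lambda>v. f (u, v))" if "u \<in> I"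
    by (rule gen[OF IK(2), of "\<lambda>v. (u, v)"]) (use that IK in \<open>auto intro!: smooth_on_Pair smooth_on_ident\<close>)
  show "smooth_map euclid_atlas B I (\<lambda>u. f (u, v))" if "v \<in> K"
    by (rule gen[OF IK(1), of "\<lambda>u. (u, v)"]) (use that IK in \<open>auto intro!: smooth_on_Pair smooth_on_ident\<close>)
qed

lemma partial_derivatives:
  assumes B: "smooth_atlas B" and f: "smooth_map euclid_atlas B V f" "open V" and w: "(u, v) \<in> V" and d: "d \<in> B" "f (u, v) \<in> fst d"
  shows "((\<lambda>t. snd d (f (u, t))) has_vector_derivative frechet_derivative (snd d \<circ> f) (at (u, v)) (0, 1)) (at v)"
    and "((\<lambda>t. snd d (f (t, v))) has_vector_derivative frechet_derivative (snd d \<circ> f) (at (u, v)) (1, 0)) (at u)"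
    and "linear (frechet_derivative (snd d \<circ> f) (at (u, v)))"
proof -
  have D: "((snd d \<circ> f) has_derivative frechet_derivative (snd d \<circ> f) (at (u, v))) (at (u, v))"
    by (rule smooth_on_has_derivative[OF smooth_map_euclidD[OF f(1) d(1)]]) (use w d in auto)
  show "linear (frechet_derivative (snd d \<circ> f) (at (u, v)))" using D by (rule has_derivative_linear)
  have 1: "((\<lambda>t. (u, t)) has_vector_derivative (0, 1)) (at v)" and 2: "((\<lambda>t. (t, v)) has_vector_derivative (1, 0)) (at u)"
    by (auto intro!: derivative_eq_intros has_vector_derivative_Pair)
  show "((\<lambda>t. snd d (f (u, t))) has_vector_derivative frechet_derivative (snd d \<circ> f) (at (u, v)) (0, 1)) (at v)"
    using has_vector_derivative_linear_image[where x = "\<lambda>t. (u, t)" and t = v, OF D 1] by simp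
  show "((\<lambda>t. snd d (f (t, v))) has_vector_derivative frechet_derivative (snd d \<circ> f) (at (u, v)) (1, 0)) (at u)"
    using has_vector_derivative_linear_image[where x = "\<lambda>t. (t, v)" and t = u, OF D 2] by simp
qed

lemma rotation_field_facts:
  assumes J: "rotation_field A g U J" and p: "p \<in> U" and \<xi>: "\<xi> \<in> tangent_space A p"
  shows "J p \<xi> \<in> tangent_space A p" "g p (J p \<xi>) (J p \<xi>) = g p \<xi> \<xi>" "g p (J p \<xi>) \<xi> = 0"
    "\<eta> \<in> tangent_space A p \<Longrightarrow> J p (tadd \<xi> \<eta>) = tadd (J p \<xi>) (J p \<eta>)" "J p (tscale r \<xi>) = tscale r (J p \<xi>)"
  using assms unfolding rotation_field_def by blast+

text \<open>Supplies the differentiable initial velocities with which the Gauss lemma starts.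
  Smoothness of \<open>J\<close> is assumed for constant coordinate vectors only; linearity extends
  it to the moving velocity.\<close>

lemma rotated_velocity_smooth:
  assumes J: "rotation_field A g U J" and U: "open U" and I: "open I" and \<alpha>: "smooth_map euclid_atlas A I \<alpha>" "\<alpha> ` I \<subseteq> U"
    and c: "c \<in> A"
  shows "smooth_on (I \<inter> \<alpha> -` fst c) (\<lambda>u. J (\<alpha> u) (velocity A \<alpha> u) c)"
proof -
  note ch = chart[OF c]
  let ?T = "I \<inter> \<alpha> -` fst c"
  let ?R = "snd c ` (U \<inter> fst c)"
  have T: "open ?T" by (rule open_domain_restrict[OF I smooth_map_continuous[OF \<alpha>(1)] chart_open_dom[OF ch]])
  have R: "open ?R" using chart_open_map[OF ch U] by (simp add: Int_commute)
  have x: "smooth_on ?T (snd c \<circ> \<alpha>)" by (rule smooth_map_euclidD[OF \<alpha>(1) c])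
  have v: "velocity A \<alpha> u c = frechet_derivative (snd c \<circ> \<alpha>) (at u) 1" if "u \<in> ?T" for u
  proof -
    have "((snd c \<circ> \<alpha>) has_vector_derivative velocity A \<alpha> u c) (at u)"
      by (rule curve_has_vector_derivative[OF \<alpha>(1) _ c]) (use that in auto)
    from fun_cong[OF frechet_derivative_at[OF this[unfolded has_vector_derivative_def]], of 1] show ?thesis by simp
  qed
  have vs: "smooth_on ?T (\<lambda>u. velocity A \<alpha> u c)"
    by (rule iffD2[OF smooth_on_cong[OF T v] smooth_on_frechet[OF x]])
  define Q where "Q x a = J (inv_chart c x) (coord_vec A c (inv_chart c x) a) c" for x a
  have Qs: "smooth_on ?R (\<lambda>x. Q x a)" for a using J c unfolding rotation_field_def Q_def by blast
  have lin: "linear (Q x)" if xR: "x \<in> ?R" for x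
  proof -
    from xR obtain p where p: "p \<in> U" "p \<in> fst c" "x = snd c p" by blast
    note cv = coord_vec_tangent[OF atlas c p(2)]
    have Q: "Q x a = J p (coord_vec A c p a) c" for a by (simp add: Q_def p(3) chart_inv[OF ch p(2)])
    show ?thesis
    proof (rule linearI)
      show "Q x (a + b) = Q x a + Q x b" for a b
        using rotation_field_facts(4)[OF J p(1) cv cv, of a b] unfolding Q tadd_coord_vec[OF atlas c p(2)]
        by (simp add: tadd_def)
      show "Q x (r *\<^sub>R a) = r *\<^sub>R Q x a" for r a
        using rotation_field_facts(5)[OF J p(1) cv, of r a] unfolding Q tscale_coord_vec[OF atlas c p(2)]
        by (simp add: tscale_def)
    qed
  qed
  have img: "(snd c \<circ> \<alpha>) ` ?T \<subseteq> ?R" using \<alpha>(2) by auto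
  have "smooth_on ?T (\<lambda>u. Q ((snd c \<circ> \<alpha>) u) (velocity A \<alpha> u c))"
  proof (rule smooth_on_apply_linear[OF T _ _ vs, where L = "\<lambda>u. Q ((snd c \<circ> \<alpha>) u)"])
    show "smooth_on ?T (\<lambda>u. Q ((snd c \<circ> \<alpha>) u) a)" for a by (rule smooth_on_compose[OF T R img x Qs])
    show "linear (Q ((snd c \<circ> \<alpha>) u))" if "u \<in> ?T" for u using lin img that by blast
  qed
  moreover have "J (\<alpha> u) (velocity A \<alpha> u) c = Q ((snd c \<circ> \<alpha>) u) (velocity A \<alpha> u c)" if "u \<in> ?T" for u
    using that coord_vec_tangent_eq[OF atlas c _ velocity_tangent[OF atlas \<alpha>(1) I], of u]
    by (simp add: Q_def chart_inv[OF ch])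
  ultimately show ?thesis using smooth_on_cong[OF T] by (metis (no_types, lifting))
qed

lemma exp_map_along_geodesic:
  assumes "geodesic_on A g {-\<epsilon><..<1+\<epsilon>} \<beta>" "0 < \<epsilon>" "s \<in> {-\<epsilon><..<1+\<epsilon>}"
  shows "exp_map A g (\<beta> 0) (tscale s (velocity A \<beta> 0)) = \<beta> s"
  using exp_map_eq[OF geodesic_from_scale[OF assms(1), of s]] assms(2,3) by (simp add: is_interval_oo)

text \<open>\<open>m\<close> is the projection of the parametrization to \<open>M\<close>, and
  \<open>n\<close> is the unit vector T along it. If \<open>cos \<theta>\<close> vanishes,
  \<open>m\<close> only traces \<alpha> and \<open>n\<close> is the rotated velocity of \<alpha>.
  Otherwise \<open>n\<close> is the v-derivative of \<open>m\<close> divided by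
  \<open>cos \<theta>\<close>, and its orthogonality to the u-derivative is the Gauss lemma.\<close>

lemma angle_parametrization_field:
  assumes I: "open I" and K: "open K" and \<alpha>: "unit_speed_curve A g I \<alpha>"
    and U: "open U" "\<alpha> ` I \<subseteq> U" and J: "rotation_field A g U J"
    and dom: "\<And>u v. u \<in> I \<Longrightarrow> v \<in> K \<Longrightarrow> angle_vector A \<theta> \<alpha> J u v \<in> exp_domain A g (\<alpha> u)"
    and m: "smooth_map euclid_atlas A (I \<times> K) m"
    and m_def: "\<And>u v. m (u, v) = exp_map A g (\<alpha> u) (angle_vector A \<theta> \<alpha> J u v)"
  obtains n where
    "\<And>w. w \<in> I \<times> K \<Longrightarrow> n w \<in> tangent_space A (m w)" "\<And>w. w \<in> I \<times> K \<Longrightarrow> g (m w) (n w) (n w) = 1"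
    "\<And>w c. w \<in> I \<times> K \<Longrightarrow> c \<in> A \<Longrightarrow> m w \<in> fst c \<Longrightarrow> frechet_derivative (snd c \<circ> m) (at w) (0, 1) = cos \<theta> *\<^sub>R n w c"
    "\<And>w c. w \<in> I \<times> K \<Longrightarrow> c \<in> A \<Longrightarrow> m w \<in> fst c \<Longrightarrow>
       G c (snd c (m w)) (n w c) (frechet_derivative (snd c \<circ> m) (at w) (1, 0)) = 0"
    "\<And>c. c \<in> A \<Longrightarrow> continuous_on {w \<in> I \<times> K. m w \<in> fst c} (\<lambda>w. n w c)"
proof -
  have s\<alpha>: "smooth_map euclid_atlas A I \<alpha>" and u\<alpha>: "\<And>u. u \<in> I \<Longrightarrow> g (\<alpha> u) (velocity A \<alpha> u) (velocity A \<alpha> u) = 1"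
    using \<alpha> by (auto simp: unit_speed_curve_def)
  have IK: "open (I \<times> K)" using I K by (rule open_Times)
  define \<xi> where "\<xi> u = J (\<alpha> u) (velocity A \<alpha> u)" for u
  have v\<alpha>: "velocity A \<alpha> u \<in> tangent_space A (\<alpha> u)" if "u \<in> I" for u by (rule velocity_tangent[OF atlas s\<alpha> I that])
  have \<xi>: "\<xi> u \<in> tangent_space A (\<alpha> u)" "g (\<alpha> u) (\<xi> u) (\<xi> u) = 1" "g (\<alpha> u) (\<xi> u) (velocity A \<alpha> u) = 0" if "u \<in> I" for u
    using rotation_field_facts(1-3)[OF J _ v\<alpha>[OF that]] U(2) u\<alpha> that by (auto simp: \<xi>_def)
  have av: "angle_vector A \<theta> \<alpha> J u v = tscale (v * cos \<theta>) (\<xi> u)" for u v by (simp add: angle_vector_def \<xi>_def)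
  note pd = partial_derivatives[OF atlas m IK]
  have ocm: "open {w \<in> I \<times> K. m w \<in> fst c}" if "c \<in> A" for c
    using open_domain_restrict[OF IK smooth_map_continuous[OF m] chart_open_dom[OF chart[OF that]]]
    by (simp add: vimage_def Int_def)
  show thesis
  proof (cases "cos \<theta> = 0")
    case True
    have m\<alpha>: "m (u, v) = \<alpha> u" if uv: "u \<in> I" "v \<in> K" for u v
    proof -
      obtain \<beta> where "geodesic_from A g (\<alpha> u) (angle_vector A \<theta> \<alpha> J u v) \<beta>"
        using dom[OF uv] unfolding exp_domain_def by blast
      then obtain \<epsilon> where \<beta>: "0 < \<epsilon>" "geodesic_on A g {-\<epsilon><..<1+\<epsilon>} \<beta>" "\<beta> 0 = \<alpha> u" by (auto simp: geodesic_from_def)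
      have "angle_vector A \<theta> \<alpha> J u v = tscale 0 (velocity A \<beta> 0)" by (simp add: av True tscale_def)
      then show ?thesis using exp_map_along_geodesic[OF \<beta>(2,1), of 0] \<beta> by (simp add: m_def)
    qed
    show thesis
    proof (rule that[of "\<lambda>w. \<xi> (fst w)"])
      fix w c assume w: "w \<in> I \<times> K"
      obtain u v where [simp]: "w = (u, v)" by (cases w)
      have uv: "u \<in> I" "v \<in> K" "(u, v) \<in> I \<times> K" using w by auto
      show "\<xi> (fst w) \<in> tangent_space A (m w)" "g (m w) (\<xi> (fst w)) (\<xi> (fst w)) = 1"
        using \<xi> uv by (simp_all add: m\<alpha>)
      assume c: "c \<in> A" "m w \<in> fst c"
      have \<alpha>c: "\<alpha> u \<in> fst c" using c uv by (simp add: m\<alpha>)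
      have "((\<lambda>t. snd c (m (u, t))) has_vector_derivative 0) (at v)"
        by (rule has_vector_derivative_transform_within_open[OF has_vector_derivative_const[of "snd c (\<alpha> u)"] K uv(2)])
          (simp add: m\<alpha> uv)
      then show "frechet_derivative (snd c \<circ> m) (at w) (0, 1) = cos \<theta> *\<^sub>R \<xi> (fst w) c"
        using vector_derivative_unique_at[OF pd(1)[OF uv(3) c(1)]] c by (simp add: True)
      have "((\<lambda>t. snd c (m (t, v))) has_vector_derivative velocity A \<alpha> u c) (at u)"
      proof (rule has_vector_derivative_transform_within_open[OF _ I uv(1)])
        show "((\<lambda>t. snd c (\<alpha> t)) has_vector_derivative velocity A \<alpha> u c) (at u)"
          using curve_has_vector_derivative[OF s\<alpha> uv(1) c(1) \<alpha>c] by (simp add: o_def)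
      qed (simp add: m\<alpha> uv)
      then have "frechet_derivative (snd c \<circ> m) (at w) (1, 0) = velocity A \<alpha> u c"
        using vector_derivative_unique_at[OF pd(2)[OF uv(3) c(1)]] c by simp
      then show "G c (snd c (m w)) (\<xi> (fst w) c) (frechet_derivative (snd c \<circ> m) (at w) (1, 0)) = 0"
        using \<xi>(3)[OF uv(1)] metric_chart[OF c(1) \<alpha>c \<xi>(1)[OF uv(1)] v\<alpha>[OF uv(1)]] by (simp add: m\<alpha> uv)
    next
      fix c assume c: "c \<in> A"
      have "continuous_on (I \<inter> \<alpha> -` fst c) (\<lambda>u. \<xi> u c)"
        unfolding \<xi>_def by (rule smooth_on_continuous[OF rotated_velocity_smooth[OF J U(1) I s\<alpha> U(2) c]])
      then show "continuous_on {w \<in> I \<times> K. m w \<in> fst c} (\<lambda>w. \<xi> (fst w) c)"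
        by (rule continuous_on_compose2[OF _ continuous_on_fst[OF continuous_on_id]]) (auto simp: m\<alpha>)
    qed
  next
    case False
    have line: "smooth_map euclid_atlas A K (\<lambda>t. m (u, t))" if "u \<in> I" for u
      by (rule smooth_map_slice(1)[OF atlas m I K that])
    have vel: "velocity A (\<lambda>t. m (u, t)) v c = frechet_derivative (snd c \<circ> m) (at (u, v)) (0, 1)"
      if "u \<in> I" "v \<in> K" "c \<in> A" "m (u, v) \<in> fst c" for u v c
      by (rule velocity_eqI) (use pd(1)[of u v c] that in \<open>simp_all add: o_def\<close>)
    define n where "n w = tscale (1 / cos \<theta>) (velocity A (\<lambda>t. m (fst w, t)) (snd w))" for w
    have vt: "velocity A (\<lambda>t. m (u, t)) v \<in> tangent_space A (m (u, v))" if "u \<in> I" "v \<in> K" for u v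
      using velocity_tangent[OF atlas line[OF that(1)] K that(2)] by simp
    have main: "g (m (a, b)) (velocity A (\<lambda>t. m (a, t)) b) (velocity A (\<lambda>t. m (a, t)) b) = (cos \<theta>)\<^sup>2 \<and>
      (c \<in> A \<longrightarrow> m (a, b) \<in> fst c \<longrightarrow>
        G c (snd c (m (a, b))) (velocity A (\<lambda>t. m (a, t)) b c) (frechet_derivative (snd c \<circ> m) (at (a, b)) (1, 0)) = 0)"
      if ab: "a \<in> I" "b \<in> K" for a b c
    proof -
      \<comment> \<open>The Gauss lemma works on the time interval [0,1], so \<open>b\<close> is
        written as \<open>s * b'\<close> with a nonzero \<open>b'\<close> in \<open>K\<close>: for
        \<open>b = 0\<close> a small \<open>b'\<close> will do, otherwise \<open>b' = b\<close>. The
        geodesics with parameter \<open>b'\<close> are provided up to time 1 by the domain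
        hypothesis.\<close>
      have "\<exists>b'\<in>K. b' \<noteq> 0 \<and> b / b' \<in> {0..1}"
      proof (cases "b = 0")
        case True
        then obtain e where "0 < e" "ball 0 e \<subseteq> K" using K ab(2) openE by blast
        then show ?thesis using True by (intro bexI[of _ "e / 2"]) (auto simp: subset_iff)
      qed (use ab in \<open>intro bexI[of _ b], auto\<close>)
      then obtain b' where b': "b' \<in> K" "b' \<noteq> 0" "b / b' \<in> {0..1}" by blast
      define s where "s = b / b'"
      have s: "s \<in> {0..1}" "s * b' = b" using b' by (auto simp: s_def)
      have "\<exists>\<beta> \<epsilon>. 0 < \<epsilon> \<and> geodesic_on A g {-\<epsilon><..<1+\<epsilon>} \<beta> \<and> \<beta> 0 = \<alpha> u \<and> velocity A \<beta> 0 = tscale (b' * cos \<theta>) (\<xi> u)"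
        if u: "u \<in> I" for u
        using dom[OF u b'(1)] unfolding exp_domain_def av geodesic_from_def by blast
      then obtain \<beta> \<epsilon> where \<beta>: "\<And>u. u \<in> I \<Longrightarrow> 0 < \<epsilon> u" "\<And>u. u \<in> I \<Longrightarrow> geodesic_on A g {-\<epsilon> u<..<1+\<epsilon> u} (\<beta> u)"
        "\<And>u. u \<in> I \<Longrightarrow> \<beta> u 0 = \<alpha> u" "\<And>u. u \<in> I \<Longrightarrow> velocity A (\<beta> u) 0 = tscale (b' * cos \<theta>) (\<xi> u)" by metis
      \<comment> \<open>One geodesic describes \<open>m\<close> for all \<open>r\<close> in an open
        interval around [0,1], so the v-derivative at \<open>b\<close> can be read off from it even
        when \<open>s = 1\<close>.\<close>
      have m\<beta>: "m (u, r * b') = \<beta> u r" if u: "u \<in> I" "r \<in> {-\<epsilon> u<..<1+\<epsilon> u}" for u r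
      proof -
        have "angle_vector A \<theta> \<alpha> J u (r * b') = tscale r (velocity A (\<beta> u) 0)"
          by (simp add: av \<beta>(4)[OF u(1)] tscale_def mult.assoc)
        then show ?thesis
          using exp_map_along_geodesic[OF \<beta>(2)[OF u(1)] \<beta>(1)[OF u(1)] u(2)] by (simp add: m_def \<beta>(3)[OF u(1)])
      qed
      have sI: "s \<in> {-\<epsilon> u<..<1+\<epsilon> u}" if "u \<in> I" for u using s(1) \<beta>(1)[OF that] by auto
      have mb: "m (u, b) = \<beta> u s" if "u \<in> I" for u using m\<beta>[OF that sI[OF that]] s(2) by simp
      have speed: "g (\<beta> u 0) (velocity A (\<beta> u) 0) (velocity A (\<beta> u) 0) = (b' * cos \<theta>)\<^sup>2" if u: "u \<in> I" for u
      proof -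
        note t = tangent_space_tscale[OF atlas \<xi>(1)[OF u], of "b' * cos \<theta>"]
        have "g (\<alpha> u) (\<xi> u) (tscale (b' * cos \<theta>) (\<xi> u)) = b' * cos \<theta>"
          using metric_facts(1)[OF \<xi>(1)[OF u] t t] metric_facts(3)[OF \<xi>(1)[OF u] \<xi>(1)[OF u] \<xi>(1)[OF u], of "b' * cos \<theta>"] \<xi>(2)[OF u] by simp
        then show ?thesis
          using metric_facts(3)[OF \<xi>(1)[OF u] t t, of "b' * cos \<theta>"] by (simp add: \<beta>(3,4)[OF u] power2_eq_square)
      qed
      have velm: "velocity A (\<lambda>t. m (a, t)) b c = (1 / b') *\<^sub>R velocity A (\<beta> a) s c"
        if c: "c \<in> A" "m (a, b) \<in> fst c" for c
      proof (rule velocity_eqI)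
        have "((snd c \<circ> \<beta> a) has_vector_derivative velocity A (\<beta> a) s c) (at (b / b'))"
          unfolding s_def[symmetric]
          by (rule curve_has_vector_derivative[OF geodesic_smooth[OF \<beta>(2)[OF ab(1)]] sI[OF ab(1)] c(1)])
            (use c mb[OF ab(1)] in simp)
        then have "(((snd c \<circ> \<beta> a) \<circ> (\<lambda>t. t / b')) has_vector_derivative (1 / b') *\<^sub>R velocity A (\<beta> a) s c) (at b)"
          by (intro vector_diff_chain_at) (auto intro!: derivative_eq_intros)
        moreover have "open {t. t / b' \<in> {-\<epsilon> a<..<1+\<epsilon> a}}"
          using open_vimage[of "{-\<epsilon> a<..<1+\<epsilon> a}" "\<lambda>t. t / b'"] b'(2) by (simp add: vimage_def continuous_intros)
        ultimately show "((snd c \<circ> (\<lambda>t. m (a, t))) has_vector_derivative (1 / b') *\<^sub>R velocity A (\<beta> a) s c) (at b)"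
        proof (rule has_vector_derivative_transform_within_open)
          show "b \<in> {t. t / b' \<in> {-\<epsilon> a<..<1+\<epsilon> a}}" using sI[OF ab(1)] by (simp add: s_def)
          show "((snd c \<circ> \<beta> a) \<circ> (\<lambda>t. t / b')) t = (snd c \<circ> (\<lambda>t. m (a, t))) t" if "t \<in> {t. t / b' \<in> {-\<epsilon> a<..<1+\<epsilon> a}}" for t
            using m\<beta>[OF ab(1), of "t / b'"] that b'(2) by simp
        qed
      qed (use c in auto)
      obtain c0 where c0: "c0 \<in> A" "m (a, b) \<in> fst c0" using atlas_cover[OF atlas] .
      have \<beta>t: "velocity A (\<beta> a) s \<in> tangent_space A (m (a, b))"
        using velocity_tangent[OF atlas geodesic_smooth[OF \<beta>(2)[OF ab(1)]] _ sI[OF ab(1)]] mb[OF ab(1)] by simp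
      have "velocity A (\<lambda>t. m (a, t)) b = tscale (1 / b') (velocity A (\<beta> a) s)"
        by (rule tangent_eqI[OF vt[OF ab] tangent_space_tscale[OF atlas \<beta>t] c0]) (simp add: velm[OF c0] tscale_def)
      then have "g (m (a, b)) (velocity A (\<lambda>t. m (a, t)) b) (velocity A (\<lambda>t. m (a, t)) b) =
          (1 / b') * ((1 / b') * g (m (a, b)) (velocity A (\<beta> a) s) (velocity A (\<beta> a) s))"
        using metric_facts(3)[OF \<beta>t tangent_space_tscale[OF atlas \<beta>t, of "1 / b'"] \<beta>t, of "1 / b'"]
          metric_facts(1)[OF \<beta>t tangent_space_tscale[OF atlas \<beta>t, of "1 / b'"] \<beta>t]
          metric_facts(3)[OF \<beta>t \<beta>t \<beta>t, of "1 / b'"] by simp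
      also have "g (m (a, b)) (velocity A (\<beta> a) s) (velocity A (\<beta> a) s) = (b' * cos \<theta>)\<^sup>2"
        using geodesic_speed_constant[OF \<beta>(2)[OF ab(1)], of s 0] speed[OF ab(1)] sI[OF ab(1)] \<beta>(1)[OF ab(1)] mb[OF ab(1)]
        by simp
      finally have norm: "g (m (a, b)) (velocity A (\<lambda>t. m (a, t)) b) (velocity A (\<lambda>t. m (a, t)) b) = (cos \<theta>)\<^sup>2"
        using b'(2) by (simp add: power2_eq_square)
      have "G c (snd c (m (a, b))) (velocity A (\<lambda>t. m (a, t)) b c) (frechet_derivative (snd c \<circ> m) (at (a, b)) (1, 0)) = 0"
        if c: "c \<in> A" "m (a, b) \<in> fst c"
      proof -
        obtain c1 where c1: "c1 \<in> A" "\<alpha> a \<in> fst c1" using atlas_cover[OF atlas] .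
        have o1: "open (I \<inter> \<alpha> -` fst c1)" and a1: "a \<in> I \<inter> \<alpha> -` fst c1"
          using open_domain_restrict[OF I smooth_map_continuous[OF s\<alpha>] chart_open_dom[OF chart[OF c1(1)]]] ab c1 by auto
        \<comment> \<open>At time 0 the variation is the velocity of \<alpha> and the geodesics
          start along its rotation.\<close>
        have "orthogonal_variation \<beta> a c1 0"
        proof -
          have "(\<lambda>u. \<xi> u c1) differentiable (at a)"
            using smooth_on_has_derivative[OF rotated_velocity_smooth[OF J U(1) I s\<alpha> U(2) c1(1)] a1] differentiableI
            unfolding \<xi>_def by blast
          then obtain \<eta> where \<eta>: "((\<lambda>u. \<xi> u c1) has_vector_derivative \<eta>) (at a)"
            using vector_derivative_works by blast
          have "((\<lambda>u. (snd c1 (\<alpha> u), (b' * cos \<theta>) *\<^sub>R \<xi> u c1)) has_vector_derivative (velocity A \<alpha> a c1, (b' * cos \<theta>) *\<^sub>R \<eta>)) (at a)"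
          proof (rule has_vector_derivative_Pair)
            show "((\<lambda>u. snd c1 (\<alpha> u)) has_vector_derivative velocity A \<alpha> a c1) (at a)"
              using curve_has_vector_derivative[OF s\<alpha> ab(1) c1] by (simp add: o_def)
            show "((\<lambda>u. (b' * cos \<theta>) *\<^sub>R \<xi> u c1) has_vector_derivative (b' * cos \<theta>) *\<^sub>R \<eta>) (at a)"
              using has_vector_derivative_linear_image[OF bounded_linear_imp_has_derivative[OF bounded_linear_scaleR_right] \<eta>] .
          qed
          then have "((\<lambda>u. (snd c1 (\<beta> u 0), velocity A (\<beta> u) 0 c1)) has_vector_derivative (velocity A \<alpha> a c1, (b' * cos \<theta>) *\<^sub>R \<eta>)) (at a)"
            by (rule has_vector_derivative_transform_within_open[OF _ I ab(1)]) (simp add: \<beta>(3,4) tscale_def)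
          moreover have "\<forall>\<^sub>F u in nhds a. \<beta> u 0 \<in> fst c1"
            unfolding eventually_nhds using o1 a1 \<beta>(3) by (intro exI[of _ "I \<inter> \<alpha> -` fst c1"]) auto
          moreover have "G c1 (snd c1 (\<beta> a 0)) (velocity A \<alpha> a c1) (velocity A (\<beta> a) 0 c1) = 0"
          proof -
            have x: "snd c1 (\<alpha> a) \<in> img c1" using c1 by auto
            have "G c1 (snd c1 (\<alpha> a)) (\<xi> a c1) (velocity A \<alpha> a c1) = 0"
              using metric_chart[OF c1 \<xi>(1)[OF ab(1)] v\<alpha>[OF ab(1)]] \<xi>(3)[OF ab(1)] by simp
            then show ?thesis
              by (simp add: \<beta>(3,4)[OF ab(1)] tscale_def G_bil[OF c1(1) x] G_sym[OF c1(1) x, of "velocity A \<alpha> a c1"])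
          qed
          ultimately show ?thesis
            unfolding orthogonal_variation_def using \<beta>(3)[OF ab(1)] c1(2) by auto
        qed
        note ov = this
        have "orthogonal_variation \<beta> a c s"
        proof (rule gauss_lemma[where \<gamma> = \<beta> and U = I and S = "\<lambda>u. {-\<epsilon> u<..<1+\<epsilon> u}" and \<kappa> = "(b' * cos \<theta>)\<^sup>2", OF I ab(1) _ _ _ \<beta>(2) speed c1(1) ov])
          show "{0..1} \<subseteq> {-\<epsilon> u<..<1+\<epsilon> u}" if "u \<in> I" for u using \<beta>(1)[OF that] by auto
          show "\<beta> a s \<in> fst c" using mb[OF ab(1)] c(2) by simp
        qed (use s c(1) in \<open>simp_all add: is_interval_oo\<close>)
        then obtain p q where pq: "((\<lambda>u. (snd c (\<beta> u s), velocity A (\<beta> u) s c)) has_vector_derivative (p, q)) (at a)"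
          "G c (snd c (\<beta> a s)) p (velocity A (\<beta> a) s c) = 0" unfolding orthogonal_variation_def by blast
        have "((\<lambda>u. snd c (\<beta> u s)) has_vector_derivative p) (at a)"
          using has_vector_derivative_linear_image[OF bounded_linear_imp_has_derivative[OF bounded_linear_fst] pq(1)] by simp
        then have "((\<lambda>u. snd c (m (u, b))) has_vector_derivative p) (at a)"
          by (rule has_vector_derivative_transform_within_open[OF _ I ab(1)]) (simp add: mb)
        then have p: "p = frechet_derivative (snd c \<circ> m) (at (a, b)) (1, 0)"
          using vector_derivative_unique_at[OF _ pd(2)[OF SigmaI[OF ab] c]] by blast
        have x: "snd c (m (a, b)) \<in> img c" using c by auto
        show ?thesis
          using pq(2) G_sym[OF c(1) x, of p "velocity A (\<beta> a) s c"]
          by (simp add: velm[OF c] p[symmetric] mb[OF ab(1), symmetric] G_bil[OF c(1) x])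
      qed
      then show ?thesis using norm by blast
    qed
    show thesis
    proof (rule that[of n])
      fix w c assume w: "w \<in> I \<times> K"
      obtain a b where [simp]: "w = (a, b)" by (cases w)
      have ab: "a \<in> I" "b \<in> K" using w by auto
      show "n w \<in> tangent_space A (m w)"
        using tangent_space_tscale[OF atlas vt[OF ab]] by (simp add: n_def)
      note t = vt[OF ab] tangent_space_tscale[OF atlas vt[OF ab], of "1 / cos \<theta>"]
      show "g (m w) (n w) (n w) = 1"
        using main[OF ab] metric_facts(3)[OF t(1) t(2) t(1), of "1 / cos \<theta>"] metric_facts(1)[OF t(1) t(2) t(1)]
          metric_facts(3)[OF t(1) t(1) t(1), of "1 / cos \<theta>"] False
        by (simp add: n_def power2_eq_square)
      assume c: "c \<in> A" "m w \<in> fst c"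
      have x: "snd c (m (a, b)) \<in> img c" using c by auto
      show "frechet_derivative (snd c \<circ> m) (at w) (0, 1) = cos \<theta> *\<^sub>R n w c"
        using vel[OF ab c(1)] c False by (simp add: n_def tscale_def)
      show "G c (snd c (m w)) (n w c) (frechet_derivative (snd c \<circ> m) (at w) (1, 0)) = 0"
        using main[OF ab, of c] c by (simp add: n_def tscale_def G_bil[OF c(1) x])
    next
      fix c assume c: "c \<in> A"
      have sm: "smooth_on {w \<in> I \<times> K. m w \<in> fst c} (snd c \<circ> m)"
        using smooth_map_euclidD[OF m c] by (simp add: vimage_def Int_def)
      have "continuous_on {w \<in> I \<times> K. m w \<in> fst c} (\<lambda>w. (1 / cos \<theta>) *\<^sub>R frechet_derivative (snd c \<circ> m) (at w) (0, 1))"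
        by (intro continuous_on_scaleR continuous_on_const smooth_on_continuous[OF smooth_on_frechet[OF sm]])
      then show "continuous_on {w \<in> I \<times> K. m w \<in> fst c} (\<lambda>w. n w c)"
        by (rule iffD2[OF continuous_on_cong[OF refl], rotated]) (use vel[OF _ _ c] in \<open>auto simp: n_def tscale_def\<close>)
    qed
  qed
qed

text \<open>The coordinate tangents are (\<partial>m/\<partial>u, 0) and (cos \<theta> n, sin
  \<theta>), both orthogonal to (- sin \<theta> n, cos \<theta>). Tangent vectors of the surface are
  defined by arbitrary smooth curves in it; \<open>tangent_direction_in_range\<close> shows that
  these directions are spanned by the coordinate tangents.\<close>

lemma angle_parametrization_normal:
  assumes I: "open I" and K: "open K" and \<alpha>: "unit_speed_curve A g I \<alpha>"
    and U: "open U" "\<alpha> ` I \<subseteq> U" and J: "rotation_field A g U J"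
    and dom: "\<And>u v. u \<in> I \<Longrightarrow> v \<in> K \<Longrightarrow> angle_vector A \<theta> \<alpha> J u v \<in> exp_domain A g (\<alpha> u)"
    and reg: "regular_parametrization (prod_atlas A) \<Sigma> p (I \<times> K) (angle_parametrization A g \<theta> \<alpha> J)"
  obtains W \<nu> where "open W" "p \<in> W" "unit_normal_field (prod_atlas A) (prod_metric A g) \<Sigma> W \<nu>"
    "\<And>q. q \<in> \<Sigma> \<inter> W \<Longrightarrow> prod_metric A g q (\<nu> q) (vertical A q) = cos \<theta>"
proof -
  let ?B = "prod_atlas A" and ?h = "prod_metric A g"
  note B = prod_atlas_smooth
  define X where "X = angle_parametrization A g \<theta> \<alpha> J"
  define V where "V = I \<times> K"
  define m where "m w = fst (X w)" for w
  have Xm: "X w = (m w, snd w * sin \<theta>)" for w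
    by (simp add: m_def X_def angle_parametrization_def case_prod_beta')
  have V: "open V" using I K by (simp add: V_def open_Times)
  have smX: "smooth_map euclid_atlas ?B V X" and pX: "p \<in> X ` V" and hom: "homeomorphism V (X ` V) X (inv_into V X)"
    and imm: "\<And>x. x \<in> V \<Longrightarrow> inj_on (differential euclid_atlas ?B X x) (tangent_space euclid_atlas x)"
    and "\<exists>W. open W \<and> X ` V = \<Sigma> \<inter> W"
    using reg unfolding regular_parametrization_def X_def[symmetric] V_def[symmetric] by blast+
  then obtain W where W: "open W" "X ` V = \<Sigma> \<inter> W" by blast
  have smm: "smooth_map euclid_atlas A V m"
    using smooth_map_compose[OF B smX V smooth_map_fst[OF atlas] atlas] by (simp add: o_def m_def[abs_def])
  have mdef: "m (u, v) = exp_map A g (\<alpha> u) (angle_vector A \<theta> \<alpha> J u v)" for u v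
    by (simp add: m_def X_def angle_parametrization_def)
  obtain n where n: "\<And>w. w \<in> V \<Longrightarrow> n w \<in> tangent_space A (m w)" "\<And>w. w \<in> V \<Longrightarrow> g (m w) (n w) (n w) = 1"
    "\<And>w c. w \<in> V \<Longrightarrow> c \<in> A \<Longrightarrow> m w \<in> fst c \<Longrightarrow> frechet_derivative (snd c \<circ> m) (at w) (0, 1) = cos \<theta> *\<^sub>R n w c"
    "\<And>w c. w \<in> V \<Longrightarrow> c \<in> A \<Longrightarrow> m w \<in> fst c \<Longrightarrow> G c (snd c (m w)) (n w c) (frechet_derivative (snd c \<circ> m) (at w) (1, 0)) = 0"
    "\<And>c. c \<in> A \<Longrightarrow> continuous_on {w \<in> V. m w \<in> fst c} (\<lambda>w. n w c)"
    by (rule angle_parametrization_field[OF I K \<alpha> U J dom smm[unfolded V_def] mdef, folded V_def]) (assumption | rule that)+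
  define \<omega> where "\<omega> = inv_into V X"
  have \<omega>: "\<omega> q \<in> V" "X (\<omega> q) = q" if "q \<in> \<Sigma> \<inter> W" for q
    using hom that W(2) unfolding homeomorphism_def \<omega>_def by (auto simp: inv_into_into f_inv_into_f)
  have \<omega>X: "\<omega> (X w) = w" if "w \<in> V" for w using homeomorphism_apply1[OF hom that] by (simp add: \<omega>_def)
  have m\<omega>: "m (\<omega> q) = fst q" if "q \<in> \<Sigma> \<inter> W" for q using \<omega>[OF that] by (simp add: m_def)
  have c\<omega>: "continuous_on (\<Sigma> \<inter> W) \<omega>" using hom W(2) by (simp add: homeomorphism_def \<omega>_def)
  define \<nu> where "\<nu> q = lift_vec A q (tscale (- sin \<theta>) (n (\<omega> q))) (cos \<theta>)" for q
  have \<nu>t: "\<nu> q \<in> tangent_space ?B q" if "q \<in> \<Sigma> \<inter> W" for q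
    unfolding \<nu>_def using lift_vec_tangent[OF atlas tangent_space_tscale[OF atlas]] n(1)[OF \<omega>(1)[OF that]] m\<omega>[OF that] by simp
  have \<nu>c: "\<nu> q (prod_chart c) = ((- sin \<theta>) *\<^sub>R n (\<omega> q) c, cos \<theta>)" if "c \<in> A" "fst q \<in> fst c" for q c
    by (simp add: \<nu>_def lift_vec_chart[OF that] tscale_def)
  have n1: "G c (snd c (fst q)) (n (\<omega> q) c) (n (\<omega> q) c) = 1" if "q \<in> \<Sigma> \<inter> W" "c \<in> A" "fst q \<in> fst c" for q c
    using n(1,2)[OF \<omega>(1)[OF that(1)]] m\<omega>[OF that(1)] metric_chart[OF that(2,3)] by simp
  have unit: "?h q (\<nu> q) (\<nu> q) = 1" if q: "q \<in> \<Sigma> \<inter> W" for q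
  proof -
    obtain c where c: "c \<in> A" "fst q \<in> fst c" using atlas_cover[OF atlas] .
    have x: "snd c (fst q) \<in> img c" using c by auto
    show ?thesis
      using prod_metric_chart[OF c \<nu>t[OF q] \<nu>t[OF q]] n1[OF q c] sin_cos_squared_add[of \<theta>]
      by (simp add: \<nu>c[OF c] G_bil[OF c(1) x] power2_eq_square)
  qed
  have vert: "?h q (\<nu> q) (vertical A q) = cos \<theta>" if q: "q \<in> \<Sigma> \<inter> W" for q
  proof -
    obtain c where c: "c \<in> A" "fst q \<in> fst c" using atlas_cover[OF atlas] .
    have x: "snd c (fst q) \<in> img c" using c by auto
    show ?thesis
      using prod_metric_chart[OF c \<nu>t[OF q] vertical_tangent[OF atlas]] vertical_in_chart[OF c]
      by (simp add: \<nu>c[OF c] G_bil[OF c(1) x])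
  qed
  have orth: "?h q (\<nu> q) \<zeta> = 0" if q: "q \<in> \<Sigma> \<inter> W" and \<zeta>: "\<zeta> \<in> surface_tangent ?B \<Sigma> q" for q \<zeta>
  proof -
    obtain \<delta> \<epsilon> where \<delta>: "\<zeta> = velocity ?B \<delta> 0" "0 < \<epsilon>" "smooth_map euclid_atlas ?B {-\<epsilon><..<\<epsilon>} \<delta>" "\<delta> ` {-\<epsilon><..<\<epsilon>} \<subseteq> \<Sigma>" "\<delta> 0 = q"
      using \<zeta> unfolding surface_tangent_def by blast
    obtain c where c: "c \<in> A" "fst q \<in> fst c" using atlas_cover[OF atlas] .
    have x: "snd c (fst q) \<in> img c" using c by auto
    let ?c = "prod_chart c" and ?w = "\<omega> q"
    have cB: "?c \<in> ?B" "q \<in> dom_chart ?c" using prod_chart_in_atlas[OF c(1)] c(2) prod_chart_simps[of c] by (auto simp: mem_Times_iff)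
    have w: "?w \<in> V" "X ?w = q" "m ?w = fst q" using \<omega>[OF q] m\<omega>[OF q] by auto
    have \<zeta>t: "\<zeta> \<in> tangent_space ?B q" using velocity_tangent[OF B \<delta>(3), of 0] \<delta> by simp
    define L where "L = frechet_derivative (snd ?c \<circ> X) (at ?w)"
    have dL: "((snd ?c \<circ> X) has_derivative L) (at ?w)"
      unfolding L_def by (rule smooth_on_has_derivative[OF smooth_map_euclidD[OF smX cB(1)]]) (use w cB in auto)
    have injL: "L v = 0 \<Longrightarrow> v = 0" for v
    proof -
      have "X ?w \<in> dom_chart ?c" using w(2) cB(2) by simp
      from iffD1[OF inj_differential_euclid[OF B smX V w(1) cB(1) this] imm[OF w(1)]] show "L v = 0 \<Longrightarrow> v = 0"
        unfolding L_def by blast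
    qed
    have c\<delta>: "continuous_on {-\<epsilon><..<\<epsilon>} \<delta>" by (rule smooth_map_continuous[OF \<delta>(3)])
    define T where "T = {-\<epsilon><..<\<epsilon>} \<inter> \<delta> -` W"
    have T: "open T" "0 \<in> T" unfolding T_def using open_domain_restrict[OF _ c\<delta> W(1)] \<delta> q by auto
    have \<delta>T: "\<delta> t \<in> \<Sigma> \<inter> W" if "t \<in> T" for t using that subsetD[OF \<delta>(4) imageI, of t] by (simp add: T_def)
    have "continuous_on T (\<lambda>t. \<omega> (\<delta> t))"
      by (rule continuous_on_compose2[OF c\<omega> continuous_on_subset[OF c\<delta>] image_subsetI[OF \<delta>T]])
        (simp_all add: T_def)
    then have \<omega>\<delta>: "continuous (at 0) (\<lambda>t. \<omega> (\<delta> t))" using T by (simp add: continuous_on_eq_continuous_at)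
    have "((snd ?c \<circ> \<delta>) has_vector_derivative \<zeta> ?c) (at 0)"
      unfolding \<delta>(1) by (rule curve_has_vector_derivative[OF \<delta>(3) _ cB(1)]) (use \<delta> cB in auto)
    moreover have "\<forall>\<^sub>F t in nhds 0. (snd ?c \<circ> X) (\<omega> (\<delta> t)) = (snd ?c \<circ> \<delta>) t"
      unfolding eventually_nhds using T \<omega>(2)[OF \<delta>T] by (intro exI[of _ T]) simp
    ultimately have "\<zeta> ?c \<in> range L"
      using tangent_direction_in_range[of "snd ?c \<circ> X" L "\<lambda>t. \<omega> (\<delta> t)" "snd ?c \<circ> \<delta>"] dL injL \<omega>\<delta> \<delta>(5) by auto
    then obtain z where z: "\<zeta> ?c = L z" by blast
    let ?M = "frechet_derivative (snd c \<circ> m) (at ?w)"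
    have dM: "((snd c \<circ> m) has_derivative ?M) (at ?w)"
      by (rule smooth_on_has_derivative[OF smooth_map_euclidD[OF smm c(1)]]) (use w c in auto)
    have "((\<lambda>w. ((snd c \<circ> m) w, snd w * sin \<theta>)) has_derivative (\<lambda>h. (?M h, snd h * sin \<theta>))) (at ?w)"
      by (intro has_derivative_Pair dM has_derivative_mult_left has_derivative_snd has_derivative_ident)
    then have "L = (\<lambda>h. (?M h, snd h * sin \<theta>))"
      using has_derivative_unique[OF dL] by (simp add: o_def Xm)
    then have Lz: "\<zeta> ?c = (?M z, snd z * sin \<theta>)" using z by simp
    have "?M z = fst z *\<^sub>R ?M (1, 0) + snd z *\<^sub>R ?M (0, 1)"
    proof -
      have "z = fst z *\<^sub>R (1, 0) + snd z *\<^sub>R (0, 1)" by (simp add: prod_eq_iff)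
      then have "?M z = ?M (fst z *\<^sub>R (1, 0) + snd z *\<^sub>R (0, 1))" by simp
      then show ?thesis by (simp only: linear_add[OF has_derivative_linear[OF dM]] linear_scale[OF has_derivative_linear[OF dM]])
    qed
    then have "G c (snd c (fst q)) (n ?w c) (?M z) = snd z * cos \<theta>"
      using n(3,4)[OF w(1) c(1)] n1[OF q c] c w by (simp add: G_bil[OF c(1) x])
    then show ?thesis
      using prod_metric_chart[OF c \<nu>t[OF q] \<zeta>t] by (simp add: \<nu>c[OF c] Lz G_bil[OF c(1) x])
  qed
  have cont: "continuous_on (\<Sigma> \<inter> W \<inter> dom_chart d) (\<lambda>q. \<nu> q d)" if d: "d \<in> ?B" for d
  proof -
    obtain c where c: "c \<in> A" "d = prod_chart c" using d by (auto elim!: prod_atlasE)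
    have "continuous_on (\<Sigma> \<inter> W \<inter> dom_chart d) (\<lambda>q. n (\<omega> q) c)"
      by (rule continuous_on_compose2[OF n(5)[OF c(1)] continuous_on_subset[OF c\<omega>]]) (use \<omega> m\<omega> c in auto)
    then have "continuous_on (\<Sigma> \<inter> W \<inter> dom_chart d) (\<lambda>q. ((- sin \<theta>) *\<^sub>R n (\<omega> q) c, cos \<theta>))"
      by (intro continuous_intros)
    then show ?thesis
      by (rule iffD2[OF continuous_on_cong[OF refl], rotated]) (use \<nu>c[OF c(1)] c in auto)
  qed
  have "unit_normal_field ?B ?h \<Sigma> W \<nu>"
    unfolding unit_normal_field_def using \<nu>t unit orth cont by blast
  then show thesis using that W(1) vert pX W(2) by blast
qed

lemma constant_angle_if_parametrized:
  assumes par: "\<forall>p\<in>\<Sigma>. \<exists>F. vertical_isometry A g F \<and>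
      (\<exists>I K \<alpha> U J.
         open I \<and> is_interval I \<and> open K \<and> is_interval K \<and>
         unit_speed_curve A g I \<alpha> \<and>
         open U \<and> \<alpha> ` I \<subseteq> U \<and> rotation_field A g U J \<and>
         (\<forall>u\<in>I. \<forall>v\<in>K. angle_vector A \<theta> \<alpha> J u v \<in> exp_domain A g (\<alpha> u)) \<and>
         regular_parametrization (prod_atlas A) (F ` \<Sigma>) (F p) (I \<times> K)
           (angle_parametrization A g \<theta> \<alpha> J))"
  shows "constant_angle A g \<Sigma> \<theta>"
  unfolding constant_angle_def
proof
  fix p assume "p \<in> \<Sigma>"
  from bspec[OF par this] obtain F I K \<alpha> U J where F: "vertical_isometry A g F" and
    *: "open I" "open K" "unit_speed_curve A g I \<alpha>" "open U" "\<alpha> ` I \<subseteq> U" "rotation_field A g U J"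
    "\<forall>u\<in>I. \<forall>v\<in>K. angle_vector A \<theta> \<alpha> J u v \<in> exp_domain A g (\<alpha> u)"
    "regular_parametrization (prod_atlas A) (F ` \<Sigma>) (F p) (I \<times> K) (angle_parametrization A g \<theta> \<alpha> J)" by blast
  obtain W \<nu> where W: "open W" "F p \<in> W" "unit_normal_field (prod_atlas A) (prod_metric A g) (F ` \<Sigma>) W \<nu>"
    "\<And>q. q \<in> F ` \<Sigma> \<inter> W \<Longrightarrow> prod_metric A g q (\<nu> q) (vertical A q) = cos \<theta>"
    using angle_parametrization_normal[OF *(1-6) _ *(8)] *(7) by blast
  obtain \<mu> where "unit_normal_field (prod_atlas A) (prod_metric A g) \<Sigma> (F -` W) \<mu>"
    "\<And>q. q \<in> \<Sigma> \<inter> F -` W \<Longrightarrow> prod_metric A g q (\<mu> q) (vertical A q) = cos \<theta>" "open (F -` W)"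
    using unit_normal_pull_back[OF F W(1,3,4)] by blast
  then show "\<exists>W \<nu>. open W \<and> p \<in> W \<and> unit_normal_field (prod_atlas A) (prod_metric A g) \<Sigma> W \<nu> \<and>
      (\<forall>q\<in>\<Sigma> \<inter> W. prod_metric A g q (\<nu> q) (vertical A q) = cos \<theta>)"
    using W(2) by (intro exI[of _ "F -` W"] exI[of _ \<mu>]) auto
qed

end

section \<open>Adapted coordinates on a constant angle surface\<close>

lemma homeomorphism_inv_into:
  assumes "homeomorphism S T f k"
  shows "homeomorphism S T f (inv_into S f)"
proof (rule homeomorphism_cong[OF assms refl refl])
  have inj: "inj_on f S" using homeomorphism_apply1[OF assms] by (metis inj_onI)
  fix y assume "y \<in> T"
  then have "k y \<in> S" "f (k y) = y" using homeomorphism_image2[OF assms] homeomorphism_apply2[OF assms] by auto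
  then show "inv_into S f y = k y" using inv_into_f_f[OF inj] by metis
qed simp

lemma open_contains_square:
  fixes U :: "(real \<times> real) set"
  assumes "open U" "(0, 0) \<in> U"
  obtains r where "0 < r" "{-r<..<r} \<times> {-r<..<r} \<subseteq> U"
proof -
  obtain P Q where PQ: "open P" "open Q" "(0, 0) \<in> P \<times> Q" "P \<times> Q \<subseteq> U"
    by (rule open_prod_elim[OF assms])
  then have "open (P \<inter> Q)" "0 \<in> P \<inter> Q" by (simp_all add: open_Int)
  then obtain r where r: "0 < r" "ball 0 r \<subseteq> P \<inter> Q" by (rule openE)
  have "{-r<..<r} \<subseteq> ball 0 r" by (auto simp: dist_real_def)
  then have "{-r<..<r} \<times> {-r<..<r} \<subseteq> U" using r(2) PQ(4) by blast
  then show thesis by (rule that[OF r(1)])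
qed

text \<open>Transport along the linear isomorphism \<open>P\<close> with inverse \<open>Q\<close>:
  charts of \<open>M\<close> take values in \<open>real^2\<close>, surface coordinates in
  pairs.\<close>

lemma smooth_inverse_function_plane:
  fixes f :: "real \<times> real \<Rightarrow> real^2"
  assumes "open U" "smooth_on U f" "w \<in> U"
    and inj: "\<And>z. frechet_derivative f (at w) z = 0 \<Longrightarrow> z = 0"
  obtains U' V h where "open U'" "U' \<subseteq> U" "w \<in> U'" "open V" "homeomorphism U' V f h" "smooth_on V h"
proof -
  define P :: "real^2 \<Rightarrow> real \<times> real" where "P x = (x $ 1, x $ 2)" for x
  define Q :: "real \<times> real \<Rightarrow> real^2" where "Q z = fst z *\<^sub>R axis 1 1 + snd z *\<^sub>R axis 2 1" for z
  have QP: "Q (P x) = x" for x by (simp add: P_def Q_def vec_eq_iff axis_def forall_2)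
  have PQ: "P (Q z) = z" for z by (simp add: P_def Q_def axis_def)
  have P: "bounded_linear P" unfolding P_def by (intro bounded_linear_Pair bounded_linear_vec_nth)
  have Q: "bounded_linear Q" unfolding Q_def
    by (intro bounded_linear_add bounded_linear_scaleR_const bounded_linear_fst bounded_linear_snd)
  have sm: "smooth_on U (\<lambda>z. P (f z))" by (rule smooth_on_linear[OF P assms(1,2)])
  have "((\<lambda>z. P (f z)) has_derivative (\<lambda>z. P (frechet_derivative f (at w) z))) (at w)"
    by (rule bounded_linear.has_derivative[OF P smooth_on_has_derivative[OF assms(2,3)]])
  then have D: "frechet_derivative (\<lambda>z. P (f z)) (at w) = (\<lambda>z. P (frechet_derivative f (at w) z))"
    by (rule frechet_derivative_at[symmetric])
  have "z = 0" if "frechet_derivative (\<lambda>z. P (f z)) (at w) z = 0" for z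
  proof -
    have "Q (P (frechet_derivative f (at w) z)) = Q 0" using that D by simp
    then show ?thesis using inj by (simp add: QP linear_0[OF bounded_linear.linear[OF Q]])
  qed
  then obtain U' V h where h: "open U'" "U' \<subseteq> U" "w \<in> U'" "open V" "homeomorphism U' V (\<lambda>z. P (f z)) h" "smooth_on V h"
    by (rule smooth_inverse_function[OF assms(1) sm assms(3)]) (assumption | rule that)+
  have o: "open (P -` V)" by (rule continuous_open_vimage[OF h(4)]) (rule linear_continuous_at[OF P])
  show thesis
  proof (rule that[OF h(1-3) o])
    show "smooth_on (P -` V) (\<lambda>x. h (P x))"
      by (rule smooth_on_compose[OF o h(4) _ smooth_on_linear[OF P o smooth_on_ident[OF o]] h(6)]) auto
    show "homeomorphism U' (P -` V) f (\<lambda>x. h (P x))"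
    proof (rule homeomorphismI)
      show "continuous_on U' f" using smooth_on_continuous[OF assms(2)] h(2) continuous_on_subset by blast
      show "continuous_on (P -` V) (\<lambda>x. h (P x))"
        by (rule continuous_on_compose2[OF homeomorphism_cont2[OF h(5)] linear_continuous_on[OF P]]) auto
      show "f ` U' \<subseteq> P -` V" using homeomorphism_image1[OF h(5)] by auto
      show "(\<lambda>x. h (P x)) ` (P -` V) \<subseteq> U'" using homeomorphism_image2[OF h(5)] by auto
      show "h (P (f x)) = x" if "x \<in> U'" for x using homeomorphism_apply1[OF h(5) that] .
      show "f (h (P y)) = y" if "y \<in> P -` V" for y
      proof -
        have "P (f (h (P y))) = P y" using homeomorphism_apply2[OF h(5), of "P y"] that by simp
        then show ?thesis using QP by metis
      qed
    qed
  qed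
qed

context riemannian_surface
begin

text \<open>The condition of the theorem at one point, after the isometry has been applied.\<close>

definition locally_parametrized :: "real \<Rightarrow> ('a \<times> real) set \<Rightarrow> 'a \<times> real \<Rightarrow> bool" where
  "locally_parametrized \<theta> S q \<longleftrightarrow> (\<exists>I K \<alpha> U J.
     open I \<and> is_interval I \<and> open K \<and> is_interval K \<and>
     unit_speed_curve A g I \<alpha> \<and>
     open U \<and> \<alpha> ` I \<subseteq> U \<and> rotation_field A g U J \<and>
     (\<forall>u\<in>I. \<forall>v\<in>K. angle_vector A \<theta> \<alpha> J u v \<in> exp_domain A g (\<alpha> u)) \<and>
     regular_parametrization (prod_atlas A) S q (I \<times> K) (angle_parametrization A g \<theta> \<alpha> J))"

end

text \<open>Coordinates of a surface \<open>S\<close> near \<open>(inv_chart c (y wb), 0)\<close> with unit normal \<open>(n, cos \<theta>)\<close>.\<close>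

locale surface_patch = riemannian_surface A g
  for A :: "('a::{t2_space, second_countable_topology}, real^2) chart set" and g :: "('a, real^2) metric" +
  fixes S :: "('a \<times> real) set" and c :: "('a, real^2) chart" and D :: "(real \<times> real) set"
    and y :: "real \<times> real \<Rightarrow> real^2" and h :: "real \<times> real \<Rightarrow> real"
    and W :: "('a \<times> real) set" and \<omega> :: "'a \<times> real \<Rightarrow> real \<times> real"
    and n :: "real \<times> real \<Rightarrow> real^2" and \<theta> :: real and wb :: "real \<times> real"
  assumes c: "c \<in> A" and D: "open D" "wb \<in> D" and y: "smooth_on D y" "y ` D \<subseteq> img c" and h: "smooth_on D h" "h wb = 0"
    and W: "open W" and hom: "homeomorphism D (S \<inter> W) (\<lambda>d. (inv_chart c (y d), h d)) \<omega>"
    and imm: "\<And>d z. d \<in> D \<Longrightarrow> frechet_derivative y (at d) z = 0 \<Longrightarrow> frechet_derivative h (at d) z = 0 \<Longrightarrow> z = 0"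
    and nn: "\<And>d. d \<in> D \<Longrightarrow> metric_coord A g c (y d) (n d) (n d) = (sin \<theta>)\<^sup>2"
    and orth: "\<And>d z. d \<in> D \<Longrightarrow> metric_coord A g c (y d) (n d) (frechet_derivative y (at d) z) + cos \<theta> * frechet_derivative h (at d) z = 0"
begin

lemma yD: "d \<in> D \<Longrightarrow> y d \<in> img c" using y(2) by auto

lemma dy: "d \<in> D \<Longrightarrow> (y has_derivative frechet_derivative y (at d)) (at d)"
  by (rule smooth_on_has_derivative[OF y(1)])

lemma dh: "d \<in> D \<Longrightarrow> (h has_derivative frechet_derivative h (at d)) (at d)"
  by (rule smooth_on_has_derivative[OF h(1)])

text \<open>The common end of all cases. The map \<kappa> exchanges the coordinates of
  \<open>D\<close> for (u, v). The equation in \<open>v\<close> with initial velocity cos \<theta> J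
  \<alpha>' identifies the curves u = const as the geodesics that the exponential map prescribes,
  and \<open>height\<close> settles the second component. Injectivity of the derivative at the
  origin makes \<kappa> a local diffeomorphism, and the parameters are cut down to a square in its
  domain.\<close>

lemma locally_parametrizedI:
  fixes \<kappa> :: "real \<times> real \<Rightarrow> real \<times> real" and \<eta> :: "real \<Rightarrow> real \<Rightarrow> real^2" and \<alpha>' :: "real \<Rightarrow> real^2"
  assumes ab: "0 < a" "0 < b" and \<kappa>: "smooth_on ({-a<..<a} \<times> {-b<..<b}) \<kappa>" "\<kappa> ` ({-a<..<a} \<times> {-b<..<b}) \<subseteq> D"
    and \<kappa>0: "\<kappa> (0, 0) = wb" and inj: "\<And>z. frechet_derivative \<kappa> (at (0, 0)) z = 0 \<Longrightarrow> z = 0"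
    and height: "\<And>u v. u \<in> {-a<..<a} \<Longrightarrow> v \<in> {-b<..<b} \<Longrightarrow> h (\<kappa> (u, v)) = v * sin \<theta>"
    and geo: "\<And>u v. u \<in> {-a<..<a} \<Longrightarrow> v \<in> {-b<..<b} \<Longrightarrow>
      ((\<lambda>s. (y (\<kappa> (u, s)), \<eta> u s)) has_vector_derivative geo_field c (y (\<kappa> (u, v)), \<eta> u v)) (at v)"
    and init: "\<And>u. u \<in> {-a<..<a} \<Longrightarrow> ((\<lambda>s. y (\<kappa> (s, 0))) has_vector_derivative \<alpha>' u) (at u)"
      "\<And>u. u \<in> {-a<..<a} \<Longrightarrow> G c (y (\<kappa> (u, 0))) (\<alpha>' u) (\<alpha>' u) = 1"
      "\<And>u. u \<in> {-a<..<a} \<Longrightarrow> \<eta> u 0 = cos \<theta> *\<^sub>R chart_rotation c (y (\<kappa> (u, 0))) (\<alpha>' u)"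
  shows "locally_parametrized \<theta> S (inv_chart c (y wb), 0)"
proof -
  let ?Q = "{-a<..<a} \<times> {-b<..<b}"
  have Q: "open ?Q" "(0, 0) \<in> ?Q" using ab by (auto simp: open_Times)
  obtain U' V k where k: "open U'" "U' \<subseteq> ?Q" "(0, 0) \<in> U'" "open V" "homeomorphism U' V \<kappa> k" "smooth_on V k"
    by (rule smooth_inverse_function[OF Q(1) \<kappa>(1) Q(2) inj]) (assumption | rule that)+
  obtain r where r: "0 < r" "{-r<..<r} \<times> {-r<..<r} \<subseteq> U'" by (rule open_contains_square[OF k(1,3)])
  define I where "I = {-r<..<r}"
  have I: "open I" "is_interval I" "0 \<in> I" using r by (auto simp: I_def is_interval_oo)
  have IU: "I \<times> I \<subseteq> U'" using r by (simp add: I_def)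
  have Iab: "I \<subseteq> {-a<..<a}" "I \<subseteq> {-b<..<b}" using IU k(2) I(3) by (auto 0 3)
  have \<kappa>D: "\<kappa> (u, v) \<in> D" if "u \<in> {-a<..<a}" "v \<in> {-b<..<b}" for u v using \<kappa>(2) that by blast
  have \<kappa>I: "\<kappa> w \<in> D" if "w \<in> I \<times> I" for w using that IU k(2) \<kappa>(2) by blast
  define x where "x w = y (\<kappa> w)" for w
  have x: "x (u, v) \<in> img c" if "u \<in> {-a<..<a}" "v \<in> {-b<..<b}" for u v using yD[OF \<kappa>D[OF that]] by (simp add: x_def)
  have smx: "smooth_on ?Q x" unfolding x_def by (rule smooth_on_compose[OF Q(1) D(1) \<kappa>(2) \<kappa>(1) y(1)])
  define \<alpha> where "\<alpha> u = inv_chart c (x (u, 0))" for u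
  define J where "J = rotation_of_chart c"
  define P where "P = angle_parametrization A g \<theta> \<alpha> J"
  have b0: "0 \<in> {-b<..<b}" using ab by simp
  have smxu: "smooth_on {-a<..<a} (\<lambda>u. x (u, 0))"
    by (rule smooth_on_compose[OF _ Q(1) _ _ smx]) (use ab in \<open>auto intro!: smooth_on_Pair smooth_on_ident\<close>)
  have x\<alpha>: "(\<lambda>u. x (u, 0)) ` {-a<..<a} \<subseteq> img c" using x b0 by blast
  have \<alpha>: "smooth_map euclid_atlas A {-a<..<a} \<alpha>"
    by (rule smooth_map_in_chart[OF atlas c _ smxu x\<alpha>]) (simp_all add: \<alpha>_def)
  have \<alpha>c: "\<alpha> u \<in> fst c" "snd c (\<alpha> u) = x (u, 0)" if "u \<in> {-a<..<a}" for u
    using chart_inv_dom[OF chart[OF c] x[OF that b0]] chart_image_inv[OF chart[OF c] x[OF that b0]] by (simp_all add: \<alpha>_def)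
  have vel: "velocity A \<alpha> u = coord_vec A c (\<alpha> u) (\<alpha>' u)" if u: "u \<in> {-a<..<a}" for u
  proof (rule tangent_eqI[OF _ coord_vec_tangent[OF atlas c \<alpha>c(1)[OF u]] c \<alpha>c(1)[OF u]])
    show "velocity A \<alpha> u \<in> tangent_space A (\<alpha> u)" by (rule velocity_tangent[OF atlas \<alpha> _ u]) simp
    have "((snd c \<circ> \<alpha>) has_vector_derivative \<alpha>' u) (at u)"
      by (rule has_vector_derivative_transform_within_open[OF init(1)[OF u] open_greaterThanLessThan u]) (simp add: \<alpha>c(2) x_def)
    then have "velocity A \<alpha> u c = \<alpha>' u" by (rule velocity_eqI[where \<gamma> = \<alpha> and t = u, OF _ c \<alpha>c(1)[OF u]])
    then show "velocity A \<alpha> u c = coord_vec A c (\<alpha> u) (\<alpha>' u) c" using coord_vec_chart[OF chart[OF c] c \<alpha>c(1)[OF u]] by simp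
  qed
  have c\<alpha>: "coord_vec A c (\<alpha> u) e c = e" "coord_vec A c (\<alpha> u) e \<in> tangent_space A (\<alpha> u)" if "u \<in> {-a<..<a}" for u e
    using coord_vec_chart[OF chart[OF c] c \<alpha>c(1)[OF that]] coord_vec_tangent[OF atlas c \<alpha>c(1)[OF that]] by auto
  have unit: "g (\<alpha> u) (velocity A \<alpha> u) (velocity A \<alpha> u) = 1" if u: "u \<in> {-a<..<a}" for u
    unfolding vel[OF u] metric_chart[OF c \<alpha>c(1)[OF u] c\<alpha>(2)[OF u] c\<alpha>(2)[OF u]] c\<alpha>(1)[OF u] \<alpha>c(2)[OF u]
    using init(2)[OF u] by (simp add: x_def)
  define \<gamma> where "\<gamma> u s = inv_chart c (x (u, s))" for u s
  have geo': "geodesic_on A g {-b<..<b} (\<gamma> u)" "velocity A (\<gamma> u) 0 = coord_vec A c (\<alpha> u) (\<eta> u 0)" if u: "u \<in> {-a<..<a}" for u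
  proof -
    have s: "smooth_on {-b<..<b} (\<lambda>s. x (u, s))"
      by (rule smooth_on_compose[OF _ Q(1) _ _ smx]) (use u in \<open>auto intro!: smooth_on_Pair smooth_on_ident\<close>)
    have i: "(\<lambda>s. x (u, s)) ` {-b<..<b} \<subseteq> img c" using x[OF u] by blast
    note * = geodesic_in_chart[OF c open_greaterThanLessThan s i, of "\<eta> u" "\<gamma> u"]
    show "geodesic_on A g {-b<..<b} (\<gamma> u)" by (rule *(1)) (use geo[OF u] in \<open>simp_all add: x_def \<gamma>_def\<close>)
    have "velocity A (\<gamma> u) 0 = coord_vec A c (\<gamma> u 0) (\<eta> u 0)"
      by (rule *(2)[OF _ _ b0]) (use geo[OF u] in \<open>simp_all add: x_def \<gamma>_def\<close>)
    then show "velocity A (\<gamma> u) 0 = coord_vec A c (\<alpha> u) (\<eta> u 0)" by (simp add: \<gamma>_def \<alpha>_def)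
  qed
  have av: "angle_vector A \<theta> \<alpha> J u v = tscale v (velocity A (\<gamma> u) 0)" if u: "u \<in> {-a<..<a}" for u v
    unfolding angle_vector_def J_def rotation_of_chart_def vel[OF u] geo'(2)[OF u] c\<alpha>(1)[OF u] \<alpha>c(2)[OF u] init(3)[OF u]
      tscale_coord_vec[OF atlas c \<alpha>c(1)[OF u]] by (simp add: x_def)
  have gf: "geodesic_from A g (\<alpha> u) (angle_vector A \<theta> \<alpha> J u v) (\<lambda>t. \<gamma> u (v * t))"
    if u: "u \<in> {-a<..<a}" and v: "v \<in> {-b<..<b}" for u v
    using geodesic_from_scale[OF geo'(1)[OF u] _ _ b0 v] by (simp add: is_interval_oo av[OF u] \<gamma>_def \<alpha>_def)
  have dom: "angle_vector A \<theta> \<alpha> J u v \<in> exp_domain A g (\<alpha> u)" if u: "u \<in> {-a<..<a}" and v: "v \<in> {-b<..<b}" for u v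
    unfolding exp_domain_def using gf[OF u v] c\<alpha>(2)[OF u] tangent_space_tscale[OF atlas c\<alpha>(2)[OF u]]
    by (auto simp: av[OF u] geo'(2)[OF u])
  have Peq: "P w = (inv_chart c (y (\<kappa> w)), h (\<kappa> w))" if "w \<in> I \<times> I" for w
  proof -
    obtain u v where w: "w = (u, v)" by (cases w)
    have uv: "u \<in> {-a<..<a}" "v \<in> {-b<..<b}" using that w Iab by auto
    show ?thesis
      using exp_map_eq[OF gf[OF uv]] height[OF uv] by (simp add: w P_def angle_parametrization_def \<gamma>_def x_def)
  qed
  have oI: "open (I \<times> I)" using I by (simp add: open_Times)
  let ?B = "prod_atlas A" and ?c = "prod_chart c"
  have B: "smooth_atlas ?B" by (rule prod_atlas_smooth)
  have cB: "?c \<in> ?B" by (rule prod_chart_in_atlas[OF c])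
  have sm\<kappa>: "smooth_on (I \<times> I) \<kappa>" by (rule smooth_on_subset[OF \<kappa>(1)]) (use IU k(2) in blast)
  have \<kappa>ID: "\<kappa> ` (I \<times> I) \<subseteq> D" using \<kappa>I by blast
  have smY\<kappa>: "smooth_on (I \<times> I) (\<lambda>w. (y (\<kappa> w), h (\<kappa> w)))"
    by (intro smooth_on_Pair oI smooth_on_compose[OF oI D(1) \<kappa>ID sm\<kappa>] y(1) h(1))
  have smP: "smooth_map euclid_atlas ?B (I \<times> I) P"
  proof (rule smooth_map_in_chart[OF B cB oI smY\<kappa>])
    show "(\<lambda>w. (y (\<kappa> w), h (\<kappa> w))) ` (I \<times> I) \<subseteq> snd ?c ` fst ?c" unfolding prod_chart_image
      by (rule image_subsetI) (use yD[OF \<kappa>I] in simp)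
    fix w assume w: "w \<in> I \<times> I"
    show "P w = inv_chart ?c (y (\<kappa> w), h (\<kappa> w))"
      using Peq[OF w] inv_prod_chart'[OF chart[OF c], of "(y (\<kappa> w), h (\<kappa> w))"] yD[OF \<kappa>I[OF w]] by simp
  qed
  have immP: "inj_on (differential euclid_atlas ?B P w) (tangent_space euclid_atlas w)" if w: "w \<in> I \<times> I" for w
  proof -
    have Pd: "P w \<in> fst ?c" using Peq[OF w] chart_inv_dom[OF chart[OF c] yD[OF \<kappa>I[OF w]]] by simp
    have d\<kappa>: "(\<kappa> has_derivative frechet_derivative \<kappa> (at w)) (at w)" by (rule smooth_on_has_derivative[OF sm\<kappa> w])
    have "((\<lambda>w. (y (\<kappa> w), h (\<kappa> w))) has_derivative
        (\<lambda>z. (frechet_derivative y (at (\<kappa> w)) (frechet_derivative \<kappa> (at w) z), frechet_derivative h (at (\<kappa> w)) (frechet_derivative \<kappa> (at w) z)))) (at w)"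
      by (intro has_derivative_Pair has_derivative_compose[OF d\<kappa> dy[OF \<kappa>I[OF w]]] has_derivative_compose[OF d\<kappa> dh[OF \<kappa>I[OF w]]])
    then have "((snd ?c \<circ> P) has_derivative
        (\<lambda>z. (frechet_derivative y (at (\<kappa> w)) (frechet_derivative \<kappa> (at w) z), frechet_derivative h (at (\<kappa> w)) (frechet_derivative \<kappa> (at w) z)))) (at w)"
    proof (rule has_derivative_transform_within_open[OF _ oI w])
      fix w' assume w': "w' \<in> I \<times> I"
      show "(y (\<kappa> w'), h (\<kappa> w')) = (snd ?c \<circ> P) w'"
        using Peq[OF w'] chart_image_inv[OF chart[OF c] yD[OF \<kappa>I[OF w']]] by simp
    qed
    note DP = fun_cong[OF frechet_derivative_at[OF this]]
    have "z = 0" if "frechet_derivative (snd ?c \<circ> P) (at w) z = 0" for z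
    proof -
      have "frechet_derivative \<kappa> (at w) z = 0"
        by (rule imm[OF \<kappa>I[OF w]]) (use that DP[of z] in \<open>simp_all add: zero_prod_def\<close>)
      moreover have wU: "w \<in> U'" using w IU by blast
      moreover have "\<kappa> w \<in> V" using homeomorphism_image1[OF k(5)] wU by blast
      then have "((\<lambda>w. k (\<kappa> w)) has_derivative (\<lambda>z. frechet_derivative k (at (\<kappa> w)) (frechet_derivative \<kappa> (at w) z))) (at w)"
        by (intro has_derivative_compose[OF d\<kappa>] smooth_on_has_derivative[OF k(6)])
      \<comment> \<open>Since \<open>k\<close> inverts \<kappa> near \<open>w\<close>, the chain
        rule makes the derivative of \<kappa> injective at every point of the square, not only at
        the origin.\<close>
      then have "((\<lambda>w. w) has_derivative (\<lambda>z. frechet_derivative k (at (\<kappa> w)) (frechet_derivative \<kappa> (at w) z))) (at w)"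
        by (rule has_derivative_transform_within_open[OF _ k(1) wU]) (rule homeomorphism_apply1[OF k(5)])
      then have eq: "(\<lambda>z. frechet_derivative k (at (\<kappa> w)) (frechet_derivative \<kappa> (at w) z)) = (\<lambda>z. z)"
        by (rule has_derivative_unique[OF _ has_derivative_ident])
      have "linear (frechet_derivative k (at (\<kappa> w)))"
        by (rule has_derivative_linear[OF smooth_on_has_derivative[OF k(6) \<open>\<kappa> w \<in> V\<close>]])
      ultimately show ?thesis using fun_cong[OF eq, of z] linear_0 by metis
    qed
    then show ?thesis using inj_differential_euclid[OF B smP oI w cB Pd] by blast
  qed
  let ?Y = "\<lambda>d. (inv_chart c (y d), h d)"
  have h\<kappa>: "homeomorphism (I \<times> I) (\<kappa> ` (I \<times> I)) \<kappa> k"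
    by (rule homeomorphism_of_subsets[OF k(5) IU subset_refl refl])
  have hY: "homeomorphism (\<kappa> ` (I \<times> I)) (?Y ` \<kappa> ` (I \<times> I)) ?Y \<omega>"
    by (rule homeomorphism_of_subsets[OF hom \<kappa>ID subset_refl refl])
  have PY: "P ` (I \<times> I) = ?Y ` \<kappa> ` (I \<times> I)" using Peq by (simp add: image_image)
  have "homeomorphism (I \<times> I) (P ` (I \<times> I)) P (k \<circ> \<omega>)"
    by (rule homeomorphism_cong[OF homeomorphism_compose[OF h\<kappa> hY] refl PY]) (simp_all add: Peq)
  then have homP: "homeomorphism (I \<times> I) (P ` (I \<times> I)) P (inv_into (I \<times> I) P)" by (rule homeomorphism_inv_into)
  \<comment> \<open>An open image in \<open>D\<close> corresponds under the surface homeomorphism to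
    a relatively open piece of \<open>S\<close>, as a regular parametrization requires.\<close>
  have "open (\<kappa> ` (I \<times> I))"
  proof -
    have "\<kappa> ` (I \<times> I) = V \<inter> k -` (I \<times> I)"
    proof (intro equalityI subsetI)
      fix d assume "d \<in> \<kappa> ` (I \<times> I)"
      then obtain w where w: "w \<in> I \<times> I" "d = \<kappa> w" by (rule imageE)
      then have "w \<in> U'" using IU by (rule_tac subsetD)
      then show "d \<in> V \<inter> k -` (I \<times> I)"
        using w homeomorphism_apply1[OF k(5)] homeomorphism_image1[OF k(5)] by (metis IntI imageI vimageI)
    next
      fix d assume d: "d \<in> V \<inter> k -` (I \<times> I)"
      have "\<kappa> (k d) = d" by (rule homeomorphism_apply2[OF k(5)]) (use d in blast)
      moreover have "k d \<in> I \<times> I" using d by blast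
      ultimately show "d \<in> \<kappa> ` (I \<times> I)" by (metis imageI)
    qed
    then show ?thesis using open_domain_restrict[OF k(4) homeomorphism_cont2[OF k(5)] oI] by simp
  qed
  then have "openin (top_of_set (S \<inter> W)) (?Y ` \<kappa> ` (I \<times> I))"
    using homeomorphism_imp_open_map[OF hom] \<kappa>ID by (simp add: openin_open_eq D(1))
  then obtain W' where W': "open W'" "?Y ` \<kappa> ` (I \<times> I) = (S \<inter> W) \<inter> W'" unfolding openin_open by blast
  have reg: "regular_parametrization ?B S (inv_chart c (y wb), 0) (I \<times> I) P"
    unfolding regular_parametrization_def
  proof (intro conjI ballI)
    have "P (0, 0) = (inv_chart c (y wb), 0)" using Peq[of "(0,0)"] I(3) \<kappa>0 h(2) by simp
    then show "(inv_chart c (y wb), 0) \<in> P ` (I \<times> I)" using I(3) by force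
    show "\<exists>W. open W \<and> P ` (I \<times> I) = S \<inter> W"
      using W W' PY by (intro exI[of _ "W \<inter> W'"]) (auto simp: Int_assoc)
  qed (use oI smP immP homP in auto)
  show ?thesis
    unfolding locally_parametrized_def
  proof (intro exI conjI)
    show "unit_speed_curve A g I \<alpha>"
      unfolding unit_speed_curve_def using smooth_map_subset[OF \<alpha> Iab(1)] unit Iab(1) by blast
    show "open (fst c)" by (rule chart_open_dom[OF chart[OF c]])
    show "\<alpha> ` I \<subseteq> fst c" using \<alpha>c(1) Iab(1) by blast
    show "rotation_field A g (fst c) J" unfolding J_def by (rule rotation_field_of_chart[OF c])
    show "\<forall>u\<in>I. \<forall>v\<in>I. angle_vector A \<theta> \<alpha> J u v \<in> exp_domain A g (\<alpha> u)" using dom Iab by blast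
    show "regular_parametrization ?B S (inv_chart c (y wb), 0) (I \<times> I) (angle_parametrization A g \<theta> \<alpha> J)"
      using reg by (simp add: P_def)
  qed (use I in auto)
qed

end

section \<open>Coordinates around a point of a constant angle surface\<close>

context riemannian_surface
begin

text \<open>A regular parametrization is read in a product chart around \<open>p\<close>, after a
  translation of heights. \<open>n\<close> is the horizontal part of the unit normal: its vertical
  part is cos \<theta>, which leaves (sin \<theta>) squared for its squared length.\<close>

lemma constant_angle_patch:
  assumes \<Sigma>: "regular_surface (prod_atlas A) \<Sigma>" and angle: "constant_angle A g \<Sigma> \<theta>" and p: "p \<in> \<Sigma>"
  obtains c D y h W \<omega> n wb where
    "surface_patch A g (vertical_translation (- snd p) ` \<Sigma>) c D y h W \<omega> n \<theta> wb" "inv_chart c (y wb) = fst p"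
proof -
  let ?B = "prod_atlas A"
  have B: "smooth_atlas ?B" by (rule prod_atlas_smooth)
  obtain V X where X: "regular_parametrization ?B \<Sigma> p V X" using \<Sigma> p unfolding regular_surface_def by blast
  then have V: "open V" "p \<in> X ` V" and smX: "smooth_map euclid_atlas ?B V X"
    and injX: "\<And>x. x \<in> V \<Longrightarrow> inj_on (differential euclid_atlas ?B X x) (tangent_space euclid_atlas x)"
    and homX: "homeomorphism V (X ` V) X (inv_into V X)"
    unfolding regular_parametrization_def by blast+
  obtain W0 where W0: "open W0" "X ` V = \<Sigma> \<inter> W0" using X unfolding regular_parametrization_def by blast
  obtain W1 \<nu> where W1: "open W1" "p \<in> W1" and \<nu>: "unit_normal_field ?B (prod_metric A g) \<Sigma> W1 \<nu>"
    and \<nu>v: "\<And>q. q \<in> \<Sigma> \<inter> W1 \<Longrightarrow> prod_metric A g q (\<nu> q) (vertical A q) = cos \<theta>"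
    using bspec[OF angle[unfolded constant_angle_def] p] by metis
  obtain c where c: "c \<in> A" "fst p \<in> fst c" using atlas_cover[OF atlas] .
  let ?c = "prod_chart c"
  have cB: "?c \<in> ?B" by (rule prod_chart_in_atlas[OF c(1)])
  have oc: "open (fst ?c)" by (rule chart_open_dom[OF atlas_chart[OF B cB]])
  define D where "D = V \<inter> X -` (W1 \<inter> fst ?c)"
  have oD: "open D" unfolding D_def
    by (rule open_domain_restrict[OF V(1) smooth_map_continuous[OF smX] open_Int[OF W1(1) oc]])
  obtain wb where wb: "wb \<in> V" "X wb = p" using V(2) by blast
  have wbD: "wb \<in> D" using wb W1 c by (simp add: D_def mem_Times_iff)
  define y where "y d = snd c (fst (X d))" for d
  define h where "h d = snd (X d) - snd p" for d
  have DX: "d \<in> V" "X d \<in> W1" "fst (X d) \<in> fst c" "X d \<in> fst ?c" "X d \<in> \<Sigma>" if "d \<in> D" for d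
    using that W0(2) by (auto simp: D_def)
  have Xc: "smooth_on D (snd ?c \<circ> X)"
    by (rule smooth_on_subset[OF smooth_map_euclidD[OF smX cB]]) (auto simp: D_def)
  have smy: "smooth_on D y" using smooth_on_fst[OF oD Xc] by (simp add: y_def[abs_def] o_def)
  have smh: "smooth_on D h" using smooth_on_diff[OF oD smooth_on_snd[OF oD Xc] smooth_on_const, of "snd p"]
    by (simp add: h_def[abs_def] o_def)
  have yi: "y ` D \<subseteq> img c" using DX(3) by (auto simp: y_def)
  have inv: "inv_chart c (y d) = fst (X d)" if "d \<in> D" for d
    using chart_inv[OF chart[OF c(1)] DX(3)[OF that]] by (simp add: y_def)
  let ?F = "vertical_translation (- snd p) :: 'a \<times> real \<Rightarrow> 'a \<times> real"
  let ?F' = "vertical_translation (snd p) :: 'a \<times> real \<Rightarrow> 'a \<times> real"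
  have FF: "?F (?F' q) = q" "?F' (?F q) = q" for q
    using vertical_translation_inverse[of "snd p" q] by simp_all
  have cF: "continuous_on T (vertical_translation r :: 'a \<times> real \<Rightarrow> 'a \<times> real)" for T r
    unfolding vertical_translation_def by (intro continuous_intros)
  define W where "W = ?F' -` (W0 \<inter> W1 \<inter> fst ?c)"
  have oW: "open W" unfolding W_def
    by (rule open_vimage[OF open_Int[OF open_Int[OF W0(1) W1(1)] oc] cF])
  have XD: "X ` D = \<Sigma> \<inter> (W0 \<inter> W1 \<inter> fst ?c)"
  proof -
    have "X ` D = X ` V \<inter> (W1 \<inter> fst ?c)" unfolding D_def by blast
    then show ?thesis unfolding W0(2) by blast
  qed
  have FW: "?F ` (X ` D) = ?F ` \<Sigma> \<inter> W"
  proof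
    show "?F ` X ` D \<subseteq> ?F ` \<Sigma> \<inter> W" unfolding XD W_def using FF by auto
    show "?F ` \<Sigma> \<inter> W \<subseteq> ?F ` X ` D" unfolding XD W_def using FF by auto
  qed
  have h1: "homeomorphism D (X ` D) X (inv_into V X)"
    by (rule homeomorphism_of_subsets[OF homX _ subset_refl refl]) (auto simp: D_def)
  have h2: "homeomorphism (X ` D) (?F ` X ` D) ?F ?F'"
    by (rule homeomorphismI) (use FF cF in \<open>auto simp: image_image\<close>)
  have hom: "homeomorphism D (?F ` \<Sigma> \<inter> W) (\<lambda>d. (inv_chart c (y d), h d)) (inv_into V X \<circ> ?F')"
  proof (rule homeomorphism_cong[OF homeomorphism_compose[OF h1 h2] refl FW[symmetric]])
    show "(inv_chart c (y d), h d) = (?F \<circ> X) d" if "d \<in> D" for d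
      using inv[OF that] by (simp add: vertical_translation_def h_def)
  qed simp
  let ?Dy = "\<lambda>d. frechet_derivative y (at d)" and ?Dh = "\<lambda>d. frechet_derivative h (at d)"
  have dX: "((snd ?c \<circ> X) has_derivative (\<lambda>z. (?Dy d z, ?Dh d z))) (at d)" if d: "d \<in> D" for d
  proof -
    have "((\<lambda>e. (y e, h e + snd p)) has_derivative (\<lambda>z. (?Dy d z, ?Dh d z + 0))) (at d)"
      by (intro has_derivative_Pair has_derivative_add has_derivative_const
          smooth_on_has_derivative[OF smy d] smooth_on_has_derivative[OF smh d])
    moreover have "snd ?c \<circ> X = (\<lambda>e. (y e, h e + snd p))" by (auto simp: y_def h_def)
    ultimately show ?thesis by simp
  qed
  have imm: "z = 0" if d: "d \<in> D" and z: "?Dy d z = 0" "?Dh d z = 0" for d z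
  proof -
    have "\<forall>v. frechet_derivative (snd ?c \<circ> X) (at d) v = 0 \<longrightarrow> v = 0"
      using inj_differential_euclid[OF B smX V(1) DX(1)[OF d] cB DX(4)[OF d]] injX[OF DX(1)[OF d]] by blast
    moreover have "frechet_derivative (snd ?c \<circ> X) (at d) z = 0"
      using fun_cong[OF frechet_derivative_at[OF dX[OF d]], of z] z by (simp add: zero_prod_def)
    ultimately show ?thesis by blast
  qed
  \<comment> \<open>Every direction in the parameter domain is the velocity of a straight line,
    whose image is a curve in the surface; so the normal is orthogonal to the whole image of the
    derivative.\<close>
  have tang: "\<exists>\<zeta> \<in> surface_tangent ?B \<Sigma> (X d). \<zeta> \<in> tangent_space ?B (X d) \<and> \<zeta> ?c = (?Dy d z, ?Dh d z)" if d: "d \<in> D" for d z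
  proof -
    define l where "l t = d + t *\<^sub>R z" for t :: real
    have dl: "(l has_vector_derivative z) (at 0)" unfolding l_def by (auto intro!: derivative_eq_intros)
    have cl: "continuous_on UNIV l" unfolding l_def by (intro continuous_intros)
    have "open (l -` D)" "0 \<in> l -` D" using open_vimage[OF oD cl] d by (auto simp: l_def)
    then obtain \<epsilon> where \<epsilon>: "0 < \<epsilon>" "ball 0 \<epsilon> \<subseteq> l -` D" by (rule openE)
    have \<epsilon>D: "l t \<in> D" if "t \<in> {-\<epsilon><..<\<epsilon>}" for t
    proof -
      have "t \<in> ball 0 \<epsilon>" using that by (auto simp: dist_real_def)
      then show ?thesis using \<epsilon>(2) by blast
    qed
    have sml: "smooth_on {-\<epsilon><..<\<epsilon>} l" unfolding l_def
      by (intro smooth_on_add smooth_on_scaleR smooth_on_const smooth_on_ident open_greaterThanLessThan)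
    have lD: "l ` {-\<epsilon><..<\<epsilon>} \<subseteq> D" using \<epsilon>D by blast
    have sm: "smooth_map euclid_atlas ?B {-\<epsilon><..<\<epsilon>} (\<lambda>t. X (l t))"
    proof (rule smooth_map_in_chart[OF B cB open_greaterThanLessThan smooth_on_compose[OF open_greaterThanLessThan oD lD sml Xc]])
      show "(\<lambda>t. (snd ?c \<circ> X) (l t)) ` {-\<epsilon><..<\<epsilon>} \<subseteq> snd ?c ` fst ?c" using DX(4)[OF \<epsilon>D] by (simp only: o_def) blast
      show "X (l t) = inv_chart ?c ((snd ?c \<circ> X) (l t))" if "t \<in> {-\<epsilon><..<\<epsilon>}" for t
        using chart_inv[OF atlas_chart[OF B cB] DX(4)[OF \<epsilon>D[OF that]]] by (simp only: o_def)
    qed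
    have "velocity ?B (\<lambda>t. X (l t)) 0 \<in> tangent_space ?B (X (l 0))"
      by (rule velocity_tangent[OF B sm]) (use \<epsilon> in auto)
    moreover have "velocity ?B (\<lambda>t. X (l t)) 0 \<in> surface_tangent ?B \<Sigma> (X d)"
      unfolding surface_tangent_def using \<epsilon>(1) sm DX(5)[OF \<epsilon>D] by (auto simp: l_def intro!: exI[of _ "\<lambda>t. X (l t)"] exI[of _ \<epsilon>])
    moreover have "velocity ?B (\<lambda>t. X (l t)) 0 ?c = (?Dy d z, ?Dh d z)"
    proof (rule velocity_eqI[OF _ cB])
      have "((snd ?c \<circ> X) has_derivative (\<lambda>z. (?Dy d z, ?Dh d z))) (at (l 0))" using dX[OF d] by (simp add: l_def)
      from has_vector_derivative_linear_image[OF this dl]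
      show "((snd ?c \<circ> (\<lambda>t. X (l t))) has_vector_derivative (?Dy d z, ?Dh d z)) (at 0)" by (simp only: o_def)
      show "X (l 0) \<in> fst ?c" using DX(4)[OF d] by (simp add: l_def)
    qed
    ultimately show ?thesis by (auto simp: l_def)
  qed
  define n where "n d = fst (\<nu> (X d) ?c)" for d
  have \<nu>t: "\<nu> (X d) \<in> tangent_space ?B (X d)" "prod_metric A g (X d) (\<nu> (X d)) (\<nu> (X d)) = 1"
    "\<And>\<zeta>. \<zeta> \<in> surface_tangent ?B \<Sigma> (X d) \<Longrightarrow> prod_metric A g (X d) (\<nu> (X d)) \<zeta> = 0" if d: "d \<in> D" for d
    using \<nu> DX(2,5)[OF d] unfolding unit_normal_field_def by blast+
  have vc: "snd (\<nu> (X d) ?c) = cos \<theta>" if d: "d \<in> D" for d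
  proof -
    have "X d \<in> \<Sigma> \<inter> W1" using DX[OF d] by blast
    then show ?thesis
      using prod_metric_chart[OF c(1) DX(3)[OF d] \<nu>t(1)[OF d] vertical_tangent[OF atlas]] \<nu>v
        vertical_in_chart[OF c(1) DX(3)[OF d]] DX(3)[OF d] G_bil(8)[OF c(1) imageI[OF DX(3)[OF d]]] by simp
  qed
  have "surface_patch A g (?F ` \<Sigma>) c D y h W (inv_into V X \<circ> ?F') n \<theta> wb"
  proof (intro surface_patch.intro surface_patch_axioms.intro riemannian_surface_axioms)
    show "G c (y d) (n d) (n d) = (sin \<theta>)\<^sup>2" if d: "d \<in> D" for d
      using prod_metric_chart[OF c(1) DX(3)[OF d] \<nu>t(1)[OF d] \<nu>t(1)[OF d]] \<nu>t(2)[OF d] vc[OF d] sin_cos_squared_add[of \<theta>]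
      by (simp add: y_def n_def power2_eq_square)
    show "G c (y d) (n d) (?Dy d z) + cos \<theta> * ?Dh d z = 0" if d: "d \<in> D" for d z
    proof -
      obtain \<zeta> where "\<zeta> \<in> surface_tangent ?B \<Sigma> (X d)" "\<zeta> \<in> tangent_space ?B (X d)" "\<zeta> ?c = (?Dy d z, ?Dh d z)"
        using tang[OF d, of z] by blast
      then show ?thesis
        using prod_metric_chart[OF c(1) DX(3)[OF d] \<nu>t(1)[OF d], of \<zeta>] \<nu>t(3)[OF d, of \<zeta>] vc[OF d]
        by (simp add: y_def n_def)
    qed
    show "h wb = 0" using wb by (simp add: h_def)
  qed (fact c(1) oD wbD smy yi smh oW hom imm)+
  moreover have "inv_chart c (y wb) = fst p" using inv[OF wbD] wb by simp
  ultimately show thesis by (rule that)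
qed

end

section \<open>Constant angle surfaces are parametrized\<close>

lemma affine_of_constant_derivative:
  fixes q :: "real \<Rightarrow> real"
  assumes "\<And>t. t \<in> {-a<..<a} \<Longrightarrow> (q has_vector_derivative k) (at t)" "t \<in> {-a<..<a}"
  shows "q t = q 0 + t * k"
proof -
  have "((\<lambda>t. q t - t * k) has_vector_derivative k - 1 * k) (at s)" if "s \<in> {-a<..<a}" for s
    by (intro has_vector_derivative_diff assms(1)[OF that] has_vector_derivative_mult_left has_vector_derivative_id)
  then have "\<exists>d. \<forall>s\<in>{-a<..<a}. q s - s * k = d"
    by (intro has_derivative_zero_constant convex_real_interval)
      (auto simp: has_vector_derivative_def intro: has_derivative_at_withinI)
  moreover have "0 \<in> {-a<..<a}" using assms(2) by auto
  ultimately show ?thesis using assms(2) by (metis add.commute diff_eq_eq diff_zero mult_zero_left)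
qed

lemma flow_curve:
  fixes \<Phi> :: "real \<Rightarrow> 'b::euclidean_space \<Rightarrow> 'b"
  assumes "0 < a" "smooth_on ({-a<..<a} \<times> ball x r) (\<lambda>p. \<Phi> (fst p) (snd p))" "0 < r"
  shows "smooth_on {-a<..<a} (\<lambda>t. \<Phi> t x)"
proof -
  have i: "(\<lambda>t. (t, x)) ` {-a<..<a} \<subseteq> {-a<..<a} \<times> ball x r" using assms(3) by auto
  have s: "smooth_on {-a<..<a} (\<lambda>t. (t, x))"
    by (intro smooth_on_Pair smooth_on_ident smooth_on_const open_greaterThanLessThan)
  have "open ({-a<..<a} \<times> ball x r)" by (intro open_Times open_greaterThanLessThan open_ball)
  from smooth_on_compose[OF open_greaterThanLessThan this i s assms(2)] show ?thesis by simp
qed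

text \<open>Starts the flow at each point of a curve: (u, v) goes to the point reached from
  \<open>Z u\<close> after time \<open>v\<close>. The parameter range is cut so that the curve stays
  among the admissible initial values.\<close>

lemma smooth_flow_through_curve:
  fixes \<Phi> :: "real \<Rightarrow> 'b::euclidean_space \<Rightarrow> 'b" and Z :: "real \<Rightarrow> 'b"
  assumes Z: "smooth_on {-p<..<p} Z" "0 < p" "Z 0 = z" and \<Phi>: "0 < b" "0 < r" "smooth_on ({-b<..<b} \<times> ball z r) (\<lambda>p. \<Phi> (fst p) (snd p))"
  obtains a where "0 < a" "a \<le> p" "\<And>u. u \<in> {-a<..<a} \<Longrightarrow> Z u \<in> ball z r"
    "smooth_on ({-a<..<a} \<times> {-b<..<b}) (\<lambda>q. \<Phi> (snd q) (Z (fst q)))"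
proof -
  have o: "open ({-p<..<p} \<inter> Z -` ball z r)"
    by (rule open_domain_restrict[OF open_greaterThanLessThan smooth_on_continuous[OF Z(1)] open_ball])
  have "0 \<in> {-p<..<p} \<inter> Z -` ball z r" using Z \<Phi>(2) by simp
  then obtain a where a: "0 < a" "ball 0 a \<subseteq> {-p<..<p} \<inter> Z -` ball z r" by (rule openE[OF o])
  have ia: "u \<in> ball 0 a" if "u \<in> {-a<..<a}" for u using that by (auto simp: dist_real_def)
  have Za: "Z u \<in> ball z r" "u \<in> {-p<..<p}" if "u \<in> {-a<..<a}" for u using subsetD[OF a(2) ia[OF that]] by auto
  have "a \<le> p"
  proof (rule ccontr)
    assume "\<not> a \<le> p"
    then have "p \<in> {-a<..<a}" using Z(2) by simp
    then show False using Za(2) by force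
  qed
  let ?Q = "{-a<..<a} \<times> {-b<..<b}"
  have Q: "open ?Q" by (intro open_Times open_greaterThanLessThan)
  have "smooth_on ?Q (\<lambda>q. Z (fst q))"
    by (rule smooth_on_compose[OF Q open_greaterThanLessThan _ smooth_on_fst[OF Q smooth_on_ident[OF Q]] Z(1)])
      (use Za(2) in auto)
  then have s: "smooth_on ?Q (\<lambda>q. (snd q, Z (fst q)))"
    by (intro smooth_on_Pair Q smooth_on_snd smooth_on_ident)
  have "open ({-b<..<b} \<times> ball z r)" by (intro open_Times open_greaterThanLessThan open_ball)
  from smooth_on_compose[OF Q this _ s \<Phi>(3)] have "smooth_on ?Q (\<lambda>q. \<Phi> (snd q) (Z (fst q)))"
    using Za(1) by (simp add: image_subset_iff)
  note sm = this
  show thesis by (rule that[OF a(1) \<open>a \<le> p\<close> _ sm]) (rule Za(1))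
qed

section \<open>Orthogonality and unit fields on a coordinate patch\<close>

context riemannian_surface
begin

text \<open>In a plane, two vectors orthogonal to a nonzero \<open>m\<close> are parallel. As
  \<open>l\<close> vanishes on \<open>a\<close> but not on \<open>b\<close>, the vector
  \<open>a\<close> can only be the zero multiple of \<open>b\<close>.\<close>

lemma orthogonal_to_same_vector:
  assumes c: "c \<in> A" "x \<in> img c" and m: "G c x m m \<noteq> 0" "G c x m a = 0" "G c x m b = 0"
    and l: "linear l" "l a = (0::real)" "l b \<noteq> 0"
  shows "a = 0"
proof -
  \<comment> \<open>The linear relation among three vectors of the plane; pairing with
    \<open>m\<close> kills its right-hand side.\<close>
  have "area a b *\<^sub>R m = area m b *\<^sub>R a + area a m *\<^sub>R b"
    by (simp add: vec_eq_iff forall_2 area_def algebra_simps)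
  then have "G c x m (area a b *\<^sub>R m) = G c x m (area m b *\<^sub>R a + area a m *\<^sub>R b)" by simp
  then have "area a b = 0" using m by (simp add: G_bil[OF c])
  then have "b $ i *\<^sub>R a = a $ i *\<^sub>R b" for i
    using exhaust_2[of i] by (auto simp: vec_eq_iff forall_2 area_def algebra_simps)
  then have "l (b $ i *\<^sub>R a) = l (a $ i *\<^sub>R b)" for i by simp
  then have "a $ i = 0" for i using l by (simp add: linear_scale[OF l(1)])
  then show ?thesis by (simp add: vec_eq_iff)
qed

text \<open>Integral curves of a unit gradient field are geodesics: the Hessian of \<open>\<psi>\<close> is symmetric and
  \<open>N\<close> lies in its kernel.\<close>

lemma unit_gradient_field:
  assumes c: "c \<in> A" and E: "open E" "E \<subseteq> img c" and \<psi>: "smooth_on E \<psi>"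
    and grad: "\<And>x e. x \<in> E \<Longrightarrow> G c x (N x) e = frechet_derivative \<psi> (at x) e"
    and unit: "\<And>x. x \<in> E \<Longrightarrow> G c x (N x) (N x) = 1"
  shows "smooth_on E N"
    and "x \<in> E \<Longrightarrow> frechet_derivative N (at x) (N x) = - christoffel A g c x (N x) (N x)"
proof -
  have ic: "x \<in> img c" if "x \<in> E" for x using that E(2) by blast
  have "smooth_on E (\<lambda>x. sharp c x (frechet_derivative \<psi> (at x)))"
    by (rule sharp_smooth[OF c E(1) smooth_on_ident[OF E(1)] _ smooth_on_frechet[OF \<psi>]]) (use E(2) in simp)
  moreover have "N x = sharp c x (frechet_derivative \<psi> (at x))" if "x \<in> E" for x
    by (rule sharp_unique[OF c ic[OF that] has_derivative_linear[OF smooth_on_has_derivative[OF \<psi> that]] grad[OF that]])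
  ultimately show smN: "smooth_on E N" using smooth_on_cong[OF E(1), of N] by simp
  assume x: "x \<in> E"
  let ?D = "frechet_derivative N (at x)" and ?n = "N x"
  let ?H = "\<lambda>b e. frechet_derivative (\<lambda>z. frechet_derivative \<psi> (at z) b) (at x) e"
  have dN: "(N has_derivative ?D) (at x)" by (rule smooth_on_has_derivative[OF smN x])
  note dG = G_comp_derivative[OF c has_derivative_ident ic[OF x] dN]
  have 1: "DG c x ?n b e + G c x (?D e) b = ?H b e" for b e
  proof -
    have "((\<lambda>z. frechet_derivative \<psi> (at z) b) has_derivative (\<lambda>e. DG c x ?n b e + G c x (?D e) b + G c x ?n 0)) (at x)"
      by (rule has_derivative_transform_within_open[OF dG[OF has_derivative_const] E(1) x]) (rule grad)
    from fun_cong[OF frechet_derivative_at[OF this], of e] show ?thesis by (simp add: G_bil[OF c ic[OF x]])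
  qed
  have 2: "2 * G c x (?D e) ?n = - DG c x ?n ?n e" for e
  proof -
    have "((\<lambda>z. 1) has_derivative (\<lambda>e. DG c x ?n ?n e + G c x (?D e) ?n + G c x ?n (?D e))) (at x)"
      by (rule has_derivative_transform_within_open[OF dG[OF dN] E(1) x]) (rule unit)
    from fun_cong[OF has_derivative_unique[OF this has_derivative_const], of e]
    show ?thesis using G_sym[OF c ic[OF x], of ?n "?D e"] by simp
  qed
  have "G c x (?D ?n + christoffel A g c x ?n ?n) e = G c x 0 e" for e
  proof -
    \<comment> \<open>By symmetry of the Hessian the derivative of \<open>N\<close> along itself is
      controlled by derivatives of the constant length of \<open>N\<close>, which leaves exactly the
      Christoffel terms.\<close>
    have "?H e ?n = ?H ?n e" by (rule frechet_derivative_symmetric[OF E(1) \<psi> x])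
    then have "G c x (?D ?n) e + DG c x ?n e ?n = DG c x ?n ?n e / 2"
      using 1[of e ?n] 1[of ?n e] 2[of e] by simp
    then show ?thesis
      using acceleration_identity[OF c ic[OF x], of "?D ?n" ?n e] by (simp add: G_bil[OF c ic[OF x]])
  qed
  then have "?D ?n + christoffel A g c x ?n ?n = 0" by (rule G_eqI[OF c ic[OF x]])
  then show "?D ?n = - christoffel A g c x ?n ?n" by (simp add: eq_neg_iff_add_eq_0)
qed

lemma unit_field:
  assumes c: "c \<in> A"
  defines "T \<equiv> \<lambda>x. (1 / sqrt (G c x (axis 1 1) (axis 1 1))) *\<^sub>R axis 1 (1::real)"
  shows "smooth_on (img c) T" "x \<in> img c \<Longrightarrow> G c x (T x) (T x) = 1"
proof -
  have pos: "0 < G c x (axis 1 1) (axis 1 1)" if "x \<in> img c" for x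
    by (rule G_pos[OF c that]) (simp add: axis_eq_0_iff)
  show "smooth_on (img c) T"
    unfolding T_def by (intro smooth_on_scaleR smooth_on_divide smooth_on_sqrt smooth_on_const open_img[OF c] G_smooth[OF c])
      (use pos in \<open>auto simp: less_imp_neq[symmetric]\<close>)
  show "G c x (T x) (T x) = 1" if "x \<in> img c" using pos[OF that] by (simp add: T_def G_bil[OF c that])
qed

end

section \<open>The three cases: neither sine nor cosine zero, sine zero, cosine zero\<close>

context surface_patch
begin

lemma yb: "y wb \<in> img c" by (rule yD[OF D(2)])

text \<open>If the derivative of \<open>y\<close> kills \<open>z\<close>, orthogonality to the
  normal forces cos \<theta> times the derivative of \<open>h\<close> to vanish as well, and
  \<open>z = 0\<close> by immersion. So the surface is a graph over \<open>M\<close> with inverse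
  projection \<open>w\<close>; the last conclusion says that the gradient of its height is - n / cos
  \<theta>.\<close>

lemma transversal_inverse:
  assumes "cos \<theta> \<noteq> 0"
  obtains E w where "open E" "E \<subseteq> img c" "smooth_on E w" "w ` E \<subseteq> D" "\<And>x. x \<in> E \<Longrightarrow> y (w x) = x" "w (y wb) = wb" "y wb \<in> E"
    "\<And>x e. x \<in> E \<Longrightarrow> G c x (n (w x)) e + cos \<theta> * frechet_derivative (\<lambda>x. h (w x)) (at x) e = 0"
proof -
  have inj: "z = 0" if "frechet_derivative y (at wb) z = 0" for z
    by (rule imm[OF D(2) that]) (use orth[OF D(2), of z] that assms G_bil(8)[OF c yb] in simp)
  obtain U E w where w: "open U" "U \<subseteq> D" "wb \<in> U" "open E" "homeomorphism U E y w" "smooth_on E w"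
    by (rule smooth_inverse_function_plane[OF D(1) y(1) D(2) inj]) (assumption | rule that)+
  have yw: "y (w x) = x" "w x \<in> D" if "x \<in> E" for x
    using homeomorphism_apply2[OF w(5) that] homeomorphism_image2[OF w(5)] w(2) that by auto
  show thesis
  proof (rule that[of E w])
    show "E \<subseteq> img c" using yD[OF yw(2)] yw(1) by (metis subsetI)
    show "w (y wb) = wb" by (rule homeomorphism_apply1[OF w(5,3)])
    show "y wb \<in> E" using homeomorphism_image1[OF w(5)] w(3) by blast
    show "w ` E \<subseteq> D" using yw(2) by blast
    fix x e assume x: "x \<in> E"
    let ?w = "frechet_derivative w (at x)"
    have dw: "(w has_derivative ?w) (at x)" by (rule smooth_on_has_derivative[OF w(6) x])
    have "((\<lambda>x. h (w x)) has_derivative (\<lambda>e. frechet_derivative h (at (w x)) (?w e))) (at x)"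
      by (rule has_derivative_compose[OF dw dh[OF yw(2)[OF x]]])
    note dhw = fun_cong[OF frechet_derivative_at[OF this], of e]
    have "((\<lambda>x. y (w x)) has_derivative (\<lambda>e. frechet_derivative y (at (w x)) (?w e))) (at x)"
      by (rule has_derivative_compose[OF dw dy[OF yw(2)[OF x]]])
    then have "((\<lambda>x. x) has_derivative (\<lambda>e. frechet_derivative y (at (w x)) (?w e))) (at x)"
      by (rule has_derivative_transform_within_open[OF _ w(4) x]) (rule yw(1))
    from fun_cong[OF has_derivative_unique[OF this has_derivative_ident], of e]
    show "G c x (n (w x)) e + cos \<theta> * frechet_derivative (\<lambda>x. h (w x)) (at x) e = 0"
      using orth[OF yw(2)[OF x], of "?w e"] dhw yw(1)[OF x] by simp
  qed (use w yw in auto)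
qed

text \<open>On a graph only the component \<open>f\<close> in \<open>M\<close> has to be found, as
  \<kappa> is then \<open>w\<close> after \<open>f\<close>. At the origin the partial derivatives of
  \<open>f\<close> are \<alpha>' and cos \<theta> J \<alpha>', which are orthogonal and nonzero. The
  height formula is demanded only where \<open>f\<close> has values over the graph.\<close>

lemma locally_parametrized_transversal:
  assumes cos: "cos \<theta> \<noteq> 0"
    and E: "open E" "smooth_on E w" "w ` E \<subseteq> D" "\<And>x. x \<in> E \<Longrightarrow> y (w x) = x" "w (y wb) = wb" "y wb \<in> E"
    and ab: "0 < a" "0 < b" and f: "smooth_on ({-a<..<a} \<times> {-b<..<b}) (\<lambda>p. f (fst p) (snd p))" "f 0 0 = y wb"
    and height: "\<And>u v. u \<in> {-a<..<a} \<Longrightarrow> v \<in> {-b<..<b} \<Longrightarrow> f u v \<in> E \<Longrightarrow> h (w (f u v)) = v * sin \<theta>"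
    and geo: "\<And>u v. u \<in> {-a<..<a} \<Longrightarrow> v \<in> {-b<..<b} \<Longrightarrow>
      ((\<lambda>s. (f u s, \<eta> u s)) has_vector_derivative geo_field c (f u v, \<eta> u v)) (at v)"
    and init: "\<And>u. u \<in> {-a<..<a} \<Longrightarrow> ((\<lambda>s. f s 0) has_vector_derivative \<alpha>' u) (at u)"
      "\<And>u. u \<in> {-a<..<a} \<Longrightarrow> G c (f u 0) (\<alpha>' u) (\<alpha>' u) = 1"
      "\<And>u. u \<in> {-a<..<a} \<Longrightarrow> \<eta> u 0 = cos \<theta> *\<^sub>R chart_rotation c (f u 0) (\<alpha>' u)"
  shows "locally_parametrized \<theta> S (inv_chart c (y wb), 0)"
proof -
  define F where "F p = f (fst p) (snd p)" for p
  let ?Q = "{-a<..<a} \<times> {-b<..<b}"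
  have Q: "open ?Q" "(0, 0) \<in> ?Q" using ab by (auto simp: open_Times)
  have smF: "smooth_on ?Q F" using f(1) by (simp add: F_def[abs_def])
  have "open (?Q \<inter> F -` E)" by (rule open_domain_restrict[OF Q(1) smooth_on_continuous[OF smF] E(1)])
  moreover have "(0, 0) \<in> ?Q \<inter> F -` E" using Q f(2) E(6) by (simp add: F_def)
  ultimately obtain r where r: "0 < r" "{-r<..<r} \<times> {-r<..<r} \<subseteq> ?Q \<inter> F -` E" by (rule open_contains_square)
  let ?R = "{-r<..<r} \<times> {-r<..<r}"
  have R: "open ?R" "(0, 0) \<in> ?R" using r by (auto simp: open_Times)
  have rQ: "u \<in> {-a<..<a}" "v \<in> {-b<..<b}" "f u v \<in> E" if "u \<in> {-r<..<r}" "v \<in> {-r<..<r}" for u v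
  proof -
    have "(u, v) \<in> ?Q \<inter> F -` E" using r(2) that by blast
    then show "u \<in> {-a<..<a}" "v \<in> {-b<..<b}" "f u v \<in> E" by (simp_all add: F_def)
  qed
  have r0: "0 \<in> {-r<..<r}" using r by simp
  have FE: "F ` ?R \<subseteq> E" using r(2) by blast
  have smFR: "smooth_on ?R F" by (rule smooth_on_subset[OF smF]) (use r(2) in blast)
  define \<kappa> where "\<kappa> p = w (F p)" for p
  have sm\<kappa>: "smooth_on ?R \<kappa>" unfolding \<kappa>_def by (rule smooth_on_compose[OF R(1) E(1) FE smFR E(2)])
  have \<kappa>D: "\<kappa> ` ?R \<subseteq> D" using FE E(3) by (auto simp: \<kappa>_def)
  have y\<kappa>: "y (\<kappa> (u, v)) = f u v" if "u \<in> {-r<..<r}" "v \<in> {-r<..<r}" for u v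
    using E(4)[OF rQ(3)[OF that]] by (simp add: \<kappa>_def F_def)
  have \<kappa>0: "\<kappa> (0, 0) = wb" using f(2) E(5) by (simp add: \<kappa>_def F_def)
  have inj: "z = 0" if z: "frechet_derivative \<kappa> (at (0, 0)) z = 0" for z
  proof -
    let ?F = "frechet_derivative F (at (0, 0))"
    have dF: "(F has_derivative ?F) (at (0, 0))" by (rule smooth_on_has_derivative[OF smFR R(2)])
    have d\<kappa>: "(\<kappa> has_derivative frechet_derivative \<kappa> (at (0, 0))) (at (0, 0))" by (rule smooth_on_has_derivative[OF sm\<kappa> R(2)])
    have "((\<lambda>p. y (\<kappa> p)) has_derivative (\<lambda>z. frechet_derivative y (at (\<kappa> (0, 0))) (frechet_derivative \<kappa> (at (0, 0)) z))) (at (0, 0))"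
      by (rule has_derivative_compose[OF d\<kappa> dy]) (simp add: \<kappa>0 D(2))
    then have "(F has_derivative (\<lambda>z. frechet_derivative y (at (\<kappa> (0, 0))) (frechet_derivative \<kappa> (at (0, 0)) z))) (at (0, 0))"
    proof (rule has_derivative_transform_within_open[OF _ R])
      show "y (\<kappa> p) = F p" if "p \<in> ?R" for p using y\<kappa>[of "fst p" "snd p"] that by (simp add: F_def mem_Times_iff)
    qed
    then have Fz: "?F z = 0"
      using fun_cong[OF has_derivative_unique[OF dF], of _ z] z linear_0[OF has_derivative_linear[OF dy[OF D(2)]]] by (simp add: \<kappa>0)
    have "((\<lambda>s. (s, 0::real)) has_vector_derivative (1, 0)) (at (0::real))" "((\<lambda>s. (0::real, s)) has_vector_derivative (0, 1)) (at (0::real))"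
      by (auto intro!: derivative_eq_intros)
    from has_vector_derivative_linear_image[where x = "\<lambda>s. (s, 0)", OF dF this(1)] has_vector_derivative_linear_image[where x = "\<lambda>s. (0, s)", OF dF this(2)]
    have 1: "((\<lambda>s. f s 0) has_vector_derivative ?F (1, 0)) (at 0)" and 2: "((\<lambda>s. f 0 s) has_vector_derivative ?F (0, 1)) (at 0)"
      by (simp_all add: F_def)
    have a0: "0 \<in> {-a<..<a}" and b0: "0 \<in> {-b<..<b}" using ab by auto
    have F1: "?F (1, 0) = \<alpha>' 0" by (rule vector_derivative_unique_at[OF 1 init(1)[OF a0]])
    have "((\<lambda>s. f 0 s) has_vector_derivative \<eta> 0 0) (at 0)"
      using has_vector_derivative_linear_image[where f = fst, OF bounded_linear_imp_has_derivative[OF bounded_linear_fst] geo[OF a0 b0]]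
      by (simp add: geo_field_def)
    then have F2: "?F (0, 1) = \<eta> 0 0" by (rule vector_derivative_unique_at[OF 2])
    have "z = fst z *\<^sub>R (1, 0) + snd z *\<^sub>R (0, 1)" by (simp add: prod_eq_iff)
    then have "?F z = fst z *\<^sub>R ?F (1, 0) + snd z *\<^sub>R ?F (0, 1)"
      by (metis linear_add[OF has_derivative_linear[OF dF]] linear_scale[OF has_derivative_linear[OF dF]])
    then have zero: "fst z *\<^sub>R \<alpha>' 0 + (snd z * cos \<theta>) *\<^sub>R chart_rotation c (y wb) (\<alpha>' 0) = 0"
      using Fz F1 F2 init(3)[OF a0] f(2) by simp
    let ?J = "chart_rotation c (y wb) (\<alpha>' 0)"
    have 1: "G c (y wb) (\<alpha>' 0) (\<alpha>' 0) = 1" using init(2)[OF a0] f(2) by simp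
    have J: "G c (y wb) ?J (\<alpha>' 0) = 0" "G c (y wb) ?J ?J = 1" "G c (y wb) (\<alpha>' 0) ?J = 0"
      using chart_rotation_orthogonal[OF c yb, of "\<alpha>' 0"] chart_rotation_isometry[OF c yb, of "\<alpha>' 0" "\<alpha>' 0"] 1
        G_sym[OF c yb, of "\<alpha>' 0" ?J] by simp_all
    have "G c (y wb) (fst z *\<^sub>R \<alpha>' 0 + (snd z * cos \<theta>) *\<^sub>R ?J) e = 0" for e
      unfolding zero by (rule G_bil(7)[OF c yb])
    from this[of "\<alpha>' 0"] this[of ?J] have "fst z = 0" "snd z * cos \<theta> = 0"
      by (simp_all add: G_bil[OF c yb] 1 J)
    then show ?thesis using cos by (simp add: prod_eq_iff)
  qed
  show ?thesis
  proof (rule locally_parametrizedI[where a = r and b = r and \<kappa> = \<kappa> and \<eta> = \<eta> and \<alpha>' = \<alpha>'])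
    fix u v :: real
    assume u: "u \<in> {-r<..<r}"
    { assume v: "v \<in> {-r<..<r}"
      show "h (\<kappa> (u, v)) = v * sin \<theta>" using height[OF rQ[OF u v]] by (simp add: \<kappa>_def F_def)
      show "((\<lambda>s. (y (\<kappa> (u, s)), \<eta> u s)) has_vector_derivative geo_field c (y (\<kappa> (u, v)), \<eta> u v)) (at v)"
        unfolding y\<kappa>[OF u v]
        by (rule has_vector_derivative_transform_within_open[OF geo[OF rQ(1,2)[OF u v]] open_greaterThanLessThan v])
          (simp add: y\<kappa>[OF u]) }
    show "((\<lambda>s. y (\<kappa> (s, 0))) has_vector_derivative \<alpha>' u) (at u)"
      by (rule has_vector_derivative_transform_within_open[OF init(1)[OF rQ(1)[OF u r0]] open_greaterThanLessThan u])
        (simp add: y\<kappa>[OF _ r0])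
    show "G c (y (\<kappa> (u, 0))) (\<alpha>' u) (\<alpha>' u) = 1" using init(2)[OF rQ(1)[OF u r0]] by (simp add: y\<kappa>[OF u r0])
    show "\<eta> u 0 = cos \<theta> *\<^sub>R chart_rotation c (y (\<kappa> (u, 0))) (\<alpha>' u)" using init(3)[OF rQ(1)[OF u r0]] by (simp add: y\<kappa>[OF u r0])
  qed (fact r(1) sm\<kappa> \<kappa>D \<kappa>0 inj)+
qed

lemma locally_parametrized_oblique:
  assumes cos: "cos \<theta> \<noteq> 0" and sin: "sin \<theta> \<noteq> 0"
  shows "locally_parametrized \<theta> S (inv_chart c (y wb), 0)"
proof -
  obtain E w where E: "open E" "E \<subseteq> img c" "smooth_on E w" "w ` E \<subseteq> D" "\<And>x. x \<in> E \<Longrightarrow> y (w x) = x" "w (y wb) = wb" "y wb \<in> E"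
    and gr: "\<And>x e. x \<in> E \<Longrightarrow> G c x (n (w x)) e + cos \<theta> * frechet_derivative (\<lambda>x. h (w x)) (at x) e = 0"
    by (rule transversal_inverse[OF cos]) (assumption | rule that)+
  have ic: "x \<in> img c" if "x \<in> E" for x using that E(2) by blast
  \<comment> \<open>The gradient of the height has length |sin \<theta> / cos \<theta>|, so this
    multiple has a gradient of length one, namely the vector \<open>N\<close> below.\<close>
  define \<psi> where "\<psi> x = (cos \<theta> / sin \<theta>) * h (w x)" for x
  define N where "N x = (- (1 / sin \<theta>)) *\<^sub>R n (w x)" for x
  have smh: "smooth_on E (\<lambda>x. h (w x))" by (rule smooth_on_compose[OF E(1) D(1) E(4) E(3) h(1)])
  have sm\<psi>: "smooth_on E \<psi>" unfolding \<psi>_def by (intro smooth_on_mult E(1) smooth_on_const smh)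
  have d\<psi>: "frechet_derivative \<psi> (at x) e = (cos \<theta> / sin \<theta>) * frechet_derivative (\<lambda>x. h (w x)) (at x) e" if x: "x \<in> E" for x e
  proof -
    have "(\<psi> has_derivative (\<lambda>e. (cos \<theta> / sin \<theta>) * frechet_derivative (\<lambda>x. h (w x)) (at x) e)) (at x)"
      unfolding \<psi>_def by (rule has_derivative_mult_right[OF smooth_on_has_derivative[OF smh x]])
    from fun_cong[OF frechet_derivative_at[OF this], of e] show ?thesis by simp
  qed
  have grad: "G c x (N x) e = frechet_derivative \<psi> (at x) e" if x: "x \<in> E" for x e
  proof -
    have "G c x (n (w x)) e = - (cos \<theta> * frechet_derivative (\<lambda>x. h (w x)) (at x) e)" using gr[OF x, of e] by simp
    then have "G c x (N x) e = - (1 / sin \<theta>) * - (cos \<theta> * frechet_derivative (\<lambda>x. h (w x)) (at x) e)"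
      unfolding N_def G_bil(3)[OF c ic[OF x]] by simp
    then show ?thesis using d\<psi>[OF x, of e] by simp
  qed
  have unit: "G c x (N x) (N x) = 1" if x: "x \<in> E" for x
  proof -
    have "w x \<in> D" using E(4) x by blast
    from nn[OF this] have "G c x (n (w x)) (n (w x)) = (sin \<theta>)\<^sup>2" using E(5)[OF x] by simp
    then show ?thesis using sin by (simp add: N_def G_bil[OF c ic[OF x]] power2_eq_square)
  qed
  have field: "smooth_on E N" "\<And>x. x \<in> E \<Longrightarrow> frechet_derivative N (at x) (N x) = - christoffel A g c x (N x) (N x)"
    using unit_gradient_field[OF c E(1,2) sm\<psi>, of N] grad unit by blast+
  \<comment> \<open>Tangent to the level curves of \<psi>; the sign is chosen so that rotating
    \<open>T\<close> gives \<open>N\<close>.\<close>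
  define T where "T x = - chart_rotation c x (N x)" for x
  have smT: "smooth_on E T" unfolding T_def
    by (rule smooth_on_minus[OF E(1) chart_rotation_smooth[OF c E(1) smooth_on_ident[OF E(1)] _ field(1)]]) (use E(2) in simp)
  \<comment> \<open>Flowing with speed cos \<theta> makes \<psi> equal to v cos \<theta> at time v,
    that is, the height equal to v sin \<theta>.\<close>
  have smM: "smooth_on E (\<lambda>x. cos \<theta> *\<^sub>R N x)" by (intro smooth_on_scaleR E(1) smooth_on_const field(1))
  obtain p q \<Psi> where \<Psi>: "0 < p" "0 < q" "smooth_on ({-p<..<p} \<times> ball (y wb) q) (\<lambda>p. \<Psi> (fst p) (snd p))"
    "\<And>x. x \<in> ball (y wb) q \<Longrightarrow> \<Psi> 0 x = x" "\<And>t x. t \<in> {-p<..<p} \<Longrightarrow> x \<in> ball (y wb) q \<Longrightarrow> \<Psi> t x \<in> E"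
    "\<And>t x. t \<in> {-p<..<p} \<Longrightarrow> x \<in> ball (y wb) q \<Longrightarrow> ((\<lambda>s. \<Psi> s x) has_vector_derivative T (\<Psi> t x)) (at t)"
    by (rule smooth_local_flow[OF E(1) smT E(7)]) (assumption | rule that)+
  obtain b r \<Phi> where \<Phi>: "0 < b" "0 < r" "smooth_on ({-b<..<b} \<times> ball (y wb) r) (\<lambda>p. \<Phi> (fst p) (snd p))"
    "\<And>x. x \<in> ball (y wb) r \<Longrightarrow> \<Phi> 0 x = x" "\<And>t x. t \<in> {-b<..<b} \<Longrightarrow> x \<in> ball (y wb) r \<Longrightarrow> \<Phi> t x \<in> E"
    "\<And>t x. t \<in> {-b<..<b} \<Longrightarrow> x \<in> ball (y wb) r \<Longrightarrow> ((\<lambda>s. \<Phi> s x) has_vector_derivative cos \<theta> *\<^sub>R N (\<Phi> t x)) (at t)"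
    by (rule smooth_local_flow[OF E(1) smM E(7)]) (assumption | rule that)+
  define \<alpha> where "\<alpha> u = \<Psi> u (y wb)" for u
  have bq: "y wb \<in> ball (y wb) q" using \<Psi>(2) by simp
  have sm\<alpha>: "smooth_on {-p<..<p} \<alpha>" unfolding \<alpha>_def by (rule flow_curve[OF \<Psi>(1,3,2)])
  have \<alpha>0: "\<alpha> 0 = y wb" using \<Psi>(4)[OF bq] by (simp add: \<alpha>_def)
  have \<alpha>E: "\<alpha> u \<in> E" "(\<alpha> has_vector_derivative T (\<alpha> u)) (at u)" if "u \<in> {-p<..<p}" for u
    using \<Psi>(5,6)[OF that bq] by (simp_all add: \<alpha>_def[abs_def])
  obtain a where a: "0 < a" "a \<le> p" "\<And>u. u \<in> {-a<..<a} \<Longrightarrow> \<alpha> u \<in> ball (y wb) r"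
    "smooth_on ({-a<..<a} \<times> {-b<..<b}) (\<lambda>q. \<Phi> (snd q) (\<alpha> (fst q)))"
    by (rule smooth_flow_through_curve[OF sm\<alpha> \<Psi>(1) \<alpha>0 \<Phi>(1-3)]) (assumption | rule that)+
  have ap: "u \<in> {-p<..<p}" if "u \<in> {-a<..<a}" for u using that a(2) by auto
  have b0: "0 \<in> {-b<..<b}" using \<Phi>(1) by simp
  have \<psi>\<alpha>: "\<psi> (\<alpha> u) = 0" if u: "u \<in> {-a<..<a}" for u
  proof -
    have "((\<lambda>t. \<psi> (\<alpha> t)) has_vector_derivative 0) (at t)" if t: "t \<in> {-p<..<p}" for t
    proof -
      have "frechet_derivative \<psi> (at (\<alpha> t)) (T (\<alpha> t)) = 0"
        unfolding grad[OF \<alpha>E(1)[OF t], symmetric] T_def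
        using chart_rotation_orthogonal[OF c ic[OF \<alpha>E(1)[OF t]], of "N (\<alpha> t)"] G_sym[OF c ic[OF \<alpha>E(1)[OF t]], of "N (\<alpha> t)"]
        by (simp add: G_bil[OF c ic[OF \<alpha>E(1)[OF t]]])
      then show ?thesis
        using has_vector_derivative_linear_image[OF smooth_on_has_derivative[OF sm\<psi> \<alpha>E(1)[OF t]] \<alpha>E(2)[OF t]] by simp
    qed
    from affine_of_constant_derivative[OF this ap[OF u]] show ?thesis
      using h(2) E(6) by (simp add: \<alpha>0 \<psi>_def)
  qed
  have \<psi>\<Phi>: "\<psi> (\<Phi> v (\<alpha> u)) = v * cos \<theta>" if u: "u \<in> {-a<..<a}" and v: "v \<in> {-b<..<b}" for u v
  proof -
    have "((\<lambda>t. \<psi> (\<Phi> t (\<alpha> u))) has_vector_derivative cos \<theta>) (at t)" if t: "t \<in> {-b<..<b}" for t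
    proof -
      have i: "\<Phi> t (\<alpha> u) \<in> E" by (rule \<Phi>(5)[OF t a(3)[OF u]])
      have "frechet_derivative \<psi> (at (\<Phi> t (\<alpha> u))) (cos \<theta> *\<^sub>R N (\<Phi> t (\<alpha> u))) = cos \<theta>"
        unfolding grad[OF i, symmetric] using unit[OF i] by (simp add: G_bil[OF c ic[OF i]])
      then show ?thesis
        using has_vector_derivative_linear_image[where x = "\<lambda>t. \<Phi> t (\<alpha> u)", OF smooth_on_has_derivative[OF sm\<psi> i] \<Phi>(6)[OF t a(3)[OF u]]] by simp
    qed
    from affine_of_constant_derivative[OF this v] show ?thesis using \<Phi>(4)[OF a(3)[OF u]] \<psi>\<alpha>[OF u] by simp
  qed
  show ?thesis
  proof (rule locally_parametrized_transversal[where f = "\<lambda>u v. \<Phi> v (\<alpha> u)" and \<eta> = "\<lambda>u v. cos \<theta> *\<^sub>R N (\<Phi> v (\<alpha> u))"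
        and \<alpha>' = "\<lambda>u. T (\<alpha> u)" and a = a and b = b, OF cos E(1,3,4,5,6,7) a(1) \<Phi>(1) a(4)])
    show "\<Phi> 0 (\<alpha> 0) = y wb" using \<Phi>(2,4) by (simp add: \<alpha>0)
    fix u v :: real
    assume u: "u \<in> {-a<..<a}"
    { assume v: "v \<in> {-b<..<b}"
      show "h (w (\<Phi> v (\<alpha> u))) = v * sin \<theta>" using \<psi>\<Phi>[OF u v] cos sin by (simp add: \<psi>_def field_simps)
      have i: "\<Phi> v (\<alpha> u) \<in> E" by (rule \<Phi>(5)[OF v a(3)[OF u]])
      let ?x = "\<Phi> v (\<alpha> u)" and ?D = "frechet_derivative N (at (\<Phi> v (\<alpha> u)))"
      have "((\<lambda>s. N (\<Phi> s (\<alpha> u))) has_vector_derivative ?D (cos \<theta> *\<^sub>R N ?x)) (at v)"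
        by (rule has_vector_derivative_linear_image[where x = "\<lambda>t. \<Phi> t (\<alpha> u)", OF smooth_on_has_derivative[OF field(1) i] \<Phi>(6)[OF v a(3)[OF u]]])
      then have "((\<lambda>s. cos \<theta> *\<^sub>R N (\<Phi> s (\<alpha> u))) has_vector_derivative cos \<theta> *\<^sub>R ?D (cos \<theta> *\<^sub>R N ?x)) (at v)"
        by (rule has_vector_derivative_linear_image[OF bounded_linear_imp_has_derivative[OF bounded_linear_scaleR_right]])
      moreover have "cos \<theta> *\<^sub>R ?D (cos \<theta> *\<^sub>R N ?x) = - christoffel A g c ?x (cos \<theta> *\<^sub>R N ?x) (cos \<theta> *\<^sub>R N ?x)"
        unfolding christoffel_scale[OF c ic[OF i]] linear_scale[OF has_derivative_linear[OF smooth_on_has_derivative[OF field(1) i]]] field(2)[OF i]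
        by (simp add: power2_eq_square)
      ultimately show "((\<lambda>s. (\<Phi> s (\<alpha> u), cos \<theta> *\<^sub>R N (\<Phi> s (\<alpha> u)))) has_vector_derivative geo_field c (?x, cos \<theta> *\<^sub>R N ?x)) (at v)"
        using has_vector_derivative_Pair[OF \<Phi>(6)[OF v a(3)[OF u]]] by (simp add: geo_field_def) }
    have \<alpha>i: "\<alpha> u \<in> img c" by (rule ic[OF \<alpha>E(1)[OF ap[OF u]]])
    have \<Phi>0: "\<Phi> 0 (\<alpha> t) = \<alpha> t" if "t \<in> {-a<..<a}" for t by (rule \<Phi>(4)[OF a(3)[OF that]])
    show "((\<lambda>s. \<Phi> 0 (\<alpha> s)) has_vector_derivative T (\<alpha> u)) (at u)"
      by (rule has_vector_derivative_transform_within_open[OF \<alpha>E(2)[OF ap[OF u]] open_greaterThanLessThan u]) (rule \<Phi>0[symmetric])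
    show "G c (\<Phi> 0 (\<alpha> u)) (T (\<alpha> u)) (T (\<alpha> u)) = 1"
      using chart_rotation_isometry[OF c \<alpha>i, of "N (\<alpha> u)" "N (\<alpha> u)"] unit[OF \<alpha>E(1)[OF ap[OF u]]]
      by (simp add: \<Phi>0[OF u] T_def G_bil[OF c \<alpha>i])
    show "cos \<theta> *\<^sub>R N (\<Phi> 0 (\<alpha> u)) = cos \<theta> *\<^sub>R chart_rotation c (\<Phi> 0 (\<alpha> u)) (T (\<alpha> u))"
      using chart_rotation_rotation[OF c \<alpha>i, of "N (\<alpha> u)"]
      by (simp add: \<Phi>0[OF u] T_def linear_neg[OF chart_rotation_linear[OF c \<alpha>i]])
  qed
qed

lemma locally_parametrized_horizontal:
  assumes sin: "sin \<theta> = 0"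
  shows "locally_parametrized \<theta> S (inv_chart c (y wb), 0)"
proof -
  have cos: "cos \<theta> \<noteq> 0" using sin sin_zero_abs_cos_one by fastforce
  obtain E w where E: "open E" "E \<subseteq> img c" "smooth_on E w" "w ` E \<subseteq> D" "\<And>x. x \<in> E \<Longrightarrow> y (w x) = x" "w (y wb) = wb" "y wb \<in> E"
    and gr: "\<And>x e. x \<in> E \<Longrightarrow> G c x (n (w x)) e + cos \<theta> * frechet_derivative (\<lambda>x. h (w x)) (at x) e = 0"
    by (rule transversal_inverse[OF cos]) (assumption | rule that)+
  have smh: "smooth_on E (\<lambda>x. h (w x))" by (rule smooth_on_compose[OF E(1) D(1) E(4) E(3) h(1)])
  have dh0: "((\<lambda>x. h (w x)) has_derivative (\<lambda>e. 0)) (at x)" if x: "x \<in> E" for x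
  proof -
    have i: "x \<in> img c" and wD: "w x \<in> D" using x E(2,4) by blast+
    \<comment> \<open>The squared length of \<open>n\<close> is the squared sine, which is 0 here;
      hence the gradient of the height vanishes.\<close>
    have "n (w x) = 0" using G_pos[OF c i, of "n (w x)"] nn[OF wD] E(5)[OF x] sin by fastforce
    then have "frechet_derivative (\<lambda>x. h (w x)) (at x) = (\<lambda>e. 0)"
      using gr[OF x] cos by (intro ext) (simp add: G_bil[OF c i])
    then show ?thesis using smooth_on_has_derivative[OF smh x] by simp
  qed
  \<comment> \<open>\<open>E\<close> may be disconnected; on a ball the zero derivative makes the
    height constant.\<close>
  obtain \<epsilon> where \<epsilon>: "0 < \<epsilon>" "ball (y wb) \<epsilon> \<subseteq> E" using openE[OF E(1,7)] .
  have hw0: "h (w x) = 0" if x: "x \<in> ball (y wb) \<epsilon>" for x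
  proof -
    have "\<exists>d. \<forall>x\<in>ball (y wb) \<epsilon>. h (w x) = d"
      by (rule has_derivative_zero_constant[OF convex_ball has_derivative_at_withinI[OF dh0]]) (use \<epsilon>(2) in blast)
    then show ?thesis using x \<epsilon>(1) E(6) h(2) by (metis centre_in_ball)
  qed
  define T where "T x = (1 / sqrt (G c x (axis 1 1) (axis 1 1))) *\<^sub>R (axis 1 1 :: real^2)" for x
  note T = unit_field[OF c, folded T_def]
  obtain p q \<Psi> where \<Psi>: "0 < p" "0 < q" "smooth_on ({-p<..<p} \<times> ball (y wb) q) (\<lambda>p. \<Psi> (fst p) (snd p))"
    "\<And>x. x \<in> ball (y wb) q \<Longrightarrow> \<Psi> 0 x = x" "\<And>t x. t \<in> {-p<..<p} \<Longrightarrow> x \<in> ball (y wb) q \<Longrightarrow> \<Psi> t x \<in> img c"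
    "\<And>t x. t \<in> {-p<..<p} \<Longrightarrow> x \<in> ball (y wb) q \<Longrightarrow> ((\<lambda>s. \<Psi> s x) has_vector_derivative T (\<Psi> t x)) (at t)"
    by (rule smooth_local_flow[OF open_img[OF c] T(1) yb]) (assumption | rule that)+
  define \<alpha> where "\<alpha> u = \<Psi> u (y wb)" for u
  have bq: "y wb \<in> ball (y wb) q" using \<Psi>(2) by simp
  have sm\<alpha>: "smooth_on {-p<..<p} \<alpha>" unfolding \<alpha>_def by (rule flow_curve[OF \<Psi>(1,3,2)])
  have \<alpha>0: "\<alpha> 0 = y wb" using \<Psi>(4)[OF bq] by (simp add: \<alpha>_def)
  have \<alpha>i: "\<alpha> u \<in> img c" "(\<alpha> has_vector_derivative T (\<alpha> u)) (at u)" if "u \<in> {-p<..<p}" for u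
    using \<Psi>(5,6)[OF that bq] by (simp_all add: \<alpha>_def[abs_def])
  have \<alpha>I: "\<alpha> ` {-p<..<p} \<subseteq> img c" using \<alpha>i(1) by blast
  \<comment> \<open>Initial data of the geodesics leaving \<alpha> along its rotated velocity. There
    is no gradient field to follow in this case, so the geodesic flow itself is used.\<close>
  define Z where "Z u = (\<alpha> u, cos \<theta> *\<^sub>R chart_rotation c (\<alpha> u) (T (\<alpha> u)))" for u
  have smZ: "smooth_on {-p<..<p} Z" unfolding Z_def
    by (intro smooth_on_Pair smooth_on_scaleR smooth_on_const open_greaterThanLessThan sm\<alpha>
      chart_rotation_smooth[OF c open_greaterThanLessThan sm\<alpha> \<alpha>I]
      smooth_on_compose[OF open_greaterThanLessThan open_img[OF c] \<alpha>I sm\<alpha> T(1)])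
  have "fst (Z 0) \<in> img c" using yb by (simp add: Z_def \<alpha>0)
  then obtain b r \<Phi> where \<Phi>: "0 < b" "0 < r" "smooth_on ({-b<..<b} \<times> ball (Z 0) r) (\<lambda>p. \<Phi> (fst p) (snd p))"
    "\<And>z. z \<in> ball (Z 0) r \<Longrightarrow> \<Phi> 0 z = z"
    "\<And>t z. t \<in> {-b<..<b} \<Longrightarrow> z \<in> ball (Z 0) r \<Longrightarrow> ((\<lambda>s. \<Phi> s z) has_vector_derivative geo_field c (\<Phi> t z)) (at t)"
    by (rule geodesic_flow_chart[OF c]) (assumption | rule that)+
  obtain a where a: "0 < a" "a \<le> p" "\<And>u. u \<in> {-a<..<a} \<Longrightarrow> Z u \<in> ball (Z 0) r"
    "smooth_on ({-a<..<a} \<times> {-b<..<b}) (\<lambda>q. \<Phi> (snd q) (Z (fst q)))"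
    by (rule smooth_flow_through_curve[OF smZ \<Psi>(1) refl \<Phi>(1-3)]) (assumption | rule that)+
  have ap: "u \<in> {-p<..<p}" if "u \<in> {-a<..<a}" for u using that a(2) by auto
  have \<Phi>0: "fst (\<Phi> 0 (Z u)) = \<alpha> u" "snd (\<Phi> 0 (Z u)) = cos \<theta> *\<^sub>R chart_rotation c (\<alpha> u) (T (\<alpha> u))" if "u \<in> {-a<..<a}" for u
    using \<Phi>(4)[OF a(3)[OF that]] by (simp_all add: Z_def)
  have sm: "smooth_on ({-a<..<a} \<times> {-b<..<b}) (\<lambda>q. fst (\<Phi> (snd q) (Z (fst q))))"
    by (rule smooth_on_fst[OF _ a(4)]) (intro open_Times open_greaterThanLessThan)
  have wB: "smooth_on (ball (y wb) \<epsilon>) w" "w ` ball (y wb) \<epsilon> \<subseteq> D" "\<And>x. x \<in> ball (y wb) \<epsilon> \<Longrightarrow> y (w x) = x"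
    using smooth_on_subset[OF E(3) \<epsilon>(2)] E(4,5) \<epsilon>(2) by blast+
  have y\<epsilon>: "y wb \<in> ball (y wb) \<epsilon>" using \<epsilon>(1) by simp
  show ?thesis
  proof (rule locally_parametrized_transversal[where f = "\<lambda>u v. fst (\<Phi> v (Z u))" and \<eta> = "\<lambda>u v. snd (\<Phi> v (Z u))"
        and \<alpha>' = "\<lambda>u. T (\<alpha> u)" and a = a and b = b, OF cos open_ball wB E(6) y\<epsilon> a(1) \<Phi>(1) sm])
    show "fst (\<Phi> 0 (Z 0)) = y wb" using \<Phi>0[of 0] a(1) by (simp add: \<alpha>0)
    fix u v :: real
    assume u: "u \<in> {-a<..<a}"
    show "h (w (fst (\<Phi> v (Z u)))) = v * sin \<theta>" if "fst (\<Phi> v (Z u)) \<in> ball (y wb) \<epsilon>"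
      using hw0[OF that] sin by simp
    show "((\<lambda>s. (fst (\<Phi> s (Z u)), snd (\<Phi> s (Z u)))) has_vector_derivative geo_field c (fst (\<Phi> v (Z u)), snd (\<Phi> v (Z u)))) (at v)"
      if v: "v \<in> {-b<..<b}" using \<Phi>(5)[OF v a(3)[OF u]] by simp
    show "((\<lambda>s. fst (\<Phi> 0 (Z s))) has_vector_derivative T (\<alpha> u)) (at u)"
      by (rule has_vector_derivative_transform_within_open[OF \<alpha>i(2)[OF ap[OF u]] open_greaterThanLessThan u]) (rule \<Phi>0(1)[symmetric])
    show "G c (fst (\<Phi> 0 (Z u))) (T (\<alpha> u)) (T (\<alpha> u)) = 1"
      unfolding \<Phi>0(1)[OF u] by (rule T(2)[OF \<alpha>i(1)[OF ap[OF u]]])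
    show "snd (\<Phi> 0 (Z u)) = cos \<theta> *\<^sub>R chart_rotation c (fst (\<Phi> 0 (Z u))) (T (\<alpha> u))"
      unfolding \<Phi>0[OF u] ..
  qed
qed

text \<open>The projection of the surface to \<open>M\<close> has rank one. A linear coordinate
  along the projected curve together with the height forms local coordinates of the surface, and in
  these the projection turns out not to depend on the height.\<close>

lemma locally_parametrized_vertical:
  assumes cos: "cos \<theta> = 0"
  shows "locally_parametrized \<theta> S (inv_chart c (y wb), 0)"
proof -
  have sin: "(sin \<theta>)\<^sup>2 = 1" using sin_cos_squared_add[of \<theta>] cos by simp
  then have sin0: "sin \<theta> \<noteq> 0" by auto
  have ny: "G c (y d) (n d) (frechet_derivative y (at d) z) = 0" if "d \<in> D" for d z using orth[OF that, of z] cos by simp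
  have n1: "G c (y d) (n d) (n d) \<noteq> 0" if "d \<in> D" for d using nn[OF that] sin by simp
  let ?Dy = "frechet_derivative y (at wb)" and ?Dh = "frechet_derivative h (at wb)"
  have "\<exists>z. ?Dy z \<noteq> 0"
  proof (rule ccontr)
    assume "\<not> ?thesis"
    then have *: "?Dh z = 0 \<Longrightarrow> z = 0" for z using imm[OF D(2)] by blast
    have lin: "linear ?Dh" by (rule has_derivative_linear[OF dh[OF D(2)]])
    \<comment> \<open>A linear functional on the plane kills this vector; if its kernel were
      trivial, its value at (1, 0) and then (1, 0) itself would be zero.\<close>
    have "?Dh (?Dh (0, 1) *\<^sub>R (1, 0) - ?Dh (1, 0) *\<^sub>R (0, 1)) = 0"
      by (simp only: linear_diff[OF lin] linear_scale[OF lin]) simp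
    from *[OF this] have "?Dh (1, 0) = 0" by (simp add: prod_eq_iff)
    from *[OF this] show False by (simp add: zero_prod_def)
  qed
  then obtain zb where zb: "?Dy zb \<noteq> 0" by blast
  \<comment> \<open>The direction of the projected curve at the base point; the Euclidean product
    with \<open>e\<close> serves as the coordinate along that curve.\<close>
  define e where "e = ?Dy zb"
  have e: "e \<bullet> e \<noteq> 0" using zb by (simp add: e_def)
  have le: "linear ((\<bullet>) e)" by (rule bounded_linear.linear[OF bounded_linear_inner_right])
  define \<chi>r where "\<chi>r d = (e \<bullet> y d, h d)" for d
  have sm\<chi>: "smooth_on D \<chi>r" unfolding \<chi>r_def
    by (intro smooth_on_Pair D(1) h(1) smooth_on_linear[OF bounded_linear_inner_right D(1) y(1)])
  have d\<chi>: "(\<chi>r has_derivative (\<lambda>z. (e \<bullet> frechet_derivative y (at d) z, frechet_derivative h (at d) z))) (at d)" if "d \<in> D" for d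
    unfolding \<chi>r_def
    by (intro has_derivative_Pair dh[OF that] bounded_linear.has_derivative[OF bounded_linear_inner_right dy[OF that]])
  have inj: "z = 0" if z: "frechet_derivative \<chi>r (at wb) z = 0" for z
  proof -
    have 1: "e \<bullet> ?Dy z = 0" "?Dh z = 0"
      using fun_cong[OF frechet_derivative_at[OF d\<chi>[OF D(2)]], of z] z by (simp_all add: zero_prod_def)
    have "?Dy z = 0"
      by (rule orthogonal_to_same_vector[OF c yb n1[OF D(2)] ny[OF D(2)] ny[OF D(2), of zb] le 1(1)]) (use e in \<open>simp add: e_def\<close>)
    then show ?thesis by (rule imm[OF D(2) _ 1(2)])
  qed
  obtain U V k where k: "open U" "U \<subseteq> D" "wb \<in> U" "open V" "homeomorphism U V \<chi>r k" "smooth_on V k"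
    by (rule smooth_inverse_function[OF D(1) sm\<chi> D(2) inj]) (assumption | rule that)+
  define sb where "sb = e \<bullet> y wb"
  have \<chi>b: "\<chi>r wb = (sb, 0)" using h(2) by (simp add: \<chi>r_def sb_def)
  have sbV: "(sb, 0) \<in> V" using homeomorphism_image1[OF k(5)] k(3) \<chi>b by force
  have "open ((\<lambda>p. (sb + fst p, snd p)) -` V)" by (rule open_vimage[OF k(4)]) (intro continuous_intros)
  moreover have "(0, 0) \<in> (\<lambda>p. (sb + fst p, snd p)) -` V" using sbV by simp
  ultimately obtain r where r: "0 < r" "{-r<..<r} \<times> {-r<..<r} \<subseteq> (\<lambda>p. (sb + fst p, snd p)) -` V"
    by (rule open_contains_square)
  define L where "L = {sb - r<..<sb + r}"
  let ?K = "{-r<..<r}"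
  have L: "open L" "sb \<in> L" using r(1) by (auto simp: L_def)
  have K0: "0 \<in> ?K" using r(1) by simp
  have LV: "(s, t) \<in> V" if "s \<in> L" "t \<in> ?K" for s t
  proof -
    have "(s - sb, t) \<in> (\<lambda>p. (sb + fst p, snd p)) -` V" by (rule subsetD[OF r(2)]) (use that in \<open>auto simp: L_def\<close>)
    then show ?thesis by simp
  qed
  have B: "open (L \<times> ?K)" by (intro open_Times L(1) open_greaterThanLessThan)
  have BV: "L \<times> ?K \<subseteq> V" using LV by blast
  have kD: "k q \<in> D" "e \<bullet> y (k q) = fst q" "h (k q) = snd q" if "q \<in> L \<times> ?K" for q
  proof -
    have q: "q \<in> V" using that BV by blast
    show "k q \<in> D" using homeomorphism_image2[OF k(5)] k(2) q by blast
    show "e \<bullet> y (k q) = fst q" "h (k q) = snd q"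
      using arg_cong[OF homeomorphism_apply2[OF k(5) q], of fst] arg_cong[OF homeomorphism_apply2[OF k(5) q], of snd]
      by (simp_all add: \<chi>r_def)
  qed
  have smk: "smooth_on (L \<times> ?K) k" by (rule smooth_on_subset[OF k(6) BV])
  define \<rho> where "\<rho> q = y (k q)" for q
  have kDi: "k ` (L \<times> ?K) \<subseteq> D" using kD(1) by blast
  have sm\<rho>: "smooth_on (L \<times> ?K) \<rho>" unfolding \<rho>_def by (rule smooth_on_compose[OF B D(1) kDi smk y(1)])
  have \<rho>i: "\<rho> q \<in> img c" if "q \<in> L \<times> ?K" for q using yD[OF kD(1)[OF that]] by (simp add: \<rho>_def)
  let ?R = "\<lambda>q. frechet_derivative \<rho> (at q)"
  have d\<rho>: "(\<rho> has_derivative ?R q) (at q)" if "q \<in> L \<times> ?K" for q by (rule smooth_on_has_derivative[OF sm\<rho> that])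
  have R: "e \<bullet> ?R q z = fst z" "G c (\<rho> q) (n (k q)) (?R q z) = 0" if q: "q \<in> L \<times> ?K" for q z
  proof -
    have "((\<lambda>q. e \<bullet> \<rho> q) has_derivative (\<lambda>z. e \<bullet> ?R q z)) (at q)"
      by (rule bounded_linear.has_derivative[OF bounded_linear_inner_right d\<rho>[OF q]])
    then have "(fst has_derivative (\<lambda>z. e \<bullet> ?R q z)) (at q)"
      by (rule has_derivative_transform_within_open[OF _ B q]) (simp add: \<rho>_def kD(2))
    from fun_cong[OF has_derivative_unique[OF this bounded_linear_imp_has_derivative[OF bounded_linear_fst]], of z]
    show "e \<bullet> ?R q z = fst z" .
    have "(\<rho> has_derivative (\<lambda>z. frechet_derivative y (at (k q)) (frechet_derivative k (at q) z))) (at q)"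
      unfolding \<rho>_def by (rule has_derivative_compose[OF smooth_on_has_derivative[OF smk q] dy[OF kD(1)[OF q]]])
    from fun_cong[OF frechet_derivative_at[OF this], of z]
    show "G c (\<rho> q) (n (k q)) (?R q z) = 0" using ny[OF kD(1)[OF q], of "frechet_derivative k (at q) z"] by (simp add: \<rho>_def)
  qed
  \<comment> \<open>Moving in the height coordinate does not change the coordinate along
    \<open>e\<close>, and the resulting vector is orthogonal to \<open>n\<close>, as is the
    derivative in the other coordinate. Hence it is zero.\<close>
  have R0: "?R q (0, 1) = 0" if q: "q \<in> L \<times> ?K" for q
    by (rule orthogonal_to_same_vector[where b = "?R q (1, 0)", OF c \<rho>i[OF q] _ R(2)[OF q] R(2)[OF q] le])
      (use n1[OF kD(1)[OF q]] R(1)[OF q] in \<open>simp_all add: \<rho>_def\<close>)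
  have \<rho>c: "\<rho> (s, t) = \<rho> (s, 0)" if s: "s \<in> L" and t: "t \<in> ?K" for s t
  proof -
    have "((\<lambda>t. \<rho> (s, t)) has_derivative (\<lambda>x. 0)) (at t within ?K)" if t: "t \<in> ?K" for t
    proof -
      have 1: "((\<lambda>t. (s, t)) has_vector_derivative (0, 1)) (at t)" by (auto intro!: derivative_eq_intros)
      have 2: "(\<rho> has_derivative ?R (s, t)) (at (s, t))" by (rule d\<rho>) (use s t in blast)
      have "((\<lambda>t. \<rho> (s, t)) has_vector_derivative ?R (s, t) (0, 1)) (at t)"
        by (rule has_vector_derivative_linear_image[where x = "\<lambda>t. (s, t)", OF 2 1])
      then have "((\<lambda>t. \<rho> (s, t)) has_derivative (\<lambda>x. 0)) (at t)"
        using R0[of "(s, t)"] s t by (simp add: has_vector_derivative_def)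
      then show ?thesis by (rule has_derivative_at_withinI)
    qed
    then have "\<exists>d. \<forall>t\<in>?K. \<rho> (s, t) = d" by (intro has_derivative_zero_constant convex_real_interval)
    then show ?thesis using t K0 by metis
  qed
  define x where "x s = \<rho> (s, 0)" for s
  define x' where "x' s = ?R (s, 0) (1, 0)" for s
  have s0: "(s, 0) \<in> L \<times> ?K" if "s \<in> L" for s using that K0 by blast
  have xi: "x s \<in> img c" if "s \<in> L" for s using \<rho>i[OF s0[OF that]] by (simp add: x_def)
  have dx: "(x has_vector_derivative x' s) (at s)" if s: "s \<in> L" for s
  proof -
    have "((\<lambda>s. (s, 0::real)) has_vector_derivative (1, 0)) (at s)" by (auto intro!: derivative_eq_intros)
    from has_vector_derivative_linear_image[where x = "\<lambda>s. (s, 0)", OF d\<rho>[OF s0[OF s]] this]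
    show ?thesis by (simp add: x_def[abs_def] x'_def)
  qed
  have s0i: "(\<lambda>s. (s, 0)) ` L \<subseteq> L \<times> ?K" using s0 by blast
  have sms: "smooth_on L (\<lambda>s. (s, 0::real))" by (intro smooth_on_Pair smooth_on_ident smooth_on_const L(1))
  have smx: "smooth_on L x" unfolding x_def by (rule smooth_on_compose[OF L(1) B s0i sms sm\<rho>])
  have smx': "smooth_on L x'" unfolding x'_def by (rule smooth_on_compose[OF L(1) B s0i sms smooth_on_frechet[OF sm\<rho>]])
  \<comment> \<open>The reciprocal speed of the projected curve; the flow of \<open>F\<close> on the
    parameter line is the reparametrization by arc length.\<close>
  define F where "F s = 1 / sqrt (G c (x s) (x' s) (x' s))" for s
  have x'0: "0 < G c (x s) (x' s) (x' s)" if s: "s \<in> L" for s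
  proof (rule G_pos[OF c xi[OF s]])
    show "x' s \<noteq> 0" using R(1)[OF s0[OF s], of "(1, 0)"] by (auto simp: x'_def)
  qed
  have xL: "x ` L \<subseteq> img c" using xi by blast
  have smF: "smooth_on L F" unfolding F_def
    by (intro smooth_on_divide smooth_on_sqrt smooth_on_const L(1) G_comp_smooth[OF c L(1) smx xL smx' smx'])
      (use x'0 in \<open>auto simp: less_imp_neq[symmetric]\<close>)
  obtain a q \<Phi> where \<Phi>: "0 < a" "0 < q" "smooth_on ({-a<..<a} \<times> ball sb q) (\<lambda>p. \<Phi> (fst p) (snd p))"
    "\<And>s. s \<in> ball sb q \<Longrightarrow> \<Phi> 0 s = s" "\<And>t s. t \<in> {-a<..<a} \<Longrightarrow> s \<in> ball sb q \<Longrightarrow> \<Phi> t s \<in> L"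
    "\<And>t x. t \<in> {-a<..<a} \<Longrightarrow> x \<in> ball sb q \<Longrightarrow> ((\<lambda>s. \<Phi> s x) has_vector_derivative F (\<Phi> t x)) (at t)"
    by (rule smooth_local_flow[OF L(1) smF L(2)]) (assumption | rule that)+
  define \<sigma> where "\<sigma> u = \<Phi> u sb" for u
  have bq: "sb \<in> ball sb q" using \<Phi>(2) by simp
  have sm\<sigma>: "smooth_on {-a<..<a} \<sigma>" unfolding \<sigma>_def by (rule flow_curve[OF \<Phi>(1,3,2)])
  have \<sigma>0: "\<sigma> 0 = sb" using \<Phi>(4)[OF bq] by (simp add: \<sigma>_def)
  have \<sigma>: "\<sigma> u \<in> L" "(\<sigma> has_vector_derivative F (\<sigma> u)) (at u)" if "u \<in> {-a<..<a}" for u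
    using \<Phi>(5,6)[OF that bq] by (simp_all add: \<sigma>_def[abs_def])
  have vK: "v * sin \<theta> \<in> ?K" if "v \<in> ?K" for v
  proof -
    have "\<bar>v * sin \<theta>\<bar> \<le> \<bar>v\<bar>" using abs_sin_le_one[of \<theta>] by (simp add: abs_mult mult_left_le)
    then show ?thesis using that by auto
  qed
  \<comment> \<open>First the arc length change along the curve, then the height v sin \<theta> that
    the formula prescribes; sin \<theta> is 1 or -1, so this is invertible.\<close>
  define \<tau> where "\<tau> q = (\<sigma> (fst q), snd q * sin \<theta>)" for q
  define \<kappa> where "\<kappa> q = k (\<tau> q)" for q
  let ?Q = "{-a<..<a} \<times> ?K"
  have Q: "open ?Q" "(0, 0) \<in> ?Q" using \<Phi>(1) r(1) by (auto simp: open_Times)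
  have \<tau>B: "\<tau> ` ?Q \<subseteq> L \<times> ?K" using \<sigma>(1) vK by (auto simp: \<tau>_def)
  have smfst: "smooth_on ?Q fst" using smooth_on_fst[OF Q(1) smooth_on_ident[OF Q(1)]] by simp
  have fsti: "fst ` ?Q \<subseteq> {-a<..<a}" by auto
  have sm\<tau>: "smooth_on ?Q \<tau>" unfolding \<tau>_def
    by (intro smooth_on_Pair smooth_on_mult smooth_on_snd smooth_on_ident smooth_on_const Q(1)
      smooth_on_compose[OF Q(1) open_greaterThanLessThan fsti smfst sm\<sigma>])
  have sm\<kappa>: "smooth_on ?Q \<kappa>" unfolding \<kappa>_def by (rule smooth_on_compose[OF Q(1) B \<tau>B sm\<tau> smk])
  have y\<kappa>: "y (\<kappa> (u, v)) = x (\<sigma> u)" if "u \<in> {-a<..<a}" "v \<in> ?K" for u v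
    using \<rho>c[OF \<sigma>(1)[OF that(1)] vK[OF that(2)]] by (simp add: \<kappa>_def \<tau>_def x_def \<rho>_def)
  have \<kappa>0: "\<kappa> (0, 0) = wb" using homeomorphism_apply1[OF k(5,3)] by (simp add: \<kappa>_def \<tau>_def \<sigma>0 \<chi>b)
  have a0: "0 \<in> {-a<..<a}" using \<Phi>(1) by simp
  have inj\<kappa>: "z = 0" if z: "frechet_derivative \<kappa> (at (0, 0)) z = 0" for z
  proof -
    have "((\<lambda>q. \<chi>r (\<kappa> q)) has_derivative
        (\<lambda>z. (e \<bullet> ?Dy (frechet_derivative \<kappa> (at (0, 0)) z), ?Dh (frechet_derivative \<kappa> (at (0, 0)) z)))) (at (0, 0))"
      by (rule has_derivative_compose[OF smooth_on_has_derivative[OF sm\<kappa> Q(2)]]) (simp add: \<kappa>0 d\<chi>[OF D(2)])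
    then have 1: "(\<tau> has_derivative
        (\<lambda>z. (e \<bullet> ?Dy (frechet_derivative \<kappa> (at (0, 0)) z), ?Dh (frechet_derivative \<kappa> (at (0, 0)) z)))) (at (0, 0))"
    proof (rule has_derivative_transform_within_open[OF _ Q])
      fix q assume "q \<in> ?Q"
      then have "\<tau> q \<in> V" using \<tau>B BV by blast
      then show "\<chi>r (\<kappa> q) = \<tau> q" unfolding \<kappa>_def by (rule homeomorphism_apply2[OF k(5)])
    qed
    have "(\<sigma> has_derivative (\<lambda>t. t *\<^sub>R F (\<sigma> (fst (0, 0))))) (at (fst (0::real, 0::real)))"
      using \<sigma>(2)[OF a0] by (simp add: has_vector_derivative_def)
    from has_derivative_compose[where f = fst and s = UNIV, OF bounded_linear_imp_has_derivative[OF bounded_linear_fst] this]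
    have "((\<lambda>q. \<sigma> (fst q)) has_derivative (\<lambda>z. fst z *\<^sub>R F sb)) (at (0::real, 0::real))" by (simp add: \<sigma>0)
    then have "(\<tau> has_derivative (\<lambda>z. (fst z *\<^sub>R F sb, snd z * sin \<theta>))) (at (0, 0))"
      unfolding \<tau>_def by (intro has_derivative_Pair has_derivative_mult_left has_derivative_snd has_derivative_ident)
    from fun_cong[OF has_derivative_unique[OF 1 this], of z]
    have "fst z * F sb = 0" "snd z * sin \<theta> = 0"
      using z linear_0[OF has_derivative_linear[OF dy[OF D(2)]]] linear_0[OF has_derivative_linear[OF dh[OF D(2)]]] by simp_all
    moreover have "F sb \<noteq> 0" using x'0[OF L(2)] by (simp add: F_def)
    ultimately show ?thesis using sin0 by (simp add: prod_eq_iff)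
  qed
  show ?thesis
  \<comment> \<open>The geodesics are constant, with velocity 0, because their initial velocity cos
    \<theta> J \<alpha>' vanishes.\<close>
  proof (rule locally_parametrizedI[where a = a and b = r and \<kappa> = \<kappa> and \<eta> = "\<lambda>u v. 0" and \<alpha>' = "\<lambda>u. F (\<sigma> u) *\<^sub>R x' (\<sigma> u)"])
    show "\<kappa> ` ?Q \<subseteq> D"
    proof (rule image_subsetI)
      fix q assume "q \<in> ?Q"
      then have "\<tau> q \<in> L \<times> ?K" using \<tau>B by blast
      then show "\<kappa> q \<in> D" unfolding \<kappa>_def by (rule kD(1))
    qed
    fix u v :: real
    assume u: "u \<in> {-a<..<a}"
    { assume v: "v \<in> ?K"
      have "\<tau> (u, v) \<in> L \<times> ?K" using \<tau>B u v by blast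
      from kD(3)[OF this] show "h (\<kappa> (u, v)) = v * sin \<theta>" by (simp add: \<kappa>_def \<tau>_def)
      have "((\<lambda>s. (x (\<sigma> u), 0::real^2)) has_vector_derivative 0) (at v)" by (rule has_vector_derivative_const)
      then have "((\<lambda>s. (y (\<kappa> (u, s)), 0::real^2)) has_vector_derivative 0) (at v)"
        by (rule has_vector_derivative_transform_within_open[OF _ open_greaterThanLessThan v]) (simp add: y\<kappa>[OF u])
      moreover have "christoffel A g c (x (\<sigma> u)) 0 0 = 0"
        using christoffel_scale[OF c xi[OF \<sigma>(1)[OF u]], of 0 0] by simp
      ultimately show "((\<lambda>s. (y (\<kappa> (u, s)), 0)) has_vector_derivative geo_field c (y (\<kappa> (u, v)), 0)) (at v)"
        by (simp add: y\<kappa>[OF u v] geo_field_def zero_prod_def) }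
    have "((\<lambda>s. x (\<sigma> s)) has_vector_derivative F (\<sigma> u) *\<^sub>R x' (\<sigma> u)) (at u)"
      using has_vector_derivative_linear_image[OF dx[OF \<sigma>(1)[OF u], unfolded has_vector_derivative_def] \<sigma>(2)[OF u]] by simp
    then show "((\<lambda>s. y (\<kappa> (s, 0))) has_vector_derivative F (\<sigma> u) *\<^sub>R x' (\<sigma> u)) (at u)"
      by (rule has_vector_derivative_transform_within_open[OF _ open_greaterThanLessThan u]) (simp add: y\<kappa>[OF _ K0])
    show "G c (y (\<kappa> (u, 0))) (F (\<sigma> u) *\<^sub>R x' (\<sigma> u)) (F (\<sigma> u) *\<^sub>R x' (\<sigma> u)) = 1"
      using x'0[OF \<sigma>(1)[OF u]] by (simp add: y\<kappa>[OF u K0] G_bil[OF c xi[OF \<sigma>(1)[OF u]]] F_def)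
    show "(0::real^2) = cos \<theta> *\<^sub>R chart_rotation c (y (\<kappa> (u, 0))) (F (\<sigma> u) *\<^sub>R x' (\<sigma> u))" using cos by simp
  qed (fact \<Phi>(1) r(1) sm\<kappa> \<kappa>0 inj\<kappa>)+
qed

end

lemma (in riemannian_surface) locally_parametrized_if_constant_angle:
  assumes \<Sigma>: "regular_surface (prod_atlas A) \<Sigma>" and angle: "constant_angle A g \<Sigma> \<theta>" and p: "p \<in> \<Sigma>"
  shows "locally_parametrized \<theta> (vertical_translation (- snd p) ` \<Sigma>) (vertical_translation (- snd p) p)"
proof -
  obtain c D y h W \<omega> n wb where
    patch: "surface_patch A g (vertical_translation (- snd p) ` \<Sigma>) c D y h W \<omega> n \<theta> wb" and b: "inv_chart c (y wb) = fst p"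
    by (rule constant_angle_patch[OF \<Sigma> angle p])
  interpret surface_patch A g "vertical_translation (- snd p) ` \<Sigma>" c D y h W \<omega> n \<theta> wb by (rule patch)
  have "locally_parametrized \<theta> (vertical_translation (- snd p) ` \<Sigma>) (inv_chart c (y wb), 0)"
    using locally_parametrized_oblique locally_parametrized_horizontal locally_parametrized_vertical by blast
  then show ?thesis by (simp add: b vertical_translation_def)
qed

theorem theorem6:
  fixes A :: "('a::{t2_space, second_countable_topology}, real^2) chart set"
    and g :: "('a, real^2) metric"
    and \<Sigma> :: "('a \<times> real) set"
    and \<theta> :: real
  assumes M: "riemannian_manifold A g"
    and \<Sigma>: "regular_surface (prod_atlas A) \<Sigma>"
  shows "constant_angle A g \<Sigma> \<theta> \<longleftrightarrow>
    (\<forall>p\<in>\<Sigma>. \<exists>F. vertical_isometry A g F \<and>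
      (\<exists>I K \<alpha> U J.
         open I \<and> is_interval I \<and> open K \<and> is_interval K \<and>
         unit_speed_curve A g I \<alpha> \<and>
         open U \<and> \<alpha> ` I \<subseteq> U \<and> rotation_field A g U J \<and>
         (\<forall>u\<in>I. \<forall>v\<in>K. angle_vector A \<theta> \<alpha> J u v \<in> exp_domain A g (\<alpha> u)) \<and>
         regular_parametrization (prod_atlas A) (F ` \<Sigma>) (F p) (I \<times> K)
           (angle_parametrization A g \<theta> \<alpha> J)))"
proof -
  interpret riemannian_surface A g by (rule riemannian_surface.intro[OF M])
  show ?thesis
  proof
    assume angle: "constant_angle A g \<Sigma> \<theta>"
    show "\<forall>p\<in>\<Sigma>. \<exists>F. vertical_isometry A g F \<and>
      (\<exists>I K \<alpha> U J.
         open I \<and> is_interval I \<and> open K \<and> is_interval K \<and>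
         unit_speed_curve A g I \<alpha> \<and>
         open U \<and> \<alpha> ` I \<subseteq> U \<and> rotation_field A g U J \<and>
         (\<forall>u\<in>I. \<forall>v\<in>K. angle_vector A \<theta> \<alpha> J u v \<in> exp_domain A g (\<alpha> u)) \<and>
         regular_parametrization (prod_atlas A) (F ` \<Sigma>) (F p) (I \<times> K)
           (angle_parametrization A g \<theta> \<alpha> J))"
    proof
      fix p assume "p \<in> \<Sigma>"
      from locally_parametrized_if_constant_angle[OF \<Sigma> angle this, unfolded locally_parametrized_def]
        vertical_isometry_translation[OF atlas, of g "- snd p"]
      show "\<exists>F. vertical_isometry A g F \<and>
      (\<exists>I K \<alpha> U J.
         open I \<and> is_interval I \<and> open K \<and> is_interval K \<and>
         unit_speed_curve A g I \<alpha> \<and>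
         open U \<and> \<alpha> ` I \<subseteq> U \<and> rotation_field A g U J \<and>
         (\<forall>u\<in>I. \<forall>v\<in>K. angle_vector A \<theta> \<alpha> J u v \<in> exp_domain A g (\<alpha> u)) \<and>
         regular_parametrization (prod_atlas A) (F ` \<Sigma>) (F p) (I \<times> K)
           (angle_parametrization A g \<theta> \<alpha> J))"
        by (intro exI[of _ "vertical_translation (- snd p)"] conjI)
    qed
  qed (rule constant_angle_if_parametrized)
qed

end
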